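(* Let $m,p,q$ be positive integers with $2m<p$ and $2m<2q+1$. Let $V^+=\mathbb{C}^p$ and $V^-=\mathbb{C}^{2q}$ be the natural representations of $O(p,\mathbb{C})$ and $Sp(2q,\mathbb{C})$, let $U=\mathbb{C}^m$ be the natural representation of $G'=SL(m,\mathbb{C})$, put $G=O(p,\mathbb{C})\times Sp(2q,\mathbb{C})$ and $W=(V^+\oplus V^-)\otimes U$, and let $\varphi: W\to X=W/\!/G'$ and $\psi: W\to Y=W/\!/G$ be the affine quotient maps. Then conditions (a)--(e) of the context hold; moreover $Y=\mathrm{Sym}(U)\oplus\mathrm{Alt}(U)\simeq M_m(\mathbb{C})$ with the $SL(m,\mathbb{C})$-action $A\mapsto gA\,{}^tg$, and $X\simeq\mathbb{G}^{\mathrm{aff}}_m(V^+\oplus V^-)$. Every $SL(m,\mathbb{C})$-orbit $\mathbb{O}'\subset M_m(\mathbb{C})$ is lifted to an $O(p,\mathbb{C})\times Sp(2q,\mathbb{C})$-orbit $\theta(\mathbb{O}')\subset\mathbb{G}^{\mathrm{aff}}_m(V^+\oplus V^-)$, and the lifting map $$\theta: M_m(\mathbb{C})/SL(m,\mathbb{C})\to\mathbb{G}^{\mathrm{aff}}_m(V^+\oplus V^-)/\bigl(O(V^+)\times Sp(V^-)\bigr)$$ is injective, preserves the closure relation (if $\mathbb{O}'_1\subset\overline{\mathbb{O}'_2}$ then $\theta(\mathbb{O}'_1)\subset\overline{\theta(\mathbb{O}'_2)}$), and maps nilpotent orbits to nilpotent orbits.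
   Context: For a reductive group $H$ acting rationally on an affine variety $Z$ over $\mathbb{C}$, $Z/\!/H=\operatorname{Spec}\mathbb{C}[Z]^H$ with quotient map induced by $\mathbb{C}[Z]^H\hookrightarrow\mathbb{C}[Z]$; for a variety $Z$ with an action of $H$, $Z/H$ is the set of $H$-orbits. $G$ acts on $X$ and $G'$ acts on $Y$ since the two actions on $W$ commute. $\mathrm{Sym}(U)$ (resp. $\mathrm{Alt}(U)$) is the space of symmetric (resp. alternating) tensors in $U\otimes U$. $\mathbb{G}^{\mathrm{aff}}_m(E)\subset\bigwedge^mE$ is the affine cone over the Grassmannian of $m$-dimensional subspaces of $E$ (decomposable $m$-vectors including $0$). Write $0$ for the images of $0\in W$ in $X$ and $Y$; closures are Zariski closures; an orbit in $X$ or $Y$ is nilpotent if its closure contains $0$. Let $\mathfrak{N}=\psi^{-1}(0)$, $X^\circ=\{x\in X:\varphi^{-1}(x)\text{ consists of a single }G'\text{-orbit}\}$ and $W^\circ=\varphi^{-1}(X^\circ)$. Conditions: (a) $\psi$ is flat, i.e. $\mathbb{C}[W]$ is flat over $\mathbb{C}[W]^G$. (b) There is an open dense $G$-orbit in $\mathfrak{N}$. (c) The scheme theoretic fiber $W\times_Y\{0\}$ is reduced. (d) A generic fiber of $\varphi$ is a single (hence closed) $G'$-orbit. (e) For any $y\in Y$, the fiber $\psi^{-1}(y)$ intersects $W^\circ$ non-trivially. Lifting: a $G'$-orbit $\mathbb{O}'\subset Y$ is lifted to the $G$-orbit $\mathbb{O}=\theta(\mathbb{O}')\subset X$ if $\varphi(\psi^{-1}(\overline{\mathbb{O}'}))=\overline{\mathbb{O}}$.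 *)

theory Defs
  imports
    "HOL-Analysis.Analysis"
    "HOL-Algebra.Module"
    "HOL-Algebra.QuotRing"
    "HOL-Algebra.Group_Action"
    "HOL-Algebra.Free_Abelian_Groups"
begin

section \<open>Tensor products and flatness\<close>

text \<open>
  The tensor product \<open>M \<otimes>\<^sub>R N\<close> of modules over a commutative ring, as an abelian group: the free
  abelian group on pairs modulo the bilinearity relations.
\<close>

definition tensor_relations ::
  "('r, 'a) ring_scheme \<Rightarrow> ('r, 'm, 'b) module_scheme \<Rightarrow> ('r, 'n, 'c) module_scheme
    \<Rightarrow> ('m \<times> 'n \<Rightarrow>\<^sub>0 int) set"
where
  "tensor_relations R M N =
     {frag_of (x \<oplus>\<^bsub>M\<^esub> x', y) - frag_of (x, y) - frag_of (x', y) | x x' y.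
        x \<in> carrier M \<and> x' \<in> carrier M \<and> y \<in> carrier N}
   \<union> {frag_of (x, y \<oplus>\<^bsub>N\<^esub> y') - frag_of (x, y) - frag_of (x, y') | x y y'.
        x \<in> carrier M \<and> y \<in> carrier N \<and> y' \<in> carrier N}
   \<union> {frag_of (r \<odot>\<^bsub>M\<^esub> x, y) - frag_of (x, r \<odot>\<^bsub>N\<^esub> y) | r x y.
        r \<in> carrier R \<and> x \<in> carrier M \<and> y \<in> carrier N}"

definition tensor_kernel ::
  "('r, 'a) ring_scheme \<Rightarrow> ('r, 'm, 'b) module_scheme \<Rightarrow> ('r, 'n, 'c) module_scheme
    \<Rightarrow> ('m \<times> 'n \<Rightarrow>\<^sub>0 int) set"
where
  "tensor_kernel R M N =
     generate (free_Abelian_group (carrier M \<times> carrier N)) (tensor_relations R M N)"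

definition tensor_product ::
  "('r, 'a) ring_scheme \<Rightarrow> ('r, 'm, 'b) module_scheme \<Rightarrow> ('r, 'n, 'c) module_scheme
    \<Rightarrow> ('m \<times> 'n \<Rightarrow>\<^sub>0 int) set monoid"
where
  "tensor_product R M N =
     free_Abelian_group (carrier M \<times> carrier N) Mod tensor_kernel R M N"

text \<open>The map \<open>id \<otimes> f : M \<otimes>\<^sub>R N \<rightarrow> M \<otimes>\<^sub>R N'\<close>, on cosets.\<close>

definition tensor_map ::
  "('r, 'a) ring_scheme \<Rightarrow> ('r, 'm, 'b) module_scheme \<Rightarrow> ('r, 'n, 'c) module_scheme
    \<Rightarrow> ('n \<Rightarrow> 'n) \<Rightarrow> ('m \<times> 'n \<Rightarrow>\<^sub>0 int) set \<Rightarrow> ('m \<times> 'n \<Rightarrow>\<^sub>0 int) set"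
where
  "tensor_map R M N' f C =
     (\<Union>c\<in>C. tensor_kernel R M N'
        #>\<^bsub>free_Abelian_group (carrier M \<times> carrier N')\<^esub> frag_extend (\<lambda>(x, y). frag_of (x, f y)) c)"

definition linear_maps ::
  "('r, 'a) ring_scheme \<Rightarrow> ('r, 'n, 'c) module_scheme \<Rightarrow> ('r, 'n, 'c) module_scheme
    \<Rightarrow> ('n \<Rightarrow> 'n) set"
where
  "linear_maps R N N' =
     {f \<in> carrier N \<rightarrow> carrier N'.
        (\<forall>x\<in>carrier N. \<forall>y\<in>carrier N. f (x \<oplus>\<^bsub>N\<^esub> y) = f x \<oplus>\<^bsub>N'\<^esub> f y) \<and>
        (\<forall>r\<in>carrier R. \<forall>x\<in>carrier N. f (r \<odot>\<^bsub>N\<^esub> x) = r \<odot>\<^bsub>N'\<^esub> f x)}"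

text \<open>
  \<open>M\<close> is flat over \<open>R\<close>: tensoring with \<open>M\<close> preserves injectivity of \<open>R\<close>-linear maps.
  HOL cannot quantify over types inside a definition, so the type of the elements of the test
  modules is a parameter; leaving it a free type variable in a theorem quantifies over all modules.
\<close>

definition flat_module ::
  "'n itself \<Rightarrow> ('r, 'a) ring_scheme \<Rightarrow> ('r, 'm, 'b) module_scheme \<Rightarrow> bool"
where
  "flat_module _ R M \<longleftrightarrow>
     (\<forall>(N :: ('r, 'n) module) (N' :: ('r, 'n) module) f.
        Module.module R N \<and> Module.module R N' \<and> f \<in> linear_maps R N N' \<and> inj_on f (carrier N)
        \<longrightarrow> inj_on (tensor_map R M N' f) (carrier (tensor_product R M N)))"

definition reduced_ring :: "('r, 'a) ring_scheme \<Rightarrow> bool" where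
  "reduced_ring R \<longleftrightarrow>
     (\<forall>x\<in>carrier R. \<forall>n::nat. x [^]\<^bsub>R\<^esub> n = \<zero>\<^bsub>R\<^esub> \<longrightarrow> x = \<zero>\<^bsub>R\<^esub>)"

section \<open>Affine varieties over the complex numbers\<close>

text \<open>
  A variety is given by its closed points together with its regular functions. The regular functions
  are total functions on the type; only their values on the points matter, so that one set of
  functions serves an affine space and all its closed subvarieties.
\<close>

record 'a variety =
  points :: "'a set"
  regular :: "('a \<Rightarrow> complex) set"

definition zariski :: "'a variety \<Rightarrow> 'a topology" where
  "zariski Z = topology_generated_by {{x \<in> points Z. f x \<noteq> 0} | f. f \<in> regular Z}"

definition regular_map :: "'a variety \<Rightarrow> 'b variety \<Rightarrow> ('a \<Rightarrow> 'b) \<Rightarrow> bool" where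
  "regular_map Z Z' h \<longleftrightarrow>
     h \<in> points Z \<rightarrow> points Z' \<and>
     (\<forall>f\<in>regular Z'. \<exists>f'\<in>regular Z. \<forall>x\<in>points Z. f (h x) = f' x)"

definition variety_iso :: "'a variety \<Rightarrow> 'b variety \<Rightarrow> ('a \<Rightarrow> 'b) \<Rightarrow> bool" where
  "variety_iso Z Z' h \<longleftrightarrow>
     bij_betw h (points Z) (points Z') \<and> regular_map Z Z' h \<and>
     regular_map Z' Z (inv_into (points Z) h)"

text \<open>The complex algebra of functions generated by a set of coordinate functions.\<close>

inductive_set poly_funs :: "('a \<Rightarrow> complex) set \<Rightarrow> ('a \<Rightarrow> complex) set"
  for B :: "('a \<Rightarrow> complex) set" where
  const: "(\<lambda>_. c) \<in> poly_funs B"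
| coord: "f \<in> B \<Longrightarrow> f \<in> poly_funs B"
| add: "f \<in> poly_funs B \<Longrightarrow> g \<in> poly_funs B \<Longrightarrow> (\<lambda>x. f x + g x) \<in> poly_funs B"
| mult: "f \<in> poly_funs B \<Longrightarrow> g \<in> poly_funs B \<Longrightarrow> (\<lambda>x. f x * g x) \<in> poly_funs B"

definition vec_coords :: "(complex^'n \<Rightarrow> complex) set" where
  "vec_coords = {(\<lambda>v. v $ i) | i. True}"

definition mat_coords :: "(complex^'m^'n \<Rightarrow> complex) set" where
  "mat_coords = {(\<lambda>A. A $ i $ j) | i j. True}"

definition mat_pair_coords :: "((complex^'m^'n) \<times> (complex^'m^'n) \<Rightarrow> complex) set" where
  "mat_pair_coords = {f \<circ> fst | f. f \<in> mat_coords} \<union> {f \<circ> snd | f. f \<in> mat_coords}"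

definition mat_space :: "(complex^'m^'n) variety" where
  "mat_space = \<lparr>points = UNIV, regular = poly_funs mat_coords\<rparr>"

section \<open>Affine quotients of matrix spaces\<close>

definition fun_ring :: "('a \<Rightarrow> complex) set \<Rightarrow> ('a \<Rightarrow> complex) ring" where
  "fun_ring A = \<lparr>carrier = A, monoid.mult = (\<lambda>f g x. f x * g x), one = (\<lambda>_. 1),
                 ring.zero = (\<lambda>_. 0), add = (\<lambda>f g x. f x + g x)\<rparr>"

definition fun_module :: "('a \<Rightarrow> complex) set \<Rightarrow> ('a \<Rightarrow> complex, 'a \<Rightarrow> complex) module" where
  "fun_module A = \<lparr>carrier = A, monoid.mult = (\<lambda>f g x. f x * g x), one = (\<lambda>_. 1),
                   ring.zero = (\<lambda>_. 0), add = (\<lambda>f g x. f x + g x), smult = (\<lambda>f g x. f x * g x)\<rparr>"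

definition invariant_funs ::
  "('h, 'k) monoid_scheme \<Rightarrow> ('h \<Rightarrow> complex^'m^'n \<Rightarrow> complex^'m^'n)
    \<Rightarrow> (complex^'m^'n \<Rightarrow> complex) set"
where
  "invariant_funs H act =
     {f \<in> regular mat_space. \<forall>h\<in>carrier H. \<forall>w. f (act h w) = f w}"

text \<open>
  \<open>W // H = Spec \<complex>[W]\<^sup>H\<close>. Its closed points are the \<open>\<complex>\<close>-algebra homomorphisms from \<open>\<complex>[W]\<^sup>H\<close> to \<open>\<complex>\<close>,
  its regular functions are the evaluations at the elements of \<open>\<complex>[W]\<^sup>H\<close>, and the inclusion of \<open>\<complex>[W]\<^sup>H\<close>
  into \<open>\<complex>[W]\<close> induces the map sending \<open>w\<close> to evaluation at \<open>w\<close>.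
\<close>

type_synonym 'w quot_point = "('w \<Rightarrow> complex) \<Rightarrow> complex"

definition algebra_points :: "('w \<Rightarrow> complex) set \<Rightarrow> 'w quot_point set" where
  "algebra_points A =
     {\<xi> \<in> extensional A.
        (\<forall>c. \<xi> (\<lambda>_. c) = c) \<and>
        (\<forall>f\<in>A. \<forall>g\<in>A. \<xi> (\<lambda>w. f w + g w) = \<xi> f + \<xi> g) \<and>
        (\<forall>f\<in>A. \<forall>g\<in>A. \<xi> (\<lambda>w. f w * g w) = \<xi> f * \<xi> g)}"

definition affine_quotient ::
  "('h, 'k) monoid_scheme \<Rightarrow> ('h \<Rightarrow> complex^'m^'n \<Rightarrow> complex^'m^'n)
    \<Rightarrow> (complex^'m^'n) quot_point variety"
where
  "affine_quotient H act =
     \<lparr>points = algebra_points (invariant_funs H act),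
      regular = {(\<lambda>\<xi>. \<xi> f) | f. f \<in> invariant_funs H act}\<rparr>"

definition aff_quotient_map ::
  "('h, 'k) monoid_scheme \<Rightarrow> ('h \<Rightarrow> complex^'m^'n \<Rightarrow> complex^'m^'n)
    \<Rightarrow> complex^'m^'n \<Rightarrow> (complex^'m^'n) quot_point"
where
  "aff_quotient_map H act w = (\<lambda>f\<in>invariant_funs H act. f w)"

text \<open>
  The action on \<open>W // H\<close> induced by an action \<open>act'\<close> on \<open>W\<close> that commutes with the action of \<open>H\<close>.
\<close>

definition quotient_act ::
  "('h, 'k) monoid_scheme \<Rightarrow> ('h \<Rightarrow> complex^'m^'n \<Rightarrow> complex^'m^'n)
    \<Rightarrow> ('g \<Rightarrow> complex^'m^'n \<Rightarrow> complex^'m^'n)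
    \<Rightarrow> 'g \<Rightarrow> (complex^'m^'n) quot_point \<Rightarrow> (complex^'m^'n) quot_point"
where
  "quotient_act H act act' g \<xi> = (\<lambda>f\<in>invariant_funs H act. \<xi> (f \<circ> act' g))"

definition equivariant ::
  "('g, 'k) monoid_scheme \<Rightarrow> 'a set \<Rightarrow> ('g \<Rightarrow> 'a \<Rightarrow> 'a) \<Rightarrow> ('g \<Rightarrow> 'b \<Rightarrow> 'b) \<Rightarrow> ('a \<Rightarrow> 'b) \<Rightarrow> bool"
where
  "equivariant G E act act' h \<longleftrightarrow> (\<forall>g\<in>carrier G. \<forall>x\<in>E. h (act g x) = act' g (h x))"

section \<open>Conditions on the quotient maps\<close>

definition null_fiber ::
  "('g, 'k) monoid_scheme \<Rightarrow> ('g \<Rightarrow> complex^'m^'n \<Rightarrow> complex^'m^'n) \<Rightarrow> (complex^'m^'n) set"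
where
  "null_fiber G act = {w. aff_quotient_map G act w = aff_quotient_map G act 0}"

definition single_orbit_points ::
  "('g, 'k) monoid_scheme \<Rightarrow> ('g \<Rightarrow> complex^'m^'n \<Rightarrow> complex^'m^'n)
    \<Rightarrow> (complex^'m^'n) quot_point set"
where
  "single_orbit_points H act =
     {x \<in> points (affine_quotient H act).
        \<exists>w. aff_quotient_map H act -` {x} = Group_Action.orbit H act w}"

definition flat_quotient ::
  "'t itself \<Rightarrow> ('g, 'k) monoid_scheme \<Rightarrow> ('g \<Rightarrow> complex^'m^'n \<Rightarrow> complex^'m^'n) \<Rightarrow> bool"
where
  "flat_quotient T G act \<longleftrightarrow>
     flat_module T (fun_ring (invariant_funs G act))
       (fun_module (regular (mat_space :: (complex^'m^'n) variety)))"

definition dense_null_orbit ::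
  "('g, 'k) monoid_scheme \<Rightarrow> ('g \<Rightarrow> complex^'m^'n \<Rightarrow> complex^'m^'n) \<Rightarrow> bool"
where
  "dense_null_orbit G act \<longleftrightarrow>
     (\<exists>Ob \<in> orbits G (null_fiber G act) act.
        openin (subtopology (zariski mat_space) (null_fiber G act)) Ob \<and>
        subtopology (zariski mat_space) (null_fiber G act) closure_of Ob = null_fiber G act)"

text \<open>
  The scheme theoretic fiber over the image of \<open>0\<close> is the spectrum of \<open>\<complex>[W] / \<mm>\<^sub>0 \<complex>[W]\<close>, where \<open>\<mm>\<^sub>0\<close> is the
  maximal ideal of that image in \<open>\<complex>[W]\<^sup>G\<close>.
\<close>

definition reduced_null_fiber ::
  "('g, 'k) monoid_scheme \<Rightarrow> ('g \<Rightarrow> complex^'m^'n \<Rightarrow> complex^'m^'n) \<Rightarrow> bool"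
where
  "reduced_null_fiber G act \<longleftrightarrow>
     reduced_ring (fun_ring (regular mat_space) Quot
       Idl\<^bsub>fun_ring (regular mat_space)\<^esub>
         {f \<in> invariant_funs G act. aff_quotient_map G act 0 f = 0})"

definition generic_fiber_orbit ::
  "('h, 'k) monoid_scheme \<Rightarrow> ('h \<Rightarrow> complex^'m^'n \<Rightarrow> complex^'m^'n) \<Rightarrow> bool"
where
  "generic_fiber_orbit H act \<longleftrightarrow>
     (\<exists>U. openin (zariski (affine_quotient H act)) U \<and>
          zariski (affine_quotient H act) closure_of U = points (affine_quotient H act) \<and>
          (\<forall>x\<in>U. \<exists>w. aff_quotient_map H act -` {x} = Group_Action.orbit H act w \<and>
                     closedin (zariski mat_space) (Group_Action.orbit H act w)))"

definition fibers_meet_single_orbits ::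
  "('g, 'k) monoid_scheme \<Rightarrow> ('g \<Rightarrow> complex^'m^'n \<Rightarrow> complex^'m^'n)
    \<Rightarrow> ('h, 'l) monoid_scheme \<Rightarrow> ('h \<Rightarrow> complex^'m^'n \<Rightarrow> complex^'m^'n) \<Rightarrow> bool"
where
  "fibers_meet_single_orbits G act H act' \<longleftrightarrow>
     (\<forall>y\<in>points (affine_quotient G act).
        aff_quotient_map G act -` {y} \<inter> aff_quotient_map H act' -` single_orbit_points H act' \<noteq> {})"

section \<open>Lifting of orbits\<close>

definition lifts_to ::
  "('w \<Rightarrow> 'x) \<Rightarrow> ('w \<Rightarrow> 'y) \<Rightarrow> 'x variety \<Rightarrow> 'y variety \<Rightarrow> 'y set \<Rightarrow> 'x set \<Rightarrow> bool"
where
  "lifts_to \<phi> \<psi> X Y Ob' Ob \<longleftrightarrow>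
     \<phi> ` (\<psi> -` (zariski Y closure_of Ob')) = zariski X closure_of Ob"

definition nilpotent_set :: "'a::zero variety \<Rightarrow> 'a set \<Rightarrow> bool" where
  "nilpotent_set Z Ob \<longleftrightarrow> 0 \<in> zariski Z closure_of Ob"

section \<open>The groups and representations\<close>

definition orth_group :: "(complex^'p^'p) monoid" where
  "orth_group = \<lparr>carrier = {g. transpose g ** g = mat 1}, monoid.mult = (**), one = mat 1\<rparr>"

definition symp_form :: "complex^('q::finite + 'q)^('q + 'q)" where
  "symp_form = (\<chi> i j. case (i, j) of
      (Inl a, Inr b) \<Rightarrow> if a = b then 1 else 0
    | (Inr a, Inl b) \<Rightarrow> if a = b then -1 else 0
    | _ \<Rightarrow> 0)"

definition symp_group :: "(complex^('q::finite + 'q)^('q + 'q)) monoid" where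
  "symp_group = \<lparr>carrier = {g. transpose g ** symp_form ** g = symp_form}, monoid.mult = (**), one = mat 1\<rparr>"

definition SL_group :: "(complex^'m^'m) monoid" where
  "SL_group = \<lparr>carrier = {g. det g = 1}, monoid.mult = (**), one = mat 1\<rparr>"

definition OSp_group :: "((complex^'p^'p) \<times> (complex^('q::finite + 'q)^('q + 'q))) monoid" where
  "OSp_group = orth_group \<times>\<times> symp_group"

text \<open>
  \<open>V\<^sup>+ \<oplus> V\<^sup>-\<close> has the coordinates \<open>'p + ('q + 'q)\<close>; \<open>blk (g, s)\<close> is the block diagonal matrix of \<open>g \<oplus> s\<close>.
\<close>

definition blk :: "(complex^'p^'p) \<times> (complex^'r^'r) \<Rightarrow> complex^('p + 'r)^('p + 'r)" where
  "blk = (\<lambda>(g, s). \<chi> i j. case (i, j) of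
      (Inl a, Inl b) \<Rightarrow> g $ a $ b
    | (Inr a, Inr b) \<Rightarrow> s $ a $ b
    | _ \<Rightarrow> 0)"

text \<open>
  \<open>W = (V\<^sup>+ \<oplus> V\<^sup>-) \<otimes> U\<close> is the space of matrices with rows indexed by \<open>V\<^sup>+ \<oplus> V\<^sup>-\<close> and columns by \<open>U\<close>;
  \<open>v \<otimes> u\<close> is the matrix with entries \<open>v $ i * u $ k\<close>. Similarly, \<open>U \<otimes> U\<close> is the space of square matrices.
\<close>

type_synonym ('m, 'p, 'q) W_space = "complex^'m^('p + ('q + 'q))"

definition OSp_act ::
  "(complex^'p^'p) \<times> (complex^('q::finite + 'q)^('q + 'q)) \<Rightarrow> ('m::finite, 'p, 'q) W_space \<Rightarrow> ('m, 'p, 'q) W_space"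
where
  "OSp_act g w = blk g ** w"

definition SL_act :: "complex^'m^'m \<Rightarrow> complex^'m^'n \<Rightarrow> complex^'m^'n" where
  "SL_act h w = w ** transpose h"

definition congr_act :: "complex^'m^'m \<Rightarrow> complex^'m^'m \<Rightarrow> complex^'m^'m" where
  "congr_act h A = h ** A ** transpose h"

definition congr_act2 ::
  "complex^'m^'m \<Rightarrow> (complex^'m^'m) \<times> (complex^'m^'m) \<Rightarrow> (complex^'m^'m) \<times> (complex^'m^'m)"
where
  "congr_act2 h = (\<lambda>(S, A). (congr_act h S, congr_act h A))"

definition Sym_space :: "(complex^'m^'m) set" where
  "Sym_space = {S. transpose S = S}"

definition Alt_space :: "(complex^'m^'m) set" where
  "Alt_space = {A. transpose A = - A}"

definition Sym_Alt_variety :: "((complex^'m^'m) \<times> (complex^'m^'m)) variety" where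
  "Sym_Alt_variety = \<lparr>points = Sym_space \<times> Alt_space, regular = poly_funs mat_pair_coords\<rparr>"

text \<open>
  The pairing \<open>W \<rightarrow> Sym(U) \<oplus> Alt(U)\<close> obtained by contracting \<open>w \<otimes> w\<close> with the symmetric form on \<open>V\<^sup>+\<close>
  and with the symplectic form on \<open>V\<^sup>-\<close>.
\<close>

definition gram :: "('m::finite, 'p::finite, 'q::finite) W_space \<Rightarrow> (complex^'m^'m) \<times> (complex^'m^'m)" where
  "gram w =
     (let w1 = (\<chi> i. w $ Inl i); w2 = (\<chi> i. w $ Inr i)
      in (transpose w1 ** w1, transpose w2 ** symp_form ** w2))"

section \<open>The affine cone over the Grassmannian\<close>

text \<open>
  The tensor power \<open>E\<^sup>\<otimes>\<^sup>m\<close> of \<open>E = \<complex>\<^sup>n\<close> has coordinates indexed by \<open>'m \<Rightarrow> 'n\<close>, the slots being indexed by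
  \<open>'m\<close>. The exterior power is realised as the space of alternating tensors, with
  \<open>v\<^sub>1 \<and> \<dots> \<and> v\<^sub>m\<close> the signed sum of the permuted tensors \<open>v\<^sub>\<sigma>\<^sub>1 \<otimes> \<dots> \<otimes> v\<^sub>\<sigma>\<^sub>m\<close>.
\<close>

definition tensor_of :: "('m::finite \<Rightarrow> complex^'n) \<Rightarrow> complex^('m \<Rightarrow> 'n)" where
  "tensor_of v = (\<chi> f. \<Prod>k\<in>UNIV. v k $ f k)"

definition wedge :: "('m::finite \<Rightarrow> complex^'n) \<Rightarrow> complex^('m \<Rightarrow> 'n)" where
  "wedge v = (\<Sum>\<sigma> | \<sigma> permutes UNIV. of_int (sign \<sigma>) *s tensor_of (v \<circ> \<sigma>))"

definition exterior_power :: "(complex^('m::finite \<Rightarrow> 'n::finite)) set" where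
  "exterior_power =
     {T. \<forall>\<sigma>. \<sigma> permutes UNIV \<longrightarrow> (\<forall>f. T $ (f \<circ> \<sigma>) = of_int (sign \<sigma>) * T $ f)}"

definition grassmann_cone :: "(complex^('m::finite \<Rightarrow> 'n::finite)) variety" where
  "grassmann_cone =
     \<lparr>points = {T \<in> exterior_power. \<exists>v. T = wedge v}, regular = poly_funs vec_coords\<rparr>"

text \<open>The action of a matrix on tensors, and so on \<open>m\<close>-vectors: \<open>v\<^sub>1 \<otimes> \<dots> \<otimes> v\<^sub>m \<mapsto> g v\<^sub>1 \<otimes> \<dots> \<otimes> g v\<^sub>m\<close>.\<close>

definition tensor_act :: "complex^'n^'n \<Rightarrow> complex^('m::finite \<Rightarrow> 'n) \<Rightarrow> complex^('m \<Rightarrow> 'n)" where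
  "tensor_act g T = (\<chi> f. \<Sum>f'\<in>UNIV. (\<Prod>k\<in>UNIV. g $ f k $ f' k) * T $ f')"

definition OSp_cone_act ::
  "(complex^'p^'p) \<times> (complex^('q::finite + 'q)^('q + 'q))
    \<Rightarrow> complex^('m::finite \<Rightarrow> 'p + ('q + 'q)) \<Rightarrow> complex^('m \<Rightarrow> 'p + ('q + 'q))"
where
  "OSp_cone_act g = tensor_act (blk g)"

text \<open>\<open>\<Sum>\<^sub>k v\<^sub>k \<otimes> e\<^sub>k \<mapsto> v\<^sub>1 \<and> \<dots> \<and> v\<^sub>m\<close>.\<close>

definition column_wedge :: "complex^'m^'n \<Rightarrow> complex^('m \<Rightarrow> 'n)" where
  "column_wedge w = wedge (\<lambda>k. column k w)"

end

theory Submission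
  imports Defs "HOL-Computational_Algebra.Fundamental_Theorem_Algebra"
begin

text \<open>
  A point of \<open>W\<close> is a matrix \<open>w\<close> with blocks \<open>w\<^sub>1\<close>, \<open>w\<^sub>2\<close>; \<open>\<psi>\<close> is the Gram map \<open>w \<mapsto> (w\<^sub>1\<^sup>T w\<^sub>1, w\<^sub>2\<^sup>T J w\<^sub>2)\<close> and
  \<open>\<phi>\<close> the vector of maximal minors. By Witt's theorem two points whose blocks have full rank are conjugate under
  \<open>G\<close> as soon as their Gram matrices agree, such points are dense in every fibre of \<open>\<psi>\<close>, and \<open>\<psi>\<close> has a polynomial section
  through them. Flatness and reducedness follow from a weight for which the initial forms of the Gram entries are products
  of pairwise distinct coordinates. Cayley's Omega process shows that the minors generate the \<open>SL\<close>-invariants.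

  The lift of the orbit of \<open>A\<close> consists of the wedges of the full rank points \<open>w\<close> with Gram sum in the orbit of \<open>A\<close>, and its
  closure of the wedges of all \<open>w\<close> with Gram sum in the closure of the orbit. Away from \<open>0\<close> this is a computation
  in Pluecker coordinates. At \<open>0\<close> one needs a degenerate point in the closure of the orbit: if \<open>det (S + z A)\<close> does not vanish
  identically in \<open>z\<close> it is an invariant that separates, and otherwise the eigenvectors of the pencil give a one-parameter
  subgroup that contracts \<open>S + A\<close> to a form with a common left and right kernel. That an orbit is determined by its closure
  follows from the extension of homomorphisms (Chevalley).
\<close>

section \<open>Polynomial functions\<close>

text \<open>The lifting condition demands that \<open>\<phi>\<close> maps the preimage of an orbit
  closure onto a closed set. For quotients by reductive groups this is true of every closed
  invariant set; here it is verified on charts of the cone. Where a maximal minor is nonzero, a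
  matrix with given Pluecker coordinates is a rational function of them, so equations on
  \<open>W\<close> become equations on the cone. The charts miss only the vertex \<open>0\<close>,
  whose fibre consists of all matrices of deficient rank. The lift is claimed to be the only orbit
  with the right closure among all orbits of the cone, those of degenerate points included. This is
  why orbits have to be recovered from their closures. The bound on \<open>p\<close> serves the
  symmetric form: the orthogonal space of fewer than \<open>m\<close> vectors must contain
  nonisotropic vectors, for reflections, and isotropic ones outside their span, for density. For the
  symplectic form every vector is isotropic. Density is proved in the Euclidean topology, where
  explicit curves have limits, and passes to Zariski closures by continuity of polynomials.\<close>

lemma poly_funs_sum:
  "(!!i. i \<in> I ==> f i \<in> poly_funs B) ==> (%x. \<Sum>i\<in>I. f i x) \<in> poly_funs B"
  by (induction I rule: infinite_finite_induct) (auto intro: poly_funs.intros)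

lemma poly_funs_prod:
  "(!!i. i \<in> I ==> f i \<in> poly_funs B) ==> (%x. \<Prod>i\<in>I. f i x) \<in> poly_funs B"
  by (induction I rule: infinite_finite_induct) (auto intro: poly_funs.intros)

lemma poly_funs_power: "f \<in> poly_funs B ==> (%x. f x ^ n) \<in> poly_funs B"
  by (induction n) (auto intro: poly_funs.intros)

lemma poly_funs_cmult: "f \<in> poly_funs B ==> (%x. c * f x) \<in> poly_funs B"
  by (auto intro: poly_funs.intros)

lemma poly_funs_uminus: "f \<in> poly_funs B ==> (%x. - f x) \<in> poly_funs B"
  using poly_funs_cmult[of f B "-1"] by simp

lemma poly_funs_diff: "f \<in> poly_funs B ==> g \<in> poly_funs B ==> (%x. f x - g x) \<in> poly_funs B"
  using poly_funs.add[OF _ poly_funs_uminus, of f B g] by simp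

lemma poly_funs_divide: "f \<in> poly_funs B ==> (%x. f x / c) \<in> poly_funs B"
  using poly_funs_cmult[of f B "1/c"] by simp

lemmas poly_funs_intros = poly_funs.intros poly_funs_sum poly_funs_prod poly_funs_power
  poly_funs_uminus poly_funs_diff poly_funs_divide

lemma poly_funs_compose:
  assumes "f \<in> poly_funs B" and "!!g. g \<in> B ==> (%x. g (h x)) \<in> poly_funs C"
  shows "(%x. f (h x)) \<in> poly_funs C"
  using assms(1) by induction (auto intro: poly_funs.intros assms(2))

lemma poly_funs_mono: "f \<in> poly_funs B ==> B \<subseteq> C ==> f \<in> poly_funs C"
  by (rule poly_funs_compose[of f B "%x. x"]) (auto intro: poly_funs.coord)

lemma mat_coord: "(%A. A $ i $ j) \<in> poly_funs mat_coords"
  by (rule poly_funs.coord) (auto simp: mat_coords_def)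

lemma vec_coord: "(%v. v $ i) \<in> poly_funs vec_coords"
  by (rule poly_funs.coord) (auto simp: vec_coords_def)

lemma poly_funs_compose_mat:
  assumes "f \<in> poly_funs mat_coords" and "!!i j. (%x. h x $ i $ j) \<in> poly_funs C"
  shows "(%x. f (h x)) \<in> poly_funs C"
  by (rule poly_funs_compose[OF assms(1)]) (auto simp: mat_coords_def assms(2))

lemma poly_funs_compose_vec:
  assumes "f \<in> poly_funs vec_coords" and "!!i. (%x. h x $ i) \<in> poly_funs C"
  shows "(%x. f (h x)) \<in> poly_funs C"
  by (rule poly_funs_compose[OF assms(1)]) (auto simp: vec_coords_def assms(2))

lemma poly_funs_det:
  assumes "!!i j. (%x. h x $ i $ j) \<in> poly_funs C"
  shows "(%x. det (h x)) \<in> poly_funs C"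
  unfolding det_def by (intro poly_funs_sum poly_funs.mult poly_funs.const poly_funs_prod assms)

lemma poly_funs_mat_mult:
  assumes "!!i j. (%x. h x $ i $ j) \<in> poly_funs C" and "!!i j. (%x. k x $ i $ j) \<in> poly_funs C"
  shows "(%x. (h x ** k x) $ i $ j) \<in> poly_funs C"
  by (simp add: matrix_matrix_mult_def) (intro poly_funs_sum poly_funs.mult assms)

lemma poly_funs_continuous:
  assumes "f \<in> poly_funs B" and "!!g. g \<in> B ==> continuous_on S g"
  shows "continuous_on S f"
  using assms(1) by induction (simp_all add: assms(2) continuous_on_add continuous_on_mult)

lemma mat_poly_continuous: "f \<in> poly_funs mat_coords ==> continuous_on S f"
  by (erule poly_funs_continuous) (auto simp: mat_coords_def intro!: continuous_intros)

text \<open>The bridge between the two topologies: points are approximated in the Euclidean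
  topology, and continuity carries polynomial equations over to the limit.\<close>

lemma continuous_zero_on_closure:
  fixes f :: "'a::topological_space => complex"
  assumes "continuous_on UNIV f" "x \<in> closure S" "!!y. y \<in> S ==> f y = c"
  shows "f x = c"
proof -
  have "closed (f -` {c})"
    using closed_vimage[OF _ assms(1), of "{c}"] by simp
  then have "closure S \<subseteq> f -` {c}"
    using assms(3) by (intro closure_minimal) auto
  then show ?thesis using assms(2) by auto
qed

text \<open>Restriction to a line reduces questions on polynomial functions to univariate
  polynomials: the domain property below, and later the existence of partial derivatives.\<close>

lemma poly_fun_line:
  assumes "f \<in> poly_funs mat_coords"
  shows "\<exists>P. \<forall>t. f (\<chi> i j. A $ i $ j + t * B $ i $ j) = poly P t"
  using assms
proof induction
  case (const c)
  show ?case by (rule exI[of _ "[:c:]"]) simp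
next
  case (coord f)
  then obtain i j where "f = (%A. A $ i $ j)" by (auto simp: mat_coords_def)
  then show ?case by (intro exI[of _ "[:A$i$j, B$i$j:]"]) simp
next
  case (add f g)
  then obtain P Q where "\<forall>t. f (\<chi> i j. A $ i $ j + t * B $ i $ j) = poly P t"
    "\<forall>t. g (\<chi> i j. A $ i $ j + t * B $ i $ j) = poly Q t" by blast
  then show ?case by (intro exI[of _ "P + Q"]) simp
next
  case (mult f g)
  then obtain P Q where "\<forall>t. f (\<chi> i j. A $ i $ j + t * B $ i $ j) = poly P t"
    "\<forall>t. g (\<chi> i j. A $ i $ j + t * B $ i $ j) = poly Q t" by blast
  then show ?case by (intro exI[of _ "P * Q"]) simp
qed

text \<open>On the line through a point with \<open>f x ~= 0\<close> and a point with
  \<open>g y ~= 0\<close> both functions restrict to nonzero polynomials, and so does their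
  product.\<close>

lemma mat_poly_domain:
  fixes f g :: "complex^'m^'n => complex"
  assumes f: "f \<in> poly_funs mat_coords" and g: "g \<in> poly_funs mat_coords"
    and fg: "!!x. f x * g x = 0"
  shows "(\<forall>x. f x = 0) \<or> (\<forall>x. g x = 0)"
proof (rule ccontr)
  assume "~ ?thesis"
  then obtain x y where x: "f x ~= 0" and y: "g y ~= 0" by blast
  let ?l = "%t. \<chi> i j. x $ i $ j + t * (y - x) $ i $ j"
  obtain P Q where P: "!!t. f (?l t) = poly P t" and Q: "!!t. g (?l t) = poly Q t"
    using poly_fun_line[OF f] poly_fun_line[OF g] by metis
  have l: "?l 0 = x" "?l 1 = y" by (simp_all add: vec_eq_iff)
  have "poly P 0 ~= 0" "poly Q 1 ~= 0"
    using x y P[of 0] Q[of 1] l by simp_all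
  then have "P * Q ~= 0" by auto
  moreover have "poly (P * Q) t = 0" for t
    using fg[of "?l t"] P Q by simp
  ultimately show False
    using poly_all_0_iff_0 by blast
qed

text \<open>A nonempty principal open set is dense: identities obtained where \<open>det\<close> or
  a minor is nonzero extend to all matrices.\<close>

lemma mat_poly_zero:
  assumes "f \<in> poly_funs mat_coords" "g \<in> poly_funs mat_coords"
    and "!!x. g x ~= 0 ==> f x = 0" "g y ~= 0"
  shows "f x = 0"
proof -
  have "f x * g x = 0" for x using assms(3)[of x] by auto
  from mat_poly_domain[OF assms(1,2) this] show ?thesis using assms(4) by auto
qed

section \<open>Zariski closures\<close>

text \<open>In the record \<open>variety\<close> the regular functions are an arbitrary set. Closure
  under products is what turns the principal open sets from a subbasis into a basis of
  \<open>zariski\<close>.\<close>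

definition multiplicative_variety :: "'a variety => bool" where
  "multiplicative_variety Z \<longleftrightarrow>
     (\<forall>f\<in>regular Z. \<forall>g\<in>regular Z. \<exists>h\<in>regular Z. \<forall>x\<in>points Z. h x = f x * g x) &
     (\<exists>h\<in>regular Z. \<forall>x\<in>points Z. h x = 1)"

lemma multiplicative_variety_poly_funs:
  "multiplicative_variety \<lparr>points = A, regular = poly_funs B\<rparr>"
  unfolding multiplicative_variety_def
  by (auto intro: bexI[OF _ poly_funs.mult] bexI[OF _ poly_funs.const])

lemma multiplicative_mat_space: "multiplicative_variety mat_space"
  unfolding mat_space_def by (rule multiplicative_variety_poly_funs)

lemma multiplicative_grassmann_cone: "multiplicative_variety grassmann_cone"
  unfolding grassmann_cone_def by (rule multiplicative_variety_poly_funs)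

lemma openin_zariski_nbhd:
  assumes Z: "multiplicative_variety Z" and "openin (zariski Z) T" "x \<in> T"
  shows "\<exists>f\<in>regular Z. f x ~= 0 & {y \<in> points Z. f y ~= 0} \<subseteq> T & x \<in> points Z"
proof -
  have "generate_topology_on {{x \<in> points Z. f x ~= 0} | f. f \<in> regular Z} T"
    using assms(2) by (simp add: zariski_def openin_topology_generated_by_iff)
  then show ?thesis using assms(3)
  proof (induction)
    case (Int a b)
    then obtain f g where fg: "f \<in> regular Z" "f x ~= 0" "{y \<in> points Z. f y ~= 0} \<subseteq> a"
      "g \<in> regular Z" "g x ~= 0" "{y \<in> points Z. g y ~= 0} \<subseteq> b" "x \<in> points Z" by blast
    then obtain h where h: "h \<in> regular Z" "\<forall>x\<in>points Z. h x = f x * g x"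
      using Z fg(1,4) unfolding multiplicative_variety_def by blast
    have "h x ~= 0" using h(2) fg(2,5,7) by simp
    moreover have "{y \<in> points Z. h y ~= 0} \<subseteq> a \<inter> b"
    proof
      fix y assume "y \<in> {y \<in> points Z. h y ~= 0}"
      then have "y \<in> points Z" "f y ~= 0" "g y ~= 0" using h(2) by auto
      then show "y \<in> a \<inter> b" using fg(3,6) by blast
    qed
    ultimately show ?case using h(1) fg(7) by blast
  next
    case (UN K)
    then obtain k where "k \<in> K" "x \<in> k" by blast
    with UN.IH[OF this] show ?case by blast
  qed blast+
qed

lemma openin_zariski_basic: "f \<in> regular Z ==> openin (zariski Z) {x \<in> points Z. f x ~= 0}"
  unfolding zariski_def by (rule topology_generated_by_Basis) blast

lemma topspace_zariski:
  assumes "multiplicative_variety Z"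
  shows "topspace (zariski Z) = points Z"
proof -
  obtain h where "h \<in> regular Z" "\<forall>x\<in>points Z. h x = 1"
    using assms by (auto simp: multiplicative_variety_def)
  then have "x \<in> {x \<in> points Z. h x ~= 0}" if "x \<in> points Z" for x
    using that by simp
  then have "points Z \<subseteq> \<Union> {{x \<in> points Z. f x ~= 0} | f. f \<in> regular Z}"
    using \<open>h \<in> regular Z\<close> by blast
  then show ?thesis
    unfolding zariski_def topology_generated_by_topspace by blast
qed

lemma zariski_closure_of_iff:
  assumes Z: "multiplicative_variety Z" and S: "S \<subseteq> points Z"
  shows "x \<in> zariski Z closure_of S \<longleftrightarrow>
           x \<in> points Z & (\<forall>f\<in>regular Z. (\<forall>y\<in>S. f y = 0) --> f x = 0)"
proof (intro iffI conjI ballI impI)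
  assume x: "x \<in> zariski Z closure_of S"
  then show p: "x \<in> points Z"
    using topspace_zariski[OF Z] by (auto simp: in_closure_of)
  fix f assume f: "f \<in> regular Z" "\<forall>y\<in>S. f y = 0"
  show "f x = 0"
  proof (rule ccontr)
    assume "f x ~= 0"
    then have "x \<in> {x \<in> points Z. f x ~= 0}" using p by simp
    moreover have "\<forall>T. x \<in> T & openin (zariski Z) T --> (\<exists>y. y \<in> S & y \<in> T)"
      using x by (simp add: in_closure_of)
    ultimately have "\<exists>y. y \<in> S & y \<in> {x \<in> points Z. f x ~= 0}"
      using openin_zariski_basic[OF f(1)] by metis
    then obtain y where "y \<in> S" "f y ~= 0" by blast
    then show False using f(2) by blast
  qed
next
  assume *: "x \<in> points Z & (\<forall>f\<in>regular Z. (\<forall>y\<in>S. f y = 0) --> f x = 0)"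
  show "x \<in> zariski Z closure_of S"
    unfolding in_closure_of
  proof (intro conjI allI impI)
    show "x \<in> topspace (zariski Z)" using * topspace_zariski[OF Z] by auto
    fix T assume "x \<in> T & openin (zariski Z) T"
    then obtain f where f: "f \<in> regular Z" "f x ~= 0" "{y \<in> points Z. f y ~= 0} \<subseteq> T"
      using openin_zariski_nbhd[OF Z] by blast
    then obtain y where "y \<in> S" "f y ~= 0" using * by blast
    then show "\<exists>y. y \<in> S & y \<in> T" using f(3) S by blast
  qed
qed

lemma zariski_closure_of_zero:
  assumes "multiplicative_variety Z" "S \<subseteq> points Z" "x \<in> zariski Z closure_of S"
    and "f \<in> regular Z" "!!y. y \<in> S ==> f y = 0"
  shows "f x = 0"
  using zariski_closure_of_iff[OF assms(1,2)] assms(3-5) by blast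

lemma variety_iso_closure_of:
  assumes h: "variety_iso Z Z' h" and Z: "multiplicative_variety Z" and Z': "multiplicative_variety Z'"
    and S: "S \<subseteq> points Z"
  shows "h ` (zariski Z closure_of S) = zariski Z' closure_of (h ` S)"
proof -
  have bij: "bij_betw h (points Z) (points Z')"
    and r1: "regular_map Z Z' h" and r2: "regular_map Z' Z (inv_into (points Z) h)"
    using h by (auto simp: variety_iso_def)
  have hS: "h ` S \<subseteq> points Z'" using bij S by (auto simp: bij_betw_def)
  have inv: "inv_into (points Z) h (h x) = x" if "x \<in> points Z" for x
    using bij that by (auto simp: bij_betw_def)
  have iff: "h x \<in> zariski Z' closure_of (h ` S) \<longleftrightarrow> x \<in> zariski Z closure_of S"
    if x: "x \<in> points Z" for x
  proof
    assume a: "h x \<in> zariski Z' closure_of (h ` S)"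
    show "x \<in> zariski Z closure_of S"
      unfolding zariski_closure_of_iff[OF Z S]
    proof (intro conjI ballI impI x)
      fix f assume f: "f \<in> regular Z" "\<forall>y\<in>S. f y = 0"
      obtain f' where f': "f' \<in> regular Z'" "\<forall>x\<in>points Z'. f (inv_into (points Z) h x) = f' x"
        using r2 f by (auto simp: regular_map_def)
      have f'h: "f' (h y) = f y" if "y \<in> points Z" for y
        using f'(2)[rule_format, of "h y"] inv[OF that] bij_betwE[OF bij] that by simp
      have "f' (h x) = 0"
        by (rule zariski_closure_of_zero[OF Z' hS a f'(1)]) (use f'h f(2) S in auto)
      then show "f x = 0" using f'h[OF x] by simp
    qed
  next
    assume a: "x \<in> zariski Z closure_of S"
    show "h x \<in> zariski Z' closure_of (h ` S)"
      unfolding zariski_closure_of_iff[OF Z' hS]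
    proof (intro conjI ballI impI)
      show "h x \<in> points Z'" using bij x by (auto simp: bij_betw_def)
      fix f assume f: "f \<in> regular Z'" "\<forall>y\<in>h ` S. f y = 0"
      obtain f' where f': "f' \<in> regular Z" "\<forall>x\<in>points Z. f (h x) = f' x"
        using r1 f by (auto simp: regular_map_def)
      have "f' x = 0"
        by (rule zariski_closure_of_zero[OF Z S a f'(1)])
           (metis f'(2) f(2) S imageI subsetD)
      then show "f (h x) = 0" using f'(2) x by simp
    qed
  qed
  have sub: "zariski Z closure_of S \<subseteq> points Z" "zariski Z' closure_of (h ` S) \<subseteq> points Z'"
    using closure_of_subset_topspace topspace_zariski[OF Z] topspace_zariski[OF Z'] by metis+
  show ?thesis
  proof (intro Set.set_eqI iffI)
    fix y assume "y \<in> h ` (zariski Z closure_of S)"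
    then show "y \<in> zariski Z' closure_of (h ` S)" using iff sub by blast
  next
    fix y assume y: "y \<in> zariski Z' closure_of (h ` S)"
    then have "y \<in> h ` points Z" using sub bij_betw_imp_surj_on[OF bij] by blast
    then obtain x where "x \<in> points Z" "y = h x" by blast
    then show "y \<in> h ` (zariski Z closure_of S)" using iff y by blast
  qed
qed

section \<open>Monomials and initial forms\<close>

text \<open>The linear span of the \<open>F i\<close> with \<open>Q i\<close>, built by adding one
  term at a time so that proofs go by induction. The predicate \<open>Q\<close> will bound weights
  or degrees, which makes the spans a filtration.\<close>

inductive_set wspan :: "('i => 'w => complex) => ('i => bool) => ('w => complex) set"
  for F Q where
  zero: "(%_. 0) \<in> wspan F Q"
| step: "f \<in> wspan F Q ==> Q i ==> (%w. f w + c * F i w) \<in> wspan F Q"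

lemma wspan_base: "Q i ==> F i \<in> wspan F Q"
  using wspan.step[OF wspan.zero, of Q i 1 F] by simp

lemma wspan_add: "g \<in> wspan F Q ==> f \<in> wspan F Q ==> (%w. f w + g w) \<in> wspan F Q"
proof (induction rule: wspan.induct)
  case (step g i c)
  from wspan.step[of _ F Q i c, OF step.IH[OF step.prems] step.hyps(2)] show ?case
    by (simp add: add.assoc)
qed auto

lemma wspan_cmult: "f \<in> wspan F Q ==> (%w. c * f w) \<in> wspan F Q"
proof (induction rule: wspan.induct)
  case (step g i k)
  from wspan.step[of _ F Q i "c * k", OF step.IH step.hyps(2)] show ?case
    by (simp add: algebra_simps)
qed (simp add: wspan.zero)

lemma wspan_diff: "f \<in> wspan F Q ==> g \<in> wspan F Q ==> (%w. f w - g w) \<in> wspan F Q"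
  using wspan_add[OF wspan_cmult[of g F Q "-1"], of f] by simp

lemma wspan_sum:
  "(!!i. i \<in> I ==> f i \<in> wspan F Q) ==> (%w. \<Sum>i\<in>I. f i w) \<in> wspan F Q"
  by (induction I rule: infinite_finite_induct) (auto intro: wspan.zero wspan_add)

lemma wspan_subset:
  assumes "f \<in> wspan F Q" "!!i. Q i ==> F i \<in> wspan G R"
  shows "f \<in> wspan G R"
  using assms(1)
proof induction
  case (step f i c)
  show ?case by (rule wspan_add[OF wspan_cmult[OF assms(2)[OF step.hyps(2)]] step.IH])
qed (rule wspan.zero)

lemma wspan_mono: "f \<in> wspan F Q ==> (!!i. Q i ==> R i) ==> f \<in> wspan F R"
  by (erule wspan_subset) (simp add: wspan_base)

definition comb :: "('i => 'w => complex) => ('i => complex) => 'w => complex" where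
  "comb F K w = (\<Sum>i | K i ~= 0. K i * F i w)"

definition indep :: "('i => 'w => complex) => bool" where
  "indep F \<longleftrightarrow> (\<forall>K. finite {i. K i ~= 0} --> (\<forall>w. comb F K w = 0) --> (\<forall>i. K i = 0))"

lemma comb_superset: "finite A ==> {i. K i ~= 0} \<subseteq> A ==> comb F K w = (\<Sum>i\<in>A. K i * F i w)"
  unfolding comb_def by (rule sum.mono_neutral_left) auto

lemma comb_add:
  assumes "finite {i. K i ~= 0}" "finite {i. L i ~= 0}"
  shows "comb F (%i. K i + L i) w = comb F K w + comb F L w"
    and "finite {i. K i + L i ~= 0}"
proof -
  let ?A = "{i. K i ~= 0} \<union> {i. L i ~= 0}"
  have A: "finite ?A" "{i. K i + L i ~= 0} \<subseteq> ?A" using assms by auto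
  show "comb F (%i. K i + L i) w = comb F K w + comb F L w"
    using A by (subst (1 2 3) comb_superset[of ?A]) (auto simp: algebra_simps sum.distrib)
  show "finite {i. K i + L i ~= 0}" using A finite_subset by blast
qed

lemma comb_cmult: "comb F (%i. c * K i) w = c * comb F K w"
  by (cases "c = 0") (simp_all add: comb_def sum_distrib_left mult.assoc)

lemma finite_supp_cmult: "finite {i. K i ~= (0::complex)} ==> finite {i. c * K i ~= 0}"
  by (rule finite_subset[of _ "{i. K i ~= 0}"]) auto

lemma comb_single: "comb F (%j. if j = i then c else 0) w = c * F i w"
  by (subst comb_superset[of "{i}"]) auto

lemma wspan_comb:
  assumes "f \<in> wspan F Q"
  shows "\<exists>K. finite {i. K i ~= 0} & (\<forall>i. K i ~= 0 --> Q i) & f = comb F K"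
  using assms
proof induction
  case zero
  then show ?case by (intro exI[of _ "%_. 0"]) (auto simp: comb_def)
next
  case (step f i c)
  then obtain K where K: "finite {i. K i ~= 0}" "\<forall>i. K i ~= 0 --> Q i" "f = comb F K" by blast
  let ?L = "%j. if j = i then c else 0"
  have L: "finite {j. ?L j ~= 0}" by (rule finite_subset[of _ "{i}"]) auto
  show ?case
    using K step.hyps(2)
    by (intro exI[of _ "%j. K j + ?L j"])
       (auto simp: fun_eq_iff comb_add[OF K(1) L] comb_single intro: comb_add(2)[OF K(1) L] split: if_splits)
qed

lemma comb_wspan:
  assumes "finite {i. K i ~= 0}" "!!i. K i ~= 0 ==> Q i"
  shows "comb F K \<in> wspan F Q"
proof -
  have "(%w. \<Sum>i\<in>{i. K i ~= 0}. K i * F i w) \<in> wspan F Q"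
    by (intro wspan_sum wspan_cmult wspan_base) (auto intro: assms(2))
  then show ?thesis by (simp add: comb_def[abs_def])
qed

lemma indep_unique:
  assumes "indep F" "finite {i. K i ~= 0}" "finite {i. L i ~= 0}" "comb F K = comb F L"
  shows "K = L"
proof -
  have L': "finite {i. - L i ~= 0}" using assms(3) by simp
  have "comb F (%i. K i + - L i) w = 0" for w
    using comb_add(1)[OF assms(2) L', of F w] comb_cmult[of F "-1" L w] assms(4) by simp
  then have "\<forall>i. K i + - L i = 0"
    using assms(1)[unfolded indep_def, rule_format, of "%i. K i + - L i"] comb_add(2)[OF assms(2) L'] by blast
  then show ?thesis by (auto simp: fun_eq_iff)
qed

text \<open>Both expansions of \<open>f\<close> have the same coefficients by independence, so every
  index that occurs satisfies both conditions.\<close>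

lemma wspan_inter:
  assumes "indep F" "f \<in> wspan F Q" "f \<in> wspan F R"
  shows "f \<in> wspan F (%i. Q i & R i)"
proof -
  obtain K where K: "finite {i. K i ~= 0}" "\<forall>i. K i ~= 0 --> Q i" "f = comb F K"
    using wspan_comb[OF assms(2)] by blast
  obtain L where L: "finite {i. L i ~= 0}" "\<forall>i. L i ~= 0 --> R i" "f = comb F L"
    using wspan_comb[OF assms(3)] by blast
  have "K = L" using indep_unique[OF assms(1) K(1) L(1)] K(3) L(3) by simp
  then show ?thesis using K L by (auto intro: comb_wspan)
qed

text \<open>Coefficients are chosen by \<open>SOME\<close>. Independence makes them the only ones,
  hence additive and homogeneous in the function, and \<open>L\<close> is obtained by putting
  \<open>h\<close> in place of \<open>F\<close>.\<close>

lemma indep_linear_extension: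
  fixes F :: "'i => 'w => complex" and h :: "'i => 'z => complex"
  assumes F: "indep F"
  shows "\<exists>L. (\<forall>f\<in>wspan F (%_. True). \<forall>g\<in>wspan F (%_. True). L (%w. f w + g w) = (%w. L f w + L g w)) &
    (\<forall>f\<in>wspan F (%_. True). \<forall>c. L (%w. c * f w) = (%w. c * L f w)) & (\<forall>i. L (F i) = h i)"
proof -
  let ?S = "wspan F (%_. True)"
  define k where "k f = (SOME K. finite {i. K i ~= 0} & f = comb F K)" for f
  have k: "finite {i. k f i ~= 0}" "comb F (k f) = f" if "f \<in> ?S" for f
  proof -
    have "\<exists>K. finite {i. K i ~= 0} & f = comb F K" using wspan_comb[OF that] by blast
    then have "finite {i. k f i ~= 0} & f = comb F (k f)" unfolding k_def by (rule someI_ex)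
    then show "finite {i. k f i ~= 0}" "comb F (k f) = f" by simp_all
  qed
  have k_eq: "k f = K" if "finite {i. K i ~= 0}" "comb F K = f" for f K
  proof -
    have "comb F K \<in> ?S" by (rule comb_wspan[OF that(1)]) simp
    then have "f \<in> ?S" using that(2) by simp
    then have "comb F (k f) = comb F K" using k(2) that(2) by simp
    with indep_unique[OF F k(1)[OF \<open>f \<in> ?S\<close>] that(1)] show ?thesis by blast
  qed
  define L where "L f = comb h (k f)" for f
  have "L (%w. f w + g w) = (%w. L f w + L g w)" if "f \<in> ?S" "g \<in> ?S" for f g
  proof -
    have "k (%w. f w + g w) = (%i. k f i + k g i)"
      by (intro k_eq comb_add(2) k that) (simp add: fun_eq_iff comb_add(1) k that)
    then have "L (%w. f w + g w) = comb h (%i. k f i + k g i)" by (simp only: L_def)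
    also have "\<dots> = (%w. L f w + L g w)" by (rule ext) (simp add: L_def comb_add(1) k that)
    finally show ?thesis .
  qed
  moreover have "L (%w. c * f w) = (%w. c * L f w)" if "f \<in> ?S" for f c
  proof -
    have "k (%w. c * f w) = (%i. c * k f i)"
      by (intro k_eq finite_supp_cmult k that) (simp add: fun_eq_iff comb_cmult k that)
    then have "L (%w. c * f w) = comb h (%i. c * k f i)" by (simp only: L_def)
    also have "\<dots> = (%w. c * L f w)" by (rule ext) (simp add: L_def comb_cmult)
    finally show ?thesis .
  qed
  moreover have "L (F i) = h i" for i
  proof -
    have "k (F i) = (%j. if j = i then 1 else 0)"
      by (rule k_eq) (auto simp: fun_eq_iff comb_single intro: finite_subset[of _ "{i}"])
    then have "L (F i) = comb h (%j. if j = i then 1 else 0)" by (simp only: L_def)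
    also have "\<dots> = h i" by (rule ext) (simp add: comb_single)
    finally show ?thesis .
  qed
  ultimately show ?thesis by blast
qed

section \<open>Monomials in a system of coordinates\<close>

definition mon :: "('v::finite => 'w => complex) => ('v => nat) => 'w => complex" where
  "mon u \<mu> w = (\<Prod>v\<in>UNIV. u v w ^ \<mu> v)"

lemma mon_add: "mon u (%v. \<mu> v + \<nu> v) w = mon u \<mu> w * mon u \<nu> w"
  by (simp add: mon_def power_add prod.distrib)

lemma mon_zero: "mon u (%_. 0) w = 1"
  by (simp add: mon_def)

lemma mon_single: "mon u (%v. if v = x then n else 0) w = u x w ^ n"
proof -
  have "mon u (%v. if v = x then n else 0) w = (\<Prod>v\<in>UNIV. if v = x then u x w ^ n else 1)"
    unfolding mon_def by (intro prod.cong) auto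
  then show ?thesis by simp
qed

lemma wspan_mon_mult:
  assumes "f \<in> wspan (mon u) Q" "g \<in> wspan (mon u) R"
    and "!!\<mu> \<nu>. Q \<mu> ==> R \<nu> ==> T (%v. \<mu> v + \<nu> v)"
  shows "(%w. f w * g w) \<in> wspan (mon u) T"
  using assms(1)
proof induction
  case zero
  show ?case by (simp add: wspan.zero)
next
  case (step f \<mu> c)
  have "(%w. mon u \<mu> w * g w) \<in> wspan (mon u) T"
    using assms(2)
  proof induction
    case zero
    show ?case by (simp add: wspan.zero)
  next
    case (step g \<nu> k)
    from wspan.step[of _ "mon u" T "%v. \<mu> v + \<nu> v" k, OF step.IH assms(3)[OF \<open>Q \<mu>\<close> step.hyps(2)]]
    show ?case by (simp add: mon_add algebra_simps)
  qed
  from wspan_add[OF wspan_cmult[OF this, of c] step.IH] show ?case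
    by (simp add: algebra_simps)
qed

lemma mon_poly_funs: "mon u \<mu> \<in> poly_funs (range u)"
  unfolding mon_def[abs_def] by (intro poly_funs_prod poly_funs_power poly_funs.coord) simp

lemma poly_funs_eq_wspan: "poly_funs (range u) = wspan (mon u) (%_. True)"
proof (intro Set.set_eqI iffI)
  fix f assume "f \<in> poly_funs (range u)"
  then show "f \<in> wspan (mon u) (%_. True)"
  proof induction
    case (const c)
    have "mon u (%_. 0) = (%_. 1)" by (rule ext) (rule mon_zero)
    with wspan_cmult[OF wspan_base[of "%_. True" "%_. 0" "mon u"], of c] show ?case by simp
  next
    case (coord f)
    then obtain x where "f = u x" by blast
    then have "f = mon u (%v. if v = x then 1 else 0)" by (auto simp: mon_single)
    then show ?case by (simp add: wspan_base)
  next
    case (add f g)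
    then show ?case by (simp add: wspan_add)
  next
    case (mult f g)
    show ?case by (rule wspan_mon_mult[OF mult.IH]) simp
  qed
next
  fix f assume "f \<in> wspan (mon u) (%_. True)"
  then show "f \<in> poly_funs (range u)"
    by induction (intro poly_funs.const poly_funs.add poly_funs_cmult mon_poly_funs; assumption)+
qed

lemma digits_unique:
  fixes d e :: "nat => nat"
  assumes "!!i. i < n ==> d i < N" "!!i. i < n ==> e i < N"
    and "(\<Sum>i<n. d i * N ^ i) = (\<Sum>i<n. e i * N ^ i)" "i < n"
  shows "d i = e i"
  using assms
proof (induction n arbitrary: d e i)
  case (Suc n)
  have shift: "(\<Sum>i<Suc n. d i * N ^ i) = d 0 + N * (\<Sum>i<n. d (Suc i) * N ^ i)" for d
    by (subst sum.lessThan_Suc_shift) (simp add: sum_distrib_left mult_ac)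
  have *: "d 0 + N * (\<Sum>i<n. d (Suc i) * N ^ i) = e 0 + N * (\<Sum>i<n. e (Suc i) * N ^ i)"
    using Suc.prems(3) shift by simp
  have d0: "d 0 < N" "e 0 < N" using Suc.prems by auto
  have "d 0 = (d 0 + N * (\<Sum>i<n. d (Suc i) * N ^ i)) mod N" using d0 by simp
  also have "\<dots> = e 0" using d0 by (simp add: *)
  finally have 0: "d 0 = e 0" .
  then have "(\<Sum>i<n. d (Suc i) * N ^ i) = (\<Sum>i<n. e (Suc i) * N ^ i)"
    using * d0 by simp
  then have "d (Suc j) = e (Suc j)" if "j < n" for j
    using Suc.IH[of "%i. d (Suc i)" "%i. e (Suc i)" j] Suc.prems(1,2) that by simp
  then show ?case using 0 Suc.prems(4) by (cases i) auto
qed simp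

text \<open>Independence of the coordinates is expressed by their taking arbitrary values
  simultaneously; linear changes of matrix entries, as used for the Gram entries, satisfy this by
  solving for the entries.\<close>

definition coordinates :: "('v => 'w => complex) => bool" where
  "coordinates u \<longleftrightarrow> (\<forall>c. \<exists>w. \<forall>v. u v w = c v)"

text \<open>Kronecker substitution \<open>u\<^sub>i = t ^ N ^ i\<close> separates the finitely many monomials involved.\<close>

lemma indep_mon:
  fixes u :: "'v::finite => 'w => complex"
  assumes u: "coordinates u"
  shows "indep (mon u)"
  unfolding indep_def
proof (intro allI impI)
  fix K :: "('v => nat) => complex" and \<mu>
  assume fin: "finite {\<mu>. K \<mu> ~= 0}" and 0: "\<forall>w. comb (mon u) K w = 0"
  \<comment> \<open>\<open>N\<close> exceeds every exponent that occurs, so exponents are digits in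
    base \<open>N\<close> and distinct monomials receive distinct powers of
    \<open>t\<close>.\<close>
  define N where "N = Suc (\<Sum>\<mu> | K \<mu> ~= 0. \<Sum>v\<in>UNIV. \<mu> v)"
  have N: "\<mu> v < N" if "K \<mu> ~= 0" for \<mu> v
  proof -
    have "\<mu> v \<le> (\<Sum>v\<in>UNIV. \<mu> v)" by (rule member_le_sum) auto
    also have "\<dots> \<le> (\<Sum>\<mu> | K \<mu> ~= 0. \<Sum>v\<in>UNIV. \<mu> v)"
      by (rule member_le_sum[where f = "%\<mu>. \<Sum>v\<in>UNIV. \<mu> v"]) (use fin that in auto)
    finally show ?thesis by (simp add: N_def)
  qed
  obtain e where e: "bij_betw e {..<CARD('v)} (UNIV :: 'v set)"
    using ex_bij_betw_nat_finite[of "UNIV :: 'v set"] by (auto simp: atLeast0LessThan)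
  define code where "code \<mu> = (\<Sum>i<CARD('v). \<mu> (e i) * N ^ i)" for \<mu>
  have inj: "inj_on code {\<mu>. K \<mu> ~= 0}"
  proof (rule inj_onI)
    fix \<mu> \<nu> assume *: "\<mu> \<in> {\<mu>. K \<mu> ~= 0}" "\<nu> \<in> {\<mu>. K \<mu> ~= 0}" "code \<mu> = code \<nu>"
    have "\<mu> (e i) = \<nu> (e i)" if "i < CARD('v)" for i
      using * N that by (intro digits_unique[of "CARD('v)" "%i. \<mu> (e i)" N "%i. \<nu> (e i)"]) (auto simp: code_def)
    then have "\<mu> v = \<nu> v" for v
      using bij_betw_imp_surj_on[OF e] by (metis UNIV_I imageE lessThan_iff)
    then show "\<mu> = \<nu>" by auto
  qed
  define p where "p = (\<Sum>\<mu> | K \<mu> ~= 0. Polynomial.monom (K \<mu>) (code \<mu>))"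
  have "poly p t = 0" for t
  proof -
    obtain w where w: "!!v. u v w = t ^ (N ^ (inv_into {..<CARD('v)} e v))"
      using u[unfolded coordinates_def, rule_format, of "%v. t ^ (N ^ (inv_into {..<CARD('v)} e v))"] by blast
    have "mon u \<mu> w = t ^ code \<mu>" for \<mu>
    proof -
      have "mon u \<mu> w = (\<Prod>i<CARD('v). u (e i) w ^ \<mu> (e i))"
        unfolding mon_def by (rule prod.reindex_bij_betw[OF e, symmetric])
      also have "\<dots> = (\<Prod>i<CARD('v). t ^ (\<mu> (e i) * N ^ i))"
        using e by (intro prod.cong refl) (simp add: w bij_betw_inv_into_left mult.commute flip: power_mult)
      also have "\<dots> = t ^ code \<mu>" by (simp add: power_sum code_def)
      finally show ?thesis .
    qed
    then have "comb (mon u) K w = poly p t"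
      by (simp add: comb_def p_def poly_sum poly_monom)
    then show ?thesis using 0 by simp
  qed
  then have "\<forall>t. poly p t = 0" by simp
  then have p: "p = 0" by (simp only: poly_all_0_iff_0)
  show "K \<mu> = 0"
  proof (rule ccontr)
    assume \<mu>: "K \<mu> ~= 0"
    have "Polynomial.coeff p (code \<mu>) = (\<Sum>\<nu> | K \<nu> ~= 0. if \<nu> = \<mu> then K \<mu> else 0)"
      unfolding p_def Polynomial.coeff_sum
      by (intro sum.cong refl) (use inj \<mu> in \<open>auto simp: inj_on_def\<close>)
    also have "\<dots> = K \<mu>" using fin \<mu> by simp
    finally show False using p \<mu> by simp
  qed
qed

text \<open>
  Functions \<open>f\<^sub>s\<close> whose initial forms with respect to the weights \<open>\<omega>\<close> are products \<open>u\<^bsub>X s\<^esub> u\<^bsub>Y s\<^esub>\<close> of two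
  variables, no variable being used twice. The functions \<open>bas \<mu>\<close> replace each pair \<open>u\<^bsub>X s\<^esub> u\<^bsub>Y s\<^esub>\<close> occurring
  in a monomial by \<open>f\<^sub>s\<close>.
\<close>

locale initial_pairs =
  fixes u :: "'v::finite => 'w => complex" and \<omega> :: "'v => nat" and P :: "'s set"
    and X Y :: "'s => 'v" and f :: "'s => 'w => complex"
  assumes coords: "coordinates u" and finP: "finite P"
    and injX: "inj_on X P" and injY: "inj_on Y P" and disj: "X ` P \<inter> Y ` P = {}"
    and lead: "s \<in> P ==> (%w. f s w - u (X s) w * u (Y s) w)
          \<in> wspan (mon u) (%\<mu>. (\<Sum>v\<in>UNIV. \<omega> v * \<mu> v) < \<omega> (X s) + \<omega> (Y s))"
begin

section \<open>Leading monomials and the adapted basis\<close>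

definition wt :: "('v => nat) => nat" where "wt \<mu> = (\<Sum>v\<in>UNIV. \<omega> v * \<mu> v)"

text \<open>The leading monomial is \<open>\<mu>\<close> with coefficient one, and nothing else has
  the same weight: initial forms consist of a single term, so no monomial order refining the weight
  is needed.\<close>

definition leads :: "('w => complex) => ('v => nat) => bool" where
  "leads g \<mu> \<longleftrightarrow> (%w. g w - mon u \<mu> w) \<in> wspan (mon u) (%\<nu>. wt \<nu> < wt \<mu>)"

definition \<delta> :: "'s => 'v => nat" where
  "\<delta> s v = (if v = X s then 1 else 0) + (if v = Y s then 1 else 0)"

text \<open>The multiplicity with which the product of the two variables of \<open>s\<close> divides
  the monomial \<open>\<mu>\<close>. No variable belongs to two pairs, so all pairs can be taken out
  at once, and the remaining exponent \<open>\<beta> \<mu>\<close> contains no pair.\<close>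

definition \<alpha> :: "('v => nat) => 's => nat" where "\<alpha> \<mu> s = min (\<mu> (X s)) (\<mu> (Y s))"

definition \<beta> :: "('v => nat) => 'v => nat" where "\<beta> \<mu> v = \<mu> v - (\<Sum>s\<in>P. \<alpha> \<mu> s * \<delta> s v)"

definition bas :: "('v => nat) => 'w => complex" where
  "bas \<mu> w = (\<Prod>s\<in>P. f s w ^ \<alpha> \<mu> s) * mon u (\<beta> \<mu>) w"

lemma wt_add: "wt (%v. \<mu> v + \<nu> v) = wt \<mu> + wt \<nu>"
  by (simp add: wt_def algebra_simps sum.distrib)

lemma leads_wspan: "leads g \<mu> ==> g \<in> wspan (mon u) (%\<nu>. wt \<nu> \<le> wt \<mu>)"
proof -
  assume "leads g \<mu>"
  then have "(%w. g w - mon u \<mu> w) \<in> wspan (mon u) (%\<nu>. wt \<nu> \<le> wt \<mu>)"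
    unfolding leads_def by (rule wspan_mono) simp
  from wspan.step[OF this, of \<mu> 1] show ?thesis by simp
qed

lemma leads_mon: "leads (mon u \<mu>) \<mu>"
  by (simp add: leads_def wspan.zero)

lemma leads_mult:
  assumes "leads g \<mu>" "leads h \<nu>"
  shows "leads (%w. g w * h w) (%v. \<mu> v + \<nu> v)"
proof -
  have "(%w. (g w - mon u \<mu> w) * h w) \<in> wspan (mon u) (%\<kappa>. wt \<kappa> < wt \<mu> + wt \<nu>)"
    using assms(1) leads_wspan[OF assms(2)] unfolding leads_def by (rule wspan_mon_mult) (simp add: wt_add)
  moreover have "(%w. mon u \<mu> w * (h w - mon u \<nu> w)) \<in> wspan (mon u) (%\<kappa>. wt \<kappa> < wt \<mu> + wt \<nu>)"
    using leads_wspan[OF leads_mon] assms(2) unfolding leads_def by (rule wspan_mon_mult) (simp add: wt_add)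
  ultimately show ?thesis
    using wspan_add unfolding leads_def by (fastforce simp: wt_add mon_add algebra_simps)
qed

lemma leads_power: "leads g \<mu> ==> leads (%w. g w ^ n) (%v. n * \<mu> v)"
proof (induction n)
  case 0
  have "mon u (%_. 0) = (%_. 1)" by (rule ext) (rule mon_zero)
  then show ?case using leads_mon[of "%_. 0"] by simp
next
  case (Suc n)
  from leads_mult[OF Suc.prems Suc.IH[OF Suc.prems]] show ?case by simp
qed

lemma leads_prod:
  "finite S ==> (!!s. s \<in> S ==> leads (g s) (\<mu> s)) ==> leads (%w. \<Prod>s\<in>S. g s w) (%v. \<Sum>s\<in>S. \<mu> s v)"
proof (induction rule: finite_induct)
  case empty
  have "mon u (%_. 0) = (%_. 1)" by (rule ext) (rule mon_zero)
  then show ?case using leads_mon[of "%_. 0"] by simp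
next
  case (insert s S)
  then have "leads (%w. g s w * (\<Prod>s\<in>S. g s w)) (%v. \<mu> s v + (\<Sum>s\<in>S. \<mu> s v))"
    by (intro leads_mult) auto
  then show ?case using insert.hyps by simp
qed

lemma wt_\<delta>: "wt (\<delta> s) = \<omega> (X s) + \<omega> (Y s)"
  by (simp add: wt_def \<delta>_def distrib_left sum.distrib if_distrib[of "%x. _ * x"] cong: if_cong)

lemma mon_\<delta>: "mon u (\<delta> s) w = u (X s) w * u (Y s) w"
proof -
  have "\<delta> s = (%v. (if v = X s then 1 else 0) + (if v = Y s then 1 else 0))"
    by (simp add: \<delta>_def fun_eq_iff)
  then show ?thesis by (simp only: mon_add mon_single power_one_right)
qed

lemma leads_f: "s \<in> P ==> leads (f s) (\<delta> s)"
  using lead by (simp add: leads_def mon_\<delta> wt_\<delta> wt_def[symmetric])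

lemma X_neq_Y: "s \<in> P ==> s' \<in> P ==> X s ~= Y s'"
  using disj by auto

lemma sum_X: "s \<in> P ==> (\<Sum>s'\<in>P. a s' * \<delta> s' (X s)) = a s"
proof -
  assume s: "s \<in> P"
  have "(\<Sum>s'\<in>P. a s' * \<delta> s' (X s)) = (\<Sum>s'\<in>P. if s' = s then a s else 0)"
    using s X_neq_Y inj_onD[OF injX] by (intro sum.cong refl) (auto simp: \<delta>_def)
  then show ?thesis using s finP by simp
qed

lemma sum_Y: "s \<in> P ==> (\<Sum>s'\<in>P. a s' * \<delta> s' (Y s)) = a s"
proof -
  assume s: "s \<in> P"
  have "(\<Sum>s'\<in>P. a s' * \<delta> s' (Y s)) = (\<Sum>s'\<in>P. if s' = s then a s else 0)"
    using s X_neq_Y inj_onD[OF injY] by (intro sum.cong refl) (fastforce simp: \<delta>_def)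
  then show ?thesis using s finP by simp
qed

lemma sum_other: "v \<notin> X ` P ==> v \<notin> Y ` P ==> (\<Sum>s'\<in>P. a s' * \<delta> s' v) = 0"
  by (rule sum.neutral) (auto simp: \<delta>_def)

lemma \<beta>_plus: "(\<Sum>s\<in>P. \<alpha> \<mu> s * \<delta> s v) + \<beta> \<mu> v = \<mu> v"
proof -
  have "(\<Sum>s\<in>P. \<alpha> \<mu> s * \<delta> s v) \<le> \<mu> v"
  proof (cases "v \<in> X ` P \<union> Y ` P")
    case True
    then show ?thesis by (auto simp: sum_X sum_Y \<alpha>_def)
  next
    case False
    then show ?thesis by (simp add: sum_other)
  qed
  then show ?thesis by (simp add: \<beta>_def)
qed

text \<open>Since \<open>f s\<close> has the leading exponent \<open>\<delta> s\<close> of the pair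
  that it replaces, the replacement keeps the leading monomial.\<close>

lemma leads_bas: "leads (bas \<mu>) \<mu>"
proof -
  have "leads (%w. \<Prod>s\<in>P. f s w ^ \<alpha> \<mu> s) (%v. \<Sum>s\<in>P. \<alpha> \<mu> s * \<delta> s v)"
    by (intro leads_prod finP leads_power leads_f)
  from leads_mult[OF this leads_mon[of "\<beta> \<mu>"]] show ?thesis
    by (simp add: bas_def[abs_def] \<beta>_plus)
qed

text \<open>The passage from \<open>mon u\<close> to \<open>bas\<close> is unitriangular for the
  weight, so it is inverted by induction on the bound \<open>d\<close>.\<close>

lemma wspan_bas_mon: "g \<in> wspan bas (%\<mu>. wt \<mu> < d) \<longleftrightarrow> g \<in> wspan (mon u) (%\<mu>. wt \<mu> < d)"
proof
  assume "g \<in> wspan bas (%\<mu>. wt \<mu> < d)"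
  then show "g \<in> wspan (mon u) (%\<mu>. wt \<mu> < d)"
  proof (rule wspan_subset)
    fix \<mu> assume "wt \<mu> < d"
    then show "bas \<mu> \<in> wspan (mon u) (%\<mu>. wt \<mu> < d)"
      by (intro wspan_mono[OF leads_wspan[OF leads_bas]]) simp
  qed
next
  show "g \<in> wspan (mon u) (%\<mu>. wt \<mu> < d) ==> g \<in> wspan bas (%\<mu>. wt \<mu> < d)"
  proof (induction d arbitrary: g rule: less_induct)
    case (less d)
    show ?case
      using less.prems
    proof (rule wspan_subset)
      fix \<mu> assume \<mu>: "wt \<mu> < d"
      have "(%w. bas \<mu> w - mon u \<mu> w) \<in> wspan bas (%\<nu>. wt \<nu> < wt \<mu>)"
        using less.IH[OF \<mu>] leads_bas by (simp add: leads_def)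
      then have "(%w. bas \<mu> w - mon u \<mu> w) \<in> wspan bas (%\<nu>. wt \<nu> < d)"
        by (rule wspan_mono) (use \<mu> in simp)
      from wspan_diff[OF wspan_base[of "%\<nu>. wt \<nu> < d", OF \<mu>] this]
      show "mon u \<mu> \<in> wspan bas (%\<mu>. wt \<mu> < d)" by simp
    qed
  qed
qed

lemma poly_funs_eq_bas: "poly_funs (range u) = wspan bas (%_. True)"
proof (intro Set.set_eqI iffI)
  fix g assume "g \<in> wspan bas (%_. True)"
  then show "g \<in> poly_funs (range u)"
    unfolding poly_funs_eq_wspan
    by (rule wspan_subset) (rule wspan_mono[OF leads_wspan[OF leads_bas]], simp)
next
  fix g assume "g \<in> poly_funs (range u)"
  then show "g \<in> wspan bas (%_. True)"
    unfolding poly_funs_eq_wspan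
  proof (rule wspan_subset)
    fix \<mu>
    have "mon u \<mu> \<in> wspan (mon u) (%\<nu>. wt \<nu> < Suc (wt \<mu>))" by (rule wspan_base) simp
    then have "mon u \<mu> \<in> wspan bas (%\<nu>. wt \<nu> < Suc (wt \<mu>))" by (simp only: wspan_bas_mon)
    then show "mon u \<mu> \<in> wspan bas (%_. True)" by (rule wspan_mono) simp
  qed
qed

text \<open>In a relation between the \<open>bas \<mu>\<close> consider the terms of maximal weight
  \<open>d\<close>. Modulo smaller weights they may be replaced by monomials, so their sum has only
  terms of weight \<open>d\<close> and only terms of weight less than \<open>d\<close>; independence
  of monomials makes it vanish coefficientwise.\<close>

lemma indep_bas: "indep bas"
  unfolding indep_def
proof (intro allI impI)
  fix K :: "('v => nat) => complex" and \<mu>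
  assume fin: "finite {\<mu>. K \<mu> ~= 0}" and 0: "\<forall>w. comb bas K w = 0"
  show "K \<mu> = 0"
  proof (rule ccontr)
  assume \<mu>: "K \<mu> ~= 0"
  let ?S = "{\<mu>. K \<mu> ~= 0}"
  define d where "d = Max (wt ` ?S)"
  have d: "wt \<nu> \<le> d" if "K \<nu> ~= 0" for \<nu>
    unfolding d_def using fin that by (intro Max_ge) auto
  have "d \<in> wt ` ?S" unfolding d_def using fin \<mu> by (intro Max_in) auto
  then obtain \<mu>0 where \<mu>0: "K \<mu>0 ~= 0" "wt \<mu>0 = d" by auto
  define K1 where "K1 \<nu> = (if wt \<nu> = d then K \<nu> else 0)" for \<nu>
  have fin1: "finite {\<nu>. K1 \<nu> ~= 0}" by (rule finite_subset[OF _ fin]) (auto simp: K1_def)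
  have "(%w. \<Sum>\<nu>\<in>?S. K \<nu> * (bas \<nu> w - mon u \<nu> w) + (K \<nu> - K1 \<nu>) * mon u \<nu> w)
      \<in> wspan (mon u) (%\<nu>. wt \<nu> < d)"
  proof (rule wspan_sum)
    fix \<nu> assume "\<nu> \<in> ?S"
    then have le: "wt \<nu> \<le> d" using d by simp
    have 1: "(%w. bas \<nu> w - mon u \<nu> w) \<in> wspan (mon u) (%\<nu>. wt \<nu> < d)"
      using leads_bas[of \<nu>] unfolding leads_def by (rule wspan_mono) (use le in simp)
    have 2: "(%w. (K \<nu> - K1 \<nu>) * mon u \<nu> w) \<in> wspan (mon u) (%\<nu>. wt \<nu> < d)"
      using le by (cases "wt \<nu> = d") (auto simp: K1_def wspan.zero intro!: wspan_cmult wspan_base)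
    show "(%w. K \<nu> * (bas \<nu> w - mon u \<nu> w) + (K \<nu> - K1 \<nu>) * mon u \<nu> w) \<in> wspan (mon u) (%\<nu>. wt \<nu> < d)"
      by (rule wspan_add[OF 2 wspan_cmult[OF 1]])
  qed
  moreover have "(\<Sum>\<nu>\<in>?S. K \<nu> * (bas \<nu> w - mon u \<nu> w) + (K \<nu> - K1 \<nu>) * mon u \<nu> w) = - comb (mon u) K1 w" for w
  proof -
    have "(\<Sum>\<nu>\<in>?S. K \<nu> * (bas \<nu> w - mon u \<nu> w) + (K \<nu> - K1 \<nu>) * mon u \<nu> w)
        = (\<Sum>\<nu>\<in>?S. K \<nu> * bas \<nu> w - K1 \<nu> * mon u \<nu> w)"
      by (intro sum.cong refl) (simp add: algebra_simps)
    also have "\<dots> = comb bas K w - (\<Sum>\<nu>\<in>?S. K1 \<nu> * mon u \<nu> w)"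
      by (simp add: sum_subtractf comb_def)
    also have "(\<Sum>\<nu>\<in>?S. K1 \<nu> * mon u \<nu> w) = comb (mon u) K1 w"
      using fin by (intro comb_superset[symmetric]) (auto simp: K1_def)
    finally show ?thesis using 0 by simp
  qed
  ultimately have "(%w. - comb (mon u) K1 w) \<in> wspan (mon u) (%\<nu>. wt \<nu> < d)" by simp
  from wspan_cmult[OF this, of "-1"] have "comb (mon u) K1 \<in> wspan (mon u) (%\<nu>. wt \<nu> < d)"
    by simp
  moreover have "comb (mon u) K1 \<in> wspan (mon u) (%\<nu>. wt \<nu> = d)"
    by (rule comb_wspan[OF fin1]) (auto simp: K1_def split: if_splits)
  ultimately have "comb (mon u) K1 \<in> wspan (mon u) (%\<nu>. wt \<nu> < d & wt \<nu> = d)"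
    by (rule wspan_inter[OF indep_mon[OF coords]])
  from wspan_comb[OF this] obtain K2 where
    K2: "\<forall>\<nu>. K2 \<nu> ~= 0 --> wt \<nu> < d & wt \<nu> = d" "comb (mon u) K1 = comb (mon u) K2" by blast
  have "K2 \<nu> = 0" for \<nu> using K2(1)[rule_format, of \<nu>] by force
  then have "\<forall>w. comb (mon u) K1 w = 0" by (simp add: K2(2) comb_def)
  then have "K1 \<mu>0 = 0" using indep_mon[OF coords, unfolded indep_def, rule_format, of K1] fin1 by blast
  then show False using \<mu>0 by (simp add: K1_def)
  qed
qed

section \<open>Freeness over the algebra generated by the \<open>f s\<close>\<close>

lemma \<delta>_X: "s \<in> P ==> s' \<in> P ==> \<delta> s (X s') = (if s' = s then 1 else 0)"
  using X_neq_Y[of s' s] inj_onD[OF injX, of s' s] by (auto simp: \<delta>_def)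

lemma \<delta>_Y: "s \<in> P ==> s' \<in> P ==> \<delta> s (Y s') = (if s' = s then 1 else 0)"
  using X_neq_Y[of s s', symmetric] inj_onD[OF injY, of s' s] unfolding \<delta>_def by fastforce

lemma \<alpha>_shift: "s \<in> P ==> s' \<in> P ==> \<alpha> (%v. \<mu> v + \<delta> s v) s' = \<alpha> \<mu> s' + (if s' = s then 1 else 0)"
  by (simp add: \<alpha>_def \<delta>_X \<delta>_Y)

lemma \<beta>_shift: "s \<in> P ==> \<beta> (%v. \<mu> v + \<delta> s v) = \<beta> \<mu>"
proof
  fix v assume s: "s \<in> P"
  have "(\<Sum>s'\<in>P. \<alpha> (%v. \<mu> v + \<delta> s v) s' * \<delta> s' v)
      = (\<Sum>s'\<in>P. \<alpha> \<mu> s' * \<delta> s' v + (if s' = s then \<delta> s v else 0))"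
    using s by (intro sum.cong refl) (auto simp: \<alpha>_shift)
  also have "\<dots> = (\<Sum>s'\<in>P. \<alpha> \<mu> s' * \<delta> s' v) + \<delta> s v"
    using s finP by (simp add: sum.distrib)
  finally show "\<beta> (%v. \<mu> v + \<delta> s v) v = \<beta> \<mu> v" by (simp add: \<beta>_def)
qed

lemma prod_shift:
  assumes "s \<in> P"
  shows "(\<Prod>s'\<in>P. f s' w ^ \<alpha> (%v. \<mu> v + \<delta> s v) s') = f s w * (\<Prod>s'\<in>P. f s' w ^ \<alpha> \<mu> s')"
proof -
  have "(\<Prod>s'\<in>P. f s' w ^ \<alpha> (%v. \<mu> v + \<delta> s v) s') = (\<Prod>s'\<in>P. f s' w ^ \<alpha> \<mu> s' * (if s' = s then f s w else 1))"
    using assms by (intro prod.cong refl) (auto simp: \<alpha>_shift)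
  also have "\<dots> = (\<Prod>s'\<in>P. f s' w ^ \<alpha> \<mu> s') * f s w"
    using assms finP by (simp add: prod.distrib)
  finally show ?thesis by (simp add: mult.commute)
qed

text \<open>Multiplication by \<open>f s\<close> merely shifts the index and preserves
  \<open>\<beta>\<close>. Hence the basis splits into classes of constant \<open>\<beta>\<close>,
  each of which is a copy of the monomials in the \<open>f s\<close>.\<close>

lemma bas_shift: "s \<in> P ==> bas (%v. \<mu> v + \<delta> s v) w = f s w * bas \<mu> w"
  by (simp add: bas_def prod_shift \<beta>_shift mult.assoc)

lemma f_poly: "s \<in> P ==> f s \<in> poly_funs (range u)"
  unfolding poly_funs_eq_wspan by (rule wspan_mono[OF leads_wspan[OF leads_f]]) auto

text \<open>The polynomial ring is free over the algebra generated by the \<open>f s\<close>, a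
  basis being the monomials that contain no pair. This is recorded in the form that flatness uses:
  \<open>c i\<close> is the coordinate at \<open>mon u i\<close>, and it vanishes identically if
  \<open>i\<close> contains a pair.\<close>

theorem module_coordinates:
  "\<exists>c :: ('v => nat) => ('w => complex) => 'w => complex.
     (\<forall>i. \<forall>g\<in>poly_funs (range u). c i g \<in> poly_funs (f ` P)) &
     (\<forall>i. \<forall>g\<in>poly_funs (range u). \<forall>h\<in>poly_funs (range u). c i (%w. g w + h w) = (%w. c i g w + c i h w)) &
     (\<forall>i. \<forall>r\<in>poly_funs (f ` P). \<forall>g\<in>poly_funs (range u). c i (%w. r w * g w) = (%w. r w * c i g w)) &
     (\<forall>g\<in>poly_funs (range u). \<exists>A. finite A & (\<forall>i. i \<notin> A --> c i g = (%_. 0)) &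
        (\<forall>w. g w = (\<Sum>i\<in>A. c i g w * mon u i w)))"
proof -
  \<comment> \<open>\<open>bas \<mu>\<close> is the product of \<open>h i \<mu>\<close> and
    \<open>mon u i\<close> for the one index \<open>i = \<beta> \<mu>\<close>, so these are its
    coordinates.\<close>
  define h where "h i \<mu> = (%w. if \<beta> \<mu> = i then \<Prod>s\<in>P. f s w ^ \<alpha> \<mu> s else 0)" for i \<mu>
  let ?S = "poly_funs (range u)"
  let ?Q = "%i L. (\<forall>g\<in>?S. \<forall>h\<in>?S. L (%w. g w + h w) = (%w. L g w + L h w)) &
      (\<forall>g\<in>?S. \<forall>c. L (%w. c * g w) = (%w. c * L g w)) & (\<forall>\<mu>. L (bas \<mu>) = h i \<mu>)"
  have ex: "\<exists>L. ?Q i L" for i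
    by (rule indep_linear_extension[OF indep_bas, folded poly_funs_eq_bas])
  define c where "c i = (SOME L. ?Q i L)" for i
  have c: "?Q i (c i)" for i unfolding c_def by (rule someI_ex[OF ex])
  have cadd: "c i (%w. g w + h w) = (%w. c i g w + c i h w)" if "g \<in> ?S" "h \<in> ?S" for i g h
    using c[of i] that by blast
  have cscale: "c i (%w. k * g w) = (%w. k * c i g w)" if "g \<in> ?S" for i g k
    using c[of i] that by blast
  have base: "c i (bas \<mu>) = h i \<mu>" for i \<mu>
    using c[of i] by blast
  have basS: "bas \<mu> \<in> ?S" for \<mu> unfolding poly_funs_eq_bas by (simp add: wspan_base)
  have fR: "f s \<in> poly_funs (f ` P)" if "s \<in> P" for s using that by (auto intro: poly_funs.coord)
  have hR: "h i \<mu> \<in> poly_funs (f ` P)" for i \<mu>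
    by (cases "\<beta> \<mu> = i") (auto simp: h_def intro!: poly_funs_prod poly_funs_power fR poly_funs.const)
  have 0: "c i (%_. 0) = (%_. 0)" for i
    using cscale[OF poly_funs.const[of 0], of i 0] by simp
  have cstep: "c i (%w. g w + k * bas \<mu> w) = (%w. c i g w + k * h i \<mu> w)" if "g \<in> ?S" for i g k \<mu>
    using cadd[OF that poly_funs_cmult[OF basS]] cscale[OF basS] base by simp
  have R: "r \<in> ?S" if "r \<in> poly_funs (f ` P)" for r
    using that by induction (auto intro: poly_funs.intros f_poly)
  have closed: "c i g \<in> poly_funs (f ` P)" if "g \<in> ?S" for i g
    using that unfolding poly_funs_eq_bas
  proof induction
    case (step g \<mu> k)
    have "g \<in> ?S" using step.hyps(1) by (simp only: poly_funs_eq_bas)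
    then show ?case
      unfolding cstep[OF \<open>g \<in> ?S\<close>] by (intro poly_funs.add poly_funs_cmult step.IH hR)
  qed (simp add: 0 poly_funs.const)
  have fmult: "c i (%w. f s w * g w) = (%w. f s w * c i g w)" if "g \<in> ?S" "s \<in> P" for i g s
    using that(1) unfolding poly_funs_eq_bas
  proof induction
    case (step g \<mu> k)
    have g: "g \<in> ?S" using step.hyps(1) by (simp only: poly_funs_eq_bas)
    have "h i (%v. \<mu> v + \<delta> s v) = (%w. f s w * h i \<mu> w)"
      using that(2) by (auto simp: h_def \<beta>_shift prod_shift)
    moreover have "(%w. f s w * (g w + k * bas \<mu> w)) = (%w. f s w * g w + k * bas (%v. \<mu> v + \<delta> s v) w)"
      using that(2) by (simp add: bas_shift algebra_simps)
    moreover have "(%w. f s w * g w) \<in> ?S" by (intro poly_funs.mult f_poly that g)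
    ultimately show ?case
      using cstep g step.IH
      by (simp add: algebra_simps)
  qed (simp add: 0)
  have linear: "c i (%w. r w * g w) = (%w. r w * c i g w)" if "r \<in> poly_funs (f ` P)" "g \<in> ?S" for i r g
    using that
  proof (induction arbitrary: g)
    case (const k)
    then show ?case by (simp add: cscale)
  next
    case (coord r)
    then show ?case using fmult by blast
  next
    case (add r q)
    have "c i (%w. r w * g w + q w * g w) = (%w. c i (%w. r w * g w) w + c i (%w. q w * g w) w)"
      by (intro cadd
          poly_funs.mult R add.hyps add.prems)
    then show ?case using add.IH add.prems by (simp add: algebra_simps)
  next
    case (mult r q)
    have "(%w. q w * g w) \<in> ?S" by (intro poly_funs.mult R mult.hyps mult.prems)
    then show ?case using mult.IH mult.prems by (simp add: mult.assoc)
  qed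
  have expand: "\<exists>A. finite A & (\<forall>i. i \<notin> A --> c i g = (%_. 0)) & (\<forall>w. g w = (\<Sum>i\<in>A. c i g w * mon u i w))"
    if "g \<in> ?S" for g
    using that unfolding poly_funs_eq_bas
  proof induction
    case zero
    show ?case by (intro exI[of _ "{}"]) (simp add: 0)
  next
    case (step g \<mu> k)
    then obtain A where A: "finite A" "!!i. i \<notin> A ==> c i g = (%_. 0)" "!!w. g w = (\<Sum>i\<in>A. c i g w * mon u i w)" by blast
    have "g \<in> ?S" using step.hyps(1) by (simp only: poly_funs_eq_bas)
    then have eq: "c i (%w. g w + k * bas \<mu> w) = (%w. c i g w + k * h i \<mu> w)" for i
      using cstep by blast
    let ?B = "insert (\<beta> \<mu>) A"
    have sumB: "g w + k * bas \<mu> w = (\<Sum>i\<in>?B. (c i g w + k * h i \<mu> w) * mon u i w)" for w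
    proof -
      have "(\<Sum>i\<in>?B. (c i g w + k * h i \<mu> w) * mon u i w)
          = (\<Sum>i\<in>?B. c i g w * mon u i w) + (\<Sum>i\<in>?B. if i = \<beta> \<mu> then k * bas \<mu> w else 0)"
        unfolding sum.distrib[symmetric]
        by (intro sum.cong refl) (auto simp: h_def bas_def algebra_simps)
      also have "(\<Sum>i\<in>?B. c i g w * mon u i w) = g w"
        unfolding A(3)[of w] by (rule sum.mono_neutral_right) (use A in auto)
      also have "(\<Sum>i\<in>?B. if i = \<beta> \<mu> then k * bas \<mu> w else 0) = k * bas \<mu> w"
        using A(1) by simp
      finally show ?thesis by simp
    qed
    have "c i (%w. g w + k * bas \<mu> w) = (%_. 0)" if "i \<notin> ?B" for i
      using that A(2) by (auto simp: eq h_def)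
    moreover have "g w + k * bas \<mu> w = (\<Sum>i\<in>?B. c i (%w. g w + k * bas \<mu> w) w * mon u i w)" for w
      unfolding eq by (rule sumB)
    moreover have "finite ?B" using A(1) by simp
    ultimately show ?case by blast
  qed
  show ?thesis by (intro exI[of _ c] conjI allI ballI closed cadd linear expand)
qed

section \<open>The ideal generated by the \<open>f s\<close> is radical\<close>

definition J :: "('w => complex) set" where
  "J = {g. \<exists>q. (\<forall>s\<in>P. q s \<in> poly_funs (range u)) & g = (%w. \<Sum>s\<in>P. f s w * q s w)}"

lemma J_I: "(!!s. s \<in> P ==> q s \<in> poly_funs (range u)) ==> (!!w. g w = (\<Sum>s\<in>P. f s w * q s w)) ==> g \<in> J"
  unfolding J_def by auto

lemma J_add:
  assumes "g \<in> J" "h \<in> J"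
  shows "(%w. g w + h w) \<in> J"
proof -
  obtain q r where "!!s. s \<in> P ==> q s \<in> poly_funs (range u)" "g = (%w. \<Sum>s\<in>P. f s w * q s w)"
    "!!s. s \<in> P ==> r s \<in> poly_funs (range u)" "h = (%w. \<Sum>s\<in>P. f s w * r s w)"
    using assms unfolding J_def by blast
  then show ?thesis
    by (intro J_I[of "%s w. q s w + r s w"]) (auto intro: poly_funs.add simp: sum.distrib distrib_left)
qed

lemma J_mult:
  assumes "g \<in> J" "h \<in> poly_funs (range u)"
  shows "(%w. g w * h w) \<in> J"
proof -
  obtain q where "!!s. s \<in> P ==> q s \<in> poly_funs (range u)" "g = (%w. \<Sum>s\<in>P. f s w * q s w)"
    using assms unfolding J_def by blast
  then show ?thesis
    using assms(2) by (intro J_I[of "%s w. q s w * h w"]) (auto intro: poly_funs.mult simp: sum_distrib_right mult.assoc)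
qed

lemma J_f:
  assumes "s \<in> P" "q \<in> poly_funs (range u)"
  shows "(%w. f s w * q w) \<in> J"
proof (rule J_I[of "%s' w. if s' = s then q w else 0"])
  show "f s w * q w = (\<Sum>s'\<in>P. f s' w * (if s' = s then q w else 0))" for w
    using assms(1) finP by (simp add: if_distrib[of "%x. _ * x"] cong: if_cong)
  show "(%w. if s' = s then q w else 0) \<in> poly_funs (range u)" for s'
    by (cases "s' = s") (auto simp: assms(2) poly_funs.const)
qed

lemma J_poly: "g \<in> J ==> g \<in> poly_funs (range u)"
  unfolding J_def by (auto intro!: poly_funs_sum poly_funs.mult f_poly)

text \<open>Together with \<open>bas_J\<close> this describes the ideal as the span of the basis
  elements in which some \<open>f s\<close> occurs, so membership can be read off from
  coefficients.\<close>

lemma J_wspan: "g \<in> J ==> g \<in> wspan bas (%\<mu>. \<exists>s\<in>P. \<alpha> \<mu> s ~= 0)"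
proof -
  assume "g \<in> J"
  then obtain q where q: "!!s. s \<in> P ==> q s \<in> poly_funs (range u)" "g = (%w. \<Sum>s\<in>P. f s w * q s w)"
    unfolding J_def by blast
  have "(%w. f s w * r w) \<in> wspan bas (%\<mu>. \<exists>s\<in>P. \<alpha> \<mu> s ~= 0)" if "s \<in> P" "r \<in> wspan bas (%_. True)" for s r
    using that(2)
  proof induction
    case (step r \<mu> c)
    have "\<exists>s'\<in>P. \<alpha> (%v. \<mu> v + \<delta> s v) s' ~= 0" using that(1) by (auto simp: \<alpha>_shift intro!: bexI[of _ s])
    from wspan.step[where Q = "%\<mu>. \<exists>s\<in>P. \<alpha> \<mu> s ~= 0" and i = "%v. \<mu> v + \<delta> s v", OF step.IH this, of c]
    show ?case using that(1) by (simp add: bas_shift algebra_simps)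
  qed (simp add: wspan.zero)
  then show ?thesis
    unfolding q(2) using q(1) by (intro wspan_sum) (auto simp: poly_funs_eq_bas)
qed

lemma bas_J: "\<exists>s\<in>P. \<alpha> \<mu> s ~= 0 ==> bas \<mu> \<in> J"
proof -
  assume "\<exists>s\<in>P. \<alpha> \<mu> s ~= 0"
  then obtain s k where s: "s \<in> P" "\<alpha> \<mu> s = Suc k" using not0_implies_Suc by blast
  have "bas \<mu> = (%w. f s w * (f s w ^ k * (\<Prod>s'\<in>P - {s}. f s' w ^ \<alpha> \<mu> s') * mon u (\<beta> \<mu>) w))"
    using s finP by (simp add: bas_def fun_eq_iff prod.remove[of P s] mult.assoc)
  moreover have "\<dots> \<in> J"
    by (intro J_f s poly_funs.mult poly_funs_power poly_funs_prod f_poly mon_poly_funs) auto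
  ultimately show ?thesis by simp
qed

text \<open>Along the curve \<open>u v = t ^ \<omega> v * c v\<close> the weight becomes the degree
  in \<open>t\<close>, and initial forms become leading coefficients of univariate
  polynomials.\<close>

lemma mon_curve:
  assumes w: "!!t v. u v (w t) = t ^ \<omega> v * c v"
  shows "mon u \<mu> (w t) = (\<Prod>v\<in>UNIV. c v ^ \<mu> v) * t ^ wt \<mu>"
proof -
  have "(\<Prod>v\<in>UNIV. (t ^ \<omega> v) ^ \<mu> v) = t ^ wt \<mu>"
    by (simp add: wt_def power_sum power_mult)
  then show ?thesis by (simp add: mon_def w power_mult_distrib prod.distrib)
qed

lemma low_along_curve:
  assumes "g \<in> wspan (mon u) (%\<mu>. wt \<mu> < d)" and w: "!!t v. u v (w t) = t ^ \<omega> v * c v"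
  shows "\<exists>p. (\<forall>t. g (w t) = poly p t) & (\<forall>i\<ge>d. coeff p i = 0)"
  using assms(1)
proof induction
  case zero
  show ?case by (intro exI[of _ 0]) simp
next
  case (step g \<mu> k)
  then obtain p where p: "\<forall>t. g (w t) = poly p t" "\<forall>i\<ge>d. coeff p i = 0" by blast
  then show ?case
    using step.hyps(2)
    by (intro exI[of _ "p + Polynomial.monom (k * (\<Prod>v\<in>UNIV. c v ^ \<mu> v)) (wt \<mu>)"])
       (auto simp: poly_monom mult.assoc mon_curve[OF w])
qed

text \<open>The initial ideal is generated by the squarefree products
  \<open>u (X s) * u (Y s)\<close> and is therefore radical; \<open>J\<close> inherits this. Modulo
  \<open>J\<close> the function \<open>g\<close> is replaced by its part \<open>h\<close> without
  pairs, and the top weight part of \<open>h\<close> is shown to vanish.\<close>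

theorem J_radical:
  assumes g: "g \<in> poly_funs (range u)" and n: "(%w. g w ^ n) \<in> J"
  shows "g \<in> J"
proof (cases "n = 0")
  case True
  then show ?thesis using J_mult[OF n g] by simp
next
  case False
  let ?A = "%\<mu>. \<exists>s\<in>P. \<alpha> \<mu> s ~= 0"
  obtain K where K: "finite {\<mu>. K \<mu> ~= 0}" "g = comb bas K"
    using g wspan_comb unfolding poly_funs_eq_bas by blast
  define K1 where "K1 \<mu> = (if ?A \<mu> then K \<mu> else 0)" for \<mu>
  define K0 where "K0 \<mu> = (if ?A \<mu> then 0 else K \<mu>)" for \<mu>
  have fin: "finite {\<mu>. K1 \<mu> ~= 0}" "finite {\<mu>. K0 \<mu> ~= 0}"
    by (rule finite_subset[OF _ K(1)], auto simp: K1_def K0_def split: if_splits)+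
  have norm: "bas \<mu> = mon u \<mu>" if "~ ?A \<mu>" for \<mu>
  proof -
    have \<beta>: "\<beta> \<mu> = \<mu>" using that by (intro ext) (simp add: \<beta>_def)
    show ?thesis using that by (intro ext) (simp add: bas_def \<beta>)
  qed
  define h where "h = comb (mon u) K0"
  have h_bas: "h w = comb bas K0 w" for w
    unfolding h_def comb_def by (intro sum.cong refl) (auto simp: K0_def norm split: if_splits)
  have gh: "g w = comb bas K1 w + h w" for w
  proof -
    have "K = (%\<mu>. K1 \<mu> + K0 \<mu>)" by (auto simp: K1_def K0_def)
    then have "comb bas K w = comb bas K1 w + comb bas K0 w" using comb_add(1)[OF fin] by simp
    then show ?thesis using K(2) h_bas by simp
  qed
  have "(%w. \<Sum>\<mu> | K1 \<mu> ~= 0. bas \<mu> w * K1 \<mu>) \<in> J"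
  proof -
    have "finite S ==> S \<subseteq> {\<mu>. K1 \<mu> ~= 0} ==> (%w. \<Sum>\<mu>\<in>S. bas \<mu> w * K1 \<mu>) \<in> J" for S
    proof (induction rule: finite_induct)
      case empty
      show ?case by (rule J_I[of "%_ _. 0"]) (auto intro: poly_funs.const)
    next
      case (insert \<mu> S)
      have "bas \<mu> \<in> J" using insert.prems by (intro bas_J) (auto simp: K1_def split: if_splits)
      then have "(%w. bas \<mu> w * K1 \<mu> + (\<Sum>\<mu>\<in>S. bas \<mu> w * K1 \<mu>)) \<in> J"
        using insert by (intro J_add J_mult poly_funs.const) auto
      then show ?case using insert.hyps by simp
    qed
    then show ?thesis using fin(1) by blast
  qed
  then have j: "comb bas K1 \<in> J" by (simp add: comb_def[abs_def] mult.commute)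
  have hP: "h \<in> poly_funs (range u)"
    unfolding poly_funs_eq_wspan h_def by (rule comb_wspan[OF fin(2)]) simp
  have "(%w. g w ^ k + - 1 * h w ^ k) \<in> J" for k
  proof (induction k)
    case 0
    show ?case by (rule J_I[of "%_ _. 0"]) (auto intro: poly_funs.const)
  next
    case (Suc k)
    have "(%w. (g w ^ k + - 1 * h w ^ k) * g w + comb bas K1 w * h w ^ k) \<in> J"
      by (intro J_add J_mult Suc.IH g j poly_funs_power hP)
    moreover have "(g w ^ k + - 1 * h w ^ k) * g w + comb bas K1 w * h w ^ k = g w ^ Suc k + - 1 * h w ^ Suc k" for w
      using gh[of w] by (simp add: algebra_simps)
    ultimately show ?case by simp
  qed
  from J_add[OF J_mult[OF this[of n] poly_funs.const[of "-1"]] n]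
  have hn: "(%w. h w ^ n) \<in> J" by simp
  have "K0 \<mu> = 0" for \<mu>
  proof (rule ccontr)
    assume "K0 \<mu> ~= 0"
    let ?S = "{\<mu>. K0 \<mu> ~= 0}"
    define d where "d = Max (wt ` ?S)"
    have d: "wt \<nu> \<le> d" if "K0 \<nu> ~= 0" for \<nu>
      unfolding d_def using fin that by (intro Max_ge) auto
    have "d \<in> wt ` ?S" unfolding d_def using fin \<open>K0 \<mu> ~= 0\<close> by (intro Max_in) auto
    then obtain \<mu>0 where \<mu>0: "K0 \<mu>0 ~= 0" "wt \<mu>0 = d" by auto
    have low: "(%w. h w ^ k) \<in> wspan (mon u) (%\<mu>. wt \<mu> < Suc (k * d))" for k
    proof (induction k)
      case 0
      have "mon u (%_. 0) = (%_. 1)" by (rule ext) (rule mon_zero)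
      then show ?case using wspan_base[of "%\<mu>. wt \<mu> < Suc 0" "%_. 0" "mon u"] by (simp add: wt_def)
    next
      case (Suc k)
      have "h \<in> wspan (mon u) (%\<mu>. wt \<mu> < Suc d)"
        unfolding h_def using d by (intro comb_wspan fin(2)) (auto simp: less_Suc_eq_le)
      from wspan_mon_mult[OF this Suc.IH, of "%\<mu>. wt \<mu> < Suc (Suc k * d)"] show ?case
        by (simp add: wt_add)
    qed
    have "(%w. h w ^ n) \<in> wspan bas (%\<mu>. wt \<mu> < Suc (n * d) & ?A \<mu>)"
      using low[of n] J_wspan[OF hn] unfolding wspan_bas_mon[symmetric] by (rule wspan_inter[OF indep_bas])
    note hn' = this
    \<comment> \<open>The top weight part of \<open>h\<close> vanishes at every \<open>c\<close>
      that annihilates all pairs. Otherwise \<open>h ^ n\<close> has degree \<open>n * d\<close>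
      along the curve of \<open>c\<close>. But \<open>h ^ n\<close> lies in \<open>J\<close>: the
      monomials of weight \<open>n * d\<close> that lead its basis elements contain a pair and
      vanish on the curve, and all other terms have smaller weight.\<close>
    have Z: "(\<Sum>\<mu> | K0 \<mu> ~= 0 & wt \<mu> = d. K0 \<mu> * (\<Prod>v\<in>UNIV. c v ^ \<mu> v)) = 0" (is "?C = 0")
      if c: "!!s. s \<in> P ==> c (X s) * c (Y s) = 0" for c :: "'v => complex"
    proof (rule ccontr)
      assume C: "?C ~= 0"
      have "\<exists>w. \<forall>v. u v w = t ^ \<omega> v * c v" for t
        using coords[unfolded coordinates_def, rule_format, of "%v. t ^ \<omega> v * c v"] .
      then obtain w where w: "!!t v. u v (w t) = t ^ \<omega> v * c v" by metis
      define p where "p = (\<Sum>\<mu> | K0 \<mu> ~= 0. Polynomial.monom (K0 \<mu> * (\<Prod>v\<in>UNIV. c v ^ \<mu> v)) (wt \<mu>))"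
      have hp: "h (w t) = poly p t" for t
        by (simp add: h_def comb_def p_def poly_sum poly_monom mon_curve[OF w] mult.assoc)
      have "coeff p d = (\<Sum>\<mu> | K0 \<mu> ~= 0. if wt \<mu> = d then K0 \<mu> * (\<Prod>v\<in>UNIV. c v ^ \<mu> v) else 0)"
        unfolding p_def Polynomial.coeff_sum by (intro sum.cong refl) simp
      also have "\<dots> = ?C" using fin(2) by (simp add: sum.inter_filter[symmetric])
      finally have pd: "coeff p d ~= 0" using C by simp
      moreover have "degree p \<le> d"
        unfolding p_def using d by (intro degree_sum_le fin) (auto intro: order_trans[OF degree_monom_le])
      ultimately have deg: "degree p = d" using le_degree[of p d] by simp
      obtain q where q: "!!t. h (w t) ^ n = poly q t" "!!i. i \<ge> n * d ==> coeff q i = 0"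
      proof -
        have "\<exists>q. (\<forall>t. r (w t) = poly q t) & (\<forall>i\<ge>n * d. coeff q i = 0)"
          if "r \<in> wspan bas (%\<mu>. wt \<mu> < Suc (n * d) & ?A \<mu>)" for r
          using that
        proof induction
          case zero
          show ?case by (intro exI[of _ 0]) simp
        next
          case (step r \<mu> k)
          then obtain q1 where q1: "\<forall>t. r (w t) = poly q1 t" "\<forall>i\<ge>n * d. coeff q1 i = 0" by blast
          have "(%w. bas \<mu> w - mon u \<mu> w) \<in> wspan (mon u) (%\<nu>. wt \<nu> < n * d)"
            using leads_bas[of \<mu>] unfolding leads_def by (rule wspan_mono) (use step.hyps(2) in simp)
          then obtain q2 where q2: "\<forall>t. bas \<mu> (w t) - mon u \<mu> (w t) = poly q2 t" "\<forall>i\<ge>n * d. coeff q2 i = 0"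
            using low_along_curve[OF _ w] by blast
          obtain s where s: "s \<in> P" "\<alpha> \<mu> s ~= 0" using step.hyps(2) by blast
          then have "\<mu> (X s) ~= 0" "\<mu> (Y s) ~= 0" by (auto simp: \<alpha>_def)
          then have "\<exists>v. c v ^ \<mu> v = 0" using c[OF s(1)] by auto
          then have "(\<Prod>v\<in>UNIV. c v ^ \<mu> v) = 0" by (metis finite_class.finite_UNIV prod_zero UNIV_I)
          then have "mon u \<mu> (w t) = 0" for t by (simp add: mon_curve[OF w])
          then show ?case using q1 q2 by (intro exI[of _ "q1 + Polynomial.smult k q2"]) auto
        qed
        from this[OF hn'] show ?thesis using that by blast
      qed
      have "poly (p ^ n) t = poly q t" for t using q(1)[of t] hp[of t] by simp
      then have "p ^ n = q" by (simp add: poly_eq_poly_eq_iff[symmetric] fun_eq_iff)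
      then have "coeff (p ^ n) (n * d) = 0" using q(2) by simp
      moreover have "degree (p ^ n) = n * d" using deg pd by (metis degree_power_eq coeff_0)
      ultimately have "lead_coeff (p ^ n) = 0" by simp
      then have "lead_coeff p ^ n = 0" by (simp only: lead_coeff_power)
      then show False using pd deg by simp
    qed
    \<comment> \<open>Only the monomials whose variables all occur in \<open>\<mu>0\<close>. Setting
      the other variables to zero is allowed in \<open>Z\<close> because \<open>\<mu>0\<close>
      contains no pair, so this part vanishes identically, against independence of
      monomials.\<close>
    define K' where "K' \<mu> = (if wt \<mu> = d & (\<forall>v. \<mu> v ~= 0 --> \<mu>0 v ~= 0) then K0 \<mu> else 0)" for \<mu>
    have K'D: "K0 \<mu> ~= 0 & wt \<mu> = d" if "K' \<mu> ~= 0" for \<mu>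
      using that by (metis K'_def)
    have finK': "finite {\<mu>. K' \<mu> ~= 0}"
      by (rule finite_subset[OF _ fin(2)]) (use K'D in blast)
    have "comb (mon u) K' w = 0" for w
    proof -
      define c where "c v = (if \<mu>0 v ~= 0 then u v w else 0)" for v
      have "~ ?A \<mu>0" using \<mu>0 by (auto simp: K0_def split: if_splits)
      then have "c (X s) * c (Y s) = 0" if "s \<in> P" for s
        using that by (auto simp: c_def \<alpha>_def min_def split: if_splits)
      from Z[OF this] have "(\<Sum>\<mu> | K0 \<mu> ~= 0 & wt \<mu> = d. K0 \<mu> * (\<Prod>v\<in>UNIV. c v ^ \<mu> v)) = 0" by blast
      moreover have "comb (mon u) K' w = (\<Sum>\<mu> | K0 \<mu> ~= 0 & wt \<mu> = d. K' \<mu> * mon u \<mu> w)"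
      proof (rule comb_superset)
        show "{\<mu>. K' \<mu> ~= 0} \<subseteq> {\<mu>. K0 \<mu> ~= 0 & wt \<mu> = d}" using K'D by blast
        show "finite {\<mu>. K0 \<mu> ~= 0 & wt \<mu> = d}" by (rule finite_subset[OF _ fin(2)]) blast
      qed
      moreover have "K' \<mu> * mon u \<mu> w = K0 \<mu> * (\<Prod>v\<in>UNIV. c v ^ \<mu> v)" if "wt \<mu> = d" for \<mu>
      proof (cases "\<forall>v. \<mu> v ~= 0 --> \<mu>0 v ~= 0")
        case True
        then have "mon u \<mu> w = (\<Prod>v\<in>UNIV. c v ^ \<mu> v)"
          unfolding mon_def
        proof (intro prod.cong refl)
          fix v
          show "u v w ^ \<mu> v = c v ^ \<mu> v"
            using True by (cases "\<mu> v = 0") (auto simp: c_def)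
        qed
        then show ?thesis using True that by (simp add: K'_def)
      next
        case False
        then obtain v where "\<mu> v ~= 0" "\<mu>0 v = 0" by blast
        then have "c v ^ \<mu> v = 0" by (simp add: c_def)
        then have "(\<Prod>v\<in>UNIV. c v ^ \<mu> v) = 0" by (metis finite_class.finite_UNIV prod_zero UNIV_I)
        moreover have "K' \<mu> = 0" using False by (metis K'_def)
        ultimately show ?thesis by simp
      qed
      ultimately show ?thesis by simp
    qed
    then have "K' \<mu>0 = 0" using indep_mon[OF coords, unfolded indep_def, rule_format, of K'] finK' by blast
    then show False using \<mu>0 by (simp add: K'_def)
  qed
  then have "h w = 0" for w by (simp add: h_def comb_def)
  then have "g = comb bas K1" using gh by auto
  then show ?thesis using j by simp
qed

end

section \<open>Isometries of bilinear forms\<close>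

definition bform :: "complex^'n^'m => complex^'m => complex^'n => complex" where
  "bform b x y = (\<Sum>i\<in>UNIV. \<Sum>j\<in>UNIV. x $ i * b $ i $ j * y $ j)"

lemma bform_add_left: "bform b (x + x') y = bform b x y + bform b x' y"
  by (simp add: bform_def algebra_simps sum.distrib)

lemma bform_add_right: "bform b x (y + y') = bform b x y + bform b x y'"
  by (simp add: bform_def algebra_simps sum.distrib)

lemma bform_scale_left: "bform b (c *s x) y = c * bform b x y"
  by (simp add: bform_def algebra_simps sum_distrib_left)

lemma bform_scale_right: "bform b x (c *s y) = c * bform b x y"
  by (simp add: bform_def algebra_simps sum_distrib_left)

lemma bform_diff_left: "bform b (x - x') y = bform b x y - bform b x' y"
  by (simp add: bform_def algebra_simps sum_subtractf)

lemma bform_diff_right: "bform b x (y - y') = bform b x y - bform b x y'"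
  by (simp add: bform_def algebra_simps sum_subtractf)

lemma bform_zero [simp]: "bform b 0 y = 0" "bform b x 0 = 0"
  by (simp_all add: bform_def)

lemmas bform_linear = bform_add_left bform_add_right bform_scale_left bform_scale_right
  bform_diff_left bform_diff_right

lemma bform_transpose: "bform (transpose b) x y = bform b y x"
proof -
  have "bform (transpose b) x y = (\<Sum>i\<in>UNIV. \<Sum>j\<in>UNIV. y $ j * b $ j $ i * x $ i)"
    by (simp add: bform_def transpose_def mult_ac)
  also have "\<dots> = bform b y x" unfolding bform_def by (rule sum.swap)
  finally show ?thesis .
qed

lemma bform_matrix_vector: "bform b x (A *v y) = bform (b ** A) x y"
proof -
  have "bform b x (A *v y) = (\<Sum>i\<in>UNIV. \<Sum>j\<in>UNIV. \<Sum>k\<in>UNIV. x $ i * b $ i $ j * A $ j $ k * y $ k)"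
    by (simp add: bform_def matrix_vector_mult_def sum_distrib_left mult_ac)
  also have "\<dots> = (\<Sum>i\<in>UNIV. \<Sum>k\<in>UNIV. \<Sum>j\<in>UNIV. x $ i * b $ i $ j * A $ j $ k * y $ k)"
    by (intro sum.cong refl sum.swap)
  also have "\<dots> = bform (b ** A) x y"
    by (simp add: bform_def matrix_matrix_mult_def sum_distrib_left sum_distrib_right mult_ac)
  finally show ?thesis .
qed

lemma bform_matrix_vector_left: "bform b (A *v x) y = bform (transpose A ** b) x y"
proof -
  have "bform b (A *v x) y = bform (transpose b) y (A *v x)" by (simp add: bform_transpose)
  also have "\<dots> = bform (transpose b ** A) y x" by (rule bform_matrix_vector)
  also have "\<dots> = bform (transpose (transpose b ** A)) x y" by (simp add: bform_transpose)
  finally show ?thesis by (simp add: matrix_transpose_mul)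
qed

lemma bform_axis: "bform b (axis i 1) (axis j 1) = b $ i $ j"
proof -
  have "bform b (axis i 1) (axis j 1) =
      (\<Sum>k\<in>UNIV. \<Sum>l\<in>UNIV. if k = i then (if l = j then b $ k $ l else 0) else 0)"
    unfolding bform_def by (intro sum.cong refl) (simp add: axis_def)
  also have "\<dots> = (\<Sum>k\<in>UNIV. if k = i then b $ i $ j else 0)"
    by (intro sum.cong refl) simp
  finally show ?thesis by simp
qed

lemma matrix_mult_axis: "A *v axis k 1 = column k (A :: complex^'m^'n)"
  by (simp add: vec_eq_iff matrix_vector_mult_def column_def axis_def if_distrib cong: if_cong)

lemma matrix_eq_bform: "A = B \<longleftrightarrow> (\<forall>x y. bform A x y = bform B x y)"
  by (metis bform_axis vec_eq_iff)

lemma congr_nth: "(transpose w ** b ** w) $ k $ l = bform b (column k w) (column l w)"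
proof -
  have "column k w = w *v axis k 1" for k
    by (rule matrix_mult_axis[symmetric])
  then have "bform b (column k w) (column l w) = bform (transpose w ** b ** w) (axis k 1) (axis l 1)"
    by (simp only: bform_matrix_vector bform_matrix_vector_left) (simp add: matrix_mul_assoc)
  then show ?thesis by (simp only: bform_axis)
qed

lemma bform_congr: "bform (transpose w ** b ** w) x y = bform b (w *v x) (w *v y)"
  by (simp only: bform_matrix_vector bform_matrix_vector_left) (simp add: matrix_mul_assoc)

definition isometries :: "complex^'n^'n => (complex^'n^'n) set" where
  "isometries b = {g. transpose g ** b ** g = b}"

lemma isometries_iff: "g \<in> isometries b \<longleftrightarrow> (\<forall>x y. bform b (g *v x) (g *v y) = bform b x y)"
  by (simp add: isometries_def matrix_eq_bform bform_congr)

lemma isometries_mult: "g \<in> isometries b ==> h \<in> isometries b ==> g ** h \<in> isometries b"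
  by (simp add: isometries_iff flip: matrix_vector_mul_assoc)

lemma isometries_one: "mat 1 \<in> isometries b"
  by (simp add: isometries_iff)

lemma isometries_inverse:
  assumes "invertible b" "g \<in> isometries b"
  shows "\<exists>h\<in>isometries b. h ** g = mat 1 & g ** h = mat 1"
proof -
  obtain b' where b': "b' ** b = mat 1" "b ** b' = mat 1" using assms(1) by (auto simp: invertible_def)
  have "(b' ** transpose g ** b) ** g = mat 1"
    using assms(2) b' by (simp add: isometries_def flip: matrix_mul_assoc)
  then obtain h where h: "h ** g = mat 1" "g ** h = mat 1"
    using matrix_left_right_inverse by blast
  have "bform b (h *v x) (h *v y) = bform b x y" for x y
  proof -
    have "bform b (g *v (h *v x)) (g *v (h *v y)) = bform b (h *v x) (h *v y)"
      using assms(2) by (simp add: isometries_iff)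
    then show ?thesis by (simp add: matrix_vector_mul_assoc h)
  qed
  with h show ?thesis by (auto simp: isometries_iff)
qed

text \<open>The parameter \<open>e\<close> treats the symmetric form on \<open>V^+\<close>
  (\<open>e = 1\<close>) and the symplectic form on \<open>V^-\<close> (\<open>e = -1\<close>)
  simultaneously.\<close>

definition eps_symmetric :: "complex => complex^'n^'n => bool" where
  "eps_symmetric e b \<longleftrightarrow> (\<forall>x y. bform b x y = e * bform b y x)"

lemma eps_symmetricD: "eps_symmetric e b ==> bform b x y = e * bform b y x"
  unfolding eps_symmetric_def by blast

text \<open>
  The reflection (for a symmetric form) or transvection (for an alternating form) along \<open>w' - w\<close>.
\<close>

lemma isometry_step:
  fixes b :: "complex^'n^'n"
  assumes b: "eps_symmetric e b" and e: "e = 1 \<or> e = -1"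
    and ww: "bform b w' w' = bform b w w" and ne: "bform b (w' - w) w ~= 0"
  shows "\<exists>g\<in>isometries b. g *v w = w' & (\<forall>x. bform b (w' - w) x = 0 --> g *v x = x)"
proof -
  have sym: "bform b x y = e * bform b y x" for x y
    using b by (rule eps_symmetricD)
  define d where "d = w' - w"
  define c where "c = bform b d w"
  define h where "h x = x + (bform b d x / c) *s d" for x
  have "Vector_Spaces.linear (*s) (*s) h"
    by (simp add: Vector_Spaces.linear_iff vec.vector_space_axioms h_def bform_linear
        vec.scale_right_distrib vec.scale_left_distrib add_divide_distrib)
  then have h: "matrix h *v x = h x" for x
    by (simp add: matrix_works)
  have c0: "c ~= 0" using ne by (simp add: c_def d_def)
  \<comment> \<open>With this value the quadratic terms cancel in the computation for
    \<open>h\<close>: it equals \<open>-2 * c\<close> for a reflection and \<open>0\<close> for a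
    transvection.\<close>
  have dd: "bform b d d = - (1 + e) * c"
  proof -
    have "bform b d d = bform b w' w' - bform b w' w - bform b w w' + bform b w w"
      by (simp add: d_def bform_linear)
    also have "\<dots> = - (bform b w' w - bform b w w) - (bform b w w' - bform b w w)"
      using ww by simp
    also have "bform b w w' = e * bform b w' w" by (rule sym)
    also have "- (bform b w' w - bform b w w) - (e * bform b w' w - bform b w w)
        = - (bform b w' w - bform b w w) - e * (bform b w' w - bform b w w)"
      using e
    proof
      assume "e = -1"
      then show ?thesis using sym[of w w, unfolded \<open>e = -1\<close>] by simp
    qed simp
    finally show ?thesis by (simp add: c_def d_def bform_linear algebra_simps)
  qed
  have "bform b (h x) (h y) = bform b x y" for x y
  proof -
    have "bform b (h x) (h y) = bform b x y + bform b d y / c * bform b x d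
        + bform b d x / c * bform b d y + bform b d x / c * (bform b d y / c) * bform b d d"
      by (simp add: h_def bform_linear algebra_simps)
    also have "bform b x d = e * bform b d x" by (rule sym)
    finally show ?thesis using c0 unfolding dd by (simp add: field_simps)
  qed
  then have "matrix h \<in> isometries b" by (simp add: isometries_iff h)
  moreover have "matrix h *v w = w'"
    using c0 by (simp add: h) (simp add: h_def c_def, simp add: d_def)
  moreover have "\<forall>x. bform b (w' - w) x = 0 --> matrix h *v x = x"
    by (simp add: h) (simp add: h_def d_def)
  ultimately show ?thesis by blast
qed

section \<open>Full rank, dual vectors and orthogonal spaces\<close>

definition full_rank :: "complex^'m^'n => bool" where
  "full_rank w \<longleftrightarrow> (\<forall>x. w *v x = 0 --> x = 0)"

lemma full_rank_left_inverse: "full_rank w \<longleftrightarrow> (\<exists>B. B ** w = mat 1)"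
  by (simp add: full_rank_def matrix_left_invertible_ker)

lemma full_rank_mult:
  assumes "full_rank w" "h ** g = mat 1"
  shows "full_rank (g ** w)"
proof -
  obtain B where "B ** w = mat 1" using assms(1) full_rank_left_inverse by blast
  then have "(B ** h) ** (g ** w) = mat 1"
    by (metis assms(2) matrix_mul_assoc matrix_mul_rid)
  then show ?thesis using full_rank_left_inverse by blast
qed

text \<open>Row \<open>k\<close> of a left inverse of \<open>w\<close> is the functional dual to
  column \<open>k\<close>, and nondegeneracy of \<open>b\<close> represents it by a vector.\<close>

lemma dual_vector:
  fixes b :: "complex^'n^'n" and w :: "complex^'m^'n"
  assumes b: "invertible b" and w: "full_rank w"
  shows "\<exists>x. bform b x (column k w) = 1 & (\<forall>j. j ~= k --> bform b x (column j w) = 0)"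
proof -
  obtain B where B: "B ** w = mat 1" using w full_rank_left_inverse by blast
  obtain b' where b': "b' ** b = mat 1" using b by (auto simp: invertible_def)
  define x where "x = transpose (B ** b') *v axis k 1"
  have "bform b x (column j w) = (mat 1 :: complex^'m^'m) $ k $ j" for j
  proof -
    have "bform b x (column j w) = bform (mat 1 :: complex^'m^'m) (axis k 1) (axis j 1)"
      unfolding x_def matrix_mult_axis[symmetric] bform_matrix_vector bform_matrix_vector_left transpose_transpose
      by (simp flip: matrix_mul_assoc) (simp add: matrix_mul_assoc[of b'] b' B)
    then show ?thesis by (simp only: bform_axis)
  qed
  then show ?thesis by (intro exI[of _ x]) (auto simp: mat_def)
qed

lemma dim_hyperplane:
  fixes U :: "(complex^'n) set"
  assumes U: "vec.subspace U"
  shows "vec.dim U \<le> Suc (vec.dim (U \<inter> {x. bform b y x = 0}))"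
proof (cases "\<forall>x\<in>U. bform b y x = 0")
  case True
  then have "U \<inter> {x. bform b y x = 0} = U" by auto
  then show ?thesis by simp
next
  case False
  then obtain u where u: "u \<in> U" "bform b y u ~= 0" by auto
  have "U \<subseteq> vec.span (insert u (U \<inter> {x. bform b y x = 0}))"
  proof
    fix x assume x: "x \<in> U"
    have "x - (bform b y x / bform b y u) *s u \<in> U \<inter> {x. bform b y x = 0}"
      using u x U by (simp add: vec.subspace_diff vec.subspace_scale bform_linear)
    then have "x - (bform b y x / bform b y u) *s u \<in> vec.span (U \<inter> {x. bform b y x = 0})"
      by (rule vec.span_base)
    then show "x \<in> vec.span (insert u (U \<inter> {x. bform b y x = 0}))"
      using vec.span_breakdown_eq by blast
  qed
  then have "vec.dim U \<le> vec.dim (insert u (U \<inter> {x. bform b y x = 0}))"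
    by (metis vec.dim_span vec.dim_subset)
  also have "\<dots> \<le> Suc (vec.dim (U \<inter> {x. bform b y x = 0}))"
    by (simp add: vec.dim_insert)
  finally show ?thesis .
qed

definition perp :: "complex^'n^'n => (complex^'n) set => (complex^'n) set" where
  "perp b L = {x. \<forall>y\<in>L. bform b y x = 0}"

lemma subspace_perp: "vec.subspace (perp b L)"
  by (rule vec.subspaceI) (auto simp: perp_def bform_linear)

lemma dim_inter_perp:
  assumes "finite L" and U: "vec.subspace U"
  shows "vec.dim U \<le> card L + vec.dim (U \<inter> perp b L)"
  using assms(1)
proof induction
  case empty
  then show ?case by (simp add: perp_def)
next
  case (insert y L)
  have "U \<inter> perp b (insert y L) = (U \<inter> perp b L) \<inter> {x. bform b y x = 0}" by (auto simp: perp_def)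
  then show ?case
    using insert dim_hyperplane[OF vec.subspace_inter[OF U subspace_perp], of b L b y] by simp
qed

lemma dim_perp_ge:
  fixes b :: "complex^'n^'n"
  assumes "finite L"
  shows "CARD('n) \<le> card L + vec.dim (perp b L)"
  using dim_inter_perp[OF assms vec.subspace_UNIV, of b] by (simp add: card_cart_basis)

lemma bform_nondegenerate:
  assumes "invertible b" "!!x. bform b x y = 0"
  shows "y = 0"
proof -
  obtain b' where b': "b' ** b = mat 1" using assms(1) by (auto simp: invertible_def)
  have "(b *v y) $ i = bform b (axis i 1) y" for i
    by (simp add: bform_def matrix_vector_mult_def axis_def if_distrib[of "%x. x * _"] sum.delta' cong: if_cong)
       (subst sum.swap, simp)
  then have "b *v y = 0" using assms(2) by (simp add: vec_eq_iff)
  then have "b' *v (b *v y) = 0" by simp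
  then show ?thesis by (simp add: matrix_vector_mul_assoc b')
qed

text \<open>A basis of \<open>N\<close> is extended to the whole space. A vector of
  \<open>perp b N\<close> that is also orthogonal to the added basis vectors lies in the radical of
  the form, so imposing \<open>CARD('n) - dim N\<close> further conditions leaves only
  \<open>0\<close>.\<close>

lemma dim_perp_le:
  fixes b :: "complex^'n^'n"
  assumes b: "invertible b" and N: "vec.subspace N"
  shows "vec.dim N + vec.dim (perp b N) \<le> CARD('n)"
proof -
  obtain B where B: "B \<subseteq> N" "vec.independent B" "N \<subseteq> vec.span B" "card B = vec.dim N"
    using vec.basis_exists by blast
  define B' where "B' = vec.extend_basis B"
  have B': "B \<subseteq> B'" "vec.independent B'" "vec.span B' = UNIV"
    unfolding B'_def
    using vec.extend_basis_superset[OF B(2)] vec.independent_extend_basis[OF B(2)] vec.span_extend_basis[OF B(2)] by auto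
  have fin: "finite B'" using B'(2) vec.finiteI_independent by blast
  have card: "card B' = CARD('n)"
    using vec.dim_eq_card[of B' UNIV] B' by (simp add: card_cart_basis)
  have "perp b N \<inter> perp b (B' - B) \<subseteq> {0}"
  proof
    fix y assume y: "y \<in> perp b N \<inter> perp b (B' - B)"
    have "B' \<subseteq> {x. bform b x y = 0}"
      using y B(1) by (auto simp: perp_def)
    moreover have "vec.subspace {x. bform b x y = 0}"
      by (rule vec.subspaceI) (auto simp: bform_linear)
    ultimately have "vec.span B' \<subseteq> {x. bform b x y = 0}"
      by (rule vec.span_minimal)
    then show "y \<in> {0}" using bform_nondegenerate[OF b, of y] B'(3) by auto
  qed
  then have "vec.dim (perp b N \<inter> perp b (B' - B)) = 0"
    by (metis vec.dim_eq_0)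
  moreover have "vec.dim (perp b N) \<le> card (B' - B) + vec.dim (perp b N \<inter> perp b (B' - B))"
    by (rule dim_inter_perp) (use fin subspace_perp in auto)
  moreover have "card (B' - B) = CARD('n) - vec.dim N"
    using B'(1) card B(4) fin by (simp add: card_Diff_subset finite_subset)
  moreover have "vec.dim N \<le> CARD('n)"
    using vec.dim_subset[of N UNIV] by (simp add: card_cart_basis)
  ultimately show ?thesis by linarith
qed

text \<open>If all vectors of \<open>perp b L\<close> were isotropic, polarisation would put this
  space into its own orthogonal space, and its dimension would be at most half of
  \<open>CARD('n)\<close>; but at most \<open>card L\<close> dimensions were lost.\<close>

lemma nonisotropic_in_perp:
  fixes b :: "complex^'n^'n"
  assumes b: "invertible b" and e: "eps_symmetric 1 b" and L: "finite L" "2 * card L < CARD('n)"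
  shows "\<exists>y\<in>perp b L. bform b y y ~= 0"
proof (rule ccontr)
  assume "~ ?thesis"
  then have 0: "bform b y y = 0" if "y \<in> perp b L" for y using that by blast
  have "bform b x y = 0" if "x \<in> perp b L" "y \<in> perp b L" for x y
  proof -
    have "bform b (x + y) (x + y) = 0"
      using that subspace_perp vec.subspace_add 0 by blast
    then have "bform b x y + bform b y x = 0" using 0[OF that(1)] 0[OF that(2)]
      by (simp add: bform_linear add.commute)
    then show ?thesis using eps_symmetricD[OF e, of y x] by simp
  qed
  then have "perp b L \<subseteq> perp b (perp b L)" by (auto simp: perp_def[of b "perp b L"])
  then have "vec.dim (perp b L) \<le> vec.dim (perp b (perp b L))" by (rule vec.dim_subset)
  then show False
    using dim_perp_le[OF b subspace_perp, of b L] dim_perp_ge[OF L(1), of b] L(2) by linarith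
qed

section \<open>Witt's theorem\<close>

lemma poly_nonroot:
  assumes "p ~= 0"
  shows "\<exists>t. poly p t ~= (0::complex)"
proof (rule ccontr)
  assume "~ ?thesis"
  then have "\<forall>t. poly p t = 0" by simp
  then have "p = 0" by (simp only: poly_all_0_iff_0)
  then show False using assms by simp
qed

text \<open>Prepares the degenerate case of Witt's step, where \<open>x1\<close> and
  \<open>x2\<close> are both carried to a third vector \<open>x1 + x\<close> of the same length; the
  two nonvanishing conditions are those of \<open>isometry_step\<close>. Generic combinations of the
  given vectors are taken, a product of nonzero polynomials having a nonroot. In the alternating
  case the length condition only concerns the vanishing of mixed terms, so any such combination
  serves.\<close>

lemma mover_exists:
  fixes b :: "complex^'n^'n"
  assumes b: "invertible b" and e: "eps_symmetric e b" and e': "e = 1 & 2 * card L < CARD('n) \<or> e = -1"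
    and L: "finite L" and y: "y1 \<in> perp b L" "bform b y1 x1 ~= 0" "y2 \<in> perp b L" "bform b y2 x2 ~= 0"
  shows "\<exists>x\<in>perp b L. bform b x x1 ~= 0 & bform b x x2 ~= 0 &
           bform b (x1 + x) (x1 + x) = bform b x1 x1"
proof -
  have sym: "bform b x y = e * bform b y x" for x y
    using e by (rule eps_symmetricD)
  have S: "vec.subspace (perp b L)" by (rule subspace_perp)
  have "[:bform b y1 x1, bform b y2 x1:] ~= 0" "[:bform b y1 x2, bform b y2 x2:] ~= 0"
    using y by simp_all
  from poly_nonroot[OF no_zero_divisors[OF this], unfolded poly_mult] obtain s where
    "poly [:bform b y1 x1, bform b y2 x1:] s * poly [:bform b y1 x2, bform b y2 x2:] s ~= 0" by blast
  then have s: "bform b y1 x1 + s * bform b y2 x1 ~= 0" "bform b y1 x2 + s * bform b y2 x2 ~= 0"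
    by simp_all
  define y0 where "y0 = y1 + s *s y2"
  have "y0 \<in> perp b L"
    unfolding y0_def by (intro vec.subspace_add vec.subspace_scale S y)
  then have y0: "y0 \<in> perp b L" "bform b y0 x1 ~= 0" "bform b y0 x2 ~= 0"
    using s by (simp_all add: y0_def bform_linear)
  show ?thesis
  proof (cases "e = -1")
    case True
    then have "bform b y0 y0 = 0" using sym[of y0 y0, unfolded True] by simp
    moreover have "bform b x1 y0 = - bform b y0 x1" using sym[of x1 y0] True by simp
    ultimately show ?thesis using y0 by (intro bexI[of _ y0]) (simp_all add: bform_linear)
  next
    case False
    then have e1: "e = 1" and "2 * card L < CARD('n)" using e' by auto
    then obtain y3 where y3: "y3 \<in> perp b L" "bform b y3 y3 ~= 0"
      using nonisotropic_in_perp[OF b _ L] e by blast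
    have "[:bform b y3 x1, bform b y0 x1:] ~= 0" "[:bform b y3 x2, bform b y0 x2:] ~= 0"
      "[:bform b y3 y3, bform b y3 y0 + bform b y0 y3, bform b y0 y0:] ~= 0"
      using y3 y0 by simp_all
    from poly_nonroot[OF no_zero_divisors[OF this(3) no_zero_divisors[OF this(1,2)]], unfolded poly_mult]
    obtain t where "poly [:bform b y3 y3, bform b y3 y0 + bform b y0 y3, bform b y0 y0:] t *
        (poly [:bform b y3 x1, bform b y0 x1:] t * poly [:bform b y3 x2, bform b y0 x2:] t) ~= 0"
      by blast
    then have
      t: "bform b y3 y3 + t * (bform b y3 y0 + bform b y0 y3 + t * bform b y0 y0) ~= 0"
        "bform b y3 x1 + t * bform b y0 x1 ~= 0" "bform b y3 x2 + t * bform b y0 x2 ~= 0"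
      by simp_all
    define z where "z = y3 + t *s y0"
    have "z \<in> perp b L"
      unfolding z_def by (intro vec.subspace_add vec.subspace_scale S y3 y0)
    moreover have "bform b z z = bform b y3 y3 + t * (bform b y3 y0 + bform b y0 y3 + t * bform b y0 y0)"
      by (simp add: z_def bform_linear algebra_simps)
    moreover have "bform b z x1 = bform b y3 x1 + t * bform b y0 x1" "bform b z x2 = bform b y3 x2 + t * bform b y0 x2"
      by (simp_all add: z_def bform_linear)
    ultimately have z: "z \<in> perp b L" "bform b z z ~= 0" "bform b z x1 ~= 0" "bform b z x2 ~= 0"
      using t by simp_all
    \<comment> \<open>The nonzero root of \<open>c * (2 * bform b z x1 + c * bform b z z)\<close>,
      the change of length on adding \<open>c *s z\<close> to \<open>x1\<close>.\<close>
    define c where "c = - 2 * bform b z x1 / bform b z z"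
    have c: "c ~= 0" using z by (simp add: c_def)
    have "c * bform b z z = - 2 * bform b z x1" using z by (simp add: c_def)
    moreover have "bform b x1 z = bform b z x1" using sym[of x1 z] e1 by simp
    moreover have "bform b (x1 + c *s z) (x1 + c *s z)
        = bform b x1 x1 + c * (bform b x1 z + bform b z x1 + c * bform b z z)"
      by (simp add: bform_linear algebra_simps)
    ultimately have "bform b (x1 + c *s z) (x1 + c *s z) = bform b x1 x1" by simp
    then show ?thesis using z c vec.subspace_scale[OF S z(1), of c]
      by (intro bexI[of _ "c *s z"]) (simp_all add: bform_linear)
  qed
qed

lemma column_mult: "column k (g ** w) = g *v column k w"
  by (simp add: vec_eq_iff column_def matrix_matrix_mult_def matrix_vector_mult_def)

text \<open>Columns are matched one at a time by isometries that fix the columns already matched. If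
  \<open>x1\<close> is the current position of a column and \<open>x2\<close> its target, one
  reflection or transvection along \<open>x2 - x1\<close> suffices unless \<open>x2 - x1\<close> is
  orthogonal to \<open>x1\<close>; then both are moved to a common vector and the second move is
  inverted.\<close>

theorem witt:
  fixes b :: "complex^'n^'n" and w w' :: "complex^'m^'n"
  assumes b: "invertible b" and e: "eps_symmetric e b"
    and e': "e = 1 & 2 * CARD('m) < CARD('n) \<or> e = -1"
    and w: "full_rank w" and w': "full_rank w'"
    and eq: "transpose w ** b ** w = transpose w' ** b ** w'"
  shows "\<exists>g\<in>isometries b. g ** w = w'"
proof -
  have sym: "bform b x y = e * bform b y x" for x y
    using e by (rule eps_symmetricD)
  have e'': "e = 1 \<or> e = -1" using e' by auto
  have "\<exists>g\<in>isometries b. \<forall>k\<in>K. g *v column k w = column k w'" for K :: "'m set"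
    using finite[of K]
  proof induction
    case empty
    then show ?case using isometries_one by blast
  next
    case (insert k K)
    then obtain g0 where g0: "g0 \<in> isometries b" "!!j. j \<in> K ==> g0 *v column j w = column j w'" by blast
    obtain g0' where "g0' ** g0 = mat 1" using isometries_inverse[OF b g0(1)] by blast
    then have v: "full_rank (g0 ** w)" using full_rank_mult[OF w] by blast
    have gram: "bform b (g0 *v column i w) (g0 *v column j w) = bform b (column i w') (column j w')" for i j
      using g0(1) eq unfolding isometries_iff by (metis congr_nth)
    define L where "L = (%j. column j w') ` K"
    define x1 where "x1 = g0 *v column k w"
    define x2 where "x2 = column k w'"
    have Lg: "y \<in> L ==> \<exists>j\<in>K. y = column j w' & y = g0 *v column j w" for y
      unfolding L_def using g0(2) by auto
    have finL: "finite L" "card L \<le> card K" by (auto simp: L_def card_image_le)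
    have "K ~= UNIV" using insert.hyps by auto
    then have "card K < CARD('m)" by (simp add: psubset_card_mono psubsetI)
    then have e_L: "e = 1 & 2 * card L < CARD('n) \<or> e = -1" using e' finL by auto
    have dL: "bform b (x2 - x1) y = 0" if "y \<in> L" for y
      using Lg[OF that] gram by (auto simp: x1_def x2_def bform_linear)
    have perp_sym: "bform b x y = 0" if "x \<in> perp b L" "y \<in> L" for x y
      using that sym[of x y] by (simp add: perp_def)
    have 11: "bform b x1 x1 = bform b x2 x2" using gram by (simp add: x1_def x2_def)
    have "\<exists>g\<in>isometries b. g *v x1 = x2 & (\<forall>y\<in>L. g *v y = y)"
    proof (cases "bform b (x2 - x1) x1 = 0")
      case False
      then show ?thesis
        using isometry_step[OF e e'' 11[symmetric] False] dL by blast
    next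
      case True
      obtain y1 where y1: "bform b y1 x1 = 1" "!!j. j ~= k ==> bform b y1 (g0 *v column j w) = 0"
        using dual_vector[OF b v, of k] by (auto simp: column_mult x1_def)
      obtain y2 where y2: "bform b y2 x2 = 1" "!!j. j ~= k ==> bform b y2 (column j w') = 0"
        using dual_vector[OF b w', of k] by (auto simp: x2_def)
      have "bform b y y1 = 0 & bform b y y2 = 0" if y: "y \<in> L" for y
      proof -
        obtain j where j: "j \<in> K" "y = column j w'" "y = g0 *v column j w" using Lg[OF y] by blast
        then have "j ~= k" using insert.hyps by auto
        then have "bform b y1 y = 0" "bform b y2 y = 0" using y1(2) y2(2) j by metis+
        then show ?thesis using sym[of y y1] sym[of y y2] by simp
      qed
      then have "y1 \<in> perp b L" "y2 \<in> perp b L" by (auto simp: perp_def)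
      then obtain x where x: "x \<in> perp b L" "bform b x x1 ~= 0" "bform b x x2 ~= 0"
        "bform b (x1 + x) (x1 + x) = bform b x1 x1"
        using mover_exists[OF b e e_L finL(1), of y1 x1 y2 x2] y1(1) y2(1) by auto
      define u where "u = x1 + x"
      have "bform b (u - x1) x1 ~= 0" using x by (simp add: u_def)
      then obtain g1 where g1: "g1 \<in> isometries b" "g1 *v x1 = u" "\<forall>y\<in>L. g1 *v y = y"
        using isometry_step[OF e e'', of u x1] x(4) perp_sym[OF x(1)] by (auto simp: u_def)
      \<comment> \<open>Hence \<open>u - x2\<close> pairs with \<open>x2\<close> exactly as
        \<open>x\<close> does, which makes the move from \<open>x2\<close> to \<open>u\<close>
        nondegenerate too.\<close>
      have "bform b x1 x2 = bform b x2 x2"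
        using True 11 sym by (metis bform_diff_left right_minus_eq)
      then have "bform b (u - x2) x2 ~= 0" using x(3) by (simp add: u_def bform_linear)
      moreover have "bform b u u = bform b x2 x2" using x(4) 11 by (simp add: u_def)
      moreover have "bform b (u - x2) y = 0" if "y \<in> L" for y
        using perp_sym[OF x(1) that] dL[OF that] by (simp add: u_def bform_linear)
      ultimately obtain g2 where g2: "g2 \<in> isometries b" "g2 *v x2 = u" "\<forall>y\<in>L. g2 *v y = y"
        using isometry_step[OF e e'', of u x2] by auto
      obtain g3 where g3: "g3 \<in> isometries b" "g3 ** g2 = mat 1"
        using isometries_inverse[OF b g2(1)] by blast
      have g32: "g3 *v (g2 *v y) = y" for y by (simp add: matrix_vector_mul_assoc g3)
      have "(g3 ** g1) *v x1 = x2" using g32[of x2] g1 g2 by (simp flip: matrix_vector_mul_assoc)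
      moreover have "\<forall>y\<in>L. (g3 ** g1) *v y = y"
        using g32 g1(3) g2(3) by (metis matrix_vector_mul_assoc)
      ultimately show ?thesis using isometries_mult[OF g3(1) g1(1)] by blast
    qed
    then obtain g where g: "g \<in> isometries b" "g *v x1 = x2" "\<forall>y\<in>L. g *v y = y" by blast
    have "(g ** g0) *v column j w = column j w'" if "j \<in> insert k K" for j
      using that g(2,3) g0(2) by (auto simp: x1_def x2_def L_def simp flip: matrix_vector_mul_assoc)
    then show ?case using isometries_mult[OF g(1) g0(1)] by blast
  qed
  then obtain g where g: "g \<in> isometries b" "!!k. g *v column k w = column k w'" by blast
  have col: "column k (g ** w) = column k w'" for k by (simp only: column_mult g(2))
  have "(g ** w) $ i $ k = w' $ i $ k" for i k
    using arg_cong[OF col[of k], of "%x. x $ i"] by (simp add: column_def)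
  then have "g ** w = w'" by (simp add: vec_eq_iff)
  then show ?thesis using g(1) by blast
qed

section \<open>Density of full rank among matrices with a given Gram matrix\<close>

text \<open>Meant for one-parameter families controlled only for \<open>t ~= 0\<close>, here
  perturbations to higher rank and later one-parameter subgroups.\<close>

lemma punctured_limit:
  fixes \<gamma> :: "complex => 'a::topological_space"
  assumes "continuous_on UNIV \<gamma>" "closed C" "!!t. t ~= 0 ==> \<gamma> t \<in> C"
  shows "\<gamma> 0 \<in> C"
proof -
  have "closed (\<gamma> -` C)" using closed_vimage[OF assms(2,1)] .
  moreover have "- {0} \<subseteq> \<gamma> -` C" using assms(3) by auto
  ultimately have "closure (- {0}) \<subseteq> \<gamma> -` C" by (simp add: closure_minimal)
  moreover have "closure (- {0 :: complex}) = UNIV" by (simp add: closure_complement)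
  ultimately have "0 \<in> \<gamma> -` C" by blast
  then show ?thesis by simp
qed

lemma complex_quadratic_root:
  fixes A B C :: complex
  assumes "A ~= 0"
  shows "\<exists>t. C + 2 * t * B + t\<^sup>2 * A = 0"
proof -
  define t where "t = (csqrt (B\<^sup>2 - A * C) - B) / A"
  have "A * t + B = csqrt (B\<^sup>2 - A * C)" using assms by (simp add: t_def)
  then have "(A * t + B)\<^sup>2 = B\<^sup>2 - A * C" by (simp only: power2_csqrt)
  moreover have "A * (C + 2 * t * B + t\<^sup>2 * A) = (A * t + B)\<^sup>2 - (B\<^sup>2 - A * C)"
    by (simp add: power2_eq_square algebra_simps)
  ultimately show ?thesis using assms by auto
qed

text \<open>The orthogonal space of \<open>L\<close> is too large to lie in the span of
  \<open>L\<close>. An alternating form makes every vector isotropic. For a symmetric form a second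
  vector, independent of the first modulo the span, is available, and a quadratic equation over the
  complex numbers yields an isotropic combination outside the span.\<close>

lemma isotropic_exists:
  fixes b :: "complex^'n^'n"
  assumes e: "eps_symmetric e b" and L: "finite L"
    and c: "e = 1 & 2 * card L + 1 < CARD('n) \<or> e = -1 & 2 * card L < CARD('n)"
  shows "\<exists>v\<in>perp b L. v \<notin> vec.span L & bform b v v = 0"
proof -
  have sym: "bform b x y = e * bform b y x" for x y
    using e by (rule eps_symmetricD)
  have outside: "\<exists>a\<in>perp b L. a \<notin> vec.span M" if "finite M" "card L + card M < CARD('n)" for M
  proof (rule ccontr)
    assume "~ ?thesis"
    then have "perp b L \<subseteq> vec.span M" by blast
    then have "vec.dim (perp b L) \<le> vec.dim (vec.span M)" by (rule vec.dim_subset)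
    also have "\<dots> \<le> card M" using vec.dim_le_card'[OF that(1)] by simp
    finally show False using dim_perp_ge[OF L, of b] that(2) by linarith
  qed
  obtain a where a: "a \<in> perp b L" "a \<notin> vec.span L" using outside[OF L] c by auto
  show ?thesis
  proof (cases "bform b a a = 0")
    case True
    then show ?thesis using a by blast
  next
    case False
    have "e ~= -1"
    proof
      assume "e = -1"
      then show False using sym[of a a, unfolded \<open>e = -1\<close>] False by simp
    qed
    then have e1: "e = 1" "2 * card L + 1 < CARD('n)" using c by auto
    moreover have "card (insert a L) \<le> Suc (card L)" using L by (simp add: card_insert_if)
    ultimately obtain a' where a': "a' \<in> perp b L" "a' \<notin> vec.span (insert a L)"
      using outside[of "insert a L"] L by auto
    obtain t where "bform b a' a' + 2 * t * bform b a a' + t\<^sup>2 * bform b a a = 0"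
      using complex_quadratic_root[OF False] by blast
    moreover have "bform b a' a = bform b a a'" using sym[of a' a] e1 by simp
    then have "bform b (a' + t *s a) (a' + t *s a)
        = bform b a' a' + 2 * t * bform b a a' + t\<^sup>2 * bform b a a"
      by (simp add: bform_linear power2_eq_square algebra_simps)
    ultimately have "bform b (a' + t *s a) (a' + t *s a) = 0" by simp
    moreover have "a' + t *s a \<in> perp b L"
      using a a' subspace_perp[of b L] by (simp add: vec.subspace_add vec.subspace_scale)
    moreover have "a' + t *s a \<notin> vec.span L"
    proof
      assume "a' + t *s a \<in> vec.span L"
      then have "a' - (- t) *s a \<in> vec.span L" by simp
      then show False using a'(2) vec.span_breakdown_eq by blast
    qed
    ultimately show ?thesis by blast
  qed
qed

text \<open>Subtracting the multiple of the kernel vector \<open>u\<close> that clears entry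
  \<open>k\<close> of \<open>x\<close> does not change \<open>w *v x\<close>, so column
  \<open>k\<close> is dispensable.\<close>

lemma mult_in_span_columns:
  fixes w :: "complex^'m^'n"
  assumes u: "w *v u = 0" and k: "u $ k ~= 0"
  shows "w *v x \<in> vec.span ((%j. column j w) ` (UNIV - {k}))"
proof -
  let ?L = "(%j. column j w) ` (UNIV - {k})"
  let ?y = "x - (x $ k / u $ k) *s u"
  have "w *v y = (\<Sum>j\<in>UNIV. y $ j *s column j w)" for y :: "complex^'m"
    by (simp add: vec_eq_iff matrix_vector_mult_def column_def mult.commute)
  then have "w *v ?y = (\<Sum>j\<in>UNIV. ?y $ j *s column j w)" .
  also have "\<dots> \<in> vec.span ?L"
  proof (rule vec.span_sum)
    fix j
    show "?y $ j *s column j w \<in> vec.span ?L"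
    proof (cases "j = k")
      case True
      then have "?y $ j = 0" using k by simp
      then show ?thesis by (simp only: vec.scale_zero_left vec.span_zero)
    next
      case False
      then have "column j w \<in> ?L" by blast
      then show ?thesis by (intro vec.span_scale vec.span_base)
    qed
  qed
  also have "w *v ?y = w *v x"
    using u by (simp only: matrix_vector_mult_diff_distrib vector_scalar_commute vec.scale_zero_right diff_zero)
  finally show ?thesis .
qed

text \<open>Induction on the dimension of the kernel. A column \<open>k\<close> that depends on the
  others is perturbed by \<open>t\<close> times an isotropic vector orthogonal to all columns and
  outside their span: the Gram matrix stays, the kernel shrinks for \<open>t ~= 0\<close>, and
  \<open>w\<close> is the limit. Only the other \<open>CARD('m) - 1\<close> columns have to be
  avoided, which is what the dimension bounds allow.\<close>

theorem full_rank_dense: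
  fixes b :: "complex^'n^'n" and w :: "complex^'m^'n"
  assumes e: "eps_symmetric e b"
    and e': "e = 1 & 2 * CARD('m) < CARD('n) \<or> e = -1 & 2 * CARD('m) \<le> CARD('n)"
  shows "w \<in> closure {w'. full_rank w' & transpose w' ** b ** w' = transpose w ** b ** w}"
proof (induction "vec.dim {x. w *v x = 0}" arbitrary: w rule: less_induct)
  case less
  let ?S = "{w'. full_rank w' & transpose w' ** b ** w' = transpose w ** b ** w}"
  show ?case
  proof (cases "full_rank w")
    case True
    then have "w \<in> ?S" by simp
    then show ?thesis by (rule subsetD[OF closure_subset])
  next
    case False
    then obtain u where u: "w *v u = 0" "u ~= 0" by (auto simp: full_rank_def)
    then obtain k where k: "u $ k ~= 0" by (auto simp: vec_eq_iff)
    define L where "L = (%j. column j w) ` (UNIV - {k})"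
    have finL: "finite L" by (simp add: L_def)
    have "card L \<le> card (UNIV - {k})" unfolding L_def by (rule card_image_le) simp
    moreover have "card (UNIV - {k}) = CARD('m) - 1" "0 < CARD('m)" by simp_all
    ultimately have cL: "card L < CARD('m)" by linarith
    have wspan: "w *v x \<in> vec.span L" for x
      unfolding L_def by (rule mult_in_span_columns[OF u(1) k])
    have cL': "e = 1 & 2 * card L + 1 < CARD('n) \<or> e = -1 & 2 * card L < CARD('n)"
      using e'
    proof
      assume "e = 1 & 2 * CARD('m) < CARD('n)"
      moreover from this cL have "2 * card L + 1 < CARD('n)" by linarith
      ultimately show ?thesis by blast
    next
      assume "e = -1 & 2 * CARD('m) \<le> CARD('n)"
      moreover from this cL have "2 * card L < CARD('n)" by linarith
      ultimately show ?thesis by blast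
    qed
    obtain v where v: "v \<in> perp b L" "v \<notin> vec.span L" "bform b v v = 0"
      using isotropic_exists[OF e finL] cL' by blast
    have perp0: "bform b x v = 0 & bform b v x = 0" if "x \<in> vec.span L" for x
    proof -
      have "vec.subspace {x. bform b x v = 0}" by (rule vec.subspaceI) (auto simp: bform_linear)
      moreover have "L \<subseteq> {x. bform b x v = 0}" using v(1) by (auto simp: perp_def)
      ultimately have "vec.span L \<subseteq> {x. bform b x v = 0}" by (simp add: vec.span_minimal)
      then have "bform b x v = 0" using that by blast
      then show ?thesis using eps_symmetricD[OF e, of v x] by simp
    qed
    define \<gamma> where "\<gamma> t = (\<chi> i j. w $ i $ j + (if j = k then t * v $ i else 0))" for t
    have col: "column j (\<gamma> t) = column j w + (if j = k then t *s v else 0)" for j t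
      by (simp add: vec_eq_iff \<gamma>_def column_def)
    have \<gamma>v: "\<gamma> t *v x = w *v x + (t * x $ k) *s v" for t x
    proof -
      have "(\<gamma> t *v x) $ i = (\<Sum>j\<in>UNIV. w $ i $ j * x $ j + (if j = k then t * v $ i * x $ k else 0))" for i
        unfolding matrix_vector_mult_def by (simp add: \<gamma>_def distrib_right) (intro sum.cong refl, auto)
      then show ?thesis by (simp add: vec_eq_iff sum.distrib matrix_vector_mult_def mult_ac)
    qed
    have colspan: "column j w \<in> vec.span L" for j using wspan[of "axis j 1"] by (simp add: matrix_mult_axis)
    have gram: "transpose (\<gamma> t) ** b ** \<gamma> t = transpose w ** b ** w" for t
    proof -
      have "bform b (column i (\<gamma> t)) (column j (\<gamma> t)) = bform b (column i w) (column j w)" for i j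
        using perp0[OF colspan] v(3) by (cases "i = k"; cases "j = k") (simp_all add: col bform_linear)
      then have "(transpose (\<gamma> t) ** b ** \<gamma> t) $ i $ j = (transpose w ** b ** w) $ i $ j" for i j
        by (simp only: congr_nth)
      then show ?thesis unfolding vec_eq_iff by blast
    qed
    have ker: "w *v x = 0 & x $ k = 0" if "\<gamma> t *v x = 0" "t ~= 0" for t x
    proof -
      have *: "w *v x + (t * x $ k) *s v = 0" using that(1) by (simp add: \<gamma>v)
      have "x $ k = 0"
      proof (rule ccontr)
        assume "x $ k ~= 0"
        have "(t * x $ k) *s v = - (w *v x)" using * by (simp add: eq_neg_iff_add_eq_0 add.commute)
        then have "(t * x $ k) *s v \<in> vec.span L" using wspan[of x] vec.span_neg by simp
        from vec.span_scale[OF this, of "1 / (t * x $ k)"] have "v \<in> vec.span L"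
          using \<open>x $ k ~= 0\<close> that(2) by simp
        then show False using v(2) by simp
      qed
      then show ?thesis using * by simp
    qed
    have \<gamma>_closure: "\<gamma> t \<in> closure ?S" if t: "t ~= 0" for t
    proof -
      have sub: "vec.subspace {x. A *v x = 0}" for A :: "complex^'m^'n"
        by (rule vec.subspaceI) (auto simp: matrix_vector_right_distrib vector_scalar_commute)
      have "{x. \<gamma> t *v x = 0} \<subset> {x. w *v x = 0}"
        using ker[OF _ t] u k by blast
      then have "vec.dim {x. \<gamma> t *v x = 0} < vec.dim {x. w *v x = 0}"
        by (intro vec.dim_psubset) (simp add: vec.span_eq_iff[THEN iffD2, OF sub])
      from less(1)[OF this] show ?thesis by (simp add: gram)
    qed
    have \<gamma>_cont: "continuous_on UNIV \<gamma>"
    proof -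
      have "continuous_on UNIV (%t. if j = k then t * v $ i else 0)" for i and j :: 'm
        by (cases "j = k") (simp_all add: continuous_on_mult_right continuous_on_id)
      then show ?thesis
        unfolding \<gamma>_def by (intro continuous_on_vec_lambda continuous_on_add continuous_on_const)
    qed
    have "\<gamma> 0 \<in> closure ?S" by (rule punctured_limit[OF \<gamma>_cont closed_closure \<gamma>_closure])
    moreover have "\<gamma> 0 = w" by (simp add: \<gamma>_def vec_eq_iff)
    ultimately show ?thesis by simp
  qed
qed

section \<open>Flatness from coordinates\<close>

lemma tensor_kernel_subgroup:
  assumes "Module.module R M" "Module.module R N"
  shows "subgroup (tensor_kernel R M N) (free_Abelian_group (carrier M \<times> carrier N))"
proof -
  interpret M: Module.module R M by (rule assms)
  interpret N: Module.module R N by (rule assms)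
  have "tensor_relations R M N \<subseteq> carrier (free_Abelian_group (carrier M \<times> carrier N))"
    unfolding tensor_relations_def
    by (auto dest!: subsetD[OF keys_diff])
  then show ?thesis
    unfolding tensor_kernel_def by (intro group.generate_is_subgroup) simp_all
qed

text \<open>The dual basis criterion for projectivity, turned directly into flatness. Each
  \<open>c i\<close> induces a map from the tensor product with \<open>N\<close> to
  \<open>N\<close>. If the image of a tensor under \<open>f\<close> is zero, then \<open>f\<close>
  kills all its coordinates, these vanish by injectivity, and the tensor is the sum of its
  coordinates at the \<open>e i\<close>.\<close>

lemma flat_module_coordinates:
  fixes R :: "('r, 'a) ring_scheme" and M :: "('r, 'm, 'b) module_scheme"
  assumes M: "Module.module R M"
    and c: "!!i x. x \<in> carrier M ==> c i x \<in> carrier R"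
    and e: "!!i. e i \<in> carrier M"
    and c_add: "!!i x y. x \<in> carrier M ==> y \<in> carrier M ==> c i (x \<oplus>\<^bsub>M\<^esub> y) = c i x \<oplus>\<^bsub>R\<^esub> c i y"
    and c_smult: "!!i r x. r \<in> carrier R ==> x \<in> carrier M ==> c i (r \<odot>\<^bsub>M\<^esub> x) = r \<otimes>\<^bsub>R\<^esub> c i x"
    and expand: "!!x. x \<in> carrier M ==> \<exists>A. finite A & (\<forall>i. i \<notin> A --> c i x = \<zero>\<^bsub>R\<^esub>) &
          x = finsum M (%i. c i x \<odot>\<^bsub>M\<^esub> e i) A"
  shows "flat_module TYPE('n) R M"
  unfolding flat_module_def
proof (intro allI impI, elim conjE)
  fix N N' :: "('r, 'n) module" and f
  assume N: "Module.module R N" and N': "Module.module R N'" and f: "f \<in> linear_maps R N N'"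
    and inj: "inj_on f (carrier N)"
  interpret M: Module.module R M by (rule M)
  interpret N: Module.module R N by (rule N)
  interpret N': Module.module R N' by (rule N')
  let ?F = "free_Abelian_group (carrier M \<times> carrier N)"
  let ?F' = "free_Abelian_group (carrier M \<times> carrier N')"
  let ?K = "tensor_kernel R M N"
  let ?K' = "tensor_kernel R M N'"
  have f_closed: "x \<in> carrier N ==> f x \<in> carrier N'" for x using f by (auto simp: linear_maps_def)
  have f_add: "x \<in> carrier N ==> y \<in> carrier N ==> f (x \<oplus>\<^bsub>N\<^esub> y) = f x \<oplus>\<^bsub>N'\<^esub> f y" for x y
    using f by (auto simp: linear_maps_def)
  have f_smult: "r \<in> carrier R ==> x \<in> carrier N ==> f (r \<odot>\<^bsub>N\<^esub> x) = r \<odot>\<^bsub>N'\<^esub> f x" for r x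
    using f by (auto simp: linear_maps_def)
  have f_zero: "f \<zero>\<^bsub>N\<^esub> = \<zero>\<^bsub>N'\<^esub>"
    using f_smult[of "\<zero>\<^bsub>R\<^esub>" "\<zero>\<^bsub>N\<^esub>"] f_closed[of "\<zero>\<^bsub>N\<^esub>"] by simp
  have K: "subgroup ?K ?F" and K': "subgroup ?K' ?F'"
    by (rule tensor_kernel_subgroup[OF M N]) (rule tensor_kernel_subgroup[OF M N'])
  have K0: "0 \<in> ?K" using subgroup.one_closed[OF K] by simp
  have K_add: "a + b \<in> ?K" if "a \<in> ?K" "b \<in> ?K" for a b using subgroup.m_closed[OF K that] by simp
  have K_minus: "- a \<in> ?K" if "a \<in> ?K" for a
    using subgroup.m_inv_closed[OF K that] subsetD[OF subgroup.subset[OF K] that] by simp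
  have K_diff: "a - b \<in> ?K" if "a \<in> ?K" "b \<in> ?K" for a b using K_add[OF that(1) K_minus[OF that(2)]] by simp
  have K_sum: "sum g A \<in> ?K" if "!!i. i \<in> A ==> g i \<in> ?K" for g :: "'i => _" and A
    using that by (induction A rule: infinite_finite_induct) (auto intro: K0 K_add)
  have rel1: "frag_of (x \<oplus>\<^bsub>M\<^esub> x', y) - frag_of (x, y) - frag_of (x', y) \<in> ?K"
    if "x \<in> carrier M" "x' \<in> carrier M" "y \<in> carrier N" for x x' y
    unfolding tensor_kernel_def by (rule generate.incl) (use that in \<open>auto simp: tensor_relations_def\<close>)
  have rel2: "frag_of (x, y \<oplus>\<^bsub>N\<^esub> y') - frag_of (x, y) - frag_of (x, y') \<in> ?K"
    if "x \<in> carrier M" "y \<in> carrier N" "y' \<in> carrier N" for x y y'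
    unfolding tensor_kernel_def by (rule generate.incl) (use that in \<open>auto simp: tensor_relations_def\<close>)
  have rel3: "frag_of (r \<odot>\<^bsub>M\<^esub> x, y) - frag_of (x, r \<odot>\<^bsub>N\<^esub> y) \<in> ?K"
    if "r \<in> carrier R" "x \<in> carrier M" "y \<in> carrier N" for r x y
    unfolding tensor_kernel_def by (rule generate.incl) (use that in \<open>auto simp: tensor_relations_def\<close>)
  have zero_right: "frag_of (x, \<zero>\<^bsub>N\<^esub>) \<in> ?K" if "x \<in> carrier M" for x
    using K_minus[OF rel2[OF that, of "\<zero>\<^bsub>N\<^esub>" "\<zero>\<^bsub>N\<^esub>"]] by simp
  have zero_left: "frag_of (\<zero>\<^bsub>M\<^esub>, y) \<in> ?K" if "y \<in> carrier N" for y
    using K_minus[OF rel1[OF _ _ that, of "\<zero>\<^bsub>M\<^esub>" "\<zero>\<^bsub>M\<^esub>"]] by simp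

  \<comment> \<open>the \<open>i\<close>-th coordinate \<open>M \<otimes> N \<rightarrow> N\<close>, and likewise for \<open>N'\<close>\<close>
  have "\<exists>h. h \<in> hom ?F (add_monoid N) & (\<forall>x\<in>carrier M. \<forall>y\<in>carrier N. h (frag_of (x, y)) = c i x \<odot>\<^bsub>N\<^esub> y)" for i
  proof -
    have "(%(x, y). c i x \<odot>\<^bsub>N\<^esub> y) ` (carrier M \<times> carrier N) \<subseteq> carrier (add_monoid N)"
      using c by auto
    from comm_group.free_Abelian_group_universal[OF N.a_comm_group this] obtain h where
      h: "h \<in> hom ?F (add_monoid N)" "!!z. z \<in> carrier M \<times> carrier N ==> h (frag_of z) = (%(x, y). c i x \<odot>\<^bsub>N\<^esub> y) z"
      by blast
    then show ?thesis by auto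
  qed
  then obtain \<Phi> where \<Phi>: "!!i. \<Phi> i \<in> hom ?F (add_monoid N)"
    "!!i x y. x \<in> carrier M ==> y \<in> carrier N ==> \<Phi> i (frag_of (x, y)) = c i x \<odot>\<^bsub>N\<^esub> y" by metis
  have "\<exists>h. h \<in> hom ?F' (add_monoid N') & (\<forall>x\<in>carrier M. \<forall>y\<in>carrier N'. h (frag_of (x, y)) = c i x \<odot>\<^bsub>N'\<^esub> y)" for i
  proof -
    have "(%(x, y). c i x \<odot>\<^bsub>N'\<^esub> y) ` (carrier M \<times> carrier N') \<subseteq> carrier (add_monoid N')"
      using c by auto
    from comm_group.free_Abelian_group_universal[OF N'.a_comm_group this] obtain h where
      h: "h \<in> hom ?F' (add_monoid N')" "!!z. z \<in> carrier M \<times> carrier N' ==> h (frag_of z) = (%(x, y). c i x \<odot>\<^bsub>N'\<^esub> y) z"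
      by blast
    then show ?thesis by auto
  qed
  then obtain \<Phi>' where \<Phi>': "!!i. \<Phi>' i \<in> hom ?F' (add_monoid N')"
    "!!i x y. x \<in> carrier M ==> y \<in> carrier N' ==> \<Phi>' i (frag_of (x, y)) = c i x \<odot>\<^bsub>N'\<^esub> y" by metis
  have \<Phi>_closed: "\<Phi> i a \<in> carrier N" if "Poly_Mapping.keys a \<subseteq> carrier M \<times> carrier N" for i a
    using \<Phi>(1)[of i] that by (auto simp: hom_def Pi_iff)
  have \<Phi>_add: "\<Phi> i (a + b) = \<Phi> i a \<oplus>\<^bsub>N\<^esub> \<Phi> i b"
    if "Poly_Mapping.keys a \<subseteq> carrier M \<times> carrier N" "Poly_Mapping.keys b \<subseteq> carrier M \<times> carrier N" for i a b
    using \<Phi>(1)[of i] that by (auto simp: hom_def)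
  have \<Phi>'_closed: "\<Phi>' i a \<in> carrier N'" if "Poly_Mapping.keys a \<subseteq> carrier M \<times> carrier N'" for i a
    using \<Phi>'(1)[of i] that by (auto simp: hom_def Pi_iff)
  have \<Phi>'_add: "\<Phi>' i (a + b) = \<Phi>' i a \<oplus>\<^bsub>N'\<^esub> \<Phi>' i b"
    if "Poly_Mapping.keys a \<subseteq> carrier M \<times> carrier N'" "Poly_Mapping.keys b \<subseteq> carrier M \<times> carrier N'" for i a b
    using \<Phi>'(1)[of i] that by (auto simp: hom_def)
  have \<Phi>_diff: "\<Phi> i (a - b) \<oplus>\<^bsub>N\<^esub> \<Phi> i b = \<Phi> i a"
    if "Poly_Mapping.keys a \<subseteq> carrier M \<times> carrier N" "Poly_Mapping.keys b \<subseteq> carrier M \<times> carrier N" for i a b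
    using \<Phi>_add[of "a - b" b i] that order_trans[OF keys_diff[of a b]] by simp
  have \<Phi>'_diff: "\<Phi>' i (a - b) \<oplus>\<^bsub>N'\<^esub> \<Phi>' i b = \<Phi>' i a"
    if "Poly_Mapping.keys a \<subseteq> carrier M \<times> carrier N'" "Poly_Mapping.keys b \<subseteq> carrier M \<times> carrier N'" for i a b
    using \<Phi>'_add[of "a - b" b i] that order_trans[OF keys_diff[of a b]] by simp
  have \<Phi>_zero: "\<Phi> i 0 = \<zero>\<^bsub>N\<^esub>" for i
    using \<Phi>_add[of 0 0 i] \<Phi>_closed[of 0 i] by (simp add: N.add.l_cancel_one')
  have \<Phi>'_zero: "\<Phi>' i 0 = \<zero>\<^bsub>N'\<^esub>" for i
    using \<Phi>'_add[of 0 0 i] \<Phi>'_closed[of 0 i] by (simp add: N'.add.l_cancel_one')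

  \<comment> \<open>The bilinearity relations go to zero, so the coordinate map is well defined on
    the tensor product.\<close>
  have \<Phi>'_kernel: "\<Phi>' i a = \<zero>\<^bsub>N'\<^esub>" if "a \<in> ?K'" for i a
  proof -
    have sub: "Poly_Mapping.keys a \<subseteq> carrier M \<times> carrier N'" if "a \<in> ?K'" for a
      using subsetD[OF subgroup.subset[OF K'] that] by simp
    have relz: "\<Phi>' i r = \<zero>\<^bsub>N'\<^esub>" if "r \<in> tensor_relations R M N'" for r
    proof -
      have split: "\<Phi>' i (frag_of p - frag_of q - frag_of s) = \<zero>\<^bsub>N'\<^esub>"
        if pqs: "p \<in> carrier M \<times> carrier N'" "q \<in> carrier M \<times> carrier N'" "s \<in> carrier M \<times> carrier N'"
          "\<Phi>' i (frag_of p) = \<Phi>' i (frag_of q) \<oplus>\<^bsub>N'\<^esub> \<Phi>' i (frag_of s)" for p q s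
      proof -
        have eq: "frag_of p - frag_of q - frag_of s + (frag_of q + frag_of s) = frag_of p" by simp
        have k: "Poly_Mapping.keys (frag_of p - frag_of q - frag_of s) \<subseteq> carrier M \<times> carrier N'"
          "Poly_Mapping.keys (frag_of q + frag_of s) \<subseteq> carrier M \<times> carrier N'"
          using keys_diff[of "frag_of p" "frag_of q"] keys_diff[of "frag_of p - frag_of q" "frag_of s"]
            keys_add[of "frag_of q" "frag_of s"] pqs by auto
        have "\<Phi>' i (frag_of p - frag_of q - frag_of s) \<oplus>\<^bsub>N'\<^esub> \<Phi>' i (frag_of q + frag_of s) = \<Phi>' i (frag_of p)"
          using \<Phi>'_add[OF k, of i] eq by simp
        also have "\<dots> = \<Phi>' i (frag_of q + frag_of s)"
          using pqs by (simp add: \<Phi>'_add)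
        finally show ?thesis
          using \<Phi>'_closed[OF k(1), of i] \<Phi>'_closed[OF k(2), of i] by (simp add: N'.add.l_cancel_one)
      qed
      have split2: "\<Phi>' i (frag_of p - frag_of q) = \<zero>\<^bsub>N'\<^esub>"
        if pq: "p \<in> carrier M \<times> carrier N'" "q \<in> carrier M \<times> carrier N'" "\<Phi>' i (frag_of p) = \<Phi>' i (frag_of q)" for p q
      proof -
        have "Poly_Mapping.keys (frag_of p - frag_of q) \<subseteq> carrier M \<times> carrier N'"
          using keys_diff[of "frag_of p" "frag_of q"] pq by auto
        then show ?thesis
          using \<Phi>'_diff[of "frag_of p" "frag_of q" i] pq \<Phi>'_closed[of "frag_of p - frag_of q" i] \<Phi>'_closed[of "frag_of q" i]
          by (simp add: N'.add.l_cancel_one)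
      qed
      show ?thesis
        using that unfolding tensor_relations_def
        by (auto intro!: split split2 simp: \<Phi>' c c_add c_smult N'.smult_l_distr N'.smult_r_distr N'.smult_assoc1
            M.R.m_comm simp flip: N'.smult_assoc1)
    qed
    show ?thesis
      using that unfolding tensor_kernel_def
    proof induction
      case one
      then show ?case by (simp add: \<Phi>'_zero)
    next
      case (incl h)
      then show ?case by (rule relz)
    next
      case (inv h)
      have h: "Poly_Mapping.keys h \<subseteq> carrier M \<times> carrier N'"
        using sub[of h] generate.incl[OF inv, of ?F'] by (simp add: tensor_kernel_def)
      then show ?case using \<Phi>'_diff[of 0 h i] relz[OF inv] \<Phi>'_zero[of i] \<Phi>'_closed[of "-h" i] by simp
    next
      case (eng a b)
      then show ?case using sub[of a] sub[of b] by (simp add: tensor_kernel_def \<Phi>'_add)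
    qed
  qed

  define fs :: "('m \<times> 'n \<Rightarrow>\<^sub>0 int) => ('m \<times> 'n \<Rightarrow>\<^sub>0 int)" where "fs = frag_extend (%(x, y). frag_of (x, f y))"
  have fs_keys: "Poly_Mapping.keys (fs a) \<subseteq> carrier M \<times> carrier N'" if "Poly_Mapping.keys a \<subseteq> carrier M \<times> carrier N" for a
    using that
  proof (induction rule: frag_induction)
    case (one x)
    then show ?case using f_closed by (auto simp: fs_def)
  next
    case (diff a b)
    then show ?case using keys_diff[of "fs a" "fs b"] by (auto simp: fs_def frag_extend_diff)
  qed (simp add: fs_def)
  \<comment> \<open>Naturality of the coordinates in the second factor; with injectivity of
    \<open>f\<close> this detects the kernel.\<close>
  have fs_\<Phi>: "\<Phi>' i (fs a) = f (\<Phi> i a)" if "Poly_Mapping.keys a \<subseteq> carrier M \<times> carrier N" for i a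
  proof -
    have "Poly_Mapping.keys a \<subseteq> carrier M \<times> carrier N & \<Phi>' i (fs a) = f (\<Phi> i a)"
      using that
    proof (induction rule: frag_induction)
      case zero
      show ?case by (simp add: fs_def \<Phi>_zero \<Phi>'_zero f_zero)
    next
      case (one x)
      then show ?case using f_closed c by (auto simp: fs_def \<Phi> \<Phi>' f_smult)
    next
      case (diff a b)
      have k: "Poly_Mapping.keys (a - b) \<subseteq> carrier M \<times> carrier N" using keys_diff[of a b] diff by auto
      have "\<Phi>' i (fs (a - b)) \<oplus>\<^bsub>N'\<^esub> \<Phi>' i (fs b) = \<Phi>' i (fs a)"
        using \<Phi>'_diff[of "fs a" "fs b" i] fs_keys diff by (simp add: fs_def frag_extend_diff)
      moreover have "f (\<Phi> i (a - b)) \<oplus>\<^bsub>N'\<^esub> f (\<Phi> i b) = f (\<Phi> i a)"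
        using \<Phi>_diff[of a b i] f_add[of "\<Phi> i (a - b)" "\<Phi> i b"] \<Phi>_closed k diff by simp
      ultimately have "\<Phi>' i (fs (a - b)) \<oplus>\<^bsub>N'\<^esub> f (\<Phi> i b) = f (\<Phi> i (a - b)) \<oplus>\<^bsub>N'\<^esub> f (\<Phi> i b)"
        using diff by simp
      then have "\<Phi>' i (fs (a - b)) = f (\<Phi> i (a - b))"
        using fs_keys[OF k] \<Phi>'_closed \<Phi>_closed[OF k] \<Phi>_closed[of b] diff f_closed by (simp add: N'.add.right_cancel)
      then show ?case using k by simp
    qed
    then show ?thesis by blast
  qed

  \<comment> \<open>Modulo the relations every tensor is the sum of its coordinates placed at the
    \<open>e i\<close>. On a generator this is the expansion of its first factor; differences
    require a common finite index set, which costs only terms with second entry zero.\<close>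
  have expansion: "\<exists>A. finite A & (\<forall>i. i \<notin> A --> \<Phi> i a = \<zero>\<^bsub>N\<^esub>) & a - (\<Sum>i\<in>A. frag_of (e i, \<Phi> i a)) \<in> ?K"
    if "Poly_Mapping.keys a \<subseteq> carrier M \<times> carrier N" for a
  proof -
    have "Poly_Mapping.keys a \<subseteq> carrier M \<times> carrier N &
       (\<exists>A. finite A & (\<forall>i. i \<notin> A --> \<Phi> i a = \<zero>\<^bsub>N\<^esub>) & a - (\<Sum>i\<in>A. frag_of (e i, \<Phi> i a)) \<in> ?K)"
      using that
    proof (induction rule: frag_induction)
      case zero
      then show ?case by (auto simp: \<Phi>_zero K0 intro!: exI[of _ "{}"])
    next
      case (one z)
      then obtain x n where z: "z = (x, n)" "x \<in> carrier M" "n \<in> carrier N" by auto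
      obtain A where A: "finite A" "!!i. i \<notin> A ==> c i x = \<zero>\<^bsub>R\<^esub>" "x = finsum M (%i. c i x \<odot>\<^bsub>M\<^esub> e i) A"
        using expand[OF z(2)] by blast
      have cx: "c i x \<in> carrier R" for i using c z by blast
      have "finite B ==> frag_of (finsum M (%i. c i x \<odot>\<^bsub>M\<^esub> e i) B, n) - (\<Sum>i\<in>B. frag_of (e i, c i x \<odot>\<^bsub>N\<^esub> n)) \<in> ?K" for B
      proof (induction rule: finite_induct)
        case empty
        then show ?case using zero_left z by simp
      next
        case (insert j B)
        let ?s = "finsum M (%i. c i x \<odot>\<^bsub>M\<^esub> e i) B"
        have s: "?s \<in> carrier M" using cx e by (intro M.finsum_closed) auto
        have eq: "finsum M (%i. c i x \<odot>\<^bsub>M\<^esub> e i) (insert j B) = c j x \<odot>\<^bsub>M\<^esub> e j \<oplus>\<^bsub>M\<^esub> ?s"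
          using insert.hyps cx e by (intro M.finsum_insert) auto
        have "(frag_of (c j x \<odot>\<^bsub>M\<^esub> e j \<oplus>\<^bsub>M\<^esub> ?s, n) - frag_of (c j x \<odot>\<^bsub>M\<^esub> e j, n) - frag_of (?s, n))
            + ((frag_of (c j x \<odot>\<^bsub>M\<^esub> e j, n) - frag_of (e j, c j x \<odot>\<^bsub>N\<^esub> n))
            + (frag_of (?s, n) - (\<Sum>i\<in>B. frag_of (e i, c i x \<odot>\<^bsub>N\<^esub> n)))) \<in> ?K"
          by (intro K_add rel1 rel3 insert.IH s cx e z(3) M.smult_closed)
        then show ?case using insert.hyps by (simp add: eq algebra_simps)
      qed
      from this[OF A(1)] have "frag_of z - (\<Sum>i\<in>A. frag_of (e i, \<Phi> i (frag_of z))) \<in> ?K"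
        using z A(3) by (simp add: \<Phi>)
      moreover have "\<Phi> i (frag_of z) = \<zero>\<^bsub>N\<^esub>" if "i \<notin> A" for i
        using A(2)[OF that] z by (simp add: \<Phi>)
      ultimately show ?case using A(1) one by auto
    next
      case (diff a b)
      then obtain A B where A: "finite A" "!!i. i \<notin> A ==> \<Phi> i a = \<zero>\<^bsub>N\<^esub>" "a - (\<Sum>i\<in>A. frag_of (e i, \<Phi> i a)) \<in> ?K"
        and B: "finite B" "!!i. i \<notin> B ==> \<Phi> i b = \<zero>\<^bsub>N\<^esub>" "b - (\<Sum>i\<in>B. frag_of (e i, \<Phi> i b)) \<in> ?K" by blast
      have ka: "Poly_Mapping.keys a \<subseteq> carrier M \<times> carrier N" and kb: "Poly_Mapping.keys b \<subseteq> carrier M \<times> carrier N"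
        using diff by auto
      have kab: "Poly_Mapping.keys (a - b) \<subseteq> carrier M \<times> carrier N" using keys_diff[of a b] ka kb by auto
      let ?C = "A \<union> B"
      have enlarge: "g - (\<Sum>i\<in>?C. frag_of (e i, \<Phi> i g)) \<in> ?K"
        if "D \<subseteq> ?C" "!!i. i \<notin> D ==> \<Phi> i g = \<zero>\<^bsub>N\<^esub>" "g - (\<Sum>i\<in>D. frag_of (e i, \<Phi> i g)) \<in> ?K" for g D
      proof -
        have "(\<Sum>i\<in>?C. frag_of (e i, \<Phi> i g)) = (\<Sum>i\<in>D. frag_of (e i, \<Phi> i g)) + (\<Sum>i\<in>?C - D. frag_of (e i, \<Phi> i g))"
          using that(1) A(1) B(1) by (simp add: sum.subset_diff add.commute)
        moreover have "(\<Sum>i\<in>?C - D. frag_of (e i, \<Phi> i g)) \<in> ?K"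
          using that(2) e zero_right by (intro K_sum) auto
        from K_diff[OF that(3) this] have "g - (\<Sum>i\<in>D. frag_of (e i, \<Phi> i g)) - (\<Sum>i\<in>?C - D. frag_of (e i, \<Phi> i g)) \<in> ?K" .
        ultimately show ?thesis by (simp add: diff_diff_eq)
      qed
      have ec: "(\<Sum>i\<in>?C. frag_of (e i, \<Phi> i a) - frag_of (e i, \<Phi> i (a - b)) - frag_of (e i, \<Phi> i b)) \<in> ?K"
      proof (rule K_sum)
        fix i
        show "frag_of (e i, \<Phi> i a) - frag_of (e i, \<Phi> i (a - b)) - frag_of (e i, \<Phi> i b) \<in> ?K"
          using rel2[OF e \<Phi>_closed[OF kab, of i] \<Phi>_closed[OF kb, of i], of i] by (simp add: \<Phi>_diff ka kb)
      qed
      have alg: "a - sa - (b - sb) + (sa - sd - sb) = a - b - sd" for sa sb sd :: "('m \<times> 'n) \<Rightarrow>\<^sub>0 int"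
        by (simp add: algebra_simps)
      have ea: "a - (\<Sum>i\<in>?C. frag_of (e i, \<Phi> i a)) \<in> ?K" by (rule enlarge[OF _ A(2,3)]) auto
      have eb: "b - (\<Sum>i\<in>?C. frag_of (e i, \<Phi> i b)) \<in> ?K" by (rule enlarge[OF _ B(2,3)]) auto
      have "(a - (\<Sum>i\<in>?C. frag_of (e i, \<Phi> i a))) - (b - (\<Sum>i\<in>?C. frag_of (e i, \<Phi> i b)))
          + (\<Sum>i\<in>?C. frag_of (e i, \<Phi> i a) - frag_of (e i, \<Phi> i (a - b)) - frag_of (e i, \<Phi> i b)) \<in> ?K"
        by (rule K_add[OF K_diff[OF ea eb] ec])
      then have "(a - b) - (\<Sum>i\<in>?C. frag_of (e i, \<Phi> i (a - b))) \<in> ?K"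
        by (simp only: sum_subtractf alg)
      moreover have "\<Phi> i (a - b) = \<zero>\<^bsub>N\<^esub>" if "i \<notin> ?C" for i
        using \<Phi>_diff[OF ka kb, of i] A(2)[of i] B(2)[of i] that \<Phi>_closed[OF kab, of i] by simp
      ultimately show ?case using kab A(1) B(1) by blast
    qed
    then show ?thesis by blast
  qed

  have kernel: "a \<in> ?K" if a: "Poly_Mapping.keys a \<subseteq> carrier M \<times> carrier N" and fa: "fs a \<in> ?K'" for a
  proof -
    have 0: "\<Phi> i a = \<zero>\<^bsub>N\<^esub>" for i
    proof -
      have "f (\<Phi> i a) = f \<zero>\<^bsub>N\<^esub>" using fs_\<Phi>[OF a, of i] \<Phi>'_kernel[OF fa, of i] f_zero by simp
      then show ?thesis using inj_onD[OF inj] \<Phi>_closed[OF a] by auto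
    qed
    obtain A where "a - (\<Sum>i\<in>A. frag_of (e i, \<Phi> i a)) \<in> ?K" using expansion[OF a] by blast
    moreover have "(\<Sum>i\<in>A. frag_of (e i, \<Phi> i a)) \<in> ?K" using e by (intro K_sum) (simp add: 0 zero_right)
    ultimately show ?thesis using K_add by fastforce
  qed

  have coset: "z \<in> H #>\<^bsub>free_Abelian_group S\<^esub> x \<longleftrightarrow> (\<exists>k\<in>H. z = k + x)" for H S and x z :: "'z \<Rightarrow>\<^sub>0 int"
    by (auto simp: r_coset_def)
  show "inj_on (tensor_map R M N' f) (carrier (tensor_product R M N))"
  proof (rule inj_onI)
    fix C1 C2
    assume C1: "C1 \<in> carrier (tensor_product R M N)" and C2: "C2 \<in> carrier (tensor_product R M N)"
      and eq: "tensor_map R M N' f C1 = tensor_map R M N' f C2"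
    obtain x1 x2 where x: "x1 \<in> carrier ?F" "C1 = ?K #>\<^bsub>?F\<^esub> x1" "x2 \<in> carrier ?F" "C2 = ?K #>\<^bsub>?F\<^esub> x2"
      using C1 C2 by (auto simp: tensor_product_def FactGroup_def RCOSETS_def)
    have "x1 \<in> C1" unfolding x(2) coset using K0 by (intro bexI[of _ 0]) auto
    moreover have "fs x1 \<in> ?K' #>\<^bsub>?F'\<^esub> fs x1"
      unfolding coset using subgroup.one_closed[OF K'] by (intro bexI[of _ 0]) auto
    ultimately have "fs x1 \<in> tensor_map R M N' f C1" unfolding tensor_map_def fs_def by blast
    then obtain y where y: "y \<in> C2" "fs x1 \<in> ?K' #>\<^bsub>?F'\<^esub> fs y"
      unfolding eq unfolding tensor_map_def fs_def by blast
    obtain k where k: "k \<in> ?K" "y = k + x2" using y(1) unfolding x(4) coset by blast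
    obtain k' where k': "k' \<in> ?K'" "fs x1 = k' + fs y" using y(2) unfolding coset by blast
    have ky: "Poly_Mapping.keys y \<subseteq> carrier M \<times> carrier N"
      using k(2) subsetD[OF subgroup.subset[OF K] k(1)] x(3) keys_add[of k x2] by auto
    have "fs (x1 - y) = k'" using k'(2) by (simp add: fs_def frag_extend_diff)
    then have "x1 - y \<in> ?K"
      using kernel[of "x1 - y"] k'(1) x(1) ky keys_diff[of x1 y] by auto
    then have d: "x1 - x2 \<in> ?K" using K_add[OF _ k(1), of "x1 - y"] k(2) by simp
    show "C1 = C2"
    proof (intro Set.set_eqI iffI)
      fix z assume "z \<in> C1"
      then obtain j where "j \<in> ?K" "z = j + x1" unfolding x(2) coset by blast
      then show "z \<in> C2" unfolding x(4) coset using K_add[OF _ d, of j] by (intro bexI[of _ "j + (x1 - x2)"]) auto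
    next
      fix z assume "z \<in> C2"
      then obtain j where "j \<in> ?K" "z = j + x2" unfolding x(4) coset by blast
      then show "z \<in> C1" unfolding x(2) coset using K_diff[OF _ d, of j] by (intro bexI[of _ "j - (x1 - x2)"]) auto
    qed
  qed
qed

section \<open>Affine quotients as varieties\<close>

lemma invariant_funs_compose:
  "f \<in> invariant_funs H act ==> f \<in> poly_funs mat_coords"
  by (simp add: invariant_funs_def mat_space_def)

lemma invariant_funs_const: "(%_. c) \<in> invariant_funs H act"
  by (simp add: invariant_funs_def mat_space_def poly_funs.const)

lemma invariant_funs_add:
  "f \<in> invariant_funs H act ==> g \<in> invariant_funs H act ==> (%w. f w + g w) \<in> invariant_funs H act"
  by (simp add: invariant_funs_def mat_space_def poly_funs.add)

lemma invariant_funs_mult: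
  "f \<in> invariant_funs H act ==> g \<in> invariant_funs H act ==> (%w. f w * g w) \<in> invariant_funs H act"
  by (simp add: invariant_funs_def mat_space_def poly_funs.mult)

lemma quotient_map_apply: "f \<in> invariant_funs H act ==> aff_quotient_map H act w f = f w"
  by (simp add: aff_quotient_map_def)

lemma quotient_map_point: "aff_quotient_map H act w \<in> points (affine_quotient H act)"
  by (auto simp: affine_quotient_def algebra_points_def aff_quotient_map_def
      invariant_funs_const invariant_funs_add invariant_funs_mult)

lemma quotient_map_eq_iff:
  "aff_quotient_map H act w = aff_quotient_map H act w' \<longleftrightarrow> (\<forall>f\<in>invariant_funs H act. f w = f w')"
  unfolding aff_quotient_map_def restrict_def by (auto simp: fun_eq_iff)

lemma multiplicative_affine_quotient: "multiplicative_variety (affine_quotient H act)"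
  unfolding multiplicative_variety_def
proof (intro conjI ballI)
  fix F G assume "F \<in> regular (affine_quotient H act)" "G \<in> regular (affine_quotient H act)"
  then obtain f g where fg: "F = (%\<xi>. \<xi> f)" "f \<in> invariant_funs H act" "G = (%\<xi>. \<xi> g)" "g \<in> invariant_funs H act"
    by (auto simp: affine_quotient_def)
  then show "\<exists>h\<in>regular (affine_quotient H act). \<forall>x\<in>points (affine_quotient H act). h x = F x * G x"
    by (intro bexI[of _ "%\<xi>. \<xi> (%w. f w * g w)"])
       (auto simp: affine_quotient_def algebra_points_def intro: invariant_funs_mult)
next
  show "\<exists>h\<in>regular (affine_quotient H act). \<forall>x\<in>points (affine_quotient H act). h x = 1"
    by (intro bexI[of _ "%\<xi>. \<xi> (%_. 1)"])
       (auto simp: affine_quotient_def algebra_points_def intro: invariant_funs_const)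
qed

text \<open>The common frame for both quotients. The hypothesis \<open>inv\<close> is the first
  fundamental theorem for the map \<open>\<pi>\<close>, and \<open>surj\<close> says that every
  homomorphism from the invariants to the complex numbers is evaluation at a point of
  \<open>W\<close>; then the spectrum of the invariants is the image of
  \<open>\<pi>\<close>.\<close>

lemma quotient_iso:
  fixes \<pi> :: "complex^'m^'n => 'b" and act :: "'h => complex^'m^'n => complex^'m^'n"
  assumes inv: "invariant_funs H act = {(%w. F (\<pi> w)) | F. F \<in> poly_funs B}"
    and sep: "!!x y. (!!F. F \<in> B ==> F x = F y) ==> x = y"
    and surj: "!!\<xi>. \<xi> \<in> points (affine_quotient H act) ==> \<exists>w. \<xi> = aff_quotient_map H act w"
    and V: "points V = range \<pi>" "regular V = poly_funs B"
    and act': "!!g w. g \<in> carrier G ==> \<pi> (act' g w) = act'' g (\<pi> w)"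
    and act'': "!!g F. g \<in> carrier G ==> F \<in> poly_funs B ==> (%x. F (act'' g x)) \<in> poly_funs B"
  shows "\<exists>\<iota>. variety_iso (affine_quotient H act) V \<iota> & (\<forall>w. \<iota> (aff_quotient_map H act w) = \<pi> w) &
           equivariant G (points (affine_quotient H act)) (quotient_act H act act') act'' \<iota>"
proof -
  let ?\<phi> = "aff_quotient_map H act" and ?X = "affine_quotient H act"
  have memI: "(%w. F (\<pi> w)) \<in> invariant_funs H act" if "F \<in> poly_funs B" for F
    unfolding inv by (rule CollectI, rule exI[of _ F]) (simp add: that)
  have memE: "\<exists>F\<in>poly_funs B. f = (%w. F (\<pi> w))" if "f \<in> invariant_funs H act" for f
    using that unfolding inv by (elim CollectE exE conjE) (rule bexI)
  have eq: "?\<phi> w = ?\<phi> w' \<longleftrightarrow> \<pi> w = \<pi> w'" for w w'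
  proof
    assume *: "?\<phi> w = ?\<phi> w'"
    have "F (\<pi> w) = F (\<pi> w')" if "F \<in> poly_funs B" for F
      using *[unfolded quotient_map_eq_iff, rule_format, OF memI[OF that]] .
    then show "\<pi> w = \<pi> w'" by (intro sep) (simp add: poly_funs.coord)
  next
    assume *: "\<pi> w = \<pi> w'"
    show "?\<phi> w = ?\<phi> w'" unfolding quotient_map_eq_iff
    proof
      fix f assume "f \<in> invariant_funs H act"
      then obtain F where "f = (%w. F (\<pi> w))" using memE by meson
      then show "f w = f w'" using * by simp
    qed
  qed
  define \<iota> where "\<iota> \<xi> = \<pi> (SOME w. \<xi> = ?\<phi> w)" for \<xi>
  have \<iota>: "\<iota> (?\<phi> w) = \<pi> w" for w
  proof -
    have "?\<phi> w = ?\<phi> (SOME w'. ?\<phi> w = ?\<phi> w')" by (rule someI[of "%w'. ?\<phi> w = ?\<phi> w'"]) simp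
    then show ?thesis by (simp add: \<iota>_def eq)
  qed
  have pts: "points ?X = range ?\<phi>" using surj quotient_map_point by blast
  have bij: "bij_betw \<iota> (points ?X) (points V)"
    unfolding bij_betw_def pts V by (auto simp: inj_on_def \<iota> eq image_image)
  have inv_\<iota>: "inv_into (points ?X) \<iota> (\<pi> w) = ?\<phi> w" for w
    using bij_betw_inv_into_left[OF bij quotient_map_point, of w] by (simp add: \<iota>)
  have regI: "(%\<xi>. \<xi> (%w. F (\<pi> w))) \<in> regular ?X" if "F \<in> poly_funs B" for F
    using memI[OF that] by (auto simp: affine_quotient_def)
  have ev: "?\<phi> w (%w. F (\<pi> w)) = F (\<pi> w)" if "F \<in> poly_funs B" for F w
    by (rule quotient_map_apply[OF memI[OF that]])
  have "regular_map ?X V \<iota>"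
    unfolding regular_map_def
  proof (intro conjI ballI)
    show "\<iota> \<in> points ?X \<rightarrow> points V" using bij by (auto simp: bij_betw_def)
    fix F assume "F \<in> regular V"
    then show "\<exists>f'\<in>regular ?X. \<forall>x\<in>points ?X. F (\<iota> x) = f' x"
      unfolding V(2) by (intro bexI[OF _ regI]) (auto simp: pts \<iota> ev)
  qed
  moreover have "regular_map V ?X (inv_into (points ?X) \<iota>)"
    unfolding regular_map_def
  proof (intro conjI ballI)
    show "inv_into (points ?X) \<iota> \<in> points V \<rightarrow> points ?X"
      using bij_betw_inv_into[OF bij] by (auto simp: bij_betw_def)
    fix f assume "f \<in> regular ?X"
    then obtain g where g: "g \<in> invariant_funs H act" "f = (%\<xi>. \<xi> g)" by (auto simp: affine_quotient_def)
    obtain F where F: "F \<in> poly_funs B" "g = (%w. F (\<pi> w))" using memE[OF g(1)] by meson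
    have "f (inv_into (points ?X) \<iota> (\<pi> w)) = F (\<pi> w)" for w
      by (simp only: inv_\<iota> g(2)) (simp only: F(2) ev[OF F(1)])
    then show "\<exists>f'\<in>regular V. \<forall>x\<in>points V. f (inv_into (points ?X) \<iota> x) = f' x"
      unfolding V using F(1) by (intro bexI[of _ F]) auto
  qed
  moreover have "equivariant G (points ?X) (quotient_act H act act') act'' \<iota>"
    unfolding equivariant_def pts
  proof (intro ballI)
    fix g \<xi> assume g: "g \<in> carrier G" and "\<xi> \<in> range ?\<phi>"
    then obtain w where w: "\<xi> = ?\<phi> w" by blast
    have "quotient_act H act act' g \<xi> = ?\<phi> (act' g w)"
    proof
      fix f
      show "quotient_act H act act' g \<xi> f = ?\<phi> (act' g w) f"
      proof (cases "f \<in> invariant_funs H act")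
        case True
        then obtain F where F: "F \<in> poly_funs B" "f = (%w. F (\<pi> w))" using memE by meson
        have "f \<circ> act' g = (%w. F (act'' g (\<pi> w)))" using F act'[OF g] by (simp add: fun_eq_iff)
        then have "?\<phi> w (f \<circ> act' g) = F (act'' g (\<pi> w))"
          using ev[OF act''[OF g F(1)]] by simp
        then show ?thesis using True F act'[OF g] w
          by (simp add: quotient_act_def aff_quotient_map_def)
      qed (simp add: quotient_act_def aff_quotient_map_def)
    qed
    then show "\<iota> (quotient_act H act act' g \<xi>) = act'' g (\<iota> \<xi>)"
      by (simp add: \<iota> w act'[OF g])
  qed
  ultimately show ?thesis using bij \<iota> by (intro exI[of _ \<iota>]) (simp add: variety_iso_def)
qed

section \<open>The quotient by the orthosymplectic group\<close>

definition top_rows :: "complex^'m^('p::finite + 'r::finite) => complex^'m^'p" where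
  "top_rows w = (\<chi> i. w $ Inl i)"

definition bottom_rows :: "complex^'m^('p::finite + 'r::finite) => complex^'m^'r" where
  "bottom_rows w = (\<chi> i. w $ Inr i)"

definition join_rows :: "complex^'m^'p::finite => complex^'m^'r::finite => complex^'m^('p::finite + 'r::finite)" where
  "join_rows x y = (\<chi> i. case i of Inl a => x $ a | Inr a => y $ a)"

lemma rows_join [simp]: "top_rows (join_rows x y) = x" "bottom_rows (join_rows x y) = y"
  by (simp_all add: top_rows_def bottom_rows_def join_rows_def vec_eq_iff)

lemma join_rows_id [simp]: "join_rows (top_rows w) (bottom_rows w) = w"
  by (simp add: top_rows_def bottom_rows_def join_rows_def vec_eq_iff split: sum.split)

lemma sum_UNIV_sum:
  "(\<Sum>i\<in>(UNIV :: ('a::finite + 'b::finite) set). f i) = (\<Sum>a\<in>UNIV. f (Inl a)) + (\<Sum>b\<in>UNIV. f (Inr b))"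
  unfolding UNIV_Plus_UNIV[symmetric] by (subst sum.Plus) simp_all

lemma OSp_act_rows: "OSp_act (g, s) w = join_rows (g ** top_rows w) (s ** bottom_rows w)"
proof -
  have "(OSp_act (g, s) w) $ i $ j = (join_rows (g ** top_rows w) (s ** bottom_rows w)) $ i $ j" for i j
    by (cases i) (simp_all add: OSp_act_def blk_def join_rows_def matrix_matrix_mult_def sum_UNIV_sum
        top_rows_def bottom_rows_def)
  then show ?thesis by (simp add: vec_eq_iff)
qed

lemma gram_rows: "gram w = (transpose (top_rows w) ** top_rows w,
    transpose (bottom_rows w) ** symp_form ** bottom_rows w)"
  by (simp add: gram_def Let_def top_rows_def bottom_rows_def)

lemma OSp_carrier: "(g, s) \<in> carrier OSp_group \<longleftrightarrow> g \<in> isometries (mat 1) & s \<in> isometries symp_form"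
  by (simp add: OSp_group_def DirProd_def orth_group_def symp_group_def isometries_def)

lemma gram_OSp_act:
  fixes w :: "('m::finite, 'p::finite, 'q::finite) W_space"
  assumes "g \<in> carrier OSp_group"
  shows "gram (OSp_act g w) = gram w"
proof -
  obtain h s where g: "g = (h, s)" "transpose h ** h = mat 1" "transpose s ** symp_form ** s = symp_form"
    using assms by (cases g) (auto simp: OSp_carrier isometries_def)
  have "transpose x ** transpose h ** (h ** x) = transpose x ** x" for x :: "complex^'m^'p"
    by (metis g(2) matrix_mul_assoc matrix_mul_rid)
  moreover have "transpose y ** transpose s ** symp_form ** (s ** y) = transpose y ** symp_form ** y"
    for y :: "complex^'m^('q + 'q)"
    by (metis g(3) matrix_mul_assoc)
  ultimately show ?thesis by (simp only: g(1) OSp_act_rows gram_rows rows_join matrix_transpose_mul)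
qed

lemma rows_SL_act: "top_rows (SL_act h w) = top_rows w ** transpose h"
  "bottom_rows (SL_act h w) = bottom_rows w ** transpose h"
  by (simp_all add: top_rows_def bottom_rows_def SL_act_def vec_eq_iff matrix_matrix_mult_def)

lemma gram_SL_act: "gram (SL_act h w) = congr_act2 h (gram w)"
  by (simp add: gram_rows rows_SL_act congr_act2_def congr_act_def matrix_transpose_mul matrix_mul_assoc)

lemma symp_form_mult: "symp_form ** symp_form = - (mat 1 :: complex^('q::finite + 'q)^('q + 'q))"
proof -
  have "((symp_form :: complex^('q + 'q)^('q + 'q)) ** symp_form) $ i $ j = (- mat 1) $ i $ j" for i j :: "'q + 'q"
    by (cases i; cases j) (simp_all add: matrix_matrix_mult_def sum_UNIV_sum symp_form_def mat_def
        if_distrib[of "%x. x * _"] cong: if_cong)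
  then show ?thesis by (simp add: vec_eq_iff)
qed

lemma invertible_symp_form: "invertible (symp_form :: complex^('q::finite + 'q)^('q + 'q))"
proof -
  have "- symp_form ** symp_form = (mat 1 :: complex^('q + 'q)^('q + 'q))"
  proof -
    have "- A ** B = - (A ** B)" for A B :: "complex^('q + 'q)^('q + 'q)"
      by (simp add: matrix_matrix_mult_def vec_eq_iff sum_negf)
    then show ?thesis by (simp only: symp_form_mult minus_minus)
  qed
  then show ?thesis unfolding invertible_def using matrix_left_right_inverse by blast
qed

lemma invertible_mat_1: "invertible (mat 1 :: complex^'n^'n)"
  by (auto simp: invertible_def intro!: exI[of _ "mat 1"])

lemma eps_symmetricI:
  assumes "!!i j. b $ i $ j = e * b $ j $ i"
  shows "eps_symmetric e b"
  unfolding eps_symmetric_def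
proof (intro allI)
  fix x y
  have "bform b x y = (\<Sum>i\<in>UNIV. \<Sum>j\<in>UNIV. e * (y $ j * b $ j $ i * x $ i))"
    unfolding bform_def by (intro sum.cong refl) (subst assms, simp)
  also have "\<dots> = e * (\<Sum>i\<in>UNIV. \<Sum>j\<in>UNIV. y $ j * b $ j $ i * x $ i)"
    by (simp only: sum_distrib_left)
  also have "(\<Sum>i\<in>UNIV. \<Sum>j\<in>UNIV. y $ j * b $ j $ i * x $ i) = bform b y x"
    unfolding bform_def by (rule sum.swap)
  finally show "bform b x y = e * bform b y x" .
qed

lemma eps_symmetric_mat_1: "eps_symmetric 1 (mat 1)"
  by (rule eps_symmetricI) (simp add: mat_def)

lemma eps_symmetric_symp_form: "eps_symmetric (-1) symp_form"
  by (rule eps_symmetricI) (simp add: symp_form_def split: sum.split)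

lemma symp_gram_nth:
  "(transpose y ** symp_form ** y) $ k $ l =
     (\<Sum>a\<in>UNIV. y $ Inl a $ k * y $ Inr a $ l - y $ Inr a $ k * y $ Inl a $ l)"
  for y :: "complex^'m^('q::finite + 'q)"
proof -
  have "(transpose y ** symp_form ** y) $ k $ l = bform symp_form (column k y) (column l y)"
    by (rule congr_nth)
  also have "\<dots> = (\<Sum>a\<in>UNIV. y $ Inl a $ k * y $ Inr a $ l) + (\<Sum>a\<in>UNIV. - (y $ Inr a $ k * y $ Inl a $ l))"
    unfolding bform_def sum_UNIV_sum
    by (simp add: symp_form_def column_def if_distrib[of "%x. x * _"] if_distrib[of "%x. _ * x"] cong: if_cong)
  finally show ?thesis by (simp add: sum.distrib[symmetric])
qed

lemma transpose_mult_nth: "(transpose x ** x) $ k $ l = (\<Sum>r\<in>UNIV. x $ r $ k * x $ r $ l)"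
  for x :: "complex^'m^'p"
  by (simp add: matrix_matrix_mult_def transpose_def)

lemma Sym_spaceI: "(!!k l. B $ l $ k = B $ k $ l) ==> B \<in> Sym_space"
  unfolding Sym_space_def vec_eq_iff transpose_def by auto

lemma Alt_spaceI:
  assumes "!!k l. B $ l $ k = - B $ k $ l"
  shows "B \<in> Alt_space"
proof -
  have "transpose B $ k $ l = (- B) $ k $ l" for k l
    using assms[of k l] by (simp add: transpose_def)
  then show ?thesis unfolding Alt_space_def vec_eq_iff by blast
qed

lemma Sym_spaceD: "B \<in> Sym_space ==> B $ l $ k = B $ k $ l"
proof -
  assume "B \<in> Sym_space"
  then have "transpose B $ k $ l = B $ k $ l" by (simp add: Sym_space_def)
  then show ?thesis by (simp add: transpose_def)
qed

lemma Alt_spaceD: "B \<in> Alt_space ==> B $ l $ k = - B $ k $ l"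
proof -
  assume "B \<in> Alt_space"
  then have "transpose B $ k $ l = (- B) $ k $ l" by (simp add: Alt_space_def)
  then show ?thesis by (simp add: transpose_def)
qed

lemma gram_in: "gram w \<in> Sym_space \<times> Alt_space"
proof -
  have "transpose x ** x \<in> Sym_space" for x :: "complex^'a^'b"
    by (rule Sym_spaceI) (simp add: transpose_mult_nth mult.commute)
  moreover have "transpose y ** symp_form ** y \<in> Alt_space" for y :: "complex^'a^('c::finite + 'c)"
    by (rule Alt_spaceI, unfold symp_gram_nth sum_negf[symmetric], intro sum.cong refl)
       (simp add: mult.commute)
  ultimately show ?thesis by (simp add: gram_rows)
qed

lemma gram_symmetries: "fst (gram w) $ l $ k = fst (gram w) $ k $ l"
  "snd (gram w) $ l $ k = - snd (gram w) $ k $ l"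
  using gram_in[of w] by (auto simp: mem_Times_iff intro: Sym_spaceD Alt_spaceD)

text \<open>Stronger than \<open>full_rank w\<close>, which only concerns the stacked matrix: each
  block has independent columns, so Witt's theorem applies to each block separately.\<close>

definition full :: "complex^'m^('p::finite + 'r::finite) => bool" where
  "full w \<longleftrightarrow> full_rank (top_rows w) & full_rank (bottom_rows w)"

lemma full_OSp_conjugate:
  fixes w w' :: "('m::finite, 'p::finite, 'q::finite) W_space"
  assumes c: "2 * CARD('m) < CARD('p)" and w: "full w" "full w'" and eq: "gram w = gram w'"
  shows "\<exists>g\<in>carrier OSp_group. OSp_act g w = w'"
proof -
  obtain g where g: "g \<in> isometries (mat 1)" "g ** top_rows w = top_rows w'"
    using witt[OF invertible_mat_1 eps_symmetric_mat_1, of "top_rows w" "top_rows w'"] c w eq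
    by (auto simp: full_def gram_rows)
  obtain s where s: "s \<in> isometries symp_form" "s ** bottom_rows w = bottom_rows w'"
    using witt[OF invertible_symp_form eps_symmetric_symp_form, of "bottom_rows w" "bottom_rows w'"] w eq
    by (auto simp: full_def gram_rows)
  show ?thesis using g s by (intro bexI[of _ "(g, s)"]) (simp_all add: OSp_act_rows OSp_carrier)
qed

lemma continuous_join_rows:
  "continuous_on S (%z. join_rows (fst z) (snd z) :: complex^'m::finite^('p::finite + 'r::finite))"
proof -
  have "continuous_on S (%z. case i of Inl a => fst z $ a | Inr a => snd z $ a)"
    for i :: "'p + 'r" and S :: "((complex^'m^'p) \<times> (complex^'m^'r)) set"
    by (cases i) (auto intro!: continuous_intros)
  then show ?thesis
    unfolding join_rows_def by (intro continuous_on_vec_lambda)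
qed

lemma full_dense:
  fixes w :: "('m::finite, 'p::finite, 'q::finite) W_space"
  assumes c: "2 * CARD('m) < CARD('p)" "2 * CARD('m) < 2 * CARD('q) + 1"
  shows "w \<in> closure {w'. full w' & gram w' = gram w}"
proof -
  let ?A = "{x. full_rank x & transpose x ** mat 1 ** x = transpose (top_rows w) ** mat 1 ** top_rows w}"
  let ?B = "{y. full_rank y & transpose y ** symp_form ** y = transpose (bottom_rows w) ** symp_form ** bottom_rows w}"
  have "top_rows w \<in> closure ?A"
    by (rule full_rank_dense[OF eps_symmetric_mat_1]) (use c in simp)
  moreover have "bottom_rows w \<in> closure ?B"
    by (rule full_rank_dense[OF eps_symmetric_symp_form]) (use c in simp)
  ultimately have "(top_rows w, bottom_rows w) \<in> closure (?A \<times> ?B)"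
    by (simp add: closure_Times)
  moreover have "continuous_on (closure (?A \<times> ?B)) (%z. join_rows (fst z) (snd z))"
    by (rule continuous_join_rows)
  ultimately have "(%z. join_rows (fst z) (snd z)) (top_rows w, bottom_rows w)
      \<in> closure ((%z. join_rows (fst z) (snd z)) ` (?A \<times> ?B))"
    using continuous_image_closure_subset by blast
  then have "w \<in> closure ((%z. join_rows (fst z) (snd z)) ` (?A \<times> ?B))" by simp
  moreover have "(%z. join_rows (fst z) (snd z)) ` (?A \<times> ?B) \<subseteq> {w'. full w' & gram w' = gram w}"
    by (auto simp: full_def gram_rows)
  ultimately show ?thesis using closure_mono by blast
qed

lemma inj_of_card_le:
  "CARD('a::finite) \<le> CARD('b::finite) ==> \<exists>f :: 'a => 'b. inj f"
  using card_le_inj[of "UNIV :: 'a set" "UNIV :: 'b set"] by auto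

lemma mat_pair_coord:
  "(%z. fst z $ i $ j) \<in> poly_funs mat_pair_coords" "(%z. snd z $ i $ j) \<in> poly_funs mat_pair_coords"
  by (rule poly_funs.coord, force simp: mat_pair_coords_def mat_coords_def comp_def)+

text \<open>
  The Gram map has a polynomial section: in the coordinates \<open>x = w\<^bsub>a\<^esub> + \<i> w\<^bsub>b\<^esub>\<close>, \<open>y = w\<^bsub>a\<^esub> - \<i> w\<^bsub>b\<^esub>\<close> on \<open>V\<^sup>+\<close>
  take \<open>x = 1\<close>, \<open>y = S\<close>, and on \<open>V\<^sup>-\<close> take \<open>x = 1\<close>, \<open>y = A / 2\<close>.
\<close>

lemma gram_section:
  assumes c: "2 * CARD('m::finite) < CARD('p::finite)" "2 * CARD('m) < 2 * CARD('q::finite) + 1"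
  shows "\<exists>\<sigma> :: (complex^'m^'m) \<times> (complex^'m^'m) => ('m, 'p, 'q) W_space.
     (\<forall>z\<in>Sym_space \<times> Alt_space. gram (\<sigma> z) = z) & (\<forall>z. full (\<sigma> z)) &
     (\<forall>i j. (%z. \<sigma> z $ i $ j) \<in> poly_funs mat_pair_coords)"
proof -
  \<comment> \<open>\<open>ab\<close> selects the coordinate pairs \<open>ab (Inl i)\<close>,
    \<open>ab (Inr i)\<close> of \<open>V^+\<close>, and \<open>d\<close> selects hyperbolic planes
    of \<open>V^-\<close>, one for each column index. All other coordinates of the section are
    zero.\<close>
  have "CARD('m + 'm) \<le> CARD('p)" using c by simp
  then obtain ab :: "'m + 'm => 'p" where ab: "inj ab" using inj_of_card_le by blast
  have "CARD('m) \<le> CARD('q)" using c by simp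
  then obtain d :: "'m => 'q" where d: "inj d" using inj_of_card_le by blast
  define \<delta> :: "'m => 'm => complex" where "\<delta> i k = (if i = k then 1 else 0)" for i k
  define s1 :: "complex^'m^'m => complex^'m^'p" where
    "s1 S = (\<chi> r k. if r \<in> range ab then
        (case inv_into UNIV ab r of Inl i => (\<delta> i k + S $ i $ k) / 2 | Inr i => (\<delta> i k - S $ i $ k) / (2 * \<i>)) else 0)" for S
  define s2 :: "complex^'m^'m => complex^'m^('q + 'q)" where
    "s2 A = (\<chi> r k. case r of
        Inl a => if a \<in> range d then \<delta> (inv_into UNIV d a) k else 0
      | Inr a => if a \<in> range d then A $ inv_into UNIV d a $ k / 2 else 0)" for A
  have s1a: "s1 S $ ab (Inl i) $ k = (\<delta> i k + S $ i $ k) / 2"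
    and s1b: "s1 S $ ab (Inr i) $ k = (\<delta> i k - S $ i $ k) / (2 * \<i>)" for S i k
    by (simp_all add: s1_def inv_f_f[OF ab])
  have s2a: "s2 A $ Inl (d i) $ k = \<delta> i k" and s2b: "s2 A $ Inr (d i) $ k = A $ i $ k / 2" for A i k
    by (simp_all add: s2_def inv_f_f[OF d])
  have g1: "transpose (s1 S) ** s1 S = S" if "S \<in> Sym_space" for S
  proof -
    have sym: "S $ l $ k = S $ k $ l" for k l
      using that by (rule Sym_spaceD)
    have "(transpose (s1 S) ** s1 S) $ k $ l = S $ k $ l" for k l
    proof -
      have "(\<Sum>r\<in>UNIV. s1 S $ r $ k * s1 S $ r $ l) = (\<Sum>r\<in>range ab. s1 S $ r $ k * s1 S $ r $ l)"
        by (rule sum.mono_neutral_right) (auto simp: s1_def)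
      also have "\<dots> = (\<Sum>x\<in>UNIV. s1 S $ ab x $ k * s1 S $ ab x $ l)"
        using ab by (simp add: sum.reindex)
      also have "\<dots> = (\<Sum>i\<in>UNIV. (\<delta> i k + S $ i $ k) / 2 * ((\<delta> i l + S $ i $ l) / 2)
          + (\<delta> i k - S $ i $ k) / (2 * \<i>) * ((\<delta> i l - S $ i $ l) / (2 * \<i>)))"
        by (simp only: sum_UNIV_sum s1a s1b sum.distrib)
      also have "\<dots> = (\<Sum>i\<in>UNIV. (if i = k then S $ i $ l / 2 else 0) + (if i = l then S $ i $ k / 2 else 0))"
        by (intro sum.cong refl) (auto simp: \<delta>_def field_simps power2_eq_square[symmetric])
      also have "\<dots> = S $ k $ l"
        by (simp add: sum.distrib sym[of l k])
      finally show ?thesis by (simp add: transpose_mult_nth)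
    qed
    then show ?thesis by (simp add: vec_eq_iff)
  qed
  have g2: "transpose (s2 A) ** symp_form ** s2 A = A" if "A \<in> Alt_space" for A
  proof -
    have alt: "A $ l $ k = - A $ k $ l" for k l
      using that by (rule Alt_spaceD)
    have "(transpose (s2 A) ** symp_form ** s2 A) $ k $ l = A $ k $ l" for k l
    proof -
      have "(transpose (s2 A) ** symp_form ** s2 A) $ k $ l
          = (\<Sum>a\<in>range d. s2 A $ Inl a $ k * s2 A $ Inr a $ l - s2 A $ Inr a $ k * s2 A $ Inl a $ l)"
        unfolding symp_gram_nth by (rule sum.mono_neutral_right) (auto simp: s2_def)
      also have "\<dots> = (\<Sum>i\<in>UNIV. \<delta> i k * (A $ i $ l / 2) - A $ i $ k / 2 * \<delta> i l)"
        using d by (simp add: sum.reindex s2a s2b)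
      also have "\<dots> = (\<Sum>i\<in>UNIV. (if i = k then A $ k $ l / 2 else 0) - (if i = l then A $ l $ k / 2 else 0))"
        by (intro sum.cong refl) (simp add: \<delta>_def)
      also have "\<dots> = A $ k $ l / 2 - A $ l $ k / 2"
        by (simp add: sum_subtractf)
      finally show ?thesis using alt[of l k] by simp
    qed
    then show ?thesis by (simp add: vec_eq_iff)
  qed
  have f1: "full_rank (s1 S)" for S
    unfolding full_rank_def
  proof (intro allI impI)
    fix x assume 0: "s1 S *v x = 0"
    have "x $ i = (s1 S *v x) $ ab (Inl i) + \<i> * (s1 S *v x) $ ab (Inr i)" for i
    proof -
      have "(s1 S *v x) $ ab (Inl i) + \<i> * (s1 S *v x) $ ab (Inr i)
          = (\<Sum>k\<in>UNIV. (\<delta> i k + S $ i $ k) / 2 * x $ k + \<i> * ((\<delta> i k - S $ i $ k) / (2 * \<i>) * x $ k))"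
        by (simp only: matrix_vector_mult_def vec_lambda_beta s1a s1b sum_distrib_left sum.distrib)
      also have "\<dots> = (\<Sum>k\<in>UNIV. if i = k then x $ k else 0)"
        by (intro sum.cong refl) (auto simp: \<delta>_def field_simps)
      finally show ?thesis by simp
    qed
    then show "x = 0" using 0 by (simp add: vec_eq_iff)
  qed
  have f2: "full_rank (s2 A)" for A
    unfolding full_rank_def
  proof (intro allI impI)
    fix x assume 0: "s2 A *v x = 0"
    have "x $ i = (s2 A *v x) $ Inl (d i)" for i
      by (simp add: matrix_vector_mult_def s2a \<delta>_def if_distrib[of "%x. x * _"] cong: if_cong)
    then show "x = 0" using 0 by (simp add: vec_eq_iff)
  qed
  define \<sigma> where "\<sigma> z = join_rows (s1 (fst z)) (s2 (snd z))" for z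
  have p1: "(%z. s1 (fst z) $ r $ k) \<in> poly_funs mat_pair_coords" for r k
  proof (cases "r \<in> range ab")
    case True
    have "(%z. (\<delta> i k + fst z $ i $ k) / 2) \<in> poly_funs mat_pair_coords"
      "(%z. (\<delta> i k - fst z $ i $ k) / (2 * \<i>)) \<in> poly_funs mat_pair_coords" for i
      by (intro poly_funs_divide poly_funs.add poly_funs_diff poly_funs.const mat_pair_coord)+
    then show ?thesis using True by (cases "inv_into UNIV ab r") (simp_all add: s1_def)
  next
    case False
    then show ?thesis by (simp add: s1_def poly_funs.const)
  qed
  have p2: "(%z. s2 (snd z) $ r $ k) \<in> poly_funs mat_pair_coords" for r k
  proof (cases r)
    case (Inr a)
    then show ?thesis
      by (cases "a \<in> range d") (simp_all add: s2_def poly_funs.const poly_funs_divide mat_pair_coord)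
  qed (simp add: s2_def poly_funs.const)
  have \<sigma>_poly: "(%z. \<sigma> z $ i $ j) \<in> poly_funs mat_pair_coords" for i j
    using p1 p2 by (cases i) (simp_all add: \<sigma>_def join_rows_def)
  have \<sigma>_gram: "gram (\<sigma> z) = z" if "z \<in> Sym_space \<times> Alt_space" for z
    using g1[of "fst z"] g2[of "snd z"] that by (simp add: gram_rows \<sigma>_def mem_Times_iff)
  have \<sigma>_full: "full (\<sigma> z)" for z by (simp add: full_def \<sigma>_def f1 f2)
  show ?thesis by (intro exI[of _ \<sigma>] conjI ballI allI \<sigma>_gram \<sigma>_full \<sigma>_poly)
qed

lemma gram_poly:
  "(%w. fst (gram w) $ i $ j) \<in> poly_funs mat_coords" "(%w. snd (gram w) $ i $ j) \<in> poly_funs mat_coords"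
  unfolding gram_rows fst_conv snd_conv transpose_mult_nth symp_gram_nth
  by (simp_all add: top_rows_def bottom_rows_def)
     (intro poly_funs_sum poly_funs_diff poly_funs.mult mat_coord)+

lemma poly_funs_compose_pair:
  assumes "f \<in> poly_funs mat_pair_coords" and "!!i j. (%x. fst (h x) $ i $ j) \<in> poly_funs C"
    and "!!i j. (%x. snd (h x) $ i $ j) \<in> poly_funs C"
  shows "(%x. f (h x)) \<in> poly_funs C"
  by (rule poly_funs_compose[OF assms(1)]) (auto simp: mat_pair_coords_def mat_coords_def assms(2,3))

text \<open>First fundamental theorem for \<open>G\<close>. Full points of a fibre of
  \<open>gram\<close> are conjugate to the point of the section and the remaining points are limits
  of full ones, so an invariant \<open>f\<close> satisfies
  \<open>f w = f (\<sigma> (gram w))\<close>. As \<open>\<sigma>\<close> is polynomial, so is the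
  function of the Gram matrices obtained in this way.\<close>

lemma OSp_invariants:
  fixes actG :: "_ => ('m::finite, 'p::finite, 'q::finite) W_space => ('m, 'p, 'q) W_space"
  assumes c: "2 * CARD('m) < CARD('p)" "2 * CARD('m) < 2 * CARD('q) + 1" and actG: "actG = OSp_act"
  shows "invariant_funs OSp_group actG = {(%w. F (gram w)) | F. F \<in> poly_funs mat_pair_coords}"
proof (intro Set.set_eqI iffI)
  fix f assume f: "f \<in> invariant_funs OSp_group actG"
  obtain \<sigma> :: "_ => ('m, 'p, 'q) W_space" where \<sigma>: "!!z. z \<in> Sym_space \<times> Alt_space ==> gram (\<sigma> z) = z"
    "!!z. full (\<sigma> z)" "!!i j. (%z. \<sigma> z $ i $ j) \<in> poly_funs mat_pair_coords"
    using gram_section[OF c] by blast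
  have poly: "f \<in> poly_funs mat_coords" using f by (rule invariant_funs_compose)
  have "f w = f (\<sigma> (gram w))" for w
  proof (rule continuous_zero_on_closure[OF mat_poly_continuous[OF poly] full_dense[OF c]])
    fix w' :: "('m, 'p, 'q) W_space" assume "w' \<in> {w'. full w' & gram w' = gram w}"
    then have "full w'" "gram w' = gram (\<sigma> (gram w))" using \<sigma>(1)[OF gram_in, of w] by simp_all
    then obtain g where g: "g \<in> carrier OSp_group" "OSp_act g w' = \<sigma> (gram w)"
      using full_OSp_conjugate[OF c(1) _ \<sigma>(2)] by blast
    have "f (OSp_act g w') = f w'" using f g(1) by (simp add: invariant_funs_def actG)
    then show "f w' = f (\<sigma> (gram w))" using g(2) by simp
  qed
  moreover have "(%z. f (\<sigma> z)) \<in> poly_funs mat_pair_coords"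
    by (rule poly_funs_compose_mat[OF poly \<sigma>(3)])
  ultimately show "f \<in> {(%w. F (gram w)) | F. F \<in> poly_funs mat_pair_coords}"
    by (intro CollectI exI[of _ "%z. f (\<sigma> z)"]) auto
next
  fix f assume "f \<in> {(%w :: ('m, 'p, 'q) W_space. F (gram w)) | F. F \<in> poly_funs mat_pair_coords}"
  then obtain F where F: "F \<in> poly_funs mat_pair_coords" "f = (%w. F (gram w))" by blast
  then show "f \<in> invariant_funs OSp_group actG"
    using poly_funs_compose_pair[OF F(1) gram_poly]
    by (simp add: invariant_funs_def mat_space_def actG gram_OSp_act)
qed

lemma algebra_points_eval:
  assumes \<xi>: "\<xi> \<in> points (affine_quotient H act)" and F: "F \<in> poly_funs B"
    and inv: "!!F. F \<in> poly_funs B ==> (%w. F (\<pi> w)) \<in> invariant_funs H act"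
    and z: "!!F. F \<in> B ==> \<xi> (%w. F (\<pi> w)) = F z"
  shows "\<xi> (%w. F (\<pi> w)) = F z"
  using F
proof induction
  case (const c)
  then show ?case using \<xi> by (simp add: affine_quotient_def algebra_points_def)
next
  case (add f g)
  then show ?case using \<xi> inv by (simp add: affine_quotient_def algebra_points_def)
next
  case (mult f g)
  then show ?case using \<xi> inv by (simp add: affine_quotient_def algebra_points_def)
qed (rule z)

lemma OSp_quotient_iso:
  assumes c: "2 * CARD('m::finite) < CARD('p::finite)" "2 * CARD('m) < 2 * CARD('q::finite) + 1"
  defines "actG \<equiv> OSp_act :: _ => ('m, 'p, 'q) W_space => ('m, 'p, 'q) W_space"
  shows "\<exists>\<iota>. variety_iso (affine_quotient OSp_group actG) Sym_Alt_variety \<iota> &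
           (\<forall>w. \<iota> (aff_quotient_map OSp_group actG w) = gram w) &
           equivariant SL_group (points (affine_quotient OSp_group actG))
             (quotient_act OSp_group actG SL_act) congr_act2 \<iota>"
proof (rule quotient_iso[where B = mat_pair_coords])
  have inv: "invariant_funs OSp_group actG = {(%w. F (gram w)) | F. F \<in> poly_funs mat_pair_coords}"
    using OSp_invariants[OF c] by (simp add: actG_def)
  then show "invariant_funs OSp_group actG = {(%w. F (gram w)) | F. F \<in> poly_funs mat_pair_coords}" .
  obtain \<sigma> :: "_ => ('m, 'p, 'q) W_space" where \<sigma>: "!!z. z \<in> Sym_space \<times> Alt_space ==> gram (\<sigma> z) = z"
    using gram_section[OF c] by blast
  show "x = y" if "!!F. F \<in> mat_pair_coords ==> F x = F y" for x y :: "(complex^'m^'m) \<times> (complex^'m^'m)"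
  proof -
    have "fst x $ i $ j = fst y $ i $ j" "snd x $ i $ j = snd y $ i $ j" for i j
      using that[of "(%A. A $ i $ j) \<circ> fst"] that[of "(%A. A $ i $ j) \<circ> snd"]
      by (auto simp: mat_pair_coords_def mat_coords_def)
    then show ?thesis by (simp add: prod_eq_iff vec_eq_iff)
  qed
  show "points Sym_Alt_variety = range (gram :: ('m, 'p, 'q) W_space => _)"
  proof (rule subset_antisym)
    show "points Sym_Alt_variety \<subseteq> range (gram :: ('m, 'p, 'q) W_space => _)"
    proof
      fix z :: "(complex^'m^'m) \<times> (complex^'m^'m)" assume "z \<in> points Sym_Alt_variety"
      then have "z = gram (\<sigma> z)" using \<sigma> by (simp add: Sym_Alt_variety_def)
      then show "z \<in> range (gram :: ('m, 'p, 'q) W_space => _)" by (rule range_eqI)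
    qed
    show "range (gram :: ('m, 'p, 'q) W_space => _) \<subseteq> points Sym_Alt_variety"
      by (simp add: Sym_Alt_variety_def image_subset_iff gram_in)
  qed
  show "regular Sym_Alt_variety = poly_funs mat_pair_coords" by (simp add: Sym_Alt_variety_def)
  show "gram (SL_act g w) = congr_act2 g (gram w)" for g and w :: "('m, 'p, 'q) W_space"
    by (rule gram_SL_act)
  show "(%x. F (congr_act2 g x)) \<in> poly_funs mat_pair_coords" if "F \<in> poly_funs mat_pair_coords"
    for g :: "complex^'m^'m" and F
  proof (rule poly_funs_compose_pair[OF that])
    have *: "(%x. congr_act g (h x) $ i $ j) \<in> poly_funs mat_pair_coords"
      if "!!i j. (%x. h x $ i $ j) \<in> poly_funs mat_pair_coords"
      for i j and h :: "(complex^'m^'m) \<times> (complex^'m^'m) => complex^'m^'m"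
      unfolding congr_act_def by (intro poly_funs_mat_mult that poly_funs.const)
    show "(%x. fst (congr_act2 g x) $ i $ j) \<in> poly_funs mat_pair_coords"
      "(%x. snd (congr_act2 g x) $ i $ j) \<in> poly_funs mat_pair_coords" for i j
      unfolding congr_act2_def case_prod_beta fst_conv snd_conv by (intro * mat_pair_coord)+
  qed
  show "\<exists>w. \<xi> = aff_quotient_map OSp_group actG w" if \<xi>: "\<xi> \<in> points (affine_quotient OSp_group actG)" for \<xi>
  proof -
    \<comment> \<open>The only possible image point of \<open>\<xi>\<close>: its coordinates are the
      values of \<open>\<xi>\<close> on the Gram entries. The symmetries of these entries are
      respected by \<open>\<xi>\<close>, so the section provides a preimage in
      \<open>W\<close>.\<close>
    define z where "z = ((\<chi> k l. \<xi> (%w. fst (gram w) $ k $ l)), (\<chi> k l. \<xi> (%w. snd (gram w) $ k $ l)))"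
    have invI: "(%w. F (gram w)) \<in> invariant_funs OSp_group actG" if "F \<in> poly_funs mat_pair_coords" for F
      unfolding inv by (rule CollectI, rule exI[of _ F]) (simp add: that)
    have ev: "\<xi> (%w. F (gram w)) = F z" if "F \<in> poly_funs mat_pair_coords" for F
      by (rule algebra_points_eval[OF \<xi> that invI]) (auto simp: mat_pair_coords_def mat_coords_def z_def)
    have "z \<in> Sym_space \<times> Alt_space"
    proof -
      have fst_eq: "(%w :: ('m, 'p, 'q) W_space. fst (gram w) $ l $ k) = (%w. fst (gram w) $ k $ l)"
        and snd_eq: "(%w :: ('m, 'p, 'q) W_space. snd (gram w) $ l $ k) = (%w. - snd (gram w) $ k $ l)" for k l
        by (rule ext, rule gram_symmetries)+
      have z1: "fst z $ l $ k = fst z $ k $ l" for k l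
        using ev[OF mat_pair_coord(1)[of l k]] ev[OF mat_pair_coord(1)[of k l]]
        unfolding fst_eq[of l k] by simp
      have z2: "snd z $ l $ k = - snd z $ k $ l" for k l
        using ev[OF mat_pair_coord(2)[of l k]] ev[OF poly_funs_uminus[OF mat_pair_coord(2)[of k l]]]
        unfolding snd_eq[of l k] by simp
      have "fst z \<in> Sym_space" "snd z \<in> Alt_space"
        by (rule Sym_spaceI[OF z1]) (rule Alt_spaceI[OF z2])
      then show ?thesis by (simp add: mem_Times_iff)
    qed
    then have "gram (\<sigma> z) = z" by (rule \<sigma>)
    moreover have "\<xi> \<in> extensional (invariant_funs OSp_group actG)"
      using \<xi> by (simp add: affine_quotient_def algebra_points_def)
    ultimately have "\<xi> f = aff_quotient_map OSp_group actG (\<sigma> z) f" for f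
    proof (cases "f \<in> invariant_funs OSp_group actG")
      case True
      then obtain F where F: "F \<in> poly_funs mat_pair_coords" "f = (%w. F (gram w))"
        unfolding inv by (elim CollectE exE conjE)
      show ?thesis
        using ev[OF F(1)] \<open>gram (\<sigma> z) = z\<close> by (simp add: quotient_map_apply[OF True]) (simp add: F(2))
    next
      case False
      then show ?thesis
        using \<open>\<xi> \<in> extensional _\<close> by (simp add: extensional_def aff_quotient_map_def)
    qed
    then have "\<xi> = aff_quotient_map OSp_group actG (\<sigma> z)" by (rule ext)
    then show ?thesis by blast
  qed
qed

section \<open>Flatness of the Gram map and reducedness of the null fibre\<close>

lemma wspan_product:
  assumes "\<omega> v1 + \<omega> v2 < D"
  shows "(%w. u v1 w * u v2 w) \<in> wspan (mon u) (%\<mu>. (\<Sum>v\<in>UNIV. \<omega> v * \<mu> v) < (D::nat))"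
proof -
  let ?\<mu> = "%v. (if v = v1 then 1 else 0) + (if v = v2 then 1 else 0 :: nat)"
  have "mon u ?\<mu> = (%w. u v1 w * u v2 w)"
    by (rule ext) (simp only: mon_add mon_single power_one_right)
  moreover have "(\<Sum>v\<in>UNIV. \<omega> v * ?\<mu> v) < D"
    using assms by (simp add: distrib_left sum.distrib if_distrib[of "%x. _ * x"] cong: if_cong)
  ultimately show ?thesis
    using wspan_base[of "%\<mu>. (\<Sum>v\<in>UNIV. \<omega> v * \<mu> v) < D" ?\<mu> "mon u"] by simp
qed

text \<open>
  In the coordinates \<open>x\<^sub>i\<^sub>k\<close>, \<open>y\<^sub>i\<^sub>k\<close> with \<open>S\<^sub>k\<^sub>l = 1/2 \<Sum>\<^sub>i (x\<^sub>i\<^sub>k y\<^sub>i\<^sub>l + x\<^sub>i\<^sub>l y\<^sub>i\<^sub>k) + \<dots>\<close>, the weights \<open>M - 2 i k\<close> of \<open>x\<^sub>i\<^sub>k\<close>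
  and \<open>M + 2 i k - i\<^sup>2\<close> of \<open>y\<^sub>i\<^sub>k\<close> give \<open>x\<^sub>i\<^sub>k y\<^sub>i\<^sub>l\<close> the weight \<open>2 M + (l - k)\<^sup>2 - (i - (l - k))\<^sup>2\<close>, so that for
  \<open>k \<le> l\<close> the initial form is the single monomial with \<open>i = l - k\<close>.
\<close>

lemma gram_initial_pairs:
  assumes c: "2 * CARD('m::finite) < CARD('p::finite)" "2 * CARD('m) < 2 * CARD('q::finite) + 1"
  shows "\<exists>(u :: ('p + ('q + 'q)) \<times> 'm => ('m, 'p, 'q) W_space => complex) \<omega> P X Y
            (f :: ('m \<times> 'm) + ('m \<times> 'm) => ('m, 'p, 'q) W_space => complex).
     initial_pairs u \<omega> P X Y f & poly_funs (range u) = poly_funs mat_coords &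
     poly_funs (f ` P) = {(%w. F (gram w)) | F. F \<in> poly_funs mat_pair_coords} & (\<forall>s\<in>P. f s 0 = 0)"
proof -
  have "CARD('m + 'm) \<le> CARD('p)" using c by simp
  then obtain ab :: "'m + 'm => 'p" where ab: "inj ab" using inj_of_card_le by blast
  have "CARD('m) \<le> CARD('q)" using c by simp
  then obtain d :: "'m => 'q" where d: "inj d" using inj_of_card_le by blast
  define m where "m = CARD('m)"
  obtain n :: "'m => nat" where n: "bij_betw n UNIV {..<m}"
    using ex_bij_betw_finite_nat[of "UNIV :: 'm set"] by (auto simp: m_def atLeast0LessThan)
  define ix where "ix j = inv_into UNIV n j" for j
  have n_ix: "n (ix j) = j" if "j < m" for j
    using bij_betw_inv_into_right[OF n, of j] that by (simp add: ix_def)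
  have n_less: "n i < m" for i using n by (auto simp: bij_betw_def)
  have n_inj: "n i = n j \<longleftrightarrow> i = j" for i j using n by (auto simp: bij_betw_def inj_on_def)
  \<comment> \<open>These are the announced weights with \<open>M = 3 * m * m\<close>, which is
    large enough for them to be natural numbers; \<open>n\<close> numbers the indices.\<close>
  define wx where "wx i k = nat (3 * int m * int m - 2 * int (n i) * int (n k))" for i k
  define wy where "wy i k = nat (3 * int m * int m + 2 * int (n i) * int (n k) - int (n i) * int (n i))" for i k
  have prod_le: "int (n i) * int (n k) \<le> int m * int m" for i k
    using n_less[of i] n_less[of k] by (intro mult_mono) auto
  have mm: "0 \<le> int m * int m" by simp
  have wx: "int (wx i k) = 3 * int m * int m - 2 * int (n i) * int (n k)" for i k
  proof -
    have "0 \<le> 3 * int m * int m - 2 * int (n i) * int (n k)"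
      using prod_le[of i k] mm unfolding mult.assoc by linarith
    then show ?thesis by (simp add: wx_def)
  qed
  have wy: "int (wy i k) = 3 * int m * int m + 2 * int (n i) * int (n k) - int (n i) * int (n i)" for i k
  proof -
    have "0 \<le> int (n i) * int (n k)" by simp
    then have "0 \<le> 3 * int m * int m + 2 * int (n i) * int (n k) - int (n i) * int (n i)"
      using prod_le[of i i] mm unfolding mult.assoc by linarith
    then show ?thesis by (simp add: wy_def)
  qed
  define i0 where "i0 k l = ix (n l - n k)" for k l
  have n_i0: "int (n (i0 k l)) = int (n l) - int (n k)" if "n k \<le> n l" for k l
    using that n_less[of l] by (simp add: i0_def n_ix)
  have lead_value: "int (wx (i0 k l) k + wy (i0 k l) l)
      = 6 * int m * int m + (int (n l) - int (n k)) * (int (n l) - int (n k))" if "n k \<le> n l" for k l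
    by (simp add: wx wy n_i0[OF that]) (simp add: algebra_simps)
  have lt1: "wx i k + wy i l < wx (i0 k l) k + wy (i0 k l) l" if "n k \<le> n l" "i ~= i0 k l" for i k l
  proof -
    let ?x = "int (n i) - (int (n l) - int (n k))"
    have "?x ~= 0" using n_i0[OF that(1)] that(2) n_inj by force
    then have "0 < ?x * ?x" by (metis not_real_square_gt_zero zero_less_mult_iff linorder_neqE_linordered_idom)
    then have "int (wx i k + wy i l) < int (wx (i0 k l) k + wy (i0 k l) l)"
      unfolding lead_value[OF that(1)] by (simp add: wx wy algebra_simps)
    then show ?thesis by linarith
  qed
  \<comment> \<open>The terms with \<open>k\<close> and \<open>l\<close> exchanged, which occur in
    both forms. Their weight falls short of the leading one by a square that is positive for
    \<open>n k < n l\<close>.\<close>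
  have lt2: "wx i l + wy i k < wx (i0 k l) k + wy (i0 k l) l" if "n k < n l" for i k l
  proof -
    let ?x = "int (n i) + (int (n l) - int (n k))"
    have "0 < ?x" using that by simp
    then have "0 < ?x * ?x" by simp
    then have "int (wx i l + wy i k) < int (wx (i0 k l) k + wy (i0 k l) l)"
      unfolding lead_value[OF less_imp_le[OF that]] by (simp add: wx wy algebra_simps)
    then show ?thesis by linarith
  qed
  \<comment> \<open>Coordinates outside the selected pairs have weight zero, so positivity of the
    leading weight puts their products among the lower terms.\<close>
  have lt0: "0 < wx (i0 k l) k + wy (i0 k l) l" if "n k \<le> n l" for k l
  proof -
    have "0 < int m * int m" using n_less[of k] by simp
    moreover have "0 \<le> (int (n l) - int (n k)) * (int (n l) - int (n k))" by simp
    ultimately have "0 < int (wx (i0 k l) k + wy (i0 k l) l)" unfolding lead_value[OF that] by linarith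
    then show ?thesis by linarith
  qed

  define u :: "('p + ('q + 'q)) \<times> 'm => ('m, 'p, 'q) W_space => complex" where
    "u = (%(r, k) w. case r of
        Inl \<rho> => if \<rho> \<in> range ab then
            (case inv_into UNIV ab \<rho> of Inl i => w $ Inl (ab (Inl i)) $ k + \<i> * w $ Inl (ab (Inr i)) $ k
             | Inr i => w $ Inl (ab (Inl i)) $ k - \<i> * w $ Inl (ab (Inr i)) $ k)
          else w $ Inl \<rho> $ k
      | Inr \<rho> => w $ Inr \<rho> $ k)"
  define \<omega> :: "('p + ('q + 'q)) \<times> 'm => nat" where
    "\<omega> = (%(r, k). case r of
        Inl \<rho> => if \<rho> \<in> range ab then (case inv_into UNIV ab \<rho> of Inl i => wx i k | Inr i => wy i k) else 0
      | Inr (Inl a) => if a \<in> range d then wx (inv_into UNIV d a) k else 0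
      | Inr (Inr a) => if a \<in> range d then wy (inv_into UNIV d a) k else 0)"
  define x1 where "x1 i k = (Inl (ab (Inl i)) :: 'p + ('q + 'q), k)" for i and k :: 'm
  define y1 where "y1 i k = (Inl (ab (Inr i)) :: 'p + ('q + 'q), k)" for i and k :: 'm
  define x2 where "x2 i k = (Inr (Inl (d i)) :: 'p + ('q + 'q), k)" for i and k :: 'm
  define y2 where "y2 i k = (Inr (Inr (d i)) :: 'p + ('q + 'q), k)" for i and k :: 'm
  have \<omega>: "\<omega> (x1 i k) = wx i k" "\<omega> (y1 i k) = wy i k" "\<omega> (x2 i k) = wx i k" "\<omega> (y2 i k) = wy i k" for i k
    by (simp_all add: \<omega>_def x1_def y1_def x2_def y2_def inv_f_f[OF ab] inv_f_f[OF d])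
  have u1: "u (x1 i k) w = w $ Inl (ab (Inl i)) $ k + \<i> * w $ Inl (ab (Inr i)) $ k"
    "u (y1 i k) w = w $ Inl (ab (Inl i)) $ k - \<i> * w $ Inl (ab (Inr i)) $ k" for i k w
    by (simp_all add: u_def x1_def y1_def inv_f_f[OF ab])
  have u2: "u (x2 i k) w = w $ Inr (Inl (d i)) $ k" "u (y2 i k) w = w $ Inr (Inr (d i)) $ k" for i k w
    by (simp_all add: u_def x2_def y2_def)
  have u0: "u (Inl \<rho>, k) w = w $ Inl \<rho> $ k" "\<omega> (Inl \<rho>, k) = 0" if "\<rho> \<notin> range ab" for \<rho> k w
    using that by (simp_all add: u_def \<omega>_def)
  have u00: "\<omega> (Inr (Inl a), k) = 0" "\<omega> (Inr (Inr a), k) = 0" if "a \<notin> range d" for a k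
    using that by (simp_all add: \<omega>_def)
  have u02: "u (Inr \<rho>, k) w = w $ Inr \<rho> $ k" for \<rho> k w by (simp add: u_def)

  have coords: "coordinates u"
    unfolding coordinates_def
  proof
    fix c :: "('p + ('q + 'q)) \<times> 'm => complex"
    define w :: "('m, 'p, 'q) W_space" where "w = (\<chi> r k. case r of
        Inl \<rho> => if \<rho> \<in> range ab then
            (case inv_into UNIV ab \<rho> of Inl i => (c (x1 i k) + c (y1 i k)) / 2
             | Inr i => (c (x1 i k) - c (y1 i k)) / (2 * \<i>))
          else c (Inl \<rho>, k)
      | Inr \<rho> => c (Inr \<rho>, k))"
    have w: "w $ Inl (ab (Inl i)) $ k = (c (x1 i k) + c (y1 i k)) / 2"
      "w $ Inl (ab (Inr i)) $ k = (c (x1 i k) - c (y1 i k)) / (2 * \<i>)"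
      "w $ Inr \<rho> $ k = c (Inr \<rho>, k)" for i k \<rho>
      by (simp_all add: w_def inv_f_f[OF ab])
    have w0: "w $ Inl \<rho> $ k = c (Inl \<rho>, k)" if "\<rho> \<notin> range ab" for \<rho> k using that by (simp add: w_def)
    have "u v w = c v" for v
    proof (cases v)
      case (Pair r k)
      show ?thesis
      proof (cases r)
        case (Inl \<rho>)
        show ?thesis
        proof (cases "\<rho> \<in> range ab")
          case True
          then obtain z where z: "\<rho> = ab z" by blast
          show ?thesis
          proof (cases z)
            case (Inl i)
            then have "v = x1 i k" using Pair \<open>r = Inl \<rho>\<close> z by (simp add: x1_def)
            then show ?thesis by (simp add: u1 w field_simps)
          next
            case (Inr i)
            then have "v = y1 i k" using Pair \<open>r = Inl \<rho>\<close> z by (simp add: y1_def)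
            then show ?thesis by (simp add: u1 w field_simps)
          qed
        next
          case False
          then show ?thesis using Pair Inl by (simp add: u0 w0)
        qed
      next
        case (Inr \<rho>)
        then show ?thesis using Pair by (simp add: u02 w)
      qed
    qed
    then show "\<exists>w. \<forall>v. u v w = c v" by blast
  qed

  have urange: "u v \<in> poly_funs (range u)" for v by (rule poly_funs.coord) simp
  have poly_eq: "poly_funs (range u) = poly_funs mat_coords"
  proof (intro Set.set_eqI iffI)
    fix g assume g: "g \<in> poly_funs (range u)"
    have umat: "u v \<in> poly_funs mat_coords" for v
    proof (cases v)
      case (Pair r k)
      show ?thesis
      proof (cases r)
        case (Inl \<rho>)
        show ?thesis
          by (cases "\<rho> \<in> range ab"; cases "inv_into UNIV ab \<rho>")
             (simp_all add: u_def Pair Inl mat_coord poly_funs.add poly_funs_diff poly_funs_cmult)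
      next
        case (Inr \<rho>)
        then show ?thesis by (simp add: u_def Pair mat_coord)
      qed
    qed
    show "g \<in> poly_funs mat_coords"
      by (rule poly_funs_compose[OF g, of "%x. x"]) (use umat in auto)
  next
    fix g assume g: "g \<in> poly_funs (mat_coords :: (('m, 'p, 'q) W_space => complex) set)"
    have "(%w. w $ r $ k) \<in> poly_funs (range u)" for r k
    proof (cases r)
      case (Inl \<rho>)
      show ?thesis
      proof (cases "\<rho> \<in> range ab")
        case True
        then obtain z where z: "\<rho> = ab z" by blast
        show ?thesis
        proof (cases z)
          case (Inl i)
          have "(%w. (u (x1 i k) w + u (y1 i k) w) / 2) \<in> poly_funs (range u)"
            by (intro poly_funs_divide poly_funs.add urange)
          then show ?thesis using \<open>r = Inl \<rho>\<close> z Inl by (simp add: u1)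
        next
          case (Inr i)
          have "(%w. (u (x1 i k) w - u (y1 i k) w) / (2 * \<i>)) \<in> poly_funs (range u)"
            by (intro poly_funs_divide poly_funs_diff urange)
          then show ?thesis using \<open>r = Inl \<rho>\<close> z Inr by (simp add: u1)
        qed
      next
        case False
        then have "(%w. w $ r $ k) = u (r, k)" using Inl by (simp add: fun_eq_iff u0)
        then show ?thesis by (simp only: urange)
      qed
    next
      case (Inr \<rho>)
      then have "(%w. w $ r $ k) = u (r, k)" by (simp add: fun_eq_iff u02)
      then show ?thesis by (simp only: urange)
    qed
    then show "g \<in> poly_funs (range u)" by (rule poly_funs_compose_mat[OF g])
  qed

  let ?S = "%k l (w :: ('m, 'p, 'q) W_space). fst (gram w) $ k $ l"
  let ?A = "%k l (w :: ('m, 'p, 'q) W_space). snd (gram w) $ k $ l"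
  \<comment> \<open>One index for each independent entry: on and above the diagonal for the
    symmetric part, strictly above it for the alternating part.\<close>
  define P :: "(('m \<times> 'm) + ('m \<times> 'm)) set" where
    "P = {Inl (k, l) | k l. n k \<le> n l} \<union> {Inr (k, l) | k l. n k < n l}"
  \<comment> \<open>The factor 2 normalises the leading coefficient: off the diagonal the leading
    product has coefficient 1/2 in \<open>S_eq\<close>, while on the diagonal two equal products add
    up to one.\<close>
  define f :: "('m \<times> 'm) + ('m \<times> 'm) => ('m, 'p, 'q) W_space => complex" where
    "f s = (case s of Inl (k, l) => if k = l then ?S k l else (%w. 2 * ?S k l w) | Inr (k, l) => ?A k l)" for s
  define X where "X s = (case s of Inl (k, l) => x1 (i0 k l) k | Inr (k, l) => x2 (i0 k l) k)" for s
  define Y where "Y s = (case s of Inl (k, l) => y1 (i0 k l) l | Inr (k, l) => y2 (i0 k l) l)" for s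
  have inj_ab: "ab z = ab z' \<longleftrightarrow> z = z'" and inj_d: "d i = d j \<longleftrightarrow> i = j" for z z' i j
    using ab d by (auto simp: inj_def)
  have i0_eq1: "l = l'" if "i0 k l = i0 k l'" "n k \<le> n l" "n k \<le> n l'" for k l l'
    using n_i0[OF that(2)] n_i0[OF that(3)] that(1) n_inj[of l l'] by simp
  have i0_eq2: "k = k'" if "i0 k l = i0 k' l" "n k \<le> n l" "n k' \<le> n l" for k k' l
    using n_i0[OF that(2)] n_i0[OF that(3)] that(1) n_inj[of k k'] by simp
  have injX: "inj_on X P"
    by (rule inj_onI) (auto simp: P_def X_def x1_def x2_def inj_ab inj_d intro: i0_eq1)
  have injY: "inj_on Y P"
    by (rule inj_onI) (auto simp: P_def Y_def y1_def y2_def inj_ab inj_d intro: i0_eq2)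
  have disj: "X ` P \<inter> Y ` P = {}"
    by (auto simp: P_def X_def Y_def x1_def x2_def y1_def y2_def inj_ab)

  have S_eq: "?S k l w = (\<Sum>i\<in>UNIV. u (x1 i k) w * u (y1 i l) w + u (x1 i l) w * u (y1 i k) w) / 2
      + (\<Sum>\<rho>\<in>- range ab. u (Inl \<rho>, k) w * u (Inl \<rho>, l) w)" for k l w
  proof -
    have "?S k l w = (\<Sum>\<rho>\<in>UNIV. w $ Inl \<rho> $ k * w $ Inl \<rho> $ l)"
      by (simp add: gram_rows transpose_mult_nth top_rows_def)
    also have "\<dots> = (\<Sum>\<rho>\<in>range ab. w $ Inl \<rho> $ k * w $ Inl \<rho> $ l) + (\<Sum>\<rho>\<in>- range ab. w $ Inl \<rho> $ k * w $ Inl \<rho> $ l)"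
      by (subst sum.union_disjoint[symmetric]) auto
    also have "(\<Sum>\<rho>\<in>range ab. w $ Inl \<rho> $ k * w $ Inl \<rho> $ l)
        = (\<Sum>i\<in>UNIV. w $ Inl (ab (Inl i)) $ k * w $ Inl (ab (Inl i)) $ l + w $ Inl (ab (Inr i)) $ k * w $ Inl (ab (Inr i)) $ l)"
      using ab by (simp add: sum.reindex sum_UNIV_sum sum.distrib)
    also have "\<dots> = (\<Sum>i\<in>UNIV. (u (x1 i k) w * u (y1 i l) w + u (x1 i l) w * u (y1 i k) w) / 2)"
      by (intro sum.cong refl) (simp add: u1 algebra_simps)
    also have "(\<Sum>\<rho>\<in>- range ab. w $ Inl \<rho> $ k * w $ Inl \<rho> $ l) = (\<Sum>\<rho>\<in>- range ab. u (Inl \<rho>, k) w * u (Inl \<rho>, l) w)"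
      by (intro sum.cong refl) (simp add: u0)
    finally show ?thesis by (simp add: sum_divide_distrib)
  qed
  have A_eq: "?A k l w = (\<Sum>i\<in>UNIV. u (x2 i k) w * u (y2 i l) w - u (x2 i l) w * u (y2 i k) w)
      + (\<Sum>a\<in>- range d. u (Inr (Inl a), k) w * u (Inr (Inr a), l) w - u (Inr (Inl a), l) w * u (Inr (Inr a), k) w)" for k l w
  proof -
    have "?A k l w = (\<Sum>a\<in>UNIV. w $ Inr (Inl a) $ k * w $ Inr (Inr a) $ l - w $ Inr (Inl a) $ l * w $ Inr (Inr a) $ k)"
      by (simp add: gram_rows symp_gram_nth bottom_rows_def mult.commute)
    also have "\<dots> = (\<Sum>a\<in>range d. w $ Inr (Inl a) $ k * w $ Inr (Inr a) $ l - w $ Inr (Inl a) $ l * w $ Inr (Inr a) $ k)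
       + (\<Sum>a\<in>- range d. w $ Inr (Inl a) $ k * w $ Inr (Inr a) $ l - w $ Inr (Inl a) $ l * w $ Inr (Inr a) $ k)"
      by (subst sum.union_disjoint[symmetric]) auto
    finally show ?thesis using d by (simp add: sum.reindex u2 u02)
  qed

  let ?L = "%k l. wspan (mon u) (%\<mu>. (\<Sum>v\<in>UNIV. \<omega> v * \<mu> v) < wx (i0 k l) k + wy (i0 k l) l)"
  have low1: "(%w. \<Sum>i\<in>UNIV - {i0 k l}. u (xx i k) w * u (yy i l) w) \<in> ?L k l"
    if "n k \<le> n l" "!!i k. \<omega> (xx i k) = wx i k" "!!i k. \<omega> (yy i k) = wy i k" for k l xx yy
    by (intro wspan_sum wspan_product) (use lt1[OF that(1)] that(2,3) in simp)
  have low2: "(%w. \<Sum>i\<in>UNIV. u (xx i l) w * u (yy i k) w) \<in> ?L k l"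
    if "n k < n l" "!!i k. \<omega> (xx i k) = wx i k" "!!i k. \<omega> (yy i k) = wy i k" for k l xx yy
    by (intro wspan_sum wspan_product) (use lt2[OF that(1)] that(2,3) in simp)
  have low3: "(%w. \<Sum>\<rho>\<in>- range ab. u (Inl \<rho>, k) w * u (Inl \<rho>, l) w) \<in> ?L k l" if "n k \<le> n l" for k l
    by (intro wspan_sum wspan_product) (use lt0[OF that] u0(2) in simp)
  have low4: "(%w. \<Sum>a\<in>- range d. u (Inr (Inl a), k) w * u (Inr (Inr a), l) w - u (Inr (Inl a), l) w * u (Inr (Inr a), k) w) \<in> ?L k l"
    if "n k \<le> n l" for k l
    by (intro wspan_sum wspan_diff wspan_product) (use lt0[OF that] u00 in simp_all)
  have remove: "(\<Sum>i\<in>UNIV. g i) = g (i0 k l) + (\<Sum>i\<in>UNIV - {i0 k l}. g i)" for g :: "'m => complex" and k l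
    by (rule sum.remove) auto
  have lead: "(%w. f s w - u (X s) w * u (Y s) w) \<in> wspan (mon u) (%\<mu>. (\<Sum>v\<in>UNIV. \<omega> v * \<mu> v) < \<omega> (X s) + \<omega> (Y s))"
    if s: "s \<in> P" for s
  proof (cases s)
    case (Inl kl)
    then obtain k l where kl: "s = Inl (k, l)" by (cases kl) auto
    then have le: "n k \<le> n l" using s by (auto simp: P_def)
    have XY: "X s = x1 (i0 k l) k" "Y s = y1 (i0 k l) l" by (simp_all add: kl X_def Y_def)
    show ?thesis
    proof (cases "k = l")
      case True
      have "f s w - u (X s) w * u (Y s) w = (\<Sum>i\<in>UNIV - {i0 k l}. u (x1 i k) w * u (y1 i l) w)
          + (\<Sum>\<rho>\<in>- range ab. u (Inl \<rho>, k) w * u (Inl \<rho>, l) w)" for w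
        unfolding XY using True remove[of "%i. u (x1 i k) w * u (y1 i l) w" k l]
        by (simp add: f_def kl S_eq sum_distrib_left[symmetric] sum.distrib add_divide_distrib)
      then show ?thesis
        unfolding XY \<omega> using wspan_add[OF low3[OF le] low1[OF le \<omega>(1,2)]] by (simp add: XY)
    next
      case False
      then have lt: "n k < n l" using le n_inj[of k l] by simp
      have "f s w - u (X s) w * u (Y s) w = ((\<Sum>i\<in>UNIV - {i0 k l}. u (x1 i k) w * u (y1 i l) w)
          + (\<Sum>i\<in>UNIV. u (x1 i l) w * u (y1 i k) w)) + 2 * (\<Sum>\<rho>\<in>- range ab. u (Inl \<rho>, k) w * u (Inl \<rho>, l) w)" for w
        unfolding XY using False remove[of "%i. u (x1 i k) w * u (y1 i l) w" k l]
        by (simp add: f_def kl S_eq sum_distrib_left[symmetric] sum.distrib add_divide_distrib)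
      then show ?thesis
        unfolding XY \<omega>
        using wspan_add[OF wspan_cmult[OF low3[OF le], of 2] wspan_add[OF low2[OF lt \<omega>(1,2)] low1[OF le \<omega>(1,2)]]]
        by (simp add: XY)
    qed
  next
    case (Inr kl)
    then obtain k l where kl: "s = Inr (k, l)" by (cases kl) auto
    then have lt: "n k < n l" using s by (auto simp: P_def)
    then have le: "n k \<le> n l" by simp
    have XY: "X s = x2 (i0 k l) k" "Y s = y2 (i0 k l) l" by (simp_all add: kl X_def Y_def)
    have "f s w - u (X s) w * u (Y s) w = ((\<Sum>i\<in>UNIV - {i0 k l}. u (x2 i k) w * u (y2 i l) w)
        - (\<Sum>i\<in>UNIV. u (x2 i l) w * u (y2 i k) w)) +
        (\<Sum>a\<in>- range d. u (Inr (Inl a), k) w * u (Inr (Inr a), l) w - u (Inr (Inl a), l) w * u (Inr (Inr a), k) w)" for w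
      unfolding XY using remove[of "%i. u (x2 i k) w * u (y2 i l) w" k l]
      by (simp add: f_def kl A_eq sum_subtractf)
    then show ?thesis
      unfolding XY \<omega>
      using wspan_add[OF low4[OF le] wspan_diff[OF low1[OF le \<omega>(3,4)] low2[OF lt \<omega>(3,4)]]] by (simp add: XY)
  qed
  have ip: "initial_pairs u \<omega> P X Y f"
    by (rule initial_pairs.intro[OF coords _ injX injY disj lead]) simp_all

  have inv_f: "poly_funs (f ` P) = {(%w. F (gram w)) | F. F \<in> poly_funs mat_pair_coords}"
  proof (intro Set.set_eqI iffI)
    fix g assume "g \<in> poly_funs (f ` P)"
    then have "g \<in> invariant_funs OSp_group (OSp_act :: _ => ('m, 'p, 'q) W_space => _)"
    proof induction
      case (coord g)
      have "(%w. F (gram w)) \<in> invariant_funs OSp_group (OSp_act :: _ => ('m, 'p, 'q) W_space => _)"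
        if "F \<in> poly_funs mat_pair_coords" for F
        using that unfolding OSp_invariants[OF c refl] by blast
      from this[OF mat_pair_coord(1)] this[OF poly_funs_cmult[OF mat_pair_coord(1), of 2]] this[OF mat_pair_coord(2)]
      show ?case using coord by (auto simp: f_def split: sum.splits)
    qed (rule invariant_funs_const invariant_funs_add invariant_funs_mult; assumption)+
    then show "g \<in> {(%w. F (gram w)) | F. F \<in> poly_funs mat_pair_coords}"
      unfolding OSp_invariants[OF c refl] .
  next
    fix g assume "g \<in> {(%w :: ('m, 'p, 'q) W_space. F (gram w)) | F. F \<in> poly_funs mat_pair_coords}"
    then obtain F where F: "F \<in> poly_funs mat_pair_coords" "g = (%w. F (gram w))" by blast
    have fP: "f s \<in> poly_funs (f ` P)" if "s \<in> P" for s using that by (auto intro: poly_funs.coord)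
    have S: "?S k l \<in> poly_funs (f ` P)" if "n k \<le> n l" for k l
    proof (cases "k = l")
      case True
      then have "?S k l = f (Inl (k, l))" by (simp add: f_def)
      then show ?thesis using fP[of "Inl (k, l)"] that by (simp add: P_def)
    next
      case False
      then have "?S k l = (%w. f (Inl (k, l)) w / 2)" by (simp add: f_def)
      then show ?thesis using poly_funs_divide[OF fP[of "Inl (k, l)"]] that by (simp add: P_def)
    qed
    have S': "?S k l \<in> poly_funs (f ` P)" for k l
    proof (cases "n k \<le> n l")
      case False
      then have "?S l k \<in> poly_funs (f ` P)" by (intro S) simp
      then show ?thesis by (simp only: gram_symmetries(1)[of _ l k])
    qed (rule S)
    have A: "?A k l \<in> poly_funs (f ` P)" if "n k < n l" for k l
      using fP[of "Inr (k, l)"] that by (simp add: P_def f_def)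
    have A': "?A k l \<in> poly_funs (f ` P)" for k l
    proof -
      consider "n k < n l" | "n l < n k" | "k = l" using n_inj[of k l] by linarith
      then show ?thesis
      proof cases
        case 2
        from poly_funs_uminus[OF A[OF 2]] show ?thesis by (simp only: gram_symmetries(2)[of _ k l])
      next
        case 3
        have "2 * ?A k k w = 0" for w
          using eq_neg_iff_add_eq_0[THEN iffD1, OF gram_symmetries(2)[of w k k]] by (simp only: mult_2)
        then have "?A k k = (%_. 0)" by simp
        then show ?thesis using 3 by (simp add: poly_funs.const)
      qed (rule A)
    qed
    show "g \<in> poly_funs (f ` P)"
      unfolding F(2) by (rule poly_funs_compose_pair[OF F(1) S' A'])
  qed
  have "f s 0 = 0" for s
    by (simp add: f_def gram_rows transpose_mult_nth symp_gram_nth top_rows_def bottom_rows_def split: sum.split prod.split)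
  then show ?thesis using ip poly_eq inv_f by blast
qed

section \<open>Rings and modules of functions, flatness and reducedness\<close>

lemma cring_fun_ring:
  assumes "!!c. (%_. c) \<in> A" "!!f g. f \<in> A ==> g \<in> A ==> (%x. f x + g x) \<in> A"
    "!!f g. f \<in> A ==> g \<in> A ==> (%x. f x * g x) \<in> A"
  shows "cring (fun_ring A)"
proof (rule cringI)
  show "abelian_group (fun_ring A)"
  proof (rule abelian_groupI)
    fix f assume "f \<in> carrier (fun_ring A)"
    then have "(%x. -1 * f x) \<in> A" using assms(3)[OF assms(1)[of "-1"], of f] by (simp add: fun_ring_def)
    then show "\<exists>g\<in>carrier (fun_ring A). g \<oplus>\<^bsub>fun_ring A\<^esub> f = \<zero>\<^bsub>fun_ring A\<^esub>"
      by (intro bexI[of _ "%x. -1 * f x"]) (auto simp: fun_ring_def)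
  qed (auto simp: fun_ring_def assms algebra_simps)
  show "Group.comm_monoid (fun_ring A)"
    by (rule comm_monoidI) (auto simp: fun_ring_def assms algebra_simps)
qed (auto simp: fun_ring_def algebra_simps)

lemma abelian_group_fun_module:
  assumes "!!c. (%_. c) \<in> A" "!!f g. f \<in> A ==> g \<in> A ==> (%x. f x + g x) \<in> A"
    "!!f g. f \<in> A ==> g \<in> A ==> (%x. f x * g x) \<in> A"
  shows "abelian_group (fun_module A)"
proof (rule abelian_groupI)
  fix f assume "f \<in> carrier (fun_module A)"
  then have "(%x. -1 * f x) \<in> A" using assms(3)[OF assms(1)[of "-1"], of f] by (simp add: fun_module_def)
  then show "\<exists>g\<in>carrier (fun_module A). g \<oplus>\<^bsub>fun_module A\<^esub> f = \<zero>\<^bsub>fun_module A\<^esub>"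
    by (intro bexI[of _ "%x. -1 * f x"]) (auto simp: fun_module_def)
qed (auto simp: fun_module_def assms algebra_simps)

lemma module_fun_module:
  assumes R: "cring (fun_ring R)" and sub: "R \<subseteq> A"
    and A: "!!c. (%_. c) \<in> A" "!!f g. f \<in> A ==> g \<in> A ==> (%x. f x + g x) \<in> A"
    "!!f g. f \<in> A ==> g \<in> A ==> (%x. f x * g x) \<in> A"
  shows "Module.module (fun_ring R) (fun_module A)"
proof (rule moduleI[OF R abelian_group_fun_module[OF A]])
  fix a x assume "a \<in> carrier (fun_ring R)" "x \<in> carrier (fun_module A)"
  then have "a \<in> A" "x \<in> A" using sub by (auto simp: fun_ring_def fun_module_def)
  then show "a \<odot>\<^bsub>fun_module A\<^esub> x \<in> carrier (fun_module A)"
    using A(3) by (simp add: fun_module_def)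
qed (auto simp: fun_module_def fun_ring_def algebra_simps)

lemma finsum_fun_module:
  assumes "abelian_group (fun_module A)" "finite B" "!!i. i \<in> B ==> g i \<in> A"
  shows "finsum (fun_module A) g B = (%w. \<Sum>i\<in>B. g i w)"
proof -
  interpret abelian_group "fun_module A" by (rule assms(1))
  show ?thesis using assms(2,3)
  proof induction
    case empty
    have "finsum (fun_module A) g {} = \<zero>\<^bsub>fun_module A\<^esub>" by (rule finsum_empty)
    then show ?case by (simp only: sum.empty) (simp add: fun_module_def)
  next
    case (insert i B)
    have "finsum (fun_module A) g (insert i B) = g i \<oplus>\<^bsub>fun_module A\<^esub> finsum (fun_module A) g B"
      by (rule finsum_insert) (use insert in \<open>auto simp: fun_module_def\<close>)
    also have "finsum (fun_module A) g B = (%w. \<Sum>i\<in>B. g i w)" using insert by blast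
    finally show ?case using insert.hyps by (simp only:) (simp add: fun_module_def)
  qed
qed

lemma regular_mat_space: "regular mat_space = poly_funs mat_coords"
  by (simp add: mat_space_def)

theorem flat_quotient_OSp:
  fixes actG :: "_ => ('m::finite, 'p::finite, 'q::finite) W_space => ('m, 'p, 'q) W_space"
  assumes c: "2 * CARD('m) < CARD('p)" "2 * CARD('m) < 2 * CARD('q) + 1" and actG: "actG = OSp_act"
  shows "flat_quotient TYPE('t) OSp_group actG"
proof -
  obtain u :: "('p + ('q + 'q)) \<times> 'm => ('m, 'p, 'q) W_space => complex" and \<omega> P X Y
    and f :: "('m \<times> 'm) + ('m \<times> 'm) => ('m, 'p, 'q) W_space => complex"
    where ip: "initial_pairs u \<omega> P X Y f" and u: "poly_funs (range u) = poly_funs mat_coords"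
      and f: "poly_funs (f ` P) = {(%w. F (gram w)) | F. F \<in> poly_funs mat_pair_coords}"
    using gram_initial_pairs[OF c] by (elim exE conjE)
  have R: "invariant_funs OSp_group actG = poly_funs (f ` P)"
    using OSp_invariants[OF c actG] f by simp
  have "\<exists>C. (\<forall>i. \<forall>g\<in>poly_funs mat_coords. C i g \<in> poly_funs (f ` P)) &
      (\<forall>i. \<forall>g\<in>poly_funs mat_coords. \<forall>h\<in>poly_funs mat_coords. C i (%w. g w + h w) = (%w. C i g w + C i h w)) &
      (\<forall>i. \<forall>r\<in>poly_funs (f ` P). \<forall>g\<in>poly_funs mat_coords. C i (%w. r w * g w) = (%w. r w * C i g w)) &
      (\<forall>g\<in>poly_funs mat_coords. \<exists>A. finite A & (\<forall>i. i \<notin> A --> C i g = (%_. 0)) &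
         (\<forall>w. g w = (\<Sum>i\<in>A. C i g w * mon u i w)))" (is "\<exists>C. ?C C")
    using initial_pairs.module_coordinates[OF ip] unfolding u .
  then obtain C where "?C C" by (elim exE)
  then have C: "!!i g. g \<in> poly_funs mat_coords ==> C i g \<in> poly_funs (f ` P)"
      "!!i g h. g \<in> poly_funs mat_coords ==> h \<in> poly_funs mat_coords ==> C i (%w. g w + h w) = (%w. C i g w + C i h w)"
      "!!i r g. r \<in> poly_funs (f ` P) ==> g \<in> poly_funs mat_coords ==> C i (%w. r w * g w) = (%w. r w * C i g w)"
      "!!g. g \<in> poly_funs mat_coords ==> \<exists>A. finite A & (\<forall>i. i \<notin> A --> C i g = (%_. 0)) &
         (\<forall>w. g w = (\<Sum>i\<in>A. C i g w * mon u i w))"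
    by simp_all
  have sub: "poly_funs (f ` P) \<subseteq> poly_funs mat_coords"
    using invariant_funs_compose unfolding R[symmetric] by blast
  have cR: "cring (fun_ring (poly_funs (f ` P)))"
    by (rule cring_fun_ring) (auto intro: poly_funs.intros)
  have ab: "abelian_group (fun_module (poly_funs (mat_coords :: (('m, 'p, 'q) W_space => complex) set)))"
    by (rule abelian_group_fun_module) (simp_all add: poly_funs.const poly_funs.add poly_funs.mult)
  have M: "Module.module (fun_ring (poly_funs (f ` P))) (fun_module (poly_funs mat_coords))"
    by (rule module_fun_module[OF cR sub]) (simp_all add: poly_funs.const poly_funs.add poly_funs.mult)
  have monu: "mon u i \<in> poly_funs mat_coords" for i using mon_poly_funs[of u i] by (simp only: u)
  have "flat_module TYPE('t) (fun_ring (poly_funs (f ` P))) (fun_module (poly_funs mat_coords))"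
  proof (rule flat_module_coordinates[where c = C and e = "mon u", OF M])
    fix x :: "('m, 'p, 'q) W_space => complex" assume "x \<in> carrier (fun_module (poly_funs mat_coords))"
    then have x: "x \<in> poly_funs mat_coords" by (simp add: fun_module_def)
    obtain A where A: "finite A" "\<forall>i. i \<notin> A --> C i x = (%_. 0)" "\<forall>w. x w = (\<Sum>i\<in>A. C i x w * mon u i w)"
      using C(4)[OF x] by blast
    have sm: "C i x \<odot>\<^bsub>fun_module (poly_funs mat_coords)\<^esub> mon u i = (%w. C i x w * mon u i w)" for i
      by (simp add: fun_module_def)
    have CM: "(%w. C i x w * mon u i w) \<in> poly_funs mat_coords" for i
      using C(1)[OF x] sub monu by (blast intro: poly_funs.mult)
    have "finsum (fun_module (poly_funs mat_coords)) (%i w. C i x w * mon u i w) A = (%w. \<Sum>i\<in>A. C i x w * mon u i w)"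
      by (rule finsum_fun_module[OF ab A(1)]) (rule CM)
    also have "\<dots> = x" by (rule ext) (rule A(3)[rule_format, symmetric])
    finally have "finsum (fun_module (poly_funs mat_coords)) (%i. C i x \<odot>\<^bsub>fun_module (poly_funs mat_coords)\<^esub> mon u i) A = x"
      by (simp only: sm)
    then show "\<exists>A. finite A & (\<forall>i. i \<notin> A --> C i x = \<zero>\<^bsub>fun_ring (poly_funs (f ` P))\<^esub>) &
        x = finsum (fun_module (poly_funs mat_coords)) (%i. C i x \<odot>\<^bsub>fun_module (poly_funs mat_coords)\<^esub> mon u i) A"
      using A(1,2) by (intro exI[of _ A]) (simp add: fun_ring_def)
  qed (simp_all add: fun_ring_def fun_module_def C monu)
  then show ?thesis by (simp only: flat_quotient_def R regular_mat_space)
qed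

text \<open>The ideal of the scheme theoretic fibre is generated by all invariants that vanish at
  \<open>0\<close>. Each \<open>f s\<close> vanishes there and the \<open>f s\<close> generate the
  invariants, so this ideal is \<open>J\<close>, and \<open>J_radical\<close> applies.\<close>

theorem reduced_null_fiber_OSp:
  fixes actG :: "_ => ('m::finite, 'p::finite, 'q::finite) W_space => ('m, 'p, 'q) W_space"
  assumes c: "2 * CARD('m) < CARD('p)" "2 * CARD('m) < 2 * CARD('q) + 1" and actG: "actG = OSp_act"
  shows "reduced_null_fiber OSp_group actG"
proof -
  obtain u :: "('p + ('q + 'q)) \<times> 'm => ('m, 'p, 'q) W_space => complex" and \<omega> P X Y
    and f :: "('m \<times> 'm) + ('m \<times> 'm) => ('m, 'p, 'q) W_space => complex"
    where ip: "initial_pairs u \<omega> P X Y f" and u: "poly_funs (range u) = poly_funs mat_coords"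
      and f: "poly_funs (f ` P) = {(%w. F (gram w)) | F. F \<in> poly_funs mat_pair_coords}"
      and f0_all: "\<forall>s\<in>P. f s 0 = 0"
    using gram_initial_pairs[OF c] by (elim exE conjE)
  note f0 = bspec[OF f0_all]
  interpret initial_pairs u \<omega> P X Y f by (rule ip)
  have R: "invariant_funs OSp_group actG = poly_funs (f ` P)"
    using OSp_invariants[OF c actG] f by simp
  let ?S = "poly_funs (mat_coords :: (('m, 'p, 'q) W_space => complex) set)"
  let ?gens = "{g \<in> poly_funs (f ` P). g 0 = 0}"
  let ?I = "Idl\<^bsub>fun_ring ?S\<^esub> ?gens"
  interpret S: cring "fun_ring ?S" by (rule cring_fun_ring) (auto intro: poly_funs.intros)
  have fS: "f s \<in> ?S" if "s \<in> P" for s using f_poly[OF that] by (simp only: u)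
  have RS: "g \<in> ?S" if "g \<in> poly_funs (f ` P)" for g
    using that by induction (auto intro: poly_funs.intros fS)
  have genS: "?gens \<subseteq> carrier (fun_ring ?S)" using RS by (auto simp: fun_ring_def)
  interpret I: ideal ?I "fun_ring ?S" by (rule S.genideal_ideal[OF genS])
  have J0: "(%_. 0) \<in> J" by (rule J_I[of "%_ _. 0"]) (auto intro: poly_funs.const)
  have J_ideal: "ideal J (fun_ring ?S)"
  proof (rule idealI)
    show "ring (fun_ring ?S)" by (rule S.ring_axioms)
    show "subgroup J (add_monoid (fun_ring ?S))"
    proof (rule group.subgroupI)
      show "Group.group (add_monoid (fun_ring ?S))" by (rule S.a_group)
      show "J \<subseteq> carrier (add_monoid (fun_ring ?S))" using J_poly unfolding u by (auto simp: fun_ring_def)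
      show "J ~= {}" using J0 by blast
      fix g assume g: "g \<in> J"
      have m: "(%w. g w * (-1)) \<in> J" by (rule J_mult[OF g poly_funs.const])
      then have mS: "(%w. g w * (-1)) \<in> ?S" and gS: "g \<in> ?S" using J_poly g unfolding u by blast+
      have "inv\<^bsub>add_monoid (fun_ring ?S)\<^esub> g = (%w. g w * (-1))"
        by (rule group.inv_equality[OF S.a_group]) (use mS gS in \<open>auto simp: fun_ring_def\<close>)
      then show "inv\<^bsub>add_monoid (fun_ring ?S)\<^esub> g \<in> J" using m by simp
      fix h assume "h \<in> J"
      then show "g \<otimes>\<^bsub>add_monoid (fun_ring ?S)\<^esub> h \<in> J" using J_add[OF g] by (simp add: fun_ring_def)
    qed
    fix a x assume "a \<in> J" "x \<in> carrier (fun_ring ?S)"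
    then have "(%w. a w * x w) \<in> J" by (intro J_mult) (simp_all add: u fun_ring_def)
    then show "x \<otimes>\<^bsub>fun_ring ?S\<^esub> a \<in> J" "a \<otimes>\<^bsub>fun_ring ?S\<^esub> x \<in> J"
      by (simp_all add: fun_ring_def mult.commute)
  qed
  \<comment> \<open>Every polynomial in the \<open>f s\<close> is constant modulo \<open>J\<close>;
    for one that vanishes at \<open>0\<close> the constant is zero.\<close>
  have "\<exists>k. (%w. g w - k) \<in> J" if "g \<in> poly_funs (f ` P)" for g
    using that
  proof induction
    case (const k)
    show ?case using J0 by (intro exI[of _ k]) simp
  next
    case (coord g)
    then obtain s where s: "s \<in> P" "g = f s" by blast
    then show ?case using J_f[OF s(1) poly_funs.const[of 1]] by (intro exI[of _ 0]) simp
  next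
    case (add g h)
    then obtain k l where kl: "(%w. g w - k) \<in> J" "(%w. h w - l) \<in> J" by blast
    show ?case using J_add[OF kl] by (intro exI[of _ "k + l"]) (simp add: algebra_simps)
  next
    case (mult g h)
    then obtain k l where kl: "(%w. g w - k) \<in> J" "(%w. h w - l) \<in> J" by blast
    have "h \<in> poly_funs (range u)" using RS[OF mult.hyps(2)] by (simp only: u)
    from J_add[OF J_mult[OF kl(1) this] J_mult[OF kl(2) poly_funs.const[of k]]]
    show ?case by (intro exI[of _ "k * l"]) (simp add: algebra_simps)
  qed
  moreover have "g 0 = 0" if "g \<in> J" for g
    using that f0 unfolding J_def by auto
  ultimately have gens_J: "?gens \<subseteq> J"
  proof (intro subsetI)
    fix g assume g: "g \<in> ?gens" and *: "!!g. g \<in> poly_funs (f ` P) ==> \<exists>k. (%w. g w - k) \<in> J"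
      and **: "!!g. g \<in> J ==> g 0 = 0"
    obtain k where k: "(%w. g w - k) \<in> J" using *[of g] g by blast
    have "k = 0" using **[OF k] g by simp
    then show "g \<in> J" using k by simp
  qed
  have I_J: "?I \<subseteq> J" by (rule S.genideal_minimal[OF J_ideal gens_J])
  have J_I': "J \<subseteq> ?I"
  proof
    fix g assume "g \<in> J"
    then obtain q where q: "!!s. s \<in> P ==> q s \<in> ?S" "g = (%w. \<Sum>s\<in>P. f s w * q s w)"
      unfolding J_def u by blast
    have "(%w. \<Sum>s\<in>Q. f s w * q s w) \<in> ?I" if "Q \<subseteq> P" for Q
      using finite_subset[OF that finP] that
    proof (induction Q rule: finite_induct)
      case empty
      show ?case using I.zero_closed by (simp add: fun_ring_def)
    next
      case (insert s Q)
      have "f s \<in> ?I"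
        using S.genideal_self[OF genS] f0 insert.prems poly_funs.coord[of "f s" "f ` P"] by blast
      then have "f s \<otimes>\<^bsub>fun_ring ?S\<^esub> q s \<in> ?I" by (rule I.I_r_closed) (use q insert.prems in \<open>simp add: fun_ring_def\<close>)
      from I.a_closed[OF this insert.IH] show ?case using insert by (simp add: fun_ring_def)
    qed
    then show "g \<in> ?I" using q(2) by blast
  qed
  have IJ: "?I = J" using I_J J_I' by blast
  have "reduced_ring (fun_ring ?S Quot ?I)"
    unfolding reduced_ring_def
  proof (intro ballI allI impI)
    fix x n assume x: "x \<in> carrier (fun_ring ?S Quot ?I)" and xn: "x [^]\<^bsub>fun_ring ?S Quot ?I\<^esub> (n::nat) = \<zero>\<^bsub>fun_ring ?S Quot ?I\<^esub>"
    obtain g where g: "g \<in> ?S" "x = ?I +>\<^bsub>fun_ring ?S\<^esub> g"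
      using x by (auto simp: FactRing_def A_RCOSETS_def' fun_ring_def)
    have gS: "(%w. g w ^ k) \<in> carrier (fun_ring ?S)" for k
      using poly_funs_power[OF g(1)] by (simp add: fun_ring_def)
    have "x [^]\<^bsub>fun_ring ?S Quot ?I\<^esub> k = ?I +>\<^bsub>fun_ring ?S\<^esub> (%w. g w ^ k)" for k :: nat
    proof (induction k)
      case 0
      show ?case by (simp add: nat_pow_def FactRing_def) (simp add: fun_ring_def)
    next
      case (Suc k)
      have "x [^]\<^bsub>fun_ring ?S Quot ?I\<^esub> Suc k = rcoset_mult (fun_ring ?S) ?I (?I +>\<^bsub>fun_ring ?S\<^esub> (%w. g w ^ k)) x"
        using Suc by (simp add: nat_pow_def FactRing_def)
      also have "\<dots> = ?I +>\<^bsub>fun_ring ?S\<^esub> ((%w. g w ^ k) \<otimes>\<^bsub>fun_ring ?S\<^esub> g)"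
        unfolding g(2) by (rule I.rcoset_mult_add[OF gS]) (use g in \<open>simp add: fun_ring_def\<close>)
      also have "(%w. g w ^ k) \<otimes>\<^bsub>fun_ring ?S\<^esub> g = (%w. g w ^ Suc k)"
        by (simp add: fun_ring_def mult.commute)
      finally show ?case .
    qed
    then have "?I +>\<^bsub>fun_ring ?S\<^esub> (%w. g w ^ n) = ?I" using xn by (simp add: FactRing_def)
    then have "(%w. g w ^ n) \<in> ?I" using I.rcos_const_imp_mem[OF gS] by blast
    then have "g \<in> J" using J_radical[of g n] g(1) by (simp add: IJ u)
    then show "x = \<zero>\<^bsub>fun_ring ?S Quot ?I\<^esub>"
      unfolding g(2) using I.a_rcos_const[of g] by (simp add: IJ FactRing_def)
  qed
  moreover have "{g \<in> invariant_funs OSp_group actG. aff_quotient_map OSp_group actG 0 g = 0} = ?gens"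
    unfolding R[symmetric] by (auto simp: quotient_map_apply)
  ultimately show ?thesis unfolding reduced_null_fiber_def regular_mat_space by simp
qed

section \<open>Cayley's Omega process\<close>

definition bump :: "complex^'m^'n => 'n => 'm => complex => complex^'m^'n" where
  "bump w a j t = (\<chi> i k. w $ i $ k + t * (if i = a & k = j then 1 else 0))"

text \<open>The partial derivative in the matrix entry \<open>(a, j)\<close>. As an honest
  derivative it depends on the function alone and not on a polynomial expression for it.\<close>

definition pd :: "'n => 'm => (complex^'m^'n => complex) => complex^'m^'n => complex" where
  "pd a j f w = deriv (%t. f (bump w a j t)) 0"

lemma bump_0 [simp]: "bump w a j 0 = w"
  by (simp add: bump_def vec_eq_iff)

lemma pd_eqI: "((%t. f (bump w a j t)) has_field_derivative d) (at 0) ==> pd a j f w = d"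
  by (simp add: pd_def DERIV_imp_deriv)

lemma pd_derivative:
  assumes "f \<in> poly_funs mat_coords"
  shows "((%t. f (bump w a j t)) has_field_derivative pd a j f w) (at 0)"
proof -
  obtain P where P: "!!t. f (bump w a j t) = poly P t"
    using poly_fun_line[OF assms, of w "\<chi> i k. if i = a & k = j then 1 else 0"] by (auto simp: bump_def)
  have "((%t. poly P t) has_field_derivative poly (pderiv P) 0) (at 0)" by (rule poly_DERIV)
  then have d: "((%t. f (bump w a j t)) has_field_derivative poly (pderiv P) 0) (at 0)" by (simp add: P)
  show ?thesis using d pd_eqI[OF d] by simp
qed

lemma pd_const: "pd a j (%_. c) = (%_. 0)"
  by (rule ext, rule pd_eqI) simp

lemma pd_coord: "pd a j (%w. w $ i $ k) = (%_. if i = a & k = j then 1 else 0)"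
  by (rule ext, rule pd_eqI) (auto simp: bump_def intro!: derivative_eq_intros)

lemma pd_add:
  "f \<in> poly_funs mat_coords ==> g \<in> poly_funs mat_coords ==>
    pd a j (%w. f w + g w) = (%w. pd a j f w + pd a j g w)"
  by (rule ext, rule pd_eqI) (intro DERIV_add pd_derivative)

lemma pd_mult:
  assumes "f \<in> poly_funs mat_coords" "g \<in> poly_funs mat_coords"
  shows "pd a j (%w. f w * g w) = (%w. pd a j f w * g w + f w * pd a j g w)"
proof (rule ext, rule pd_eqI)
  fix w
  show "((%t. f (bump w a j t) * g (bump w a j t)) has_field_derivative pd a j f w * g w + f w * pd a j g w) (at 0)"
    using DERIV_mult[OF pd_derivative[OF assms(1), of w a j] pd_derivative[OF assms(2), of w a j]]
    by (simp add: mult.commute)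
qed

lemma pd_cmult: "f \<in> poly_funs mat_coords ==> pd a j (%w. c * f w) = (%w. c * pd a j f w)"
  by (subst pd_mult) (simp_all add: poly_funs.const pd_const)

lemma pd_poly: "f \<in> poly_funs mat_coords ==> pd a j f \<in> poly_funs mat_coords"
proof (induction rule: poly_funs.induct)
  case (coord f)
  then obtain i k where "f = (%w. w $ i $ k)" by (auto simp: mat_coords_def)
  then show ?case by (simp add: pd_coord poly_funs.const)
qed (simp_all add: pd_const pd_add pd_mult poly_funs.intros)

lemma poly_right_mult:
  assumes "f \<in> poly_funs mat_coords"
  shows "(%g. f (w ** g)) \<in> poly_funs mat_coords"
  by (rule poly_funs_compose_mat[OF assms]) (intro poly_funs_mat_mult poly_funs.const mat_coord)

lemma pd_right_mult:
  fixes w :: "complex^'m^'n"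
  assumes "f \<in> poly_funs mat_coords"
  shows "pd i j (%g. f (w ** g)) g = (\<Sum>a\<in>UNIV. w $ a $ i * pd a j f (w ** g))"
  using assms
proof (induction arbitrary: g)
  case (const c)
  then show ?case by (simp add: pd_const)
next
  case (coord f)
  then obtain r k where f: "f = (%w. w $ r $ k)" by (auto simp: mat_coords_def)
  have "pd i j (%g. (w ** g) $ r $ k) g = (if k = j then w $ r $ i else 0)"
  proof (rule pd_eqI)
    have "(w ** bump g i j t) $ r $ k = (w ** g) $ r $ k + t * (if k = j then w $ r $ i else 0)" for t
    proof -
      have "(w ** bump g i j t) $ r $ k = (\<Sum>l\<in>UNIV. w $ r $ l * g $ l $ k + (if l = i then (if k = j then t * w $ r $ i else 0) else 0))"
        unfolding matrix_matrix_mult_def vec_lambda_beta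
        by (intro sum.cong refl) (auto simp: bump_def algebra_simps)
      then show ?thesis by (simp add: sum.distrib matrix_matrix_mult_def)
    qed
    then show "((%t. (w ** bump g i j t) $ r $ k) has_field_derivative (if k = j then w $ r $ i else 0)) (at 0)"
      by (auto intro!: derivative_eq_intros)
  qed
  also have "\<dots> = (\<Sum>a\<in>UNIV. w $ a $ i * (if r = a & k = j then 1 else 0))"
    by (simp add: if_distrib[of "%x. _ * x"] if_bool_eq_conj[symmetric] cong: if_cong)
  finally show ?case by (simp add: f pd_coord)
next
  case (add f h)
  then show ?case
    by (simp add: pd_add poly_right_mult sum.distrib distrib_left)
next
  case (mult f h)
  then show ?case
    by (simp add: pd_mult poly_right_mult sum.distrib distrib_left sum_distrib_left sum_distrib_right mult_ac)
qed

lemma pd_sum: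
  assumes "!!i. i \<in> I ==> f i \<in> poly_funs mat_coords"
  shows "pd a j (%w. \<Sum>i\<in>I. f i w) = (%w. \<Sum>i\<in>I. pd a j (f i) w)"
  using assms
proof (induction I rule: infinite_finite_induct)
  case (insert x F)
  then show ?case by (simp add: pd_add poly_funs_sum)
qed (simp_all add: pd_const)

text \<open>A fixed order of the columns, along which partial derivatives are iterated; no
  commutation of the operators has to be discussed.\<close>

definition col_list :: "'m::finite list" where
  "col_list = (SOME L. distinct L & set L = UNIV)"

lemma col_list: "distinct (col_list :: 'm::finite list)" "set (col_list :: 'm list) = UNIV"
proof -
  have "\<exists>L. distinct L & set L = (UNIV :: 'm set)" using finite_distinct_list[of "UNIV :: 'm set"] by auto
  then have "distinct (col_list :: 'm list) & set (col_list :: 'm list) = UNIV"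
    unfolding col_list_def by (rule someI_ex)
  then show "distinct (col_list :: 'm list)" "set (col_list :: 'm list) = UNIV" by auto
qed

definition pds :: "('m => 'n) => 'm list => (complex^'m^'n => complex) => complex^'m^'n => complex" where
  "pds b L f = foldr (%j. pd (b j) j) L f"

lemma pds_simps: "pds b [] f = f" "pds b (j # L) f = pd (b j) j (pds b L f)"
  by (simp_all add: pds_def)

lemma pds_poly: "f \<in> poly_funs mat_coords ==> pds b L f \<in> poly_funs mat_coords"
  by (induction L) (simp_all add: pds_simps pd_poly)

lemma pds_cong: "(!!j. j \<in> set L ==> b j = b' j) ==> pds b L f = pds b' L f"
  by (induction L) (simp_all add: pds_simps)

lemma pds_add:
  "f \<in> poly_funs mat_coords ==> g \<in> poly_funs mat_coords ==>
     pds b L (%w. f w + g w) = (%w. pds b L f w + pds b L g w)"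
  by (induction L) (simp_all add: pds_simps pd_add pds_poly)

lemma pds_cmult: "f \<in> poly_funs mat_coords ==> pds b L (%w. c * f w) = (%w. c * pds b L f w)"
  by (induction L) (simp_all add: pds_simps pd_cmult pds_poly)

text \<open>Iterated chain rule: the derivative in row \<open>b j\<close> and column
  \<open>j\<close> of \<open>g\<close> brings out the entries of column \<open>b j\<close> of
  \<open>w\<close>, one for each choice of a row \<open>a j\<close>.\<close>

lemma pds_right_mult:
  fixes w :: "complex^'m::finite^'n::finite"
  assumes f: "f \<in> poly_funs mat_coords" and "distinct L"
  shows "pds b L (%g. f (w ** g)) =
    (%g. \<Sum>a\<in>PiE (set L) (%_. UNIV). (\<Prod>j\<in>set L. w $ a j $ b j) * pds a L f (w ** g))"
  using assms(2)
proof (induction L)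
  case Nil
  then show ?case by (simp add: pds_simps)
next
  case (Cons j L)
  let ?E = "PiE (set L) (%_. UNIV :: 'n set)"
  have j: "j \<notin> set L" "distinct L" using Cons.prems by auto
  have poly: "pds a L f \<in> poly_funs mat_coords" for a using pds_poly[OF f] .
  have "pds b (j # L) (%g. f (w ** g)) = pd (b j) j (%g. \<Sum>a\<in>?E. (\<Prod>j\<in>set L. w $ a j $ b j) * pds a L f (w ** g))"
    by (simp only: pds_simps Cons.IH[OF j(2)])
  also have "\<dots> = (%g. \<Sum>a\<in>?E. (\<Prod>j\<in>set L. w $ a j $ b j) * (\<Sum>r\<in>UNIV. w $ r $ b j * pd r j (pds a L f) (w ** g)))"
    by (simp add: pd_sum pd_cmult poly_funs_cmult poly_right_mult poly pd_right_mult[OF poly])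
  also have "\<dots> = (%g. \<Sum>a\<in>PiE (set (j # L)) (%_. UNIV). (\<Prod>j\<in>set (j # L). w $ a j $ b j) * pds a (j # L) f (w ** g))"
  proof
    fix g
    have inj: "inj_on (%(r, a). a(j := r)) (UNIV \<times> ?E)" using j(1) by (rule inj_combinator)
    have "(\<Sum>a\<in>PiE (set (j # L)) (%_. UNIV). (\<Prod>j\<in>set (j # L). w $ a j $ b j) * pds a (j # L) f (w ** g))
        = (\<Sum>(r, a)\<in>UNIV \<times> ?E. (\<Prod>i\<in>set (j # L). w $ (a(j := r)) i $ b i) * pds (a(j := r)) (j # L) f (w ** g))"
      unfolding list.set(2) PiE_insert_eq
      by (subst sum.reindex[OF inj]) (simp add: case_prod_beta comp_def)
    also have "\<dots> = (\<Sum>(r, a)\<in>UNIV \<times> ?E. (w $ r $ b j * (\<Prod>i\<in>set L. w $ a i $ b i)) * pd r j (pds a L f) (w ** g))"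
    proof (intro sum.cong refl, clarify)
      fix r a
      have "(\<Prod>i\<in>set L. w $ (a(j := r)) i $ b i) = (\<Prod>i\<in>set L. w $ a i $ b i)"
        using j(1) by (intro prod.cong refl) auto
      moreover have "pds (a(j := r)) L f = pds a L f" using j(1) by (intro pds_cong) auto
      ultimately show "(\<Prod>i\<in>set (j # L). w $ (a(j := r)) i $ b i) * pds (a(j := r)) (j # L) f (w ** g)
          = (w $ r $ b j * (\<Prod>i\<in>set L. w $ a i $ b i)) * pd r j (pds a L f) (w ** g)"
        using j(1) by (simp add: pds_simps)
    qed
    also have "\<dots> = (\<Sum>r\<in>UNIV. \<Sum>a\<in>?E. (w $ r $ b j * (\<Prod>i\<in>set L. w $ a i $ b i)) * pd r j (pds a L f) (w ** g))"
      by (simp add: sum.cartesian_product)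
    also have "\<dots> = (\<Sum>a\<in>?E. \<Sum>r\<in>UNIV. (w $ r $ b j * (\<Prod>i\<in>set L. w $ a i $ b i)) * pd r j (pds a L f) (w ** g))"
      by (rule sum.swap)
    finally show "(\<Sum>a\<in>?E. (\<Prod>j\<in>set L. w $ a j $ b j) * (\<Sum>r\<in>UNIV. w $ r $ b j * pd r j (pds a L f) (w ** g)))
       = (\<Sum>a\<in>PiE (set (j # L)) (%_. UNIV). (\<Prod>j\<in>set (j # L). w $ a j $ b j) * pds a (j # L) f (w ** g))"
      by (simp add: sum_distrib_left mult_ac)
  qed
  finally show ?case .
qed

text \<open>Cayley's operator: the determinant with each matrix entry replaced by the partial
  derivative in that entry.\<close>

definition Omega :: "(complex^'m::finite^'m => complex) => complex^'m^'m => complex" where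
  "Omega f g = (\<Sum>\<sigma> | \<sigma> permutes UNIV. of_int (sign \<sigma>) * pds \<sigma> col_list f g)"

definition minor :: "('m::finite => 'n) => complex^'m^'n => complex" where
  "minor a w = det (\<chi> k l. w $ a k $ l)"

lemma Omega_poly: "f \<in> poly_funs mat_coords ==> Omega f \<in> poly_funs mat_coords"
  unfolding Omega_def[abs_def] by (intro poly_funs_sum poly_funs_cmult pds_poly)

lemma Omega_add:
  "f \<in> poly_funs mat_coords ==> g \<in> poly_funs mat_coords ==> Omega (%w. f w + g w) = (%w. Omega f w + Omega g w)"
  by (simp add: Omega_def fun_eq_iff pds_add sum.distrib distrib_left)

lemma Omega_cmult: "f \<in> poly_funs mat_coords ==> Omega (%w. c * f w) = (%w. c * Omega f w)"
  by (simp add: Omega_def fun_eq_iff pds_cmult sum_distrib_left mult_ac)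

text \<open>The alternating sum over the rows of \<open>g\<close> collects the products of entries
  of \<open>w\<close> in the iterated chain rule into minors of \<open>w\<close>.\<close>

lemma Omega_right_mult:
  fixes w :: "complex^'m::finite^'n::finite"
  assumes f: "f \<in> poly_funs mat_coords"
  shows "Omega (%g. f (w ** g)) = (%g. \<Sum>a\<in>UNIV. minor a w * pds a col_list f (w ** g))"
proof
  fix g
  have "Omega (%g. f (w ** g)) g
      = (\<Sum>\<sigma> | \<sigma> permutes UNIV. \<Sum>a\<in>UNIV. of_int (sign \<sigma>) * (\<Prod>j\<in>UNIV. w $ a j $ \<sigma> j) * pds a col_list f (w ** g))"
    by (simp add: Omega_def pds_right_mult[OF f col_list(1)] col_list(2) PiE_UNIV_domain sum_distrib_left mult.assoc)
  also have "\<dots> = (\<Sum>a\<in>UNIV. \<Sum>\<sigma> | \<sigma> permutes UNIV. of_int (sign \<sigma>) * (\<Prod>j\<in>UNIV. w $ a j $ \<sigma> j) * pds a col_list f (w ** g))"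
    by (rule sum.swap)
  also have "\<dots> = (\<Sum>a\<in>UNIV. minor a w * pds a col_list f (w ** g))"
    by (simp add: minor_def det_def sum_distrib_right)
  finally show "Omega (%g. f (w ** g)) g = (\<Sum>a\<in>UNIV. minor a w * pds a col_list f (w ** g))" .
qed

definition Omega_pow :: "nat => (complex^'m::finite^'m => complex) => complex^'m^'m => complex" where
  "Omega_pow d = Omega ^^ d"

lemma Omega_pow_simps: "Omega_pow 0 f = f" "Omega_pow (Suc d) f = Omega_pow d (Omega f)"
  by (simp_all add: Omega_pow_def funpow_swap1)

lemma Omega_pow_poly: "f \<in> poly_funs mat_coords ==> Omega_pow d f \<in> poly_funs mat_coords"
  by (induction d arbitrary: f) (simp_all add: Omega_pow_simps Omega_poly)

lemma Omega_pow_add: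
  "f \<in> poly_funs mat_coords ==> g \<in> poly_funs mat_coords ==>
    Omega_pow d (%w. f w + g w) = (%w. Omega_pow d f w + Omega_pow d g w)"
  by (induction d arbitrary: f g) (simp_all add: Omega_pow_simps Omega_add Omega_poly)

lemma Omega_pow_cmult: "f \<in> poly_funs mat_coords ==> Omega_pow d (%w. c * f w) = (%w. c * Omega_pow d f w)"
  by (induction d arbitrary: f) (simp_all add: Omega_pow_simps Omega_cmult Omega_poly)

lemma Omega_pow_sum:
  assumes "!!i. i \<in> I ==> f i \<in> poly_funs mat_coords"
  shows "Omega_pow d (%w. \<Sum>i\<in>I. f i w) = (%w. \<Sum>i\<in>I. Omega_pow d (f i) w)"
  using assms
proof (induction I rule: infinite_finite_induct)
  case (insert x F)
  then show ?case by (simp add: Omega_pow_add poly_funs_sum)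
next
  case (infinite I)
  then show ?case using Omega_pow_cmult[OF poly_funs.const[of 0], of d 0] by simp
next
  case empty
  then show ?case using Omega_pow_cmult[OF poly_funs.const[of 0], of d 0] by simp
qed

text \<open>Each application of \<open>Omega\<close> splits off one minor, and at
  \<open>g = 0\<close> the factor that is left over no longer depends on \<open>w\<close>.\<close>

lemma Omega_pow_minors:
  assumes "f \<in> poly_funs (mat_coords :: (complex^'m::finite^'n::finite => complex) set)"
  shows "(%w. Omega_pow d (%g. f (w ** g)) 0) \<in> poly_funs (range minor)"
  using assms
proof (induction d arbitrary: f)
  case 0
  have "w ** 0 = (0 :: complex^'m^'n)" for w :: "complex^'m^'n"
    by (simp add: matrix_matrix_mult_def vec_eq_iff)
  then show ?case by (simp add: Omega_pow_simps poly_funs.const)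
next
  case (Suc d)
  have p: "pds a col_list f \<in> poly_funs mat_coords" for a using pds_poly[OF Suc.prems] .
  have "Omega_pow (Suc d) (%g. f (w ** g)) 0
      = (\<Sum>a\<in>UNIV. minor a w * Omega_pow d (%g. pds a col_list f (w ** g)) 0)" for w
    by (simp add: Omega_pow_simps Omega_right_mult[OF Suc.prems] Omega_pow_sum Omega_pow_cmult
        poly_funs_cmult poly_right_mult p)
  moreover have "(%w. \<Sum>a\<in>UNIV. minor a w * Omega_pow d (%g. pds a col_list f (w ** g)) 0) \<in> poly_funs (range minor)"
    by (intro poly_funs_sum poly_funs.mult Suc.IH p) (rule poly_funs.coord, simp)
  ultimately show ?case by simp
qed

section \<open>The apolar pairing and powers of the determinant\<close>

definition coef :: "('v::finite => 'w => complex) => ('w => complex) => ('v => nat) => complex" where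
  "coef u f = (SOME K. finite {\<mu>. K \<mu> ~= 0} & f = comb (mon u) K)"

text \<open>The apolar (Fischer) pairing: apply \<open>f\<close> as a differential operator to
  \<open>g\<close> and evaluate at zero. It shows that \<open>Omega_pow d\<close> maps the
  \<open>d\<close>-th power of \<open>det\<close> to a nonzero value without computing the constant
  of Cayley's identity.\<close>

definition pairing :: "('v::finite => 'w => complex) => ('w => complex) => ('w => complex) => complex" where
  "pairing u f g = (\<Sum>\<mu> | coef u f \<mu> ~= 0. coef u f \<mu> * coef u g \<mu> * (\<Prod>v\<in>UNIV. fact (\<mu> v)))"

context
  fixes u :: "'v::finite => 'w => complex"
  assumes u: "coordinates u"
begin

lemma coef_props:
  assumes "f \<in> wspan (mon u) Q"
  shows "finite {\<mu>. coef u f \<mu> ~= 0}" "comb (mon u) (coef u f) = f"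
proof -
  have "\<exists>K. finite {\<mu>. K \<mu> ~= 0} & f = comb (mon u) K" using wspan_comb[OF assms] by blast
  then have "finite {\<mu>. coef u f \<mu> ~= 0} & f = comb (mon u) (coef u f)"
    unfolding coef_def by (rule someI_ex)
  then show "finite {\<mu>. coef u f \<mu> ~= 0}" "comb (mon u) (coef u f) = f" by simp_all
qed

lemma coef_eqI:
  assumes "finite {\<mu>. K \<mu> ~= 0}" "comb (mon u) K = f"
  shows "coef u f = K"
proof -
  have "comb (mon u) K \<in> wspan (mon u) (%_. True)" by (rule comb_wspan[OF assms(1)]) simp
  then have f: "f \<in> wspan (mon u) (%_. True)" using assms(2) by simp
  show ?thesis
    by (rule indep_unique[OF indep_mon[OF u] coef_props(1)[OF f] assms(1)])
       (simp only: coef_props(2)[OF f] assms(2))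
qed

lemma coef_add:
  assumes "f \<in> wspan (mon u) (%_. True)" "g \<in> wspan (mon u) (%_. True)"
  shows "coef u (%w. f w + g w) = (%\<mu>. coef u f \<mu> + coef u g \<mu>)"
proof (rule coef_eqI)
  note fin = coef_props(1)[OF assms(1)] coef_props(1)[OF assms(2)]
  show "finite {\<mu>. coef u f \<mu> + coef u g \<mu> ~= 0}" by (rule comb_add(2)[OF fin])
  show "comb (mon u) (%\<mu>. coef u f \<mu> + coef u g \<mu>) = (%w. f w + g w)"
    by (rule ext) (simp only: comb_add(1)[OF fin] coef_props(2)[OF assms(1)] coef_props(2)[OF assms(2)])
qed

lemma coef_cmult:
  assumes "f \<in> wspan (mon u) (%_. True)"
  shows "coef u (%w. c * f w) = (%\<mu>. c * coef u f \<mu>)"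
proof (rule coef_eqI)
  show "finite {\<mu>. c * coef u f \<mu> ~= 0}" by (rule finite_supp_cmult[OF coef_props(1)[OF assms]])
  show "comb (mon u) (%\<mu>. c * coef u f \<mu>) = (%w. c * f w)"
    by (rule ext) (simp only: comb_cmult coef_props(2)[OF assms])
qed

lemma coef_mon: "coef u (mon u \<mu>) = (%\<nu>. if \<nu> = \<mu> then 1 else 0)"
proof (rule coef_eqI)
  show "finite {\<nu>. (if \<nu> = \<mu> then 1 else 0 :: complex) ~= 0}" by simp
  show "comb (mon u) (%\<nu>. if \<nu> = \<mu> then 1 else 0) = mon u \<mu>"
    by (rule ext) (simp only: comb_single mult_1)
qed

lemma coef_zero: "coef u (%_. 0) = (%_. 0)"
  by (rule coef_eqI) (simp_all add: comb_def fun_eq_iff)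

lemma coef_support:
  assumes "f \<in> wspan (mon u) Q" "coef u f \<mu> ~= 0"
  shows "Q \<mu>"
proof -
  obtain K where K: "finite {\<mu>. K \<mu> ~= 0}" "\<forall>\<mu>. K \<mu> ~= 0 --> Q \<mu>" "f = comb (mon u) K"
    using wspan_comb[OF assms(1)] by blast
  have "coef u f = K" by (rule coef_eqI) (simp_all add: K)
  then show ?thesis using K(2) assms(2) by simp
qed

lemma pairing_superset:
  assumes "finite A" "{\<mu>. coef u f \<mu> ~= 0} \<subseteq> A"
  shows "pairing u f g = (\<Sum>\<mu>\<in>A. coef u f \<mu> * coef u g \<mu> * (\<Prod>v\<in>UNIV. fact (\<mu> v)))"
  unfolding pairing_def by (rule sum.mono_neutral_left) (use assms in auto)

lemma pairing_add_left:
  assumes "f \<in> wspan (mon u) (%_. True)" "h \<in> wspan (mon u) (%_. True)"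
  shows "pairing u (%w. f w + h w) g = pairing u f g + pairing u h g"
proof -
  let ?A = "{\<mu>. coef u f \<mu> ~= 0} \<union> {\<mu>. coef u h \<mu> ~= 0}"
  have A: "finite ?A" using coef_props(1)[OF assms(1)] coef_props(1)[OF assms(2)] by simp
  have "pairing u (%w. f w + h w) g = (\<Sum>\<mu>\<in>?A. (coef u f \<mu> + coef u h \<mu>) * coef u g \<mu> * (\<Prod>v\<in>UNIV. fact (\<mu> v)))"
    by (subst pairing_superset[OF A]) (auto simp: coef_add[OF assms])
  also have "\<dots> = pairing u f g + pairing u h g"
    by (subst (1 2) pairing_superset[OF A]) (auto simp: sum.distrib algebra_simps)
  finally show ?thesis .
qed

lemma pairing_cmult_left:
  assumes "f \<in> wspan (mon u) (%_. True)"
  shows "pairing u (%w. c * f w) g = c * pairing u f g"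
proof -
  have "pairing u (%w. c * f w) g = (\<Sum>\<mu> | coef u f \<mu> ~= 0. (c * coef u f \<mu>) * coef u g \<mu> * (\<Prod>v\<in>UNIV. fact (\<mu> v)))"
    by (subst pairing_superset[OF coef_props(1)[OF assms]]) (auto simp: coef_cmult[OF assms])
  then show ?thesis by (simp add: pairing_def sum_distrib_left mult.assoc)
qed

lemma pairing_add_right:
  assumes "g \<in> wspan (mon u) (%_. True)" "h \<in> wspan (mon u) (%_. True)"
  shows "pairing u f (%w. g w + h w) = pairing u f g + pairing u f h"
  by (simp add: pairing_def coef_add[OF assms] algebra_simps sum.distrib)

lemma pairing_cmult_right:
  assumes "g \<in> wspan (mon u) (%_. True)"
  shows "pairing u f (%w. c * g w) = c * pairing u f g"
  by (simp add: pairing_def coef_cmult[OF assms] sum_distrib_left mult_ac)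

lemma pairing_zero: "pairing u (%_. 0) g = 0" "pairing u f (%_. 0) = 0"
  by (simp_all add: pairing_def coef_zero)

lemma pairing_mon: "pairing u (mon u \<mu>) (mon u \<nu>) = (if \<mu> = \<nu> then \<Prod>v\<in>UNIV. fact (\<mu> v) else 0)"
proof -
  have "pairing u (mon u \<mu>) (mon u \<nu>)
      = (\<Sum>\<kappa>\<in>{\<mu>}. coef u (mon u \<mu>) \<kappa> * coef u (mon u \<nu>) \<kappa> * (\<Prod>v\<in>UNIV. fact (\<kappa> v)))"
    by (rule pairing_superset) (auto simp: coef_mon)
  then show ?thesis by (simp add: coef_mon)
qed

text \<open>\<open>D\<close> stands for the derivative in the coordinate \<open>u v\<close>, given
  only by linearity and its values on monomials. By bilinearity the claim concerns two monomials,
  where it is the recursion of the factorial.\<close>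

lemma pairing_adjoint:
  assumes D_add: "!!f g. f \<in> wspan (mon u) (%_. True) ==> g \<in> wspan (mon u) (%_. True) ==>
        D (%w. f w + g w) = (%w. D f w + D g w)"
    and D_cmult: "!!f c. f \<in> wspan (mon u) (%_. True) ==> D (%w. c * f w) = (%w. c * D f w)"
    and D_mon: "!!\<mu>. D (mon u \<mu>) = (%w. of_nat (\<mu> v) * mon u (\<mu>(v := \<mu> v - 1)) w)"
    and D_poly: "!!f. f \<in> wspan (mon u) (%_. True) ==> D f \<in> wspan (mon u) (%_. True)"
    and f: "f \<in> wspan (mon u) (%_. True)" and g: "g \<in> wspan (mon u) (%_. True)"
  shows "pairing u (%w. u v w * f w) g = pairing u f (D g)"
proof -
  let ?S = "wspan (mon u) (%_. True)"
  have monS: "mon u \<mu> \<in> ?S" for \<mu> by (simp add: wspan_base)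
  have x_mon: "u v w * mon u \<mu> w = mon u (\<mu>(v := Suc (\<mu> v))) w" for \<mu> w
  proof -
    have "\<mu>(v := Suc (\<mu> v)) = (%x. (if x = v then 1 else 0) + \<mu> x)" by auto
    then show ?thesis by (simp only: mon_add mon_single power_one_right)
  qed
  have xS: "(%w. u v w * h w) \<in> ?S" if "h \<in> ?S" for h
    using that
  proof induction
    case (step h i c)
    from wspan.step[where Q = "%_. True" and i = "i(v := Suc (i v))", OF step.IH, of c]
    show ?case by (simp only: distrib_left x_mon[symmetric] mult.left_commute[of "u v _" c])
  qed (simp add: wspan.zero)
  have mm: "pairing u (%w. u v w * mon u \<mu> w) (mon u \<nu>) = pairing u (mon u \<mu>) (D (mon u \<nu>))" for \<mu> \<nu>
  proof (cases "\<mu>(v := Suc (\<mu> v)) = \<nu>")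
    case True
    then have \<nu>: "\<nu> v = Suc (\<mu> v)" "\<nu>(v := \<nu> v - 1) = \<mu>" by auto
    have "(\<Prod>x\<in>UNIV. fact (\<nu> x)) = (of_nat (\<nu> v) * (\<Prod>x\<in>UNIV. fact (\<mu> x)) :: complex)"
    proof -
      have "(\<Prod>x\<in>UNIV. fact (\<nu> x) :: complex) = fact (\<nu> v) * (\<Prod>x\<in>UNIV - {v}. fact (\<nu> x))"
        by (rule prod.remove) auto
      also have "(\<Prod>x\<in>UNIV - {v}. fact (\<nu> x) :: complex) = (\<Prod>x\<in>UNIV - {v}. fact (\<mu> x))"
        using True by (intro prod.cong refl) auto
      also have "fact (\<nu> v) = (of_nat (\<nu> v) * fact (\<mu> v) :: complex)" by (simp add: \<nu>(1))
      finally show ?thesis by (simp add: prod.remove[of UNIV v] mult.assoc)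
    qed
    then show ?thesis
      unfolding x_mon True D_mon \<nu>(2) pairing_cmult_right[OF monS] pairing_mon by simp
  next
    case False
    have "\<mu> ~= \<nu>(v := \<nu> v - 1) \<or> \<nu> v = 0"
    proof (rule ccontr)
      assume "~ ?thesis"
      then have "\<mu>(v := Suc (\<mu> v)) = \<nu>" by (auto simp: fun_eq_iff)
      then show False using False by simp
    qed
    then show ?thesis
      using False by (auto simp: x_mon pairing_mon D_mon pairing_cmult_right[OF monS])
  qed
  have left: "pairing u (%w. u v w * f w) (mon u \<nu>) = pairing u f (D (mon u \<nu>))" for \<nu>
    using f
  proof induction
    case zero
    show ?case by (simp add: pairing_zero)
  next
    case (step h \<mu> c)
    have "pairing u (%w. u v w * h w + c * (u v w * mon u \<mu> w)) (mon u \<nu>)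
        = pairing u (%w. u v w * h w) (mon u \<nu>) + c * pairing u (%w. u v w * mon u \<mu> w) (mon u \<nu>)"
      by (simp add: pairing_add_left xS step.hyps wspan_cmult monS pairing_cmult_left)
    moreover have "(%w. u v w * (h w + c * mon u \<mu> w)) = (%w. u v w * h w + c * (u v w * mon u \<mu> w))"
      by (simp add: algebra_simps)
    ultimately show ?case
      by (simp add: step.IH mm pairing_add_left step.hyps wspan_cmult monS pairing_cmult_left)
  qed
  show ?thesis
    using g
  proof induction
    case zero
    have "D (%_. 0) = (%_. 0)" using D_cmult[OF wspan.zero, of 0] by simp
    then show ?case by (simp add: pairing_zero)
  next
    case (step h \<mu> c)
    then show ?case
      by (simp add: pairing_add_right wspan_cmult monS pairing_cmult_right left D_add D_cmult D_poly)
  qed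
qed

text \<open>The pairing is bilinear and not hermitian; for real coefficients it is nevertheless a
  sum of squares with positive weights.\<close>

lemma pairing_self_nonzero:
  assumes f: "f \<in> wspan (mon u) (%_. True)" and real: "!!\<mu>. coef u f \<mu> \<in> \<real>" and "f w ~= 0"
  shows "pairing u f f ~= 0"
proof -
  let ?S = "{\<mu>. coef u f \<mu> ~= 0}"
  have "?S ~= {}"
  proof
    assume "?S = {}"
    then have "comb (mon u) (coef u f) w = 0" by (simp add: comb_def)
    then show False using assms(3) by (simp add: coef_props(2)[OF f])
  qed
  have re: "coef u f \<mu> = of_real (Re (coef u f \<mu>))" for \<mu> using real[of \<mu>] by (simp add: complex_is_Real_iff complex_eq_iff)
  have eq: "coef u f \<mu> * coef u f \<mu> * (\<Prod>v\<in>UNIV. fact (\<mu> v)) = of_real (Re (coef u f \<mu>) * Re (coef u f \<mu>) * (\<Prod>v\<in>UNIV. fact (\<mu> v)))" for \<mu>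
    unfolding of_real_mult of_real_prod of_real_fact re[symmetric] ..
  have sum: "pairing u f f = of_real (\<Sum>\<mu>\<in>?S. Re (coef u f \<mu>) * Re (coef u f \<mu>) * (\<Prod>v\<in>UNIV. fact (\<mu> v)))"
    unfolding pairing_def of_real_sum by (intro sum.cong refl eq)
  have pos: "(\<Sum>\<mu>\<in>?S. Re (coef u f \<mu>) * Re (coef u f \<mu>) * (\<Prod>v\<in>UNIV. fact (\<mu> v))) > 0"
  proof (rule sum_pos)
    show "finite ?S" by (rule coef_props(1)[OF f])
    show "?S ~= {}" by fact
    fix \<mu> assume "\<mu> \<in> ?S"
    then have "Re (coef u f \<mu>) ~= 0" using real[of \<mu>] by (auto simp: complex_is_Real_iff complex_eq_iff)
    then have "0 < Re (coef u f \<mu>) * Re (coef u f \<mu>)" by (simp add: zero_less_mult_iff linorder_neq_iff) linarith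
    moreover have "0 < (\<Prod>v\<in>UNIV. fact (\<mu> v) :: real)" by (intro prod_pos) simp
    ultimately show "0 < Re (coef u f \<mu>) * Re (coef u f \<mu>) * (\<Prod>v\<in>UNIV. fact (\<mu> v))" by simp
  qed
  have "pairing u f f ~= 0" if "pairing u f f = of_real r" "0 < r" for r :: real
    using that by simp
  then show ?thesis using sum pos by blast
qed

end

definition entry :: "'n \<times> 'm => complex^'m^'n => complex" where
  "entry = (%(i, j) w. w $ i $ j)"

lemma coordinates_entry: "coordinates (entry :: 'n::finite \<times> 'm::finite => _)"
  unfolding coordinates_def
proof
  fix c :: "'n \<times> 'm => complex"
  show "\<exists>w. \<forall>v. entry v w = c v" by (intro exI[of _ "\<chi> i j. c (i, j)"]) (auto simp: entry_def)
qed

lemma poly_funs_entry: "poly_funs (mat_coords :: (complex^'m::finite^'n::finite => complex) set) = wspan (mon entry) (%_. True)"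
proof -
  have "(mat_coords :: (complex^'m^'n => complex) set) = range entry"
    by (auto simp: mat_coords_def entry_def image_def split: prod.splits)
  then show ?thesis using poly_funs_eq_wspan[of "entry :: 'n \<times> 'm => _"] by argo
qed

lemma pd_entry: "pd i j (entry v) = (%_. if v = (i, j) then 1 else 0)"
proof (cases v)
  case (Pair a b)
  then have "entry v = (%w. w $ a $ b)" by (simp add: entry_def)
  then show ?thesis by (simp add: pd_coord Pair)
qed

lemma entry_poly: "entry v \<in> poly_funs mat_coords"
  unfolding poly_funs_entry using poly_funs_eq_wspan[of entry] by (metis poly_funs.coord rangeI)

lemma pd_entry_power:
  "pd i j (%w. entry v w ^ n) = (%w. if v = (i, j) then of_nat n * entry v w ^ (n - 1) else 0)"
proof (induction n)
  case 0
  show ?case by (simp add: pd_const fun_eq_iff)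
next
  case (Suc n)
  have "pd i j (%w. entry v w * entry v w ^ n) = (%w. pd i j (entry v) w * entry v w ^ n + entry v w * pd i j (%w. entry v w ^ n) w)"
    by (rule pd_mult[OF entry_poly poly_funs_power[OF entry_poly]])
  also have "\<dots> = (%w. if v = (i, j) then of_nat (Suc n) * entry v w ^ n else 0)"
    unfolding Suc.IH by (cases n) (auto simp: fun_eq_iff pd_entry algebra_simps)
  finally show ?case by (simp only: power_Suc diff_Suc_1)
qed

lemma pd_mon:
  "pd i j (mon entry \<mu>) = (%w. of_nat (\<mu> (i, j)) * mon entry (\<mu>((i, j) := \<mu> (i, j) - 1)) w)"
  for i :: "'n::finite" and j :: "'m::finite"
proof -
  have poly: "(%w. \<Prod>v\<in>S. entry v w ^ \<mu> v) \<in> poly_funs mat_coords" for S :: "('n \<times> 'm) set"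
    by (intro poly_funs_prod poly_funs_power entry_poly)
  have z: "pd i j (%w. \<Prod>v\<in>S. entry v w ^ \<mu> v) = (%_. 0)" if "(i, j) \<notin> S" for S :: "('n \<times> 'm) set"
    using finite[of S] that
  proof induction
    case empty
    show ?case by (simp add: pd_const)
  next
    case (insert v S)
    then show ?case by (auto simp: pd_mult poly poly_funs_power entry_poly pd_entry_power fun_eq_iff)
  qed
  have split: "mon entry \<nu> = (%w. entry (i, j) w ^ \<nu> (i, j) * (\<Prod>v\<in>UNIV - {(i, j)}. entry v w ^ \<nu> v))" for \<nu> :: "'n \<times> 'm => nat"
    unfolding mon_def[abs_def] by (rule ext, rule prod.remove) auto
  have "pd i j (mon entry \<mu>) = (%w. of_nat (\<mu> (i, j)) * entry (i, j) w ^ (\<mu> (i, j) - 1) * (\<Prod>v\<in>UNIV - {(i, j)}. entry v w ^ \<mu> v))"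
    unfolding split[of \<mu>] by (simp add: pd_mult poly poly_funs_power entry_poly pd_entry_power z)
  also have "\<dots> = (%w. of_nat (\<mu> (i, j)) * mon entry (\<mu>((i, j) := \<mu> (i, j) - 1)) w)"
    unfolding split[of "\<mu>((i, j) := \<mu> (i, j) - 1)"] by (auto simp: fun_eq_iff mult.assoc intro!: prod.cong)
  finally show ?thesis .
qed

lemma pairing_pd:
  assumes "f \<in> poly_funs mat_coords" "g \<in> poly_funs mat_coords"
  shows "pairing entry (%w. w $ i $ j * f w) g = pairing entry f (pd i j g)"
proof -
  have "pairing entry (%w. entry (i, j) w * f w) g = pairing entry f (pd i j g)"
    by (rule pairing_adjoint[OF coordinates_entry])
       (use assms in \<open>simp_all add: poly_funs_entry[symmetric] pd_add pd_cmult pd_mon pd_poly\<close>)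
  then show ?thesis by (simp add: entry_def)
qed

lemma pairing_pds:
  assumes "f \<in> poly_funs mat_coords" "g \<in> poly_funs mat_coords"
  shows "pairing entry (%w. (\<Prod>j\<leftarrow>L. w $ b j $ j) * f w) g = pairing entry f (pds b L g)"
  using assms(1)
proof (induction L arbitrary: f)
  case Nil
  then show ?case by (simp add: pds_simps)
next
  case (Cons j L)
  have "(%w. w $ b j $ j * f w) \<in> poly_funs mat_coords" by (intro poly_funs.mult mat_coord Cons.prems)
  from Cons.IH[OF this] have "pairing entry (%w. (\<Prod>j\<leftarrow>L. w $ b j $ j) * (w $ b j $ j * f w)) g
      = pairing entry (%w. w $ b j $ j * f w) (pds b L g)" .
  also have "\<dots> = pairing entry f (pd (b j) j (pds b L g))"
    by (rule pairing_pd[OF Cons.prems pds_poly[OF assms(2)]])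
  finally show ?case by (simp add: pds_simps mult_ac)
qed

lemma det_columns: "det w = (\<Sum>\<sigma> | \<sigma> permutes UNIV. of_int (sign \<sigma>) * (\<Prod>j\<leftarrow>col_list. w $ \<sigma> j $ j))"
  for w :: "complex^'m::finite^'m"
proof -
  have "(\<Prod>j\<leftarrow>col_list. w $ \<sigma> j $ j) = (\<Prod>j\<in>UNIV. w $ \<sigma> j $ j)" for \<sigma>
    by (simp add: prod.distinct_set_conv_list[OF col_list(1), symmetric] col_list(2))
  then have "(\<Sum>\<sigma> | \<sigma> permutes UNIV. of_int (sign \<sigma>) * (\<Prod>j\<leftarrow>col_list. w $ \<sigma> j $ j)) = det (transpose w)"
    by (simp add: det_def transpose_def)
  then show ?thesis by simp
qed

lemma det_poly: "det \<in> poly_funs mat_coords"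
  using poly_funs_det[of "%w. w" mat_coords] by (simp add: mat_coord)

lemma pairing_sum_left:
  assumes "!!i. i \<in> I ==> f i \<in> poly_funs mat_coords"
  shows "pairing entry (%w. \<Sum>i\<in>I. f i w) g = (\<Sum>i\<in>I. pairing entry (f i) g)"
  using assms
proof (induction I rule: infinite_finite_induct)
  case (insert x F)
  then show ?case
    by (simp add: pairing_add_left[OF coordinates_entry] poly_funs_entry[symmetric] poly_funs_sum)
qed (simp_all add: pairing_zero[OF coordinates_entry])

lemma pairing_sum_right:
  assumes "!!i. i \<in> I ==> f i \<in> poly_funs mat_coords"
  shows "pairing entry g (%w. \<Sum>i\<in>I. f i w) = (\<Sum>i\<in>I. pairing entry g (f i))"
  using assms
proof (induction I rule: infinite_finite_induct)
  case (insert x F)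
  then show ?case
    by (simp add: pairing_add_right[OF coordinates_entry] poly_funs_entry[symmetric] poly_funs_sum)
qed (simp_all add: pairing_zero[OF coordinates_entry])

lemma pairing_Omega:
  fixes f g :: "complex^'m::finite^'m => complex"
  assumes "f \<in> poly_funs mat_coords" "g \<in> poly_funs mat_coords"
  shows "pairing entry (%w. det w * f w) g = pairing entry f (Omega g)"
proof -
  have p: "(%w. (\<Prod>j\<leftarrow>L. w $ \<sigma> j $ j) * f w) \<in> poly_funs mat_coords" for \<sigma> and L :: "'m list"
  proof -
    have "(%w :: complex^'m^'m. \<Prod>j\<leftarrow>L. w $ \<sigma> j $ j) \<in> poly_funs mat_coords"
      by (induction L) (auto intro: poly_funs.intros mat_coord)
    then show ?thesis using assms(1) by (rule poly_funs.mult)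
  qed
  have "pairing entry (%w. det w * f w) g
      = pairing entry (%w. \<Sum>\<sigma> | \<sigma> permutes UNIV. of_int (sign \<sigma>) * ((\<Prod>j\<leftarrow>col_list. w $ \<sigma> j $ j) * f w)) g"
    by (simp add: det_columns sum_distrib_right mult.assoc)
  also have "\<dots> = (\<Sum>\<sigma> | \<sigma> permutes UNIV. of_int (sign \<sigma>) * pairing entry f (pds \<sigma> col_list g))"
    using p by (simp add: pairing_sum_left poly_funs_cmult pairing_cmult_left[OF coordinates_entry]
        poly_funs_entry[symmetric] pairing_pds[OF assms])
  also have "\<dots> = pairing entry f (Omega g)"
    unfolding Omega_def[abs_def]
    by (simp add: pairing_sum_right poly_funs_cmult pds_poly[OF assms(2)] pairing_cmult_right[OF coordinates_entry]
        poly_funs_entry[symmetric])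
  finally show ?thesis .
qed

lemma pairing_Omega_pow:
  fixes f g :: "complex^'m::finite^'m => complex"
  assumes "f \<in> poly_funs mat_coords" "g \<in> poly_funs mat_coords"
  shows "pairing entry (%w. det w ^ d * f w) g = pairing entry f (Omega_pow d g)"
  using assms(2)
proof (induction d arbitrary: g)
  case 0
  then show ?case by (simp add: Omega_pow_simps)
next
  case (Suc d)
  have "pairing entry (%w. det w * (det w ^ d * f w)) g = pairing entry (%w. det w ^ d * f w) (Omega g)"
    by (rule pairing_Omega) (intro poly_funs.mult poly_funs_power det_poly assms(1) Suc.prems)+
  then show ?case by (simp add: Suc.IH[OF Omega_poly[OF Suc.prems]] Omega_pow_simps mult.assoc)
qed

lemma pairing_one:
  assumes "f \<in> poly_funs (mat_coords :: (complex^'m::finite^'n::finite => complex) set)"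
  shows "pairing entry (%_. 1) f = f 0"
proof -
  have one: "(%_. 1) = mon (entry :: 'n \<times> 'm => _) (%_. 0)" by (rule ext) (simp add: mon_zero)
  have m0: "mon entry \<mu> (0 :: complex^'m^'n) = (if \<mu> = (%_. 0) then 1 else 0)" for \<mu>
  proof (cases "\<mu> = (%_. 0)")
    case True
    then show ?thesis by (simp add: mon_zero)
  next
    case False
    then have "\<exists>v. \<mu> v ~= 0" by (simp add: fun_eq_iff)
    then obtain v where "\<mu> v ~= 0" ..
    then have "entry v (0 :: complex^'m^'n) ^ \<mu> v = 0" by (simp add: entry_def case_prod_beta)
    then have "(\<Prod>v\<in>UNIV. entry v (0 :: complex^'m^'n) ^ \<mu> v) = 0"
      by (intro prod_zero[OF finite] bexI[of _ v] UNIV_I)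
    then show ?thesis using False by (simp add: mon_def)
  qed
  have "f \<in> wspan (mon entry) (%_. True)" using assms by (simp only: poly_funs_entry)
  then show ?thesis
  proof induction
    case zero
    show ?case by (simp add: pairing_zero[OF coordinates_entry])
  next
    case (step f \<mu> c)
    then show ?case
      by (simp add: pairing_add_right[OF coordinates_entry] wspan_cmult wspan_base
          pairing_cmult_right[OF coordinates_entry] one pairing_mon[OF coordinates_entry] m0)
  qed
qed

text \<open>By adjointness the value at \<open>0\<close> is the pairing of two powers of
  \<open>det\<close>. Different powers are homogeneous of different degrees and have no monomial in
  common.\<close>

lemma Omega_pow_det:
  "Omega_pow d (%w. det w ^ e) (0 :: complex^'m::finite^'m) = (if d = e then pairing entry (%w :: complex^'m^'m. det w ^ d) (%w. det w ^ d) else 0)"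
proof -
  let ?deg = "%\<mu> :: 'm \<times> 'm => nat. \<Sum>v\<in>UNIV. \<mu> v"
  have dp: "(%w :: complex^'m^'m. det w ^ k) \<in> poly_funs mat_coords" for k
    by (rule poly_funs_power[OF det_poly])
  have "Omega_pow d (%w. det w ^ e) (0 :: complex^'m^'m) = pairing entry (%_. 1) (Omega_pow d (%w :: complex^'m^'m. det w ^ e))"
    by (rule pairing_one[OF Omega_pow_poly[OF dp], symmetric])
  also have "\<dots> = pairing entry (%w. det w ^ d * 1) (%w :: complex^'m^'m. det w ^ e)"
    by (rule pairing_Omega_pow[symmetric]) (rule poly_funs.const, rule dp)
  finally have eq: "Omega_pow d (%w. det w ^ e) (0 :: complex^'m^'m) = pairing entry (%w. det w ^ d) (%w :: complex^'m^'m. det w ^ e)"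
    by simp
  have ent: "entry v \<in> wspan (mon entry) (%\<mu>. ?deg \<mu> = 1)" for v :: "'m \<times> 'm"
  proof -
    have "entry v = mon entry (%x. if x = v then 1 else 0)" by (simp add: fun_eq_iff mon_single)
    moreover have "mon entry (%x. if x = v then 1 else 0) \<in> wspan (mon entry) (%\<mu>. ?deg \<mu> = 1)"
      by (rule wspan_base) simp
    ultimately show ?thesis by (simp only:)
  qed
  have list: "(%w :: complex^'m^'m. \<Prod>j\<leftarrow>L. w $ \<sigma> j $ j) \<in> wspan (mon entry) (%\<mu>. ?deg \<mu> = length L)" for \<sigma> L
  proof (induction L)
    case Nil
    have "(%_. 1) = mon (entry :: 'm \<times> 'm => _) (%_. 0)" by (rule ext) (simp add: mon_zero)
    then show ?case using wspan_base[of "%\<mu>. ?deg \<mu> = 0" "%_. 0" "mon entry"] by simp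
  next
    case (Cons j L)
    have "(%w :: complex^'m^'m. entry (\<sigma> j, j) w * (\<Prod>j\<leftarrow>L. w $ \<sigma> j $ j)) \<in> wspan (mon entry) (%\<mu>. ?deg \<mu> = length (j # L))"
      by (rule wspan_mon_mult[OF ent Cons.IH]) (simp add: sum.distrib)
    then show ?case by (simp add: entry_def)
  qed
  have detw: "(det :: complex^'m^'m => complex) \<in> wspan (mon entry) (%\<mu>. ?deg \<mu> = CARD('m))"
  proof -
    have "length (col_list :: 'm list) = card (set (col_list :: 'm list))"
      by (rule distinct_card[OF col_list(1), symmetric])
    then have "length (col_list :: 'm list) = CARD('m)" by (simp only: col_list(2))
    then show ?thesis
      unfolding det_columns[abs_def] using list[of _ col_list] by (intro wspan_sum wspan_cmult) simp
  qed
  have pw: "(%w :: complex^'m^'m. det w ^ k) \<in> wspan (mon entry) (%\<mu>. ?deg \<mu> = k * CARD('m))" for k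
  proof (induction k)
    case 0
    have "(%_. 1) = mon (entry :: 'm \<times> 'm => _) (%_. 0)" by (rule ext) (simp add: mon_zero)
    then show ?case using wspan_base[of "%\<mu>. ?deg \<mu> = 0" "%_. 0" "mon entry"] by simp
  next
    case (Suc k)
    have "(%w :: complex^'m^'m. det w * det w ^ k) \<in> wspan (mon entry) (%\<mu>. ?deg \<mu> = Suc k * CARD('m))"
      by (rule wspan_mon_mult[OF detw Suc.IH]) (simp add: sum.distrib)
    then show ?case by simp
  qed
  have "pairing entry (%w. det w ^ d) (%w :: complex^'m^'m. det w ^ e) = 0" if "d ~= e"
    unfolding pairing_def
  proof (intro sum.neutral ballI)
    fix \<mu> :: "'m \<times> 'm => nat" assume "\<mu> \<in> {\<mu>. coef entry (%w :: complex^'m^'m. det w ^ d) \<mu> ~= 0}"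
    then have "?deg \<mu> = d * CARD('m)" using coef_support[OF coordinates_entry pw] by blast
    then have "?deg \<mu> ~= e * CARD('m)" using that by simp
    then have "coef entry (%w :: complex^'m^'m. det w ^ e) \<mu> = 0" using coef_support[OF coordinates_entry pw] by blast
    then show "coef entry (%w. det w ^ d) \<mu> * coef entry (%w :: complex^'m^'m. det w ^ e) \<mu> * (\<Prod>v\<in>UNIV. fact (\<mu> v)) = 0" by simp
  qed
  then show ?thesis using eq by simp
qed

text \<open>\<open>det\<close> commutes with complex conjugation of the entries, so uniqueness of
  coefficients makes those of its powers real.\<close>

lemma pairing_det_nonzero: "pairing entry (%w :: complex^'m::finite^'m. det w ^ d) (%w. det w ^ d) ~= 0"
proof (rule pairing_self_nonzero[OF coordinates_entry, where w = "mat 1"])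
  show p: "(%w :: complex^'m^'m. det w ^ d) \<in> wspan (mon entry) (%_. True)"
    unfolding poly_funs_entry[symmetric] by (rule poly_funs_power[OF det_poly])
  let ?f = "%w :: complex^'m^'m. det w ^ d" and ?K = "coef entry (%w :: complex^'m^'m. det w ^ d)"
  have fin: "finite {\<mu>. cnj (?K \<mu>) ~= 0}" using coef_props(1)[OF coordinates_entry p] by simp
  have "comb (mon entry) (%\<mu>. cnj (?K \<mu>)) w = ?f w" for w :: "complex^'m^'m"
  proof -
    let ?c = "\<chi> i j. cnj (w $ i $ j) :: complex^'m^'m"
    have "mon entry \<mu> w = cnj (mon entry \<mu> ?c)" for \<mu> :: "'m \<times> 'm => nat"
      by (simp add: mon_def entry_def case_prod_beta)
    then have "comb (mon entry) (%\<mu>. cnj (?K \<mu>)) w = cnj (comb (mon entry) ?K ?c)"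
      by (simp add: comb_def)
    also have "comb (mon entry) ?K ?c = ?f ?c" by (simp only: coef_props(2)[OF coordinates_entry p])
    also have "cnj (?f ?c) = ?f w" by (simp add: det_def)
    finally show ?thesis .
  qed
  then have "?K = (%\<mu>. cnj (?K \<mu>))" by (intro coef_eqI[OF coordinates_entry fin] ext)
  then have "?K \<mu> = cnj (?K \<mu>)" for \<mu> by (rule fun_cong)
  then show "?K \<mu> \<in> \<real>" for \<mu> by (metis Reals_cnj_iff)
  show "?f (mat 1) ~= 0" by simp
qed

section \<open>The invariants of the special linear group\<close>

text \<open>For an invariant of the special linear group the scaling of one column stands for the
  action of an arbitrary matrix of determinant \<open>\<delta>\<close>. The same expansion serves
  later to extend functions from the special linear group to all matrices.\<close>

lemma diag_expansion:
  fixes f :: "complex^'m::finite^'n::finite => complex"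
  assumes "f \<in> poly_funs mat_coords"
  shows "\<exists>P N. (\<forall>e. (%w. poly.coeff (P w) e) \<in> poly_funs mat_coords) & (\<forall>w. degree (P w) \<le> N) &
     (\<forall>w \<delta>. f (\<chi> r k. w $ r $ k * (if k = l then \<delta> else 1)) = poly (P w) \<delta>)"
  using assms
proof induction
  case (const c)
  show ?case
    by (intro exI[of _ "%_. [:c:]"] exI[of _ 0])
       (auto simp: coeff_pCons poly_funs.const split: nat.split)
next
  case (coord f)
  then obtain r k where f: "f = (%w. w $ r $ k)" by (auto simp: mat_coords_def)
  show ?case
  proof (cases "k = l")
    case True
    have "(%w :: complex^'m^'n. poly.coeff [:0, w $ r $ k:] e) \<in> poly_funs mat_coords" for e
      by (cases e; cases "e - 1") (simp_all add: poly_funs.const mat_coord)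
    then show ?thesis using True
      by (intro exI[of _ "%w. [:0, w $ r $ k:]"] exI[of _ 1]) (simp add: f mult.commute)
  next
    case False
    have "(%w :: complex^'m^'n. poly.coeff [:w $ r $ k:] e) \<in> poly_funs mat_coords" for e
      by (cases e) (simp_all add: poly_funs.const mat_coord)
    then show ?thesis using False
      by (intro exI[of _ "%w. [:w $ r $ k:]"] exI[of _ 0]) (simp add: f)
  qed
next
  case (add f g)
  then obtain P N Q M where P: "!!e. (%w. poly.coeff (P w) e) \<in> poly_funs mat_coords" "!!w. degree (P w) \<le> N"
    "!!w \<delta>. f (\<chi> r k. w $ r $ k * (if k = l then \<delta> else 1)) = poly (P w) \<delta>"
    and Q: "!!e. (%w. poly.coeff (Q w) e) \<in> poly_funs mat_coords" "!!w. degree (Q w) \<le> M"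
    "!!w \<delta>. g (\<chi> r k. w $ r $ k * (if k = l then \<delta> else 1)) = poly (Q w) \<delta>" by blast
  have "degree (P w + Q w) \<le> max N M" for w
    using P(2)[of w] Q(2)[of w] by (intro degree_add_le) auto
  then show ?case
    using P Q by (intro exI[of _ "%w. P w + Q w"] exI[of _ "max N M"]) (auto intro: poly_funs.add)
next
  case (mult f g)
  then obtain P N Q M where P: "!!e. (%w. poly.coeff (P w) e) \<in> poly_funs mat_coords" "!!w. degree (P w) \<le> N"
    "!!w \<delta>. f (\<chi> r k. w $ r $ k * (if k = l then \<delta> else 1)) = poly (P w) \<delta>"
    and Q: "!!e. (%w. poly.coeff (Q w) e) \<in> poly_funs mat_coords" "!!w. degree (Q w) \<le> M"
    "!!w \<delta>. g (\<chi> r k. w $ r $ k * (if k = l then \<delta> else 1)) = poly (Q w) \<delta>" by blast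
  have "degree (P w * Q w) \<le> N + M" for w
    using P(2)[of w] Q(2)[of w] degree_mult_le[of "P w" "Q w"] by linarith
  moreover have "(%w. poly.coeff (P w * Q w) e) \<in> poly_funs mat_coords" for e
    unfolding coeff_mult by (intro poly_funs_sum poly_funs.mult P(1) Q(1))
  ultimately show ?case
    using P(3) Q(3) by (intro exI[of _ "%w. P w * Q w"] exI[of _ "N + M"]) simp
qed

lemma minor_mult_right: "minor a (w ** h) = minor a w * det h"
proof -
  have "(\<chi> k l. (w ** h) $ a k $ l) = (\<chi> k l. w $ a k $ l) ** h"
    by (simp add: vec_eq_iff matrix_matrix_mult_def)
  then show ?thesis by (simp add: minor_def det_mul)
qed

lemma poly_eq_sum_le: "degree (p :: complex poly) \<le> N ==> poly p x = (\<Sum>e\<le>N. poly.coeff p e * x ^ e)"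
  unfolding poly_altdef by (rule sum.mono_neutral_left) (auto simp: coeff_eq_0)

text \<open>An invariant depends on \<open>g\<close> in \<open>f (w ** g)\<close> only through
  \<open>det g\<close>, so this is a polynomial in \<open>det g\<close> with coefficients depending
  on \<open>w\<close>. Applying \<open>Omega_pow d\<close> in \<open>g\<close> and evaluating at
  \<open>0\<close> isolates the coefficient of degree \<open>d\<close> up to a nonzero constant, and
  the result is a polynomial in the minors. At \<open>g = mat 1\<close> the coefficients add up to
  \<open>f w\<close>.\<close>

theorem SL_invariants_minors:
  assumes f: "f \<in> invariant_funs SL_group (SL_act :: complex^'m::finite^'m => complex^'m^'n::finite => complex^'m^'n)"
  shows "f \<in> poly_funs (range minor)"
proof -
  have poly: "f \<in> poly_funs mat_coords" using f by (rule invariant_funs_compose)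
  have inv: "f (w ** h) = f w" if "det h = 1" for w h
  proof -
    have "f (SL_act (transpose h) w) = f w" using f that by (simp add: invariant_funs_def SL_group_def)
    then show ?thesis by (simp add: SL_act_def)
  qed
  obtain l :: 'm where True by blast
  obtain P N where P: "!!e. (%w. poly.coeff (P w) e) \<in> poly_funs mat_coords" "!!w. degree (P w) \<le> N"
    "!!w \<delta>. f (\<chi> r k. w $ r $ k * (if k = l then \<delta> else 1)) = poly (P w) \<delta>"
    using diag_expansion[OF poly, of l] by blast
  define diag :: "complex => complex^'m^'m" where "diag \<delta> = (\<chi> i j. if i = j then (if i = l then \<delta> else 1) else 0)" for \<delta>
  have diag: "w ** diag \<delta> = (\<chi> r k. w $ r $ k * (if k = l then \<delta> else 1))" for w :: "complex^'m^'b::finite" and \<delta>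
    by (simp add: vec_eq_iff matrix_matrix_mult_def diag_def if_distrib[of "%x. _ * x"] cong: if_cong)
  have det_diag: "det (diag \<delta>) = \<delta>" for \<delta>
  proof -
    have "det (diag \<delta>) = (\<Prod>i\<in>UNIV. diag \<delta> $ i $ i)" by (rule det_diagonal) (simp add: diag_def)
    also have "\<dots> = (\<Prod>i\<in>UNIV. if i = l then \<delta> else 1)" by (simp add: diag_def)
    finally show ?thesis by simp
  qed
  \<comment> \<open>A matrix with nonzero determinant is the diagonal matrix
    \<open>diag (det g)\<close> times one of determinant 1, on which \<open>f\<close> does not
    depend.\<close>
  have gen: "f (w ** g) = poly (P w) (det g)" if "det g ~= 0" for w g
  proof -
    have "diag (det g) ** diag (1 / det g) = mat 1"
      using that unfolding diag by (auto simp: vec_eq_iff diag_def mat_def)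
    then have "w ** g = (w ** diag (det g)) ** (diag (1 / det g) ** g)"
      by (metis matrix_mul_assoc matrix_mul_rid)
    moreover have "det (diag (1 / det g) ** g) = 1" using that by (simp add: det_mul det_diag)
    ultimately have "f (w ** g) = f (w ** diag (det g))" using inv by simp
    then show ?thesis by (simp add: diag P(3))
  qed
  have all: "f (w ** g) = (\<Sum>e\<le>N. poly.coeff (P w) e * det g ^ e)" for w g
  proof -
    have "f (w ** g) - (\<Sum>e\<le>N. poly.coeff (P w) e * det g ^ e) = 0"
    proof (rule mat_poly_zero[where g = det and y = "mat 1" and f = "%g. f (w ** g) - (\<Sum>e\<le>N. poly.coeff (P w) e * det g ^ e)"])
      show "(%g. f (w ** g) - (\<Sum>e\<le>N. poly.coeff (P w) e * det g ^ e)) \<in> poly_funs mat_coords"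
        by (intro poly_funs_diff poly_right_mult poly poly_funs_sum poly_funs_cmult poly_funs_power det_poly)
      show "f (w ** x) - (\<Sum>e\<le>N. poly.coeff (P w) e * det x ^ e) = 0" if "det x ~= 0" for x
        using gen[OF that, of w] poly_eq_sum_le[OF P(2), of w] by simp
    qed (simp_all add: det_poly)
    then show ?thesis by simp
  qed
  have dp: "(%w :: complex^'m^'m. det w ^ k) \<in> poly_funs mat_coords" for k
    by (rule poly_funs_power[OF det_poly])
  have co: "(%w. poly.coeff (P w) d) \<in> poly_funs (range minor)" if "d \<le> N" for d
  proof -
    let ?c = "pairing entry (%w :: complex^'m^'m. det w ^ d) (%w. det w ^ d)"
    have "Omega_pow d (%g. f (w ** g)) 0 = (\<Sum>e\<le>N. poly.coeff (P w) e * Omega_pow d (%g :: complex^'m^'m. det g ^ e) 0)" for w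
      unfolding all by (simp add: Omega_pow_sum poly_funs_cmult dp Omega_pow_cmult)
    also have "\<dots> w = (\<Sum>e\<le>N. if e = d then poly.coeff (P w) d * ?c else 0)" for w
      by (intro sum.cong refl) (simp add: Omega_pow_det)
    finally have "Omega_pow d (%g. f (w ** g)) 0 = poly.coeff (P w) d * ?c" for w
      using that by simp
    then have "poly.coeff (P w) d = Omega_pow d (%g. f (w ** g)) 0 / ?c" for w
      by (simp add: pairing_det_nonzero)
    then have "(%w. poly.coeff (P w) d) = (%w. Omega_pow d (%g. f (w ** g)) 0 / ?c)" by (rule ext)
    then show ?thesis by (simp only: poly_funs_divide[OF Omega_pow_minors[OF poly]])
  qed
  have "f w = (\<Sum>e\<le>N. poly.coeff (P w) e)" for w using all[of w "mat 1"] by simp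
  then have "f = (%w. \<Sum>e\<le>N. poly.coeff (P w) e)" by (rule ext)
  moreover have "(%w. \<Sum>e\<le>N. poly.coeff (P w) e) \<in> poly_funs (range minor)"
    by (rule poly_funs_sum) (rule co, simp)
  ultimately show ?thesis by simp
qed

section \<open>Maximal minors\<close>

lemma column_wedge_nth: "column_wedge w $ a = minor a w"
  by (simp add: column_wedge_def wedge_def minor_def det_def sum_component tensor_of_def column_def)

lemma column_wedge_eq_iff: "column_wedge w = column_wedge w' \<longleftrightarrow> (\<forall>a. minor a w = minor a w')"
  by (simp add: vec_eq_iff column_wedge_nth)

lemma column_wedge_eq_0_iff: "column_wedge w = 0 \<longleftrightarrow> (\<forall>a. minor a w = 0)"
  by (simp add: vec_eq_iff column_wedge_nth)

lemma minor_poly: "minor a \<in> poly_funs mat_coords"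
  unfolding minor_def[abs_def] by (rule poly_funs_det) (simp add: mat_coord)

text \<open>Cauchy-Binet before sorting: the sum runs over all maps and not over subsets, in
  accordance with tensors indexed by all maps.\<close>

lemma det_rows_sum:
  fixes A :: "'m::finite => 'n::finite => complex" and w :: "complex^'m^'n"
  shows "det (\<chi> k l. \<Sum>r\<in>UNIV. A k r * w $ r $ l) = (\<Sum>f\<in>UNIV. (\<Prod>k\<in>UNIV. A k (f k)) * minor f w)"
proof -
  have "(\<Prod>k\<in>UNIV. \<Sum>r\<in>UNIV. A k r * w $ r $ p k) = (\<Sum>f\<in>UNIV. (\<Prod>k\<in>UNIV. A k (f k)) * (\<Prod>k\<in>UNIV. w $ f k $ p k))"
    for p :: "'m => 'm"
    by (subst prod_sum_PiE) (simp_all add: prod.distrib)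
  then have "det (\<chi> k l. \<Sum>r\<in>UNIV. A k r * w $ r $ l) =
      (\<Sum>p | p permutes UNIV. \<Sum>f\<in>UNIV. (\<Prod>k\<in>UNIV. A k (f k)) * (of_int (sign p) * (\<Prod>k\<in>UNIV. w $ f k $ p k)))"
    by (simp add: det_def sum_distrib_left mult_ac)
  also have "\<dots> = (\<Sum>f\<in>UNIV. \<Sum>p | p permutes UNIV. (\<Prod>k\<in>UNIV. A k (f k)) * (of_int (sign p) * (\<Prod>k\<in>UNIV. w $ f k $ p k)))"
    by (rule sum.swap)
  also have "\<dots> = (\<Sum>f\<in>UNIV. (\<Prod>k\<in>UNIV. A k (f k)) * minor f w)"
    by (simp add: minor_def det_def sum_distrib_left)
  finally show ?thesis .
qed

lemma minor_mult_left:
  fixes B :: "complex^'n::finite^'r::finite" and w :: "complex^'m::finite^'n"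
  shows "minor f (B ** w) = (\<Sum>f'\<in>UNIV. (\<Prod>k\<in>UNIV. B $ f k $ f' k) * minor f' w)"
  using det_rows_sum[of "%k r. B $ f k $ r" w] by (simp add: minor_def matrix_matrix_mult_def)

lemma tensor_act_column_wedge: "tensor_act g (column_wedge w) = column_wedge (g ** w)"
  by (simp add: vec_eq_iff tensor_act_def column_wedge_nth minor_mult_left)

lemma minor_permute:
  assumes "\<sigma> permutes UNIV"
  shows "minor (f \<circ> \<sigma>) w = of_int (sign \<sigma>) * minor f w"
  using det_permute_rows[OF assms, of "\<chi> k l. w $ f k $ l"] by (simp add: minor_def)

lemma full_rank_iff_minor:
  fixes w :: "complex^'m::finite^'n::finite"
  shows "full_rank w \<longleftrightarrow> (\<exists>a. minor a w ~= 0)"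
proof
  assume "full_rank w"
  then obtain B where "B ** w = mat 1" using full_rank_left_inverse by blast
  then have "minor id (B ** w) = 1" by (simp add: minor_def)
  then have "(\<Sum>f'\<in>UNIV. (\<Prod>k\<in>UNIV. B $ id k $ f' k) * minor f' w) ~= 0" by (simp add: minor_mult_left)
  then obtain f where "(\<Prod>k\<in>UNIV. B $ id k $ f k) * minor f w ~= 0" by (rule sum.not_neutral_contains_not_neutral)
  then show "\<exists>a. minor a w ~= 0" by (intro exI[of _ f]) simp
next
  assume "\<exists>a. minor a w ~= 0"
  then obtain a where a: "minor a w ~= 0" by blast
  let ?A = "(\<chi> k l. w $ a k $ l) :: complex^'m^'m"
  have inv: "invertible ?A" using a by (simp add: invertible_det_nz minor_def)
  show "full_rank w"
    unfolding full_rank_def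
  proof (intro allI impI)
    fix x assume "w *v x = 0"
    then have "?A *v x = 0" by (simp add: vec_eq_iff matrix_vector_mult_def)
    then show "x = 0" using inv matrix_left_invertible_ker[of ?A] unfolding invertible_def by blast
  qed
qed

lemma column_wedge_nonzero_iff: "column_wedge w ~= 0 \<longleftrightarrow> full_rank w"
  by (simp add: column_wedge_eq_0_iff full_rank_iff_minor)

lemma column_wedge_0: "column_wedge (0 :: complex^'m::finite^'n::finite) = 0"
proof (rule ccontr)
  assume "column_wedge (0 :: complex^'m^'n) ~= 0"
  then have "full_rank (0 :: complex^'m^'n)" by (simp only: column_wedge_nonzero_iff)
  then have "(axis undefined 1 :: complex^'m) = 0" unfolding full_rank_def by simp
  then have "(axis undefined 1 :: complex^'m) $ undefined = 0" by simp
  then show False by (simp add: axis_def)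
qed

section \<open>Pluecker coordinates and the affine charts of the cone\<close>

text \<open>The rows selected by \<open>f\<close> form a basis. Cramer's rule gives the coordinates
  of row \<open>r\<close>, replacement of a selected row by \<open>r\<close> being the update
  \<open>f(l := r)\<close>.\<close>

lemma minor_cramer:
  fixes w :: "complex^'m::finite^'n::finite"
  assumes "minor f w ~= 0"
  shows "w $ r = (\<Sum>l\<in>UNIV. (minor (f(l := r)) w / minor f w) *s w $ f l)"
proof -
  let ?A = "(\<chi> k l. w $ f k $ l) :: complex^'m^'m"
  have row: "row i ?A = w $ f i" for i by (simp add: row_def)
  have "invertible ?A" using assms by (simp add: invertible_det_nz minor_def)
  then obtain B where "B ** ?A = mat 1" unfolding invertible_def by blast
  then have "transpose ?A ** transpose B = mat 1" by (metis matrix_transpose_mul transpose_mat)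
  then have "transpose ?A *v (transpose B *v w $ r) = w $ r"
    by (metis matrix_vector_mul_assoc matrix_vector_mul_lid)
  then obtain y where y: "transpose ?A *v y = w $ r" by blast
  have sum: "(\<Sum>i\<in>UNIV. y $ i *s row i ?A) = w $ r"
    unfolding y[symmetric] row by (simp add: vec_eq_iff sum_component matrix_vector_mult_def transpose_def mult.commute)
  have sum': "(\<Sum>i\<in>UNIV. y $ i *s w $ f i) = w $ r" using sum unfolding row .
  have "minor (f(l := r)) w = y $ l * minor f w" for l
  proof -
    have "(\<chi> i. if i = l then \<Sum>i\<in>UNIV. y $ i *s row i ?A else row i ?A) = (\<chi> k c. w $ (f(l := r)) k $ c)"
      unfolding row sum' by (simp add: vec_eq_iff)
    then show ?thesis using cramer_lemma_transpose[of l y ?A] by (simp only: minor_def)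
  qed
  then show ?thesis using assms sum' by simp
qed

text \<open>The affine chart of the Grassmannian where \<open>t f ~= 0\<close>: for Pluecker
  coordinates \<open>t\<close> it is the representative whose rows selected by \<open>f\<close> form
  the identity matrix.\<close>

definition ratio_matrix :: "('m::finite => 'n) => (('m => 'n) => complex) => complex^'m^'n" where
  "ratio_matrix f t = (\<chi> r l. t (f(l := r)) / t f)"

definition scale_column :: "complex => complex^'m^'m" where
  "scale_column d = (\<chi> i j. if i = j then (if i = undefined then d else 1) else 0)"

lemma det_scale_column [simp]: "det (scale_column d :: complex^'m::finite^'m) = d"
proof -
  have "det (scale_column d :: complex^'m^'m) = (\<Prod>i\<in>UNIV. (scale_column d :: complex^'m^'m) $ i $ i)"
    by (rule det_diagonal) (simp add: scale_column_def)
  also have "\<dots> = (\<Prod>i\<in>UNIV. if i = (undefined :: 'm) then d else 1)" by (simp add: scale_column_def)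
  finally show ?thesis by simp
qed

text \<open>The ratio matrix has the minors \<open>t\<close> only up to the factor
  \<open>t f\<close>; scaling a single column corrects this. For Pluecker coordinates this gives a
  rational section of \<open>column_wedge\<close>, whose only denominator is
  \<open>t f\<close>.\<close>

definition plucker_matrix :: "('m::finite => 'n) => (('m => 'n) => complex) => complex^'m^'n" where
  "plucker_matrix f t = ratio_matrix f t ** scale_column (t f)"

lemma plucker_matrix_nth:
  "plucker_matrix f t $ r $ l = t (f(l := r)) * (if l = undefined then t f / t f else 1 / t f)"
  unfolding plucker_matrix_def
  by (simp add: matrix_matrix_mult_def scale_column_def ratio_matrix_def if_distrib[of "%x. _ * x"] cong: if_cong)

lemma minor_ratio_matrix:
  fixes f g :: "'m::finite => 'n::finite"
  assumes "t f ~= 0"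
  shows "minor g (ratio_matrix f t) * t f ^ CARD('m) = det (\<chi> k l. t (f(l := g k)))"
proof -
  have "det (\<chi> k. t f *s (\<chi> l. t (f(l := g k)) / t f)) = (\<Prod>k\<in>(UNIV :: 'm set). t f) * det (\<chi> k. \<chi> l. t (f(l := g k)) / t f)"
    by (rule det_rows_mul)
  moreover have "(\<chi> k. t f *s (\<chi> l. t (f(l := g k)) / t f)) = (\<chi> k l. t (f(l := g k)))"
    using assms by (simp add: vec_eq_iff)
  ultimately show ?thesis by (simp add: minor_def ratio_matrix_def mult.commute)
qed

lemma ratio_matrix_mult:
  fixes w :: "complex^'m::finite^'n::finite"
  assumes "minor f w ~= 0"
  shows "w = ratio_matrix f (%a. minor a w) ** (\<chi> k l. w $ f k $ l)"
proof -
  have "w $ r $ c = (ratio_matrix f (%a. minor a w) ** (\<chi> k l. w $ f k $ l)) $ r $ c" for r c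
    by (subst minor_cramer[OF assms, of r]) (simp add: ratio_matrix_def matrix_matrix_mult_def sum_component)
  then show ?thesis unfolding vec_eq_iff by blast
qed

text \<open>The minors of the ratio matrix computed in two ways, with denominators cleared. As a
  polynomial identity between minors it is preserved by every homomorphism on the
  invariants.\<close>

lemma plucker_relation:
  fixes w :: "complex^'m::finite^'n::finite"
  shows "minor f w ^ CARD('m) * minor g w = minor f w * det (\<chi> k l. minor (f(l := g k)) w)"
proof (cases "minor f w = 0")
  case False
  have "minor g w = minor g (ratio_matrix f (%a. minor a w) ** (\<chi> k l. w $ f k $ l))"
    using ratio_matrix_mult[OF False] by simp
  also have "\<dots> = minor g (ratio_matrix f (%a. minor a w)) * minor f w"
    by (simp add: minor_mult_right) (simp add: minor_def)
  finally have "minor f w ^ CARD('m) * minor g w =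
      minor f w * (minor g (ratio_matrix f (%a. minor a w)) * minor f w ^ CARD('m))" by simp
  then show ?thesis using minor_ratio_matrix[of "%a. minor a w" f g] False by simp
qed simp

lemma minor_plucker_matrix:
  fixes f g :: "'m::finite => 'n::finite"
  assumes "t f ~= 0" and rel: "t f ^ CARD('m) * t g = t f * det (\<chi> k l. t (f(l := g k)))"
  shows "minor g (plucker_matrix f t) = t g"
proof -
  have "t f ^ CARD('m) * t g = t f * (minor g (ratio_matrix f t) * t f ^ CARD('m))"
    using rel minor_ratio_matrix[of t f g] assms(1) by simp
  then have "t g = t f * minor g (ratio_matrix f t)" using assms(1) by simp
  then show ?thesis by (simp add: plucker_matrix_def minor_mult_right)
qed

text \<open>\<open>w\<close> is its ratio matrix times the block \<open>?A\<close> of selected rows.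
  The inverse of this block followed by the column scaling has determinant 1 because the scaling
  factor is \<open>det ?A\<close>.\<close>

lemma plucker_matrix_orbit:
  fixes w :: "complex^'m::finite^'n::finite"
  assumes "minor f w ~= 0"
  shows "\<exists>h. det h = 1 & plucker_matrix f (%a. minor a w) = w ** h"
proof -
  let ?A = "(\<chi> k l. w $ f k $ l) :: complex^'m^'m" and ?R = "ratio_matrix f (%a. minor a w)"
  have dA: "det ?A = minor f w" by (simp add: minor_def)
  then have "invertible ?A" using assms by (simp add: invertible_det_nz)
  then obtain B where B: "?A ** B = mat 1" unfolding invertible_def by blast
  then have dB: "det ?A * det B = 1" by (metis det_mul det_I)
  have eq: "w ** (B ** scale_column (minor f w)) = ?R ** (?A ** B) ** scale_column (minor f w)"
    using ratio_matrix_mult[OF assms] by (metis matrix_mul_assoc)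
  have "plucker_matrix f (%a. minor a w) = w ** (B ** scale_column (minor f w))"
    unfolding eq B plucker_matrix_def by simp
  moreover have "det (B ** scale_column (minor f w)) = 1" using dA dB by (simp add: det_mul mult.commute)
  ultimately show ?thesis by blast
qed

lemma column_wedge_mult_SL: "det h = 1 ==> column_wedge (w ** h) = column_wedge w"
  by (simp add: column_wedge_eq_iff minor_mult_right)

lemma column_wedge_SL_act: "h \<in> carrier SL_group ==> column_wedge (SL_act h w) = column_wedge w"
  unfolding SL_act_def by (rule column_wedge_mult_SL) (simp add: SL_group_def)

text \<open>Both matrices are conjugate to the same \<open>plucker_matrix\<close>, which depends on
  the minors only.\<close>

lemma full_SL_conjugate:
  fixes w w' :: "complex^'m::finite^'n::finite"
  assumes "column_wedge w = column_wedge w'" "column_wedge w ~= 0"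
  shows "\<exists>h\<in>carrier SL_group. SL_act h w = w'"
proof -
  obtain f where f: "minor f w ~= 0" using assms(2) by (auto simp: column_wedge_eq_0_iff)
  have eq: "(%a. minor a w) = (%a. minor a w')" using assms(1) by (auto simp: column_wedge_eq_iff)
  have f': "minor f w' ~= 0" using f fun_cong[OF eq, of f] by simp
  obtain h where h: "det h = 1" "plucker_matrix f (%a. minor a w) = w ** h" using plucker_matrix_orbit[OF f] by blast
  obtain k where k: "det k = 1" "plucker_matrix f (%a. minor a w') = w' ** k" using plucker_matrix_orbit[OF f'] by blast
  have "invertible k" using k(1) by (simp add: invertible_det_nz)
  then obtain k' where k': "k ** k' = mat 1" unfolding invertible_def by blast
  then have "det k * det k' = 1" by (metis det_mul det_I)
  then have dk: "det k' = 1" using k(1) by simp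
  have "w' = w' ** (k ** k')" by (simp add: k')
  also have "\<dots> = w ** h ** k'" using h(2) k(2) eq by (simp add: matrix_mul_assoc)
  finally have "SL_act (transpose (h ** k')) w = w'" by (simp add: SL_act_def matrix_mul_assoc)
  moreover have "transpose (h ** k') \<in> carrier SL_group" using h(1) dk by (simp add: SL_group_def det_mul)
  ultimately show ?thesis by blast
qed

section \<open>The cone as the quotient by the special linear group\<close>

lemma points_grassmann_cone: "points grassmann_cone = range (column_wedge :: complex^'m::finite^'n::finite => _)"
proof (intro Set.set_eqI iffI)
  fix T :: "complex^('m => 'n)" assume "T \<in> points grassmann_cone"
  then obtain v where "T = wedge v" by (auto simp: grassmann_cone_def)
  then have "T = column_wedge (\<chi> r k. v k $ r)" by (simp add: column_wedge_def column_def)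
  then show "T \<in> range (column_wedge :: complex^'m^'n => _)" by (rule range_eqI)
next
  fix T assume "T \<in> range (column_wedge :: complex^'m^'n => _)"
  then obtain w :: "complex^'m^'n" where T: "T = column_wedge w" by blast
  have "T \<in> exterior_power"
    unfolding exterior_power_def T by (simp add: column_wedge_nth minor_permute)
  moreover have "T = wedge (%k. column k w)" by (simp add: T column_wedge_def)
  ultimately show "T \<in> points grassmann_cone" by (auto simp: grassmann_cone_def)
qed

lemma regular_grassmann_cone: "regular grassmann_cone = poly_funs vec_coords"
  by (simp add: grassmann_cone_def)

lemma column_wedge_poly: "F \<in> poly_funs vec_coords ==> (%w. F (column_wedge w)) \<in> poly_funs mat_coords"
  by (rule poly_funs_compose_vec) (auto simp: column_wedge_nth minor_poly)

theorem SL_invariants: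
  fixes act :: "_ => complex^'m::finite^'n::finite => complex^'m^'n"
  assumes act: "act = SL_act"
  shows "invariant_funs SL_group act = {(%w. F (column_wedge w)) | F. F \<in> poly_funs vec_coords}"
proof (intro Set.set_eqI iffI)
  fix f assume "f \<in> invariant_funs SL_group act"
  then have "f \<in> poly_funs (range minor)" using SL_invariants_minors unfolding act by blast
  then have "\<exists>F\<in>poly_funs vec_coords. f = (%w. F (column_wedge w))"
  proof induction
    case (const c)
    show ?case by (rule bexI[of _ "%_. c"]) (simp_all add: poly_funs.const)
  next
    case (coord f)
    then obtain a where "f = minor a" by blast
    then show ?case by (intro bexI[of _ "%v. v $ a"]) (simp_all add: vec_coord column_wedge_nth fun_eq_iff)
  next
    case (add f g)
    then obtain F G where "F \<in> poly_funs vec_coords" "G \<in> poly_funs vec_coords"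
      "f = (%w. F (column_wedge w))" "g = (%w. G (column_wedge w))" by blast
    then show ?case by (intro bexI[of _ "%x. F x + G x"]) (simp_all add: poly_funs.add)
  next
    case (mult f g)
    then obtain F G where "F \<in> poly_funs vec_coords" "G \<in> poly_funs vec_coords"
      "f = (%w. F (column_wedge w))" "g = (%w. G (column_wedge w))" by blast
    then show ?case by (intro bexI[of _ "%x. F x * G x"]) (simp_all add: poly_funs.mult)
  qed
  then obtain F where "F \<in> poly_funs vec_coords" "f = (%w. F (column_wedge w))" by (elim bexE)
  then show "f \<in> {(%w. F (column_wedge w)) | F. F \<in> poly_funs vec_coords}"
    by (intro CollectI exI[of _ F] conjI)
next
  fix f :: "complex^'m^'n => complex" assume "f \<in> {(%w. F (column_wedge w)) | F. F \<in> poly_funs vec_coords}"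
  then obtain F where F: "F \<in> poly_funs vec_coords" "f = (%w. F (column_wedge w))" by (elim CollectE exE conjE)
  show "f \<in> invariant_funs SL_group act"
    unfolding F(2) act invariant_funs_def
    by (rule CollectI) (use column_wedge_poly[OF F(1)] in \<open>simp add: mat_space_def column_wedge_SL_act\<close>)
qed

lemma SL_quotient_iso:
  defines "act \<equiv> SL_act :: _ => ('m::finite, 'p::finite, 'q::finite) W_space => ('m, 'p, 'q) W_space"
  shows "\<exists>\<iota>. variety_iso (affine_quotient SL_group act) grassmann_cone \<iota> &
           (\<forall>w. \<iota> (aff_quotient_map SL_group act w) = column_wedge w) &
           equivariant OSp_group (points (affine_quotient SL_group act))
             (quotient_act SL_group act OSp_act) OSp_cone_act \<iota>"
proof (rule quotient_iso[where B = vec_coords])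
  show inv: "invariant_funs SL_group act = {(%w. F (column_wedge w)) | F. F \<in> poly_funs vec_coords}"
    by (rule SL_invariants) (simp add: act_def)
  show "x = y" if "!!F. F \<in> vec_coords ==> F x = F y" for x y :: "complex^('m => 'p + ('q + 'q))"
  proof -
    have "x $ a = y $ a" for a using that[of "%v. v $ a"] by (auto simp: vec_coords_def)
    then show ?thesis unfolding vec_eq_iff by blast
  qed
  show "points grassmann_cone = range (column_wedge :: ('m, 'p, 'q) W_space => _)" by (rule points_grassmann_cone)
  show "regular grassmann_cone = poly_funs vec_coords" by (rule regular_grassmann_cone)
  show "column_wedge (OSp_act g w) = OSp_cone_act g (column_wedge w)" for g and w :: "('m, 'p, 'q) W_space"
    by (simp add: OSp_act_def OSp_cone_act_def tensor_act_column_wedge)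
  show "(%x. F (OSp_cone_act g x)) \<in> poly_funs vec_coords" if "F \<in> poly_funs vec_coords"
    for g :: "(complex^'p^'p) \<times> (complex^('q + 'q)^('q + 'q))" and F :: "complex^('m => 'p + ('q + 'q)) => complex"
    by (rule poly_funs_compose_vec[OF that])
       (simp add: OSp_cone_act_def tensor_act_def poly_funs_sum poly_funs_cmult vec_coord)
  show "\<exists>w. \<xi> = aff_quotient_map SL_group act w" if \<xi>: "\<xi> \<in> points (affine_quotient SL_group act)" for \<xi>
  proof -
    define z where "z = (\<chi> a. \<xi> (%w. minor a w))"
    have invI: "(%w. F (column_wedge w)) \<in> invariant_funs SL_group act" if "F \<in> poly_funs vec_coords" for F
      unfolding inv by (rule CollectI, rule exI[of _ F]) (simp add: that)
    have ev: "\<xi> (%w. F (column_wedge w)) = F z" if "F \<in> poly_funs vec_coords" for F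
      by (rule algebra_points_eval[OF \<xi> that invI]) (auto simp: vec_coords_def z_def column_wedge_nth)
    have "\<exists>w :: ('m, 'p, 'q) W_space. column_wedge w = z"
    proof (cases "z = 0")
      case True
      have "column_wedge (0 :: ('m, 'p, 'q) W_space) = 0"
        by (rule column_wedge_0)
      then show ?thesis using True by blast
    next
      case False
      then obtain f where f: "z $ f ~= 0" by (auto simp: vec_eq_iff)
      \<comment> \<open>The relations hold for the coordinates of \<open>\<xi>\<close> because
        \<open>\<xi>\<close> maps the zero function to zero. They suffice to realise
        \<open>z\<close> by a matrix in the chart of \<open>f\<close>.\<close>
      have rel: "z $ f ^ CARD('m) * z $ g = z $ f * det (\<chi> k l. z $ (f(l := g k)))" for g
      proof -
        let ?F = "%x :: complex^('m => 'p + ('q + 'q)). x $ f ^ CARD('m) * x $ g - x $ f * det (\<chi> k l. x $ (f(l := g k)))"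
        have "?F \<in> poly_funs vec_coords"
          by (intro poly_funs_diff poly_funs.mult poly_funs_power vec_coord poly_funs_det) (simp add: vec_coord)
        then have "\<xi> (%w. ?F (column_wedge w)) = ?F z" by (rule ev)
        also have "(%w :: ('m, 'p, 'q) W_space. ?F (column_wedge w)) = (%_. 0)"
          by (simp add: column_wedge_nth plucker_relation)
        also have "\<xi> (%_. 0) = 0" using \<xi> by (simp add: affine_quotient_def algebra_points_def)
        finally have "?F z = 0" by (rule sym)
        then show ?thesis by (simp only: right_minus_eq)
      qed
      have "minor g (plucker_matrix f (%a. z $ a)) = z $ g" for g
        by (rule minor_plucker_matrix) (use f rel in auto)
      then have "column_wedge (plucker_matrix f (%a. z $ a)) = z" by (simp add: vec_eq_iff column_wedge_nth)
      then show ?thesis by blast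
    qed
    then obtain w :: "('m, 'p, 'q) W_space" where w: "column_wedge w = z" by blast
    have ext: "\<xi> \<in> extensional (invariant_funs SL_group act)"
      using \<xi> by (simp add: affine_quotient_def algebra_points_def)
    have "\<xi> f = aff_quotient_map SL_group act w f" for f
    proof (cases "f \<in> invariant_funs SL_group act")
      case True
      then obtain F where F: "F \<in> poly_funs vec_coords" "f = (%w. F (column_wedge w))"
        unfolding inv by (elim CollectE exE conjE)
      show ?thesis
        unfolding quotient_map_apply[OF True] using ev[OF F(1)] by (simp add: F(2) w)
    next
      case False
      then show ?thesis using extensional_arb[OF ext False] by (simp add: aff_quotient_map_def)
    qed
    then show ?thesis by blast
  qed
qed

section \<open>Degenerate pencils\<close>

lemma bform_add_form: "bform (b + c) x y = bform b x y + bform c x y"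
  by (simp add: bform_def sum.distrib distrib_left distrib_right)

lemma bform_sum_right: "bform b x (\<Sum>i\<in>I. f i) = (\<Sum>i\<in>I. bform b x (f i))"
  by (induction I rule: infinite_finite_induct) (simp_all add: bform_add_right)

lemma prod_power_int: "t ~= 0 ==> (\<Prod>i\<in>I. t powi e i) = (t :: complex) powi (\<Sum>i\<in>I. e i)"
  by (induction I rule: infinite_finite_induct) (simp_all add: power_int_add)

text \<open>If \<open>A\<close> were injective on the span, applying \<open>S + c j A\<close> to a
  relation between the \<open>u n\<close> would remove its \<open>j\<close>-th term and scale the
  others by nonzero factors, as with eigenvectors for distinct eigenvalues. All \<open>u n\<close>
  would be independent, which the finite dimension forbids.\<close>

lemma pencil_common_kernel:
  fixes S A :: "complex^'m::finite^'m" and u :: "nat => complex^'m" and c :: "nat => complex"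
  assumes u: "!!n. u n ~= 0" "!!n z. bform S z (u n) = - c n * bform A z (u n)" and c: "inj c"
  shows "\<exists>x\<in>vec.span (range u). x ~= 0 & (\<forall>z. bform A z x = 0)"
proof (rule ccontr)
  assume "~ ?thesis"
  then have inj: "x = 0" if "x \<in> vec.span (range u)" "!!z. bform A z x = 0" for x using that by blast
  have indep: "\<forall>n\<in>F. k n = 0" if "finite F" "(\<Sum>n\<in>F. k n *s u n) = 0" for F and k :: "nat => complex"
    using that
  proof (induction F arbitrary: k rule: finite_induct)
    case (insert j F)
    let ?x = "\<Sum>n\<in>insert j F. k n *s u n" and ?y = "\<Sum>n\<in>F. (k n * (c j - c n)) *s u n"
    have "bform A z ?y = 0" for z
    proof -
      have "bform S z ?x + c j * bform A z ?x = bform A z ?y"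
        using insert.hyps
        by (simp add: bform_sum_right bform_add_right bform_scale_right u(2) sum_distrib_left)
           (simp add: sum_distrib_left sum.distrib[symmetric] ring_distribs mult_ac)
      then show ?thesis using insert.prems by simp
    qed
    moreover have "?y \<in> vec.span (range u)"
      by (intro vec.span_sum vec.span_scale vec.span_base rangeI)
    ultimately have "?y = 0" by (intro inj)
    then have "\<forall>n\<in>F. k n * (c j - c n) = 0" by (rule insert.IH)
    moreover have "c j - c n ~= 0" if "n \<in> F" for n
      using that insert.hyps(2) injD[OF c, of j n] by auto
    ultimately have k: "\<forall>n\<in>F. k n = 0" by simp
    then have "k j *s u j = 0" using insert.prems insert.hyps by simp
    then show ?case using k u(1) by simp
  qed simp
  have inj_u: "inj u"
  proof (rule injI, rule ccontr)
    fix i j assume "u i = u j" "i ~= j"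
    then show False using indep[of "{i, j}" "%n. if n = i then 1 else -1"] by simp
  qed
  let ?N = "{..CARD('m)}"
  have "vec.independent (u ` ?N)"
  proof (rule vec.independent_if_scalars_zero)
    show "finite (u ` ?N)" by simp
    fix f x assume f: "(\<Sum>x\<in>u ` ?N. f x *s x) = 0" and x: "x \<in> u ` ?N"
    have "(\<Sum>n\<in>?N. f (u n) *s u n) = 0"
      using f by (subst (asm) sum.reindex) (auto intro: inj_on_subset[OF inj_u])
    then have "\<forall>n\<in>?N. f (u n) = 0" by (intro indep) simp_all
    then show "f x = 0" using x by blast
  qed
  then have "card (u ` ?N) \<le> CARD('m)"
    using vec.independent_card_le_dim[of "u ` ?N" UNIV] by (simp add: card_cart_basis)
  moreover have "card (u ` ?N) = Suc (CARD('m))"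
    using card_image[OF inj_on_subset[OF inj_u subset_UNIV], of ?N] by simp
  ultimately show False by simp
qed

text \<open>
  The eigenvectors of the pencil span a subspace \<open>U\<close> on which \<open>S + A\<close> vanishes and whose orthogonal space has
  codimension less than \<open>dim U\<close>; a one-parameter subgroup of weights \<open>-codim U\<^sup>\<bottom>\<close> on \<open>U\<close>, \<open>0\<close> on \<open>U\<^sup>\<bottom> / U\<close> and
  \<open>dim U\<close> on the rest has determinant 1 and contracts \<open>S + A\<close> to a form with \<open>U\<close> in its kernels.
\<close>

theorem degenerate_pencil_limit:
  fixes S A :: "complex^'m::finite^'m"
  assumes S: "S \<in> Sym_space" and A: "A \<in> Alt_space"
    and deg: "!!z. det (\<chi> i j. S $ i $ j + z * A $ i $ j) = 0"
  shows "\<exists>T'\<in>closure {congr_act h (S + A) | h. det h = 1}. \<exists>u. u ~= 0 & T' *v u = 0 & transpose T' *v u = 0"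
proof -
  have eS: "eps_symmetric 1 S" by (rule eps_symmetricI) (simp only: mult_1, rule Sym_spaceD[OF S])
  have eA: "eps_symmetric (-1) A" by (rule eps_symmetricI) (simp only: mult_minus1, rule Alt_spaceD[OF A])
  have s: "bform S x y = bform S y x" for x y
    using eps_symmetricD[OF eS, of x y] unfolding mult_1 .
  have a: "bform A x y = - bform A y x" for x y
    using eps_symmetricD[OF eA, of x y] unfolding mult_minus1 .
  \<comment> \<open>Distinct parameters with \<open>c i + c j ~= 0\<close> for all \<open>i\<close>
    and \<open>j\<close>, the case \<open>i = j\<close> included; positive integers qualify.\<close>
  define c where "c n = complex_of_nat (Suc n)" for n
  have "\<exists>v. v ~= 0 & (\<forall>z. bform S z v = - c n * bform A z v)" for n
  proof -
    let ?P = "(\<chi> i j. S $ i $ j + c n * A $ i $ j) :: complex^'m^'m"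
    have "~ invertible ?P" using deg[of "c n"] by (simp add: invertible_det_nz)
    then obtain v where v: "v ~= 0" "?P *v v = 0"
      using matrix_left_invertible_ker[of ?P] invertible_left_inverse[of ?P] by blast
    have "bform S z v + c n * bform A z v = bform (mat 1) z (?P *v v)" for z
      unfolding bform_matrix_vector
      by (simp add: bform_def sum_distrib_left sum.distrib[symmetric] algebra_simps)
    then have "bform S z v + c n * bform A z v = 0" for z by (simp add: v(2))
    then have "bform S z v = - c n * bform A z v" for z by (simp add: eq_neg_iff_add_eq_0)
    then show ?thesis using v(1) by blast
  qed
  then obtain u where u: "!!n. u n ~= 0" "!!n z. bform S z (u n) = - c n * bform A z (u n)" by metis
  have cn: "c i + c j ~= 0" for i j
    unfolding c_def of_nat_add[symmetric] of_nat_eq_0_iff by simp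
  have inj_c: "inj c" by (rule injI) (simp add: c_def)
  let ?U = "vec.span (range u)"
  obtain x0 where x0: "x0 \<in> ?U" "x0 ~= 0" "!!z. bform A z x0 = 0"
    using pencil_common_kernel[OF u inj_c] by blast
  \<comment> \<open>On two eigenvectors, symmetry of \<open>S\<close> and skew symmetry of
    \<open>A\<close> give \<open>(c i + c j) * bform A (u i) (u j) = 0\<close>.\<close>
  have iso: "bform A x y = 0" if "x \<in> ?U" "y \<in> ?U" for x y
  proof -
    have uu: "bform A (u i) (u j) = 0" for i j
    proof -
      have "- c j * bform A (u i) (u j) = - c i * bform A (u j) (u i)"
        using u(2)[of "u i" j] u(2)[of "u j" i] s[of "u i" "u j"] by simp
      also have "\<dots> = c i * bform A (u i) (u j)" by (simp add: a[of "u j" "u i"])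
      finally have f: "- c j * bform A (u i) (u j) = c i * bform A (u i) (u j)" .
      have "(c i + c j) * bform A (u i) (u j) = 0" unfolding distrib_right f[symmetric] by simp
      then show ?thesis using cn by simp
    qed
    have xu: "bform A x (u j) = 0" for j
      using that(1) by (induction rule: vec.span_induct_alt) (auto simp: bform_add_left bform_scale_left uu)
    show ?thesis
      using that(2) by (induction rule: vec.span_induct_alt) (auto simp: bform_add_right bform_scale_right xu)
  qed
  obtain B1 where B1: "{x0} \<subseteq> B1" "B1 \<subseteq> ?U" "vec.independent B1" "?U \<subseteq> vec.span B1"
    by (rule vec.maximal_independent_subset_extend[of "{x0}" ?U]) (use x0 in auto)
  \<comment> \<open>As \<open>x0\<close> is in the kernel of \<open>A\<close>, leaving it out does
    not change the orthogonal space, but it lowers the bound on the codimension to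
    \<open>card B1 - 1\<close>. This strict inequality is what makes the weights contract.\<close>
  let ?V = "perp A (B1 - {x0})"
  have UV: "?U \<subseteq> ?V" using iso B1(2) by (auto simp: perp_def)
  have AV: "bform A y x = 0" if "x \<in> ?V" "y \<in> ?U" for x y
  proof -
    have bx: "bform A b x = 0" if "b \<in> B1" for b
    proof (cases "b = x0")
      case True
      then show ?thesis using a[of x0 x] x0(3)[of x] by simp
    next
      case False
      then show ?thesis using that \<open>x \<in> ?V\<close> by (simp add: perp_def)
    qed
    have "y \<in> vec.span B1" using that(2) B1(4) by blast
    then show ?thesis
      by (induction rule: vec.span_induct_alt) (auto simp: bform_add_left bform_scale_left bx)
  qed
  have SV: "bform S y x = 0" if "x \<in> ?V" "y \<in> ?U" for x y
  proof -
    have ux: "bform S (u n) x = 0" for n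
      using u(2)[of x n] a[of x "u n"] AV[OF that(1), of "u n"] s[of "u n" x] by (simp add: vec.span_base)
    show ?thesis using that(2)
      by (induction rule: vec.span_induct_alt) (auto simp: bform_add_left bform_scale_left ux)
  qed
  let ?T = "S + A"
  have TV: "bform ?T x y = 0" "bform ?T y x = 0" if "x \<in> ?V" "y \<in> ?U" for x y
    using AV[OF that] SV[OF that] s[of x y] a[of x y] by (simp_all add: bform_add_form)
  obtain B2 where B2: "B1 \<subseteq> B2" "B2 \<subseteq> ?V" "vec.independent B2" "?V \<subseteq> vec.span B2"
    by (rule vec.maximal_independent_subset_extend[OF _ B1(3), of ?V]) (use B1(2) UV in auto)
  obtain B3 where B3: "B2 \<subseteq> B3" "vec.independent B3" "UNIV \<subseteq> vec.span B3"
    by (rule vec.maximal_independent_subset_extend[OF subset_UNIV B2(3)]) auto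
  have fin: "finite B3" "finite B2" "finite B1" using B1(3) B2(3) B3(2) vec.finiteI_independent by blast+
  have card3: "card B3 = CARD('m)"
    using vec.dim_eq_card[of B3 UNIV] B3 by (simp add: card_cart_basis top.extremum_unique)
  have card2: "card B2 = vec.dim ?V"
    by (rule vec.dim_unique[symmetric, OF B2(2,4,3) refl])
  define cd where "cd = CARD('m) - card B2"
  have "CARD('m) \<le> card (B1 - {x0}) + vec.dim ?V" by (rule dim_perp_ge) (use fin in simp)
  moreover have "0 < card B1" using B1(1) fin(3) by (auto simp: card_gt_0_iff)
  moreover have "card (B1 - {x0}) = card B1 - 1" using B1(1) by (simp add: card_Diff_singleton)
  ultimately have cd: "cd < card B1" unfolding cd_def card2 by linarith
  obtain \<beta> :: "'m => complex^'m" where \<beta>: "bij_betw \<beta> UNIV B3"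
    using finite_same_card_bij[of "UNIV :: 'm set" B3] fin card3 by auto
  have \<beta>_in: "\<beta> i \<in> B3" for i using \<beta> by (auto simp: bij_betw_def)
  have inj_\<beta>: "inj \<beta>" using \<beta> by (simp add: bij_betw_def)
  have card_\<beta>: "card {i. \<beta> i \<in> B} = card B" if "B \<subseteq> B3" for B
  proof -
    have "\<beta> ` {i. \<beta> i \<in> B} = B" using that \<beta> by (auto simp: bij_betw_def)
    then show ?thesis using card_image[OF inj_on_subset[OF inj_\<beta> subset_UNIV], of "{i. \<beta> i \<in> B}"] by simp
  qed
  define Q :: "complex^'m^'m" where "Q = (\<chi> r i. \<beta> i $ r)"
  have colQ: "column i Q = \<beta> i" for i by (simp add: Q_def column_def vec_eq_iff)
  have "\<exists>B. B ** Q = mat 1"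
    unfolding matrix_left_invertible_independent_columns colQ
  proof (intro allI impI)
    fix k i assume k: "(\<Sum>i\<in>UNIV. k i *s \<beta> i) = 0"
    let ?k = "%v. k (inv_into UNIV \<beta> v)"
    have "(\<Sum>v\<in>B3. ?k v *s v) = (\<Sum>i\<in>UNIV. ?k (\<beta> i) *s \<beta> i)"
      by (rule sum.reindex_bij_betw[OF \<beta>, symmetric])
    also have "\<dots> = 0" using k by (simp add: inv_f_f[OF inj_\<beta>])
    finally have "?k (\<beta> i) = 0" by (rule vec.independentD[OF B3(2) fin(1) subset_refl _ \<beta>_in])
    then show "k i = 0" by (simp add: inv_f_f[OF inj_\<beta>])
  qed
  then obtain R where R: "R ** Q = mat 1" by blast
  then have R': "Q ** R = mat 1" by (simp add: matrix_left_right_inverse)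
  define e :: "'m => int" where
    "e i = (if \<beta> i \<in> B1 then - int cd else if \<beta> i \<in> B2 then 0 else int (card B1))" for i
  have sum_e: "(\<Sum>i\<in>UNIV. e i) = 0"
  proof -
    have "e i = (if \<beta> i \<in> B1 then - int cd else 0) + (if \<beta> i \<in> B3 - B2 then int (card B1) else 0)" for i
      using B2(1) \<beta>_in[of i] by (auto simp: e_def)
    then have "(\<Sum>i\<in>UNIV. e i) = (\<Sum>i\<in>UNIV. if \<beta> i \<in> B1 then - int cd else 0) + (\<Sum>i\<in>UNIV. if \<beta> i \<in> B3 - B2 then int (card B1) else 0)"
      by (simp only: sum.distrib)
    also have "\<dots> = int (card B1) * (- int cd) + int (card (B3 - B2)) * int (card B1)"
      using card_\<beta>[of B1] card_\<beta>[of "B3 - B2"] B2(1) B3(1) by (simp only: sum.If_cases[OF finite] sum_constant sum.neutral_const) auto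
    also have "card (B3 - B2) = cd" using B3(1) fin by (simp add: cd_def card_Diff_subset card3)
    finally show ?thesis by simp
  qed
  define D :: "complex => complex^'m^'m" where "D t = (\<chi> i j. if i = j then t powi e i else 0)" for t
  have detD: "det (D t) = 1" if "t ~= 0" for t
  proof -
    have "det (D t) = (\<Prod>i\<in>UNIV. D t $ i $ i)" by (rule det_diagonal) (simp add: D_def)
    also have "\<dots> = (\<Prod>i\<in>UNIV. t powi e i)" by (simp add: D_def)
    finally show ?thesis using prod_power_int[OF that, of e UNIV] by (simp add: sum_e)
  qed
  define T0 where "T0 = transpose Q ** ?T ** Q"
  have T0: "T0 $ i $ j = bform ?T (\<beta> i) (\<beta> j)" for i j by (simp add: T0_def congr_nth colQ)
  have T0_U: "\<beta> j \<notin> B2" if "\<beta> i \<in> B1" "T0 $ i $ j ~= 0 \<or> T0 $ j $ i ~= 0" for i j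
  proof
    assume "\<beta> j \<in> B2"
    then have "\<beta> j \<in> ?V" "\<beta> i \<in> ?U" using that(1) B2(2) B1(2) by blast+
    then show False using TV that(2) by (simp add: T0)
  qed
  \<comment> \<open>The partner of a vector of \<open>U\<close> lies outside \<open>?V\<close>, so
    the sum is \<open>card B1 - cd\<close>, positive by \<open>cd\<close>.\<close>
  have e_U: "e i + e j > 0" if "\<beta> i \<in> B1" "T0 $ i $ j ~= 0 \<or> T0 $ j $ i ~= 0" for i j
    using T0_U[OF that] that(1) B2(1) cd by (auto simp: e_def)
  have e_nonneg: "e i + e j \<ge> 0" if "T0 $ i $ j ~= 0" for i j
  proof (cases "\<beta> i \<in> B1 \<or> \<beta> j \<in> B1")
    case True
    then show ?thesis using e_U[of i j] e_U[of j i] that by (auto simp: add.commute)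
  qed (simp add: e_def)
  \<comment> \<open>The action of the one-parameter subgroup written with nonnegative exponents, so
    that it also makes sense at \<open>t = 0\<close>.\<close>
  define \<gamma> :: "complex => complex^'m^'m" where
    "\<gamma> t = (\<chi> i j. t ^ nat (e i + e j) * T0 $ i $ j)" for t
  have \<gamma>: "\<gamma> t = transpose (D t) ** T0 ** D t" if "t ~= 0" for t
  proof -
    have "(transpose (D t) ** T0 ** D t) $ i $ j = t powi e i * T0 $ i $ j * t powi e j" for i j
      by (simp add: matrix_matrix_mult_def transpose_def D_def if_distrib[of "%x. _ * x"] if_distrib[of "%x. x * _"]
          cong: if_cong)
    also have "\<dots> i j = t ^ nat (e i + e j) * T0 $ i $ j" for i j
      using e_nonneg[of i j] that by (cases "T0 $ i $ j = 0") (auto simp: power_int_add[symmetric] power_int_def[of _ "e i + e j"] mult_ac simp flip: power_int_add)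
    finally show ?thesis by (simp add: vec_eq_iff \<gamma>_def)
  qed
  define M where "M t = transpose R ** \<gamma> t ** R" for t
  have M_orbit: "M t \<in> {congr_act h ?T | h. det h = 1}" if "t ~= 0" for t
  proof -
    let ?h = "transpose (Q ** D t ** R)"
    have "det Q * det R = 1" using R' by (metis det_mul det_I)
    then have "det ?h = 1" using detD[OF that] by (simp add: det_mul mult_ac)
    moreover have "M t = congr_act ?h ?T"
      by (simp add: M_def \<gamma>[OF that] T0_def congr_act_def matrix_transpose_mul matrix_mul_assoc)
    ultimately show ?thesis by blast
  qed
  have "continuous_on UNIV M"
  proof -
    have "M = (%t. \<chi> i j. \<Sum>k\<in>UNIV. (\<Sum>l\<in>UNIV. R $ l $ i * (t ^ nat (e l + e k) * T0 $ l $ k)) * R $ k $ j)"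
      by (rule ext) (simp add: M_def \<gamma>_def matrix_matrix_mult_def transpose_def)
    then show ?thesis by (simp only:) (intro continuous_intros)
  qed
  then have M0: "M 0 \<in> closure {congr_act h ?T | h. det h = 1}"
    by (rule punctured_limit[OF _ closed_closure]) (rule subsetD[OF closure_subset M_orbit])
  have x0B: "x0 \<in> B1" "x0 \<in> range \<beta>" using \<beta> B1(1) B2(1) B3(1) by (auto simp: bij_betw_def)
  from x0B(2) obtain i where i: "\<beta> i = x0" by (metis imageE)
  then have i1: "\<beta> i \<in> B1" using x0B(1) by simp
  have \<gamma>0: "\<gamma> 0 $ j $ i = 0" "\<gamma> 0 $ i $ j = 0" for j
  proof -
    show "\<gamma> 0 $ j $ i = 0"
      using e_U[OF i1, of j] by (cases "T0 $ j $ i = 0") (simp_all add: \<gamma>_def add.commute[of "e j"])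
    show "\<gamma> 0 $ i $ j = 0"
      using e_U[OF i1, of j] by (cases "T0 $ i $ j = 0") (simp_all add: \<gamma>_def)
  qed
  have "Q *v axis i 1 = x0" by (simp add: matrix_mult_axis colQ i)
  then have Rx: "R *v x0 = axis i 1" using R by (metis matrix_vector_mul_assoc matrix_vector_mul_lid)
  have "\<gamma> 0 *v axis i 1 = 0" "transpose (\<gamma> 0) *v axis i 1 = 0"
    unfolding matrix_mult_axis by (simp_all add: vec_eq_iff column_def transpose_def \<gamma>0)
  then have "M 0 *v x0 = 0" "transpose (M 0) *v x0 = 0"
    by (simp_all add: M_def matrix_transpose_mul matrix_vector_mul_assoc[symmetric] Rx)
  then show ?thesis using M0 x0(2) by blast
qed

section \<open>Extension of homomorphisms\<close>

definition algebra_hom :: "('x => complex) set => (('x => complex) => complex) => bool" where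
  "algebra_hom A \<xi> \<longleftrightarrow> (\<forall>c. \<xi> (%_. c) = c) &
     (\<forall>f\<in>A. \<forall>g\<in>A. \<xi> (%x. f x + g x) = \<xi> f + \<xi> g & \<xi> (%x. f x * g x) = \<xi> f * \<xi> g)"

definition function_domain :: "('x => complex) set => bool" where
  "function_domain A \<longleftrightarrow>
     (\<forall>f\<in>A. \<forall>g\<in>A. (\<forall>x. f x * g x = 0) --> (\<forall>x. f x = 0) \<or> (\<forall>x. g x = 0))"

text \<open>A polynomial over an algebra \<open>A\<close> of functions is represented as a function with values in the complex polynomials.\<close>

definition poly_over :: "('x => complex) set => nat => ('x => complex poly) set" where
  "poly_over A n = {q. (\<forall>i. (%x. poly.coeff (q x) i) \<in> A) & (\<forall>x. \<forall>i\<ge>n. poly.coeff (q x) i = 0)}"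

definition hom_poly :: "(('x => complex) => complex) => ('x => complex poly) => complex poly" where
  "hom_poly \<xi> q = Abs_poly (%i. \<xi> (%x. poly.coeff (q x) i))"

lemma poly_over_coeff: "q \<in> poly_over A n ==> (%x. poly.coeff (q x) i) \<in> A"
  by (simp add: poly_over_def)

lemma poly_over_bound: "q \<in> poly_over A n ==> n \<le> i ==> poly.coeff (q x) i = 0"
  by (simp add: poly_over_def)

lemma poly_over_mono: "q \<in> poly_over A n ==> n \<le> m ==> q \<in> poly_over A m"
  by (simp add: poly_over_def)

lemma poly_over_lower:
  assumes q: "q \<in> poly_over A (Suc n)" and 0: "!!x. poly.coeff (q x) n = 0"
  shows "q \<in> poly_over A n"
proof -
  have "poly.coeff (q x) i = 0" if "n \<le> i" for x i
  proof (cases "i = n")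
    case False
    then show ?thesis using that poly_over_bound[OF q, of i x] by simp
  qed (simp add: 0)
  then show ?thesis using q by (simp add: poly_over_def)
qed

lemma poly_over_0: "q \<in> poly_over A 0 ==> q x = 0"
  by (simp add: poly_over_def poly_eq_iff)

lemma poly_over_add:
  "q \<in> poly_over (poly_funs B) n ==> r \<in> poly_over (poly_funs B) n ==> (%x. q x + r x) \<in> poly_over (poly_funs B) n"
  by (simp add: poly_over_def poly_funs.add)

lemma poly_over_diff:
  "q \<in> poly_over (poly_funs B) n ==> r \<in> poly_over (poly_funs B) n ==> (%x. q x - r x) \<in> poly_over (poly_funs B) n"
  by (simp add: poly_over_def poly_funs_diff)

lemma poly_over_smult:
  "f \<in> poly_funs B ==> q \<in> poly_over (poly_funs B) n ==> (%x. Polynomial.smult (f x) (q x)) \<in> poly_over (poly_funs B) n"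
  by (simp add: poly_over_def poly_funs.mult)

lemma poly_over_monom: "f \<in> poly_funs B ==> (%x. monom (f x) k) \<in> poly_over (poly_funs B) (Suc k)"
proof -
  assume f: "f \<in> poly_funs B"
  have "(%x. if k = i then f x else 0) \<in> poly_funs B" for i
    by (cases "k = i") (simp_all add: f poly_funs.const)
  then show ?thesis by (simp add: poly_over_def)
qed

lemma poly_over_mult:
  assumes q: "q \<in> poly_over (poly_funs B) n" and r: "r \<in> poly_over (poly_funs B) m"
  shows "(%x. q x * r x) \<in> poly_over (poly_funs B) (n + m)"
proof -
  have "poly.coeff (q x * r x) i = 0" if "n + m \<le> i" for x i
    unfolding coeff_mult
  proof (intro sum.neutral ballI)
    fix j assume "j \<in> {..i}"
    then have "n \<le> j \<or> m \<le> i - j" using that by auto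
    then show "poly.coeff (q x) j * poly.coeff (r x) (i - j) = 0"
      using poly_over_bound[OF q] poly_over_bound[OF r] by auto
  qed
  moreover have "(%x. poly.coeff (q x * r x) i) \<in> poly_funs B" for i
    unfolding coeff_mult
    by (intro poly_funs_sum poly_funs.mult poly_over_coeff[OF q] poly_over_coeff[OF r])
  ultimately show ?thesis by (simp add: poly_over_def)
qed

lemma poly_over_eval:
  assumes q: "q \<in> poly_over (poly_funs B) n"
  shows "(%x. poly (q x) (b x)) \<in> poly_funs (insert b B)"
proof -
  have "poly (q x) (b x) = (\<Sum>i<n. poly.coeff (q x) i * b x ^ i)" for x
  proof -
    have "poly (q x) (b x) = (\<Sum>i\<le>degree (q x). poly.coeff (q x) i * b x ^ i)" by (rule poly_altdef)
    also have "\<dots> = (\<Sum>i\<le>n + degree (q x). poly.coeff (q x) i * b x ^ i)"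
      by (rule sum.mono_neutral_left) (auto simp: coeff_eq_0)
    also have "\<dots> = (\<Sum>i<n. poly.coeff (q x) i * b x ^ i)"
      by (rule sum.mono_neutral_right) (auto simp: poly_over_bound[OF q])
    finally show ?thesis .
  qed
  moreover have "(%x. \<Sum>i<n. poly.coeff (q x) i * b x ^ i) \<in> poly_funs (insert b B)"
    by (intro poly_funs_sum poly_funs.mult poly_funs_power poly_funs.coord insertI1
        poly_funs_mono[OF poly_over_coeff[OF q] subset_insertI])
  ultimately show ?thesis by simp
qed

lemma poly_over_exists:
  assumes "f \<in> poly_funs (insert b B)"
  shows "\<exists>n. \<exists>q\<in>poly_over (poly_funs B) n. f = (%x. poly (q x) (b x))"
  using assms
proof induction
  case (const c)
  have "(%_. monom c 0) \<in> poly_over (poly_funs B) (Suc 0)" by (rule poly_over_monom[OF poly_funs.const])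
  then show ?case by (intro exI[of _ "Suc 0"] bexI[of _ "%_. monom c 0"]) (simp_all add: poly_monom)
next
  case (coord f)
  show ?case
  proof (cases "f = b")
    case True
    have "(%_. monom 1 1) \<in> poly_over (poly_funs B) (Suc 1)" by (rule poly_over_monom[OF poly_funs.const])
    then show ?thesis using True
      by (intro exI[of _ "Suc 1"] bexI[of _ "%_. monom 1 1"]) (simp_all add: poly_monom)
  next
    case False
    then have "f \<in> B" using coord by simp
    then have "(%x. monom (f x) 0) \<in> poly_over (poly_funs B) (Suc 0)" by (intro poly_over_monom poly_funs.coord)
    then show ?thesis by (intro exI[of _ "Suc 0"] bexI[of _ "%x. monom (f x) 0"]) (simp_all add: poly_monom)
  qed
next
  case (add f g)
  then obtain n m q r where q: "q \<in> poly_over (poly_funs B) n" "f = (%x. poly (q x) (b x))"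
    and r: "r \<in> poly_over (poly_funs B) m" "g = (%x. poly (r x) (b x))" by blast
  have "(%x. q x + r x) \<in> poly_over (poly_funs B) (max n m)"
    by (rule poly_over_add) (use q r in \<open>auto intro: poly_over_mono\<close>)
  then show ?case using q(2) r(2) by (intro exI[of _ "max n m"] bexI[of _ "%x. q x + r x"]) simp_all
next
  case (mult f g)
  then obtain n m q r where q: "q \<in> poly_over (poly_funs B) n" "f = (%x. poly (q x) (b x))"
    and r: "r \<in> poly_over (poly_funs B) m" "g = (%x. poly (r x) (b x))" by blast
  then show ?case
    by (intro exI[of _ "n + m"] bexI[of _ "%x. q x * r x"] poly_over_mult) simp_all
qed

section \<open>Pseudo-division and adjunction of one element\<close>

text \<open>The leading coefficient of \<open>p\<close> is a function and cannot be inverted, so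
  \<open>q\<close> is multiplied by a power of it. Bounds in \<open>poly_over\<close> are strict:
  \<open>Suc n\<close> means formal degree \<open>n\<close>, and the remainder has degree less than
  \<open>n\<close>.\<close>

lemma pseudo_division:
  assumes p: "p \<in> poly_over (poly_funs B) (Suc n)" and q: "q \<in> poly_over (poly_funs B) N"
  shows "\<exists>k. \<exists>r\<in>poly_over (poly_funs B) (N - n). \<exists>s\<in>poly_over (poly_funs B) n.
           \<forall>x. Polynomial.smult (poly.coeff (p x) n ^ k) (q x) = p x * r x + s x"
  using q
proof (induction N arbitrary: q)
  case 0
  have z: "(%_. 0) \<in> poly_over (poly_funs B) m" for m by (simp add: poly_over_def poly_funs.const)
  have "q x = 0" for x using 0 by (rule poly_over_0)
  then show ?case using z by (intro exI[of _ 0] bexI[of _ "%_. 0"]) simp_all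
next
  case (Suc M)
  have z: "(%_. 0) \<in> poly_over (poly_funs B) m" for m by (simp add: poly_over_def poly_funs.const)
  show ?case
  proof (cases "Suc M \<le> n")
    case True
    then have "q \<in> poly_over (poly_funs B) n" using Suc.prems by (rule poly_over_mono[rotated])
    then show ?thesis using z by (intro exI[of _ 0] bexI[of _ "%_. 0"] bexI[of _ q]) simp_all
  next
    case False
    let ?a = "%x. poly.coeff (p x) n" and ?c = "%x. poly.coeff (q x) M"
    let ?m = "%x. monom (?c x) (M - n)"
    let ?q = "%x. Polynomial.smult (?a x) (q x) - p x * ?m x"
    have a: "?a \<in> poly_funs B" and c: "?c \<in> poly_funs B"
      using poly_over_coeff[OF p] poly_over_coeff[OF Suc.prems] by blast+
    have cm: "poly.coeff (p x * ?m x) i = (if i < M - n then 0 else ?c x * poly.coeff (p x) (i - (M - n)))" for x i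
      by (simp add: mult.commute[of "p x"] coeff_monom_mult)
    have m: "?m \<in> poly_over (poly_funs B) (Suc (M - n))" by (rule poly_over_monom[OF c])
    have "?q \<in> poly_over (poly_funs B) (Suc M)"
    proof (rule poly_over_diff)
      show "(%x. Polynomial.smult (?a x) (q x)) \<in> poly_over (poly_funs B) (Suc M)" by (rule poly_over_smult[OF a Suc.prems])
      have "(%x. p x * ?m x) \<in> poly_over (poly_funs B) (Suc n + Suc (M - n))" by (rule poly_over_mult[OF p m])
      moreover have "poly.coeff (p x * ?m x) i = 0" if "Suc M \<le> i" for x i
      proof -
        have "poly.coeff (p x) (i - (M - n)) = 0" by (rule poly_over_bound[OF p]) (use that False in simp)
        then show ?thesis by (simp add: cm)
      qed
      ultimately show "(%x. p x * ?m x) \<in> poly_over (poly_funs B) (Suc M)"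
        unfolding poly_over_def by blast
    qed
    moreover have "poly.coeff (?q x) M = 0" for x
      using False by (simp add: cm)
    ultimately have "?q \<in> poly_over (poly_funs B) M" by (rule poly_over_lower)
    from Suc.IH[OF this] obtain k r s where r: "r \<in> poly_over (poly_funs B) (M - n)"
      and s: "s \<in> poly_over (poly_funs B) n" and eq: "!!x. Polynomial.smult (?a x ^ k) (?q x) = p x * r x + s x" by blast
    let ?r = "%x. r x + Polynomial.smult (?a x ^ k) (?m x)"
    have "?r \<in> poly_over (poly_funs B) (Suc M - n)"
    proof (rule poly_over_add)
      show "r \<in> poly_over (poly_funs B) (Suc M - n)" by (rule poly_over_mono[OF r]) simp
      have "(%x. Polynomial.smult (?a x ^ k) (?m x)) \<in> poly_over (poly_funs B) (Suc (M - n))"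
        by (rule poly_over_smult[OF poly_funs_power[OF a] m])
      then show "(%x. Polynomial.smult (?a x ^ k) (?m x)) \<in> poly_over (poly_funs B) (Suc M - n)"
        using False by (simp add: Suc_diff_le)
    qed
    moreover have "Polynomial.smult (?a x ^ Suc k) (q x) = p x * ?r x + s x" for x
    proof -
      have "Polynomial.smult (?a x ^ Suc k) (q x) = Polynomial.smult (?a x ^ k) (?q x) + p x * Polynomial.smult (?a x ^ k) (?m x)"
        by (simp add: smult_diff_right mult.commute[of _ "?a x ^ k"])
      then show ?thesis unfolding eq by (simp add: algebra_simps)
    qed
    ultimately show ?thesis
      by (intro exI[of _ "Suc k"] bexI[of _ ?r] bexI[OF _ s] allI)
  qed
qed

lemma algebra_hom_sum:
  assumes "algebra_hom (poly_funs B) \<xi>" "!!i. i \<in> I ==> f i \<in> poly_funs B"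
  shows "\<xi> (%x. \<Sum>i\<in>I. f i x) = (\<Sum>i\<in>I. \<xi> (f i))"
  using assms(2)
proof (induction I rule: infinite_finite_induct)
  case (insert i I)
  then have "(%x. \<Sum>i\<in>I. f i x) \<in> poly_funs B" by (intro poly_funs_sum) simp
  then show ?case using assms(1) insert by (simp add: algebra_hom_def)
qed (use assms(1) in \<open>simp_all add: algebra_hom_def\<close>)

lemma algebra_hom_power:
  assumes "algebra_hom (poly_funs B) \<xi>" "f \<in> poly_funs B"
  shows "\<xi> (%x. f x ^ n) = \<xi> f ^ n"
proof (induction n)
  case (Suc n)
  have "\<xi> (%x. f x * f x ^ n) = \<xi> f * \<xi> (%x. f x ^ n)"
    using assms poly_funs_power[OF assms(2), of n] by (simp add: algebra_hom_def)
  then show ?case using Suc by simp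
qed (use assms(1) in \<open>simp add: algebra_hom_def\<close>)

context
  fixes B :: "('x => complex) set" and \<xi>
  assumes \<xi>: "algebra_hom (poly_funs B) \<xi>"
begin

lemma hom_poly_coeff:
  assumes "q \<in> poly_over (poly_funs B) n"
  shows "poly.coeff (hom_poly \<xi> q) i = \<xi> (%x. poly.coeff (q x) i)"
proof -
  have "(%x. poly.coeff (q x) i) = (%_. 0)" if "n \<le> i" for i
    using poly_over_bound[OF assms that] by (rule ext)
  then have "\<xi> (%x. poly.coeff (q x) i) = 0" if "n \<le> i" for i
    using \<xi> that by (simp add: algebra_hom_def)
  then have "\<forall>\<^sub>\<infinity>i. \<xi> (%x. poly.coeff (q x) i) = 0"
    unfolding MOST_nat_le by blast
  then show ?thesis unfolding hom_poly_def by (simp add: Abs_poly_inverse)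
qed

lemma hom_poly_add:
  assumes q: "q \<in> poly_over (poly_funs B) n" and r: "r \<in> poly_over (poly_funs B) m"
  shows "hom_poly \<xi> (%x. q x + r x) = hom_poly \<xi> q + hom_poly \<xi> r"
proof (rule poly_eqI)
  fix i
  have "(%x. q x + r x) \<in> poly_over (poly_funs B) (max n m)"
    by (rule poly_over_add) (use q r in \<open>auto intro: poly_over_mono\<close>)
  from hom_poly_coeff[OF this, of i]
  show "poly.coeff (hom_poly \<xi> (%x. q x + r x)) i = poly.coeff (hom_poly \<xi> q + hom_poly \<xi> r) i"
    using \<xi> poly_over_coeff[OF q, of i] poly_over_coeff[OF r, of i]
    by (simp add: hom_poly_coeff[OF q] hom_poly_coeff[OF r] algebra_hom_def)
qed

lemma hom_poly_mult:
  assumes q: "q \<in> poly_over (poly_funs B) n" and r: "r \<in> poly_over (poly_funs B) m"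
  shows "hom_poly \<xi> (%x. q x * r x) = hom_poly \<xi> q * hom_poly \<xi> r"
proof (rule poly_eqI)
  fix i
  have "poly.coeff (hom_poly \<xi> (%x. q x * r x)) i = \<xi> (%x. \<Sum>j\<le>i. poly.coeff (q x) j * poly.coeff (r x) (i - j))"
    unfolding hom_poly_coeff[OF poly_over_mult[OF q r]] coeff_mult ..
  also have "\<dots> = (\<Sum>j\<le>i. \<xi> (%x. poly.coeff (q x) j * poly.coeff (r x) (i - j)))"
    by (intro algebra_hom_sum[OF \<xi>] poly_funs.mult poly_over_coeff[OF q] poly_over_coeff[OF r])
  also have "\<dots> = (\<Sum>j\<le>i. \<xi> (%x. poly.coeff (q x) j) * \<xi> (%x. poly.coeff (r x) (i - j)))"
    using \<xi> poly_over_coeff[OF q] poly_over_coeff[OF r] by (simp add: algebra_hom_def)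
  finally show "poly.coeff (hom_poly \<xi> (%x. q x * r x)) i = poly.coeff (hom_poly \<xi> q * hom_poly \<xi> r) i"
    by (simp add: coeff_mult hom_poly_coeff[OF q] hom_poly_coeff[OF r])
qed

lemma hom_poly_smult:
  assumes f: "f \<in> poly_funs B" and q: "q \<in> poly_over (poly_funs B) n"
  shows "hom_poly \<xi> (%x. Polynomial.smult (f x) (q x)) = Polynomial.smult (\<xi> f) (hom_poly \<xi> q)"
  using \<xi> f poly_over_coeff[OF q]
  by (intro poly_eqI) (simp add: hom_poly_coeff[OF poly_over_smult[OF f q]] hom_poly_coeff[OF q] algebra_hom_def)

lemma hom_poly_0: "(!!x. q x = 0) ==> hom_poly \<xi> q = 0"
  using \<xi> by (intro poly_eqI) (simp add: hom_poly_coeff[of _ 0] poly_over_def poly_funs.const algebra_hom_def)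

lemma hom_poly_monom: "f \<in> poly_funs B ==> hom_poly \<xi> (%x. monom (f x) k) = monom (\<xi> f) k"
  using \<xi> by (intro poly_eqI) (auto simp: hom_poly_coeff[OF poly_over_monom] algebra_hom_def)

text \<open>Sends \<open>b\<close> to \<open>\<beta>\<close>. The hypothesis is precisely
  independence of the representing polynomial: a relation satisfied by \<open>b\<close> must turn
  into a polynomial with root \<open>\<beta>\<close>.\<close>

lemma algebra_hom_extend:
  assumes ker: "\<forall>n. \<forall>q\<in>poly_over (poly_funs B) n. (\<forall>x. poly (q x) (b x) = 0) --> poly (hom_poly \<xi> q) \<beta> = 0"
  shows "\<exists>\<xi>'. algebra_hom (poly_funs (insert b B)) \<xi>' & (\<forall>f\<in>poly_funs B. \<xi>' f = \<xi> f) &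
     (\<forall>n. \<forall>q\<in>poly_over (poly_funs B) n. \<xi>' (%x. poly (q x) (b x)) = poly (hom_poly \<xi> q) \<beta>)"
proof -
  let ?R = "%f q. (\<exists>n. q \<in> poly_over (poly_funs B) n) & f = (%x. poly (q x) (b x))"
  define \<xi>' where "\<xi>' f = poly (hom_poly \<xi> (SOME q. ?R f q)) \<beta>" for f
  have val: "\<xi>' (%x. poly (q x) (b x)) = poly (hom_poly \<xi> q) \<beta>" if q: "q \<in> poly_over (poly_funs B) n" for q n
  proof -
    let ?f = "%x. poly (q x) (b x)"
    define r where "r = (SOME r. ?R ?f r)"
    have "\<exists>r. ?R ?f r" using q by blast
    then have "?R ?f (SOME r. ?R ?f r)" by (rule someI_ex)
    then have "?R ?f r" by (simp only: r_def)
    then obtain m where r: "r \<in> poly_over (poly_funs B) m" and eq: "?f = (%x. poly (r x) (b x))" by blast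
    have "(%_. -1) \<in> poly_funs B" by (rule poly_funs.const)
    from poly_over_smult[OF this r] have r': "(%x. Polynomial.smult (-1) (r x)) \<in> poly_over (poly_funs B) m" .
    have A: "(%x. q x + Polynomial.smult (-1) (r x)) \<in> poly_over (poly_funs B) (max n m)"
      by (rule poly_over_add) (use q r' in \<open>auto intro: poly_over_mono\<close>)
    have "poly (q x + Polynomial.smult (-1) (r x)) (b x) = 0" for x using fun_cong[OF eq, of x] by simp
    then have "poly (hom_poly \<xi> (%x. q x + Polynomial.smult (-1) (r x))) \<beta> = 0"
      by (rule ker[rule_format, OF A])
    moreover have "hom_poly \<xi> (%x. q x + Polynomial.smult (-1) (r x)) = hom_poly \<xi> q + Polynomial.smult (-1) (hom_poly \<xi> r)"
      unfolding hom_poly_add[OF q r'] hom_poly_smult[OF \<open>(%_. -1) \<in> poly_funs B\<close> r]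
      using \<xi> by (simp add: algebra_hom_def)
    ultimately show ?thesis by (simp add: \<xi>'_def r_def)
  qed
  have "algebra_hom (poly_funs (insert b B)) \<xi>'"
    unfolding algebra_hom_def
  proof (intro conjI allI ballI)
    have *: "\<xi>' f = \<xi> f" if f: "f \<in> poly_funs B" for f
      using val[OF poly_over_monom[OF f, of 0]] by (simp add: poly_monom hom_poly_monom[OF f])
    show "\<xi>' (%_. c) = c" for c using *[OF poly_funs.const] \<xi> by (simp add: algebra_hom_def)
    fix f g assume "f \<in> poly_funs (insert b B)" "g \<in> poly_funs (insert b B)"
    then obtain n m q r where q: "q \<in> poly_over (poly_funs B) n" "f = (%x. poly (q x) (b x))"
      and r: "r \<in> poly_over (poly_funs B) m" "g = (%x. poly (r x) (b x))" using poly_over_exists by meson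
    have "(%x. q x + r x) \<in> poly_over (poly_funs B) (max n m)"
      by (rule poly_over_add) (use q r in \<open>auto intro: poly_over_mono\<close>)
    from val[OF this] show "\<xi>' (%x. f x + g x) = \<xi>' f + \<xi>' g"
      unfolding q(2) r(2) val[OF q(1)] val[OF r(1)] hom_poly_add[OF q(1) r(1)] by simp
    from val[OF poly_over_mult[OF q(1) r(1)]] show "\<xi>' (%x. f x * g x) = \<xi>' f * \<xi>' g"
      unfolding q(2) r(2) val[OF q(1)] val[OF r(1)] hom_poly_mult[OF q(1) r(1)] by simp
  qed
  moreover have "\<xi>' f = \<xi> f" if f: "f \<in> poly_funs B" for f
    using val[OF poly_over_monom[OF f, of 0]] by (simp add: poly_monom hom_poly_monom[OF f])
  ultimately show ?thesis using val by blast
qed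

end

lemma function_domainD:
  "function_domain A ==> f \<in> A ==> g \<in> A ==> (!!x. f x * g x = 0) ==> \<exists>x. f x ~= 0 ==> g x = 0"
  unfolding function_domain_def by blast

lemma function_domain_power:
  assumes A: "function_domain (poly_funs B)" and f: "f \<in> poly_funs B" "\<exists>x. f x ~= 0"
    and g: "g \<in> poly_funs B" "!!x. f x ^ k * g x = 0"
  shows "g x = 0"
  using g
proof (induction k arbitrary: g x)
  case (Suc k)
  have "f x ^ k * g x = 0" for x
    by (rule function_domainD[OF A f(1) poly_funs.mult[OF poly_funs_power[OF f(1)] Suc.prems(1)] _ f(2)])
       (use Suc.prems(2) in simp)
  then show ?case by (rule Suc.IH[OF Suc.prems(1)])
qed simp

text \<open>
  Either \<open>b\<close> is transcendental over \<open>A = poly_funs B\<close>, and any value \<open>\<beta>\<close> can be chosen for it, or \<open>\<beta>\<close> has to be a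
  root of the image of a relation \<open>p\<close> of minimal degree; a resultant of \<open>p\<close> and a polynomial that represents \<open>v\<close>
  ensures that the value of \<open>v\<close> is nonzero.
\<close>

lemma extend_hom_step:
  assumes dom: "function_domain (poly_funs (insert b B))"
    and v: "v \<in> poly_funs (insert b B)" "\<exists>x. v x ~= 0"
  shows "\<exists>u\<in>poly_funs B. (\<exists>x. u x ~= 0) & (\<forall>\<xi>. algebra_hom (poly_funs B) \<xi> & \<xi> u ~= 0 -->
     (\<exists>\<xi>'. algebra_hom (poly_funs (insert b B)) \<xi>' & (\<forall>f\<in>poly_funs B. \<xi>' f = \<xi> f) & \<xi>' v ~= 0))"
proof -
  let ?RP = "poly_over (poly_funs B)"
  have sub: "f \<in> poly_funs B ==> f \<in> poly_funs (insert b B)" for f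
    by (rule poly_funs_mono[OF _ subset_insertI])
  have domB: "function_domain (poly_funs B)" using dom sub unfolding function_domain_def by blast
  obtain n0 q0 where q0: "q0 \<in> ?RP n0" "v = (%x. poly (q0 x) (b x))" using poly_over_exists[OF v(1)] by blast
  define rel where "rel q \<longleftrightarrow> (\<forall>x. poly (q x) (b x) = 0)" for q
  have not_rel0: "~ rel q0" using v(2) q0(2) by (auto simp: rel_def)
  show ?thesis
  proof (cases "\<exists>n. \<exists>p\<in>?RP n. rel p & (\<exists>x. p x ~= 0)")
    case False
    \<comment> \<open>Transcendental case: one nonzero coefficient of \<open>q0\<close> serves as
      \<open>u\<close>, since it keeps the image of \<open>q0\<close> nonzero and leaves only
      finitely many values \<open>\<beta>\<close> to avoid.\<close>
    obtain x0 where "q0 x0 ~= 0" using not_rel0 unfolding rel_def by (metis poly_0)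
    then obtain i where i: "poly.coeff (q0 x0) i ~= 0" by (auto simp: poly_eq_iff)
    let ?u = "%x. poly.coeff (q0 x) i"
    have ext: "\<exists>\<xi>'. algebra_hom (poly_funs (insert b B)) \<xi>' & (\<forall>f\<in>poly_funs B. \<xi>' f = \<xi> f) & \<xi>' v ~= 0"
      if \<xi>: "algebra_hom (poly_funs B) \<xi>" and u: "\<xi> ?u ~= 0" for \<xi>
    proof -
      have "hom_poly \<xi> q0 ~= 0" using u hom_poly_coeff[OF \<xi> q0(1), of i] by auto
      then have "finite {z. poly (hom_poly \<xi> q0) z = 0}" by (rule poly_roots_finite)
      then obtain \<beta> where \<beta>: "poly (hom_poly \<xi> q0) \<beta> ~= 0"
        using infinite_UNIV_char_0 by (metis (mono_tags, lifting) UNIV_eq_I mem_Collect_eq)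
      have "\<forall>n. \<forall>q\<in>?RP n. (\<forall>x. poly (q x) (b x) = 0) --> poly (hom_poly \<xi> q) \<beta> = 0"
      proof (intro allI ballI impI)
        fix n q assume "q \<in> ?RP n" "\<forall>x. poly (q x) (b x) = 0"
        then have q: "q \<in> ?RP n" "rel q" by (simp_all add: rel_def)
        have "q x = 0" for x
        proof (rule ccontr)
          assume "q x ~= 0"
          then have "\<exists>n. \<exists>p\<in>?RP n. rel p & (\<exists>x. p x ~= 0)"
            using q by (intro exI[of _ n] bexI[of _ q] conjI exI[of _ x])
          then show False using False by simp
        qed
        then show "poly (hom_poly \<xi> q) \<beta> = 0" using hom_poly_0[OF \<xi>] by simp
      qed
      from algebra_hom_extend[OF \<xi> this] obtain \<xi>' where
        "algebra_hom (poly_funs (insert b B)) \<xi>'" "\<forall>f\<in>poly_funs B. \<xi>' f = \<xi> f"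
        "\<forall>n. \<forall>q\<in>?RP n. \<xi>' (%x. poly (q x) (b x)) = poly (hom_poly \<xi> q) \<beta>" by blast
      then show ?thesis using \<beta> q0 by (intro exI[of _ \<xi>']) auto
    qed
    show ?thesis
    proof (rule bexI[OF _ poly_over_coeff[OF q0(1), of i]], intro conjI allI impI)
      show "\<exists>x. poly.coeff (q0 x) i ~= 0" using i by blast
    qed (rule ext, simp_all)
  next
    case True
    let ?P = "%n. \<exists>p\<in>?RP (Suc n). rel p & (\<exists>x. p x ~= 0)"
    obtain n' p' x' where p': "p' \<in> ?RP n'" "rel p'" "p' x' ~= 0" using True by (elim exE bexE conjE)
    have "p' \<in> ?RP (Suc n')" by (rule poly_over_mono[OF p'(1)]) simp
    then have "?P n'" by (intro bexI[of _ p'] conjI exI[of _ x'] p')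
    then have "\<exists>n. ?P n" by (rule exI)
    define n where "n = (LEAST n. ?P n)"
    have "?P n" unfolding n_def by (rule LeastI_ex) fact
    then obtain p x1 where p: "p \<in> ?RP (Suc n)" "rel p" "p x1 ~= 0" by (elim bexE conjE exE)
    have min: "s x = 0" if "s \<in> ?RP n" "rel s" for s x
    proof (cases n)
      case 0
      then have "s \<in> ?RP 0" using that(1) by simp
      then show ?thesis by (rule poly_over_0)
    next
      case (Suc k)
      then have nP: "~ ?P k" using not_less_Least[of k ?P] by (simp add: n_def)
      show ?thesis
      proof (rule ccontr)
        assume "s x ~= 0"
        then have "?P k" using that Suc by (intro bexI[of _ s] conjI exI[of _ x]) simp_all
        then show False using nP by contradiction
      qed
    qed
    let ?a = "%x. poly.coeff (p x) n"
    have a: "?a \<in> poly_funs B" by (rule poly_over_coeff[OF p(1)])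
    have a0: "\<exists>x. ?a x ~= 0"
    proof (rule ccontr)
      assume "\<nexists>x. ?a x ~= 0"
      then have "p \<in> ?RP n" by (intro poly_over_lower[OF p(1)]) blast
      then show False using min[OF _ p(2), of x1] p(3) by simp
    qed
    have n0: "n ~= 0"
    proof
      assume n: "n = 0"
      have "p x = [:?a x:]" for x
        using poly_over_bound[OF p(1)] n by (intro poly_eqI) (auto simp: coeff_pCons split: nat.split)
      then have "poly (p x) (b x) = ?a x" for x by (metis poly_const_conv poly_pCons mult_zero_right add.right_neutral poly_0)
      then show False using p(2) a0 by (simp add: rel_def)
    qed
    \<comment> \<open>The ideal generated by \<open>p\<close> and \<open>q0\<close>. Its element of
      least degree that is not a relation of \<open>b\<close> plays the role of the resultant and
      will turn out to be constant.\<close>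
    let ?I = "%q. \<exists>m. \<exists>r1\<in>?RP m. \<exists>r2\<in>?RP m. \<forall>x. q x = p x * r1 x + q0 x * r2 x"
    let ?K = "%k. \<exists>q\<in>?RP (Suc k). ~ rel q & ?I q"
    obtain j r s where r: "r \<in> ?RP (n0 - n)" and s: "s \<in> ?RP n"
      and div: "!!x. Polynomial.smult (?a x ^ j) (q0 x) = p x * r x + s x"
      using pseudo_division[OF p(1) q0(1)] by blast
    have "~ rel s"
    proof
      assume "rel s"
      then have "?a x ^ j * v x = 0" for x
        using arg_cong[OF div[of x], of "%q. poly q (b x)"] p(2) by (simp add: rel_def q0(2))
      then have "v x = 0" for x
        by (rule function_domain_power[OF dom sub[OF a] a0 v(1)])
      then show False using v(2) by blast
    qed
    moreover have "?I s"
    proof -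
      let ?m = "max (n0 - n) 1"
      let ?r1 = "%x. Polynomial.smult (-1) (r x)" and ?r2 = "%x. monom (?a x ^ j) 0"
      have "?r1 \<in> ?RP (n0 - n)" by (rule poly_over_smult[OF poly_funs.const r])
      then have "?r1 \<in> ?RP ?m" by (rule poly_over_mono) simp
      moreover have "?r2 \<in> ?RP (Suc 0)" by (rule poly_over_monom[OF poly_funs_power[OF a]])
      then have "?r2 \<in> ?RP ?m" by (rule poly_over_mono) simp
      moreover have "s x = p x * ?r1 x + q0 x * ?r2 x" for x
        using div[of x] by (simp add: monom_0)
      ultimately show ?thesis by (intro exI[of _ ?m] bexI[of _ ?r1] bexI[of _ ?r2] allI)
    qed
    moreover have "s \<in> ?RP (Suc (n - 1))" using s n0 by simp
    ultimately have K: "?K (n - 1)" by (intro bexI[of _ s] conjI)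
    define k where "k = (LEAST k. ?K k)"
    have "?K k" unfolding k_def by (rule LeastI[of ?K, OF K])
    then obtain q m r1 r2 where q: "q \<in> ?RP (Suc k)" "~ rel q" and r12: "r1 \<in> ?RP m" "r2 \<in> ?RP m"
      and qI: "\<forall>x. q x = p x * r1 x + q0 x * r2 x" by (elim bexE conjE exE)
    have k_less: "k < n" using Least_le[of ?K, OF K] n0 by (simp add: k_def)
    have minK: "rel s" if "s \<in> ?RP k" "?I s" for s
    proof (cases k)
      case 0
      then have "s \<in> ?RP 0" using that(1) by simp
      then have "s x = 0" for x by (rule poly_over_0)
      then show ?thesis by (simp add: rel_def)
    next
      case (Suc l)
      then have nK: "~ ?K l" using not_less_Least[of l ?K] by (simp add: k_def)
      show ?thesis
      proof (rule ccontr)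
        assume "~ rel s"
        then have "?K l" using that Suc by (intro bexI[of _ s] conjI) simp_all
        then show False using nK by contradiction
      qed
    qed
    let ?c = "%x. poly.coeff (q x) k"
    have c: "?c \<in> poly_funs B" by (rule poly_over_coeff[OF q(1)])
    have c0: "\<exists>x. ?c x ~= 0"
    proof (rule ccontr)
      assume "\<nexists>x. ?c x ~= 0"
      then have "q \<in> ?RP k" by (intro poly_over_lower[OF q(1)]) blast
      moreover have "?I q" by (intro exI[of _ m] bexI[OF _ r12(1)] bexI[OF _ r12(2)] qI)
      ultimately have "rel q" by (rule minK)
      then show False using q(2) by contradiction
    qed
    \<comment> \<open>Otherwise \<open>p\<close> is divided by \<open>q\<close>. The remainder is in
      the ideal and of smaller degree than \<open>q\<close>, so it is a relation, and zero by
      minimality of \<open>n\<close>. Then the quotient is a relation of degree less than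
      \<open>n\<close>, hence zero as well, although a multiple of \<open>p\<close> by a nonzero
      function remains.\<close>
    have "k = 0"
    proof (rule ccontr)
      assume k: "k ~= 0"
      obtain j' r' s' where r': "r' \<in> ?RP (Suc n - k)" and s': "s' \<in> ?RP k"
        and div': "!!x. Polynomial.smult (?c x ^ j') (p x) = q x * r' x + s' x"
        using pseudo_division[OF q(1) p(1)] by blast
      have "?I s'"
      proof -
        let ?M = "max 1 (m + (Suc n - k))"
        let ?t1 = "%x. monom (?c x ^ j') 0 - r1 x * r' x" and ?t2 = "%x. Polynomial.smult (-1) (r2 x * r' x)"
        have M0: "(%x. monom (?c x ^ j') 0) \<in> ?RP ?M"
          by (rule poly_over_mono[OF poly_over_monom[OF poly_funs_power[OF c]]]) simp
        have M12: "(%x. r1 x * r' x) \<in> ?RP ?M" "(%x. r2 x * r' x) \<in> ?RP ?M"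
          by (rule poly_over_mono[OF poly_over_mult[OF r12(1) r']] poly_over_mono[OF poly_over_mult[OF r12(2) r']], simp)+
        have "?t1 \<in> ?RP ?M" by (rule poly_over_diff[OF M0 M12(1)])
        moreover have "?t2 \<in> ?RP ?M" by (rule poly_over_smult[OF poly_funs.const M12(2)])
        moreover have "s' x = p x * ?t1 x + q0 x * ?t2 x" for x
        proof -
          have "s' x = Polynomial.smult (?c x ^ j') (p x) - q x * r' x" using div'[of x] by simp
          then show ?thesis by (simp add: qI[rule_format] monom_0 algebra_simps)
        qed
        ultimately show ?thesis by (intro exI[of _ ?M] bexI[of _ ?t1] bexI[of _ ?t2] allI)
      qed
      then have s'_rel: "rel s'" by (rule minK[OF s'])
      have "s' \<in> ?RP n" by (rule poly_over_mono[OF s']) (use k_less in simp)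
      then have s0: "s' x = 0" for x using min s'_rel by simp
      have "poly (q x) (b x) * poly (r' x) (b x) = 0" for x
        using arg_cong[OF div'[of x], of "%q. poly q (b x)"] p(2) by (simp add: s0 rel_def)
      then have "poly (r' x) (b x) = 0" for x
        by (rule function_domainD[OF dom poly_over_eval[OF q(1)] poly_over_eval[OF r']])
           (use q(2) in \<open>auto simp: rel_def\<close>)
      then have r'_rel: "rel r'" by (simp add: rel_def)
      have "r' \<in> ?RP n" by (rule poly_over_mono[OF r']) (use k in simp)
      then have "r' x = 0" for x using min r'_rel by simp
      then have "Polynomial.smult (?c x ^ j') (p x) = 0" for x using div'[of x] s0 by simp
      then have "?c x ^ j' * ?a x = 0" for x by (metis coeff_smult coeff_0)
      then have "?a x = 0" for x by (rule function_domain_power[OF domB c c0 a])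
      then show False using a0 by blast
    qed
    then have qc: "q x = monom (?c x) 0" for x
      using poly_over_bound[OF q(1)] by (intro poly_eqI) (auto simp: not_less_eq_eq[symmetric] Suc_le_eq)
    let ?u = "%x. ?a x * ?c x"
    have u: "?u \<in> poly_funs B" by (rule poly_funs.mult[OF a c])
    have u0: "\<exists>x. ?u x ~= 0"
    proof (rule ccontr)
      assume "\<nexists>x. ?u x ~= 0"
      then have "?c x = 0" for x by (intro function_domainD[OF domB a c _ a0]) blast
      then show False using c0 by blast
    qed
    have ext: "\<exists>\<xi>'. algebra_hom (poly_funs (insert b B)) \<xi>' & (\<forall>f\<in>poly_funs B. \<xi>' f = \<xi> f) & \<xi>' v ~= 0"
      if \<xi>: "algebra_hom (poly_funs B) \<xi>" and u: "\<xi> ?u ~= 0" for \<xi>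
    proof -
      have ac: "\<xi> ?a ~= 0" "\<xi> ?c ~= 0" using u \<xi> a c by (auto simp: algebra_hom_def)
      have cn: "poly.coeff (hom_poly \<xi> p) n ~= 0" using ac(1) by (simp add: hom_poly_coeff[OF \<xi> p(1)])
      then have "degree (hom_poly \<xi> p) ~= 0" using n0 le_degree[OF cn] by simp
      then have "~ constant (poly (hom_poly \<xi> p))" by (simp add: constant_degree)
      then obtain \<beta> where \<beta>: "poly (hom_poly \<xi> p) \<beta> = 0" using fundamental_theorem_of_algebra by blast
      \<comment> \<open>Up to a power of the leading coefficient \<open>?a\<close> every relation is
        a multiple of \<open>p\<close>, the remainder being zero by minimality.\<close>
      have ker: "poly (hom_poly \<xi> f) \<beta> = 0" if f: "f \<in> ?RP N" "!!x. poly (f x) (b x) = 0" for f N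
      proof -
        obtain i g h where g: "g \<in> ?RP (N - n)" and h: "h \<in> ?RP n"
          and d: "!!x. Polynomial.smult (?a x ^ i) (f x) = p x * g x + h x"
          using pseudo_division[OF p(1) f(1)] by blast
        have "poly (h x) (b x) = 0" for x
          using arg_cong[OF d[of x], of "%q. poly q (b x)"] p(2) f(2) by (simp add: rel_def)
        then have "h x = 0" for x using min[OF h] by (simp add: rel_def)
        then have eq: "(%x. Polynomial.smult (?a x ^ i) (f x)) = (%x. p x * g x)" using d by simp
        have "Polynomial.smult (\<xi> ?a ^ i) (hom_poly \<xi> f) = hom_poly \<xi> (%x. Polynomial.smult (?a x ^ i) (f x))"
          unfolding hom_poly_smult[OF \<xi> poly_funs_power[OF a] f(1)] algebra_hom_power[OF \<xi> a] ..
        also have "\<dots> = hom_poly \<xi> p * hom_poly \<xi> g"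
          unfolding eq by (rule hom_poly_mult[OF \<xi> p(1) g])
        finally have "Polynomial.smult (\<xi> ?a ^ i) (hom_poly \<xi> f) = hom_poly \<xi> p * hom_poly \<xi> g" .
        then have "\<xi> ?a ^ i * poly (hom_poly \<xi> f) \<beta> = 0" using \<beta> by (metis mult_zero_left poly_mult poly_smult)
        then show ?thesis using ac(1) by simp
      qed
      \<comment> \<open>Evaluated at the root \<open>\<beta>\<close> of the image of
        \<open>p\<close>, this exhibits the nonzero constant \<open>\<xi> ?c\<close> as a multiple
        of the value of the image of \<open>q0\<close>, which is the value of
        \<open>v\<close>.\<close>
      have "q = (%x. p x * r1 x + q0 x * r2 x)" by (rule ext) (rule qI[rule_format])
      then have "hom_poly \<xi> q = hom_poly \<xi> (%x. p x * r1 x + q0 x * r2 x)" by (rule arg_cong)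
      also have "\<dots> = hom_poly \<xi> p * hom_poly \<xi> r1 + hom_poly \<xi> q0 * hom_poly \<xi> r2"
        unfolding hom_poly_add[OF \<xi> poly_over_mult[OF p(1) r12(1)] poly_over_mult[OF q0(1) r12(2)]]
          hom_poly_mult[OF \<xi> p(1) r12(1)] hom_poly_mult[OF \<xi> q0(1) r12(2)] ..
      finally have "poly (hom_poly \<xi> q) \<beta> = poly (hom_poly \<xi> q0) \<beta> * poly (hom_poly \<xi> r2) \<beta>"
        by (simp add: \<beta>)
      moreover have "q = (%x. monom (?c x) 0)" by (rule ext) (rule qc)
      then have "hom_poly \<xi> q = hom_poly \<xi> (%x. monom (?c x) 0)" by (rule arg_cong)
      then have "poly (hom_poly \<xi> q) \<beta> = \<xi> ?c" by (simp only: hom_poly_monom[OF \<xi> c] poly_monom power_0 mult_1_right)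
      ultimately have "poly (hom_poly \<xi> q0) \<beta> ~= 0" using ac(2) by auto
      moreover have "\<forall>N. \<forall>f\<in>?RP N. (\<forall>x. poly (f x) (b x) = 0) --> poly (hom_poly \<xi> f) \<beta> = 0"
        by (intro allI ballI impI) (rule ker, assumption, simp)
      from algebra_hom_extend[OF \<xi> this] obtain \<xi>' where
        "algebra_hom (poly_funs (insert b B)) \<xi>'" "\<forall>f\<in>poly_funs B. \<xi>' f = \<xi> f"
        "\<forall>n. \<forall>q\<in>?RP n. \<xi>' (%x. poly (q x) (b x)) = poly (hom_poly \<xi> q) \<beta>" by blast
      ultimately show ?thesis using q0 by (intro exI[of _ \<xi>']) auto
    qed
    show ?thesis by (rule bexI[OF _ u], intro conjI u0 allI impI) (rule ext, simp_all)
  qed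
qed

text \<open>The generators are adjoined one at a time, the function that controls one adjunction
  becoming the function \<open>v\<close> of those before it. Geometrically, the image of a dominant
  map contains a nonempty principal open set.\<close>

theorem extend_hom:
  assumes "finite D" "function_domain (poly_funs (D \<union> B))" "v \<in> poly_funs (D \<union> B)" "\<exists>x. v x ~= 0"
  shows "\<exists>u\<in>poly_funs B. (\<exists>x. u x ~= 0) & (\<forall>\<xi>. algebra_hom (poly_funs B) \<xi> & \<xi> u ~= 0 -->
     (\<exists>\<xi>'. algebra_hom (poly_funs (D \<union> B)) \<xi>' & (\<forall>f\<in>poly_funs B. \<xi>' f = \<xi> f) & \<xi>' v ~= 0))"
  using assms
proof (induction D arbitrary: v rule: finite_induct)
  case empty
  then show ?case by (intro bexI[of _ v]) auto
next
  case (insert d D)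
  have sub: "f \<in> poly_funs (D \<union> B) ==> f \<in> poly_funs (insert d (D \<union> B))" for f
    by (rule poly_funs_mono[OF _ subset_insertI])
  have sub': "f \<in> poly_funs B ==> f \<in> poly_funs (D \<union> B)" for f
    by (rule poly_funs_mono) auto
  have dom: "function_domain (poly_funs (insert d (D \<union> B)))" and v: "v \<in> poly_funs (insert d (D \<union> B))"
    using insert.prems by simp_all
  obtain u' where u': "u' \<in> poly_funs (D \<union> B)" "\<exists>x. u' x ~= 0"
    "\<forall>\<xi>. algebra_hom (poly_funs (D \<union> B)) \<xi> & \<xi> u' ~= 0 --> (\<exists>\<xi>'. algebra_hom (poly_funs (insert d (D \<union> B))) \<xi>' &
       (\<forall>f\<in>poly_funs (D \<union> B). \<xi>' f = \<xi> f) & \<xi>' v ~= 0)"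
    using extend_hom_step[OF dom v insert.prems(3)] by (elim bexE conjE)
  have "function_domain (poly_funs (D \<union> B))" using dom sub unfolding function_domain_def by blast
  from insert.IH[OF this u'(1,2)] obtain u where u: "u \<in> poly_funs B" "\<exists>x. u x ~= 0"
    "\<forall>\<xi>. algebra_hom (poly_funs B) \<xi> & \<xi> u ~= 0 --> (\<exists>\<xi>'. algebra_hom (poly_funs (D \<union> B)) \<xi>' &
       (\<forall>f\<in>poly_funs B. \<xi>' f = \<xi> f) & \<xi>' u' ~= 0)" by (elim bexE conjE)
  show ?case
  proof (intro bexI[OF _ u(1)] conjI u(2) allI impI)
    fix \<xi> assume "algebra_hom (poly_funs B) \<xi> & \<xi> u ~= 0"
    from u(3)[rule_format, OF this] obtain \<xi>1 where 1: "algebra_hom (poly_funs (D \<union> B)) \<xi>1"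
      "\<forall>f\<in>poly_funs B. \<xi>1 f = \<xi> f" "\<xi>1 u' ~= 0" by (elim exE conjE)
    from u'(3)[rule_format, OF conjI[OF 1(1,3)]] obtain \<xi>2 where
      "algebra_hom (poly_funs (insert d (D \<union> B))) \<xi>2" "\<forall>f\<in>poly_funs (D \<union> B). \<xi>2 f = \<xi>1 f" "\<xi>2 v ~= 0"
      by (elim exE conjE)
    then show "\<exists>\<xi>'. algebra_hom (poly_funs (insert d D \<union> B)) \<xi>' & (\<forall>f\<in>poly_funs B. \<xi>' f = \<xi> f) & \<xi>' v ~= 0"
      using 1(2) sub' by (intro exI[of _ \<xi>2]) simp
  qed
qed

section \<open>Orbits with the same closure\<close>

text \<open>The extension theorem concerns functions on a whole type. With the group as a type, two
  polynomials that agree on the group become the same function.\<close>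

typedef (overloaded) ('m::finite) special_linear = "{g :: complex^'m^'m. det g = 1}"
  morphisms sl_matrix Abs_special_linear
  by (rule exI[of _ "mat 1"]) simp

lemma det_sl_matrix: "det (sl_matrix g) = 1"
  using sl_matrix[of g] by simp

lemma sl_matrix_surj: "det h = 1 ==> \<exists>g. sl_matrix g = h"
  using Abs_special_linear_inverse[of h] by auto

text \<open>Polynomials on the special linear group extend to all matrices after scaling one column by \<open>1 / det g\<close> and
  clearing denominators.\<close>

lemma special_linear_extension:
  assumes "F \<in> poly_funs (mat_coords :: (complex^'m::finite^'m => complex) set)"
  shows "\<exists>F'\<in>poly_funs mat_coords. \<exists>N. \<forall>g. det g ~= 0 --> F' g = det g ^ N * F (g ** scale_column (1 / det g))"
proof -
  obtain P N where P: "\<forall>e. (%w. poly.coeff (P w) e) \<in> poly_funs mat_coords" "\<forall>w. degree (P w) \<le> N"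
    "\<forall>w \<delta>. F (\<chi> r k. w $ r $ k * (if k = undefined then \<delta> else 1)) = poly (P w) \<delta>"
    using diag_expansion[OF assms, of undefined] by (elim exE conjE)
  let ?F = "%g. \<Sum>e\<le>N. poly.coeff (P g) e * det g ^ (N - e)"
  have "?F \<in> poly_funs mat_coords"
    by (intro poly_funs_sum poly_funs.mult poly_funs_power det_poly) (use P(1) in blast)
  moreover have "?F g = det g ^ N * F (g ** scale_column (1 / det g))" if "det g ~= 0" for g
  proof -
    have "g ** scale_column (1 / det g) = (\<chi> r k. g $ r $ k * (if k = undefined then 1 / det g else 1))"
      by (simp add: vec_eq_iff matrix_matrix_mult_def scale_column_def if_distrib[of "%x. _ * x"] cong: if_cong)
    then have "F (g ** scale_column (1 / det g)) = poly (P g) (1 / det g)" using P(3) by simp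
    also have "\<dots> = (\<Sum>e\<le>N. poly.coeff (P g) e * (1 / det g) ^ e)"
      by (rule poly_eq_sum_le) (use P(2) in blast)
    finally have "det g ^ N * F (g ** scale_column (1 / det g)) = (\<Sum>e\<le>N. det g ^ N * (poly.coeff (P g) e * (1 / det g) ^ e))"
      by (simp only: sum_distrib_left)
    also have "\<dots> = ?F g"
    proof (rule sum.cong[OF refl])
      fix e assume "e \<in> {..N}"
      then have "det g ^ N = det g ^ (N - e) * det g ^ e" by (simp flip: power_add)
      then show "det g ^ N * (poly.coeff (P g) e * (1 / det g) ^ e) = poly.coeff (P g) e * det g ^ (N - e)"
        using that by (simp add: power_divide)
    qed
    finally show ?thesis by simp
  qed
  ultimately show ?thesis by (intro bexI[of _ ?F] exI[of _ N] allI impI)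
qed

text \<open>Irreducibility of the special linear group, inherited from the matrix space: the
  extended functions have product zero wherever \<open>det\<close> is nonzero, hence
  everywhere.\<close>

lemma special_linear_domain:
  assumes F: "F \<in> poly_funs (mat_coords :: (complex^'m::finite^'m => complex) set)" and G: "G \<in> poly_funs mat_coords"
    and FG: "!!h. det h = 1 ==> F h * G h = 0"
  shows "(\<forall>h. det h = 1 --> F h = 0) \<or> (\<forall>h. det h = 1 --> G h = 0)"
proof -
  obtain F' N where F': "F' \<in> poly_funs mat_coords"
    "\<forall>g. det g ~= 0 --> F' g = det g ^ N * F (g ** scale_column (1 / det g))"
    using special_linear_extension[OF F] by (elim bexE exE)
  obtain G' M where G': "G' \<in> poly_funs mat_coords"
    "\<forall>g. det g ~= 0 --> G' g = det g ^ M * G (g ** scale_column (1 / det g))"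
    using special_linear_extension[OF G] by (elim bexE exE)
  have z: "F' g * G' g = 0" if "det g ~= 0" for g
  proof -
    have "det (g ** scale_column (1 / det g)) = 1" using that by (simp add: det_mul)
    then have "F (g ** scale_column (1 / det g)) * G (g ** scale_column (1 / det g)) = 0" by (rule FG)
    then show ?thesis using F'(2) G'(2) that by auto
  qed
  have "F' g * G' g = 0" for g
    by (rule mat_poly_zero[where g = det and y = "mat 1" and f = "%g. F' g * G' g"])
       (use z in \<open>simp_all add: poly_funs.mult F'(1) G'(1) det_poly\<close>)
  then have "(\<forall>g. F' g = 0) \<or> (\<forall>g. G' g = 0)" by (rule mat_poly_domain[OF F'(1) G'(1)])
  moreover have "scale_column 1 = (mat 1 :: complex^'m^'m)" by (simp add: scale_column_def mat_def vec_eq_iff)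
  then have "F' h = F h" "G' h = G h" if "det h = 1" for h using F'(2) G'(2) that by simp_all
  ultimately show ?thesis by metis
qed

lemma congr_act_poly: "(%h. congr_act h T $ i $ j) \<in> poly_funs mat_coords" "(%T. congr_act h T $ i $ j) \<in> poly_funs mat_coords"
  unfolding congr_act_def
  by (intro poly_funs_mat_mult poly_funs.const mat_coord; simp add: transpose_def mat_coord)+

definition SL_orbit :: "complex^'m::finite^'m => (complex^'m^'m) set" where
  "SL_orbit T = {congr_act h T | h. det h = 1}"

definition poly_closure :: "(complex^'m^'n) set => (complex^'m^'n) set" where
  "poly_closure S = {x. \<forall>F\<in>poly_funs mat_coords. (\<forall>y\<in>S. F y = 0) --> F x = 0}"

lemma poly_closureD: "x \<in> poly_closure S ==> F \<in> poly_funs mat_coords ==> (!!y. y \<in> S ==> F y = 0) ==> F x = 0"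
  unfolding poly_closure_def by blast

text \<open>The functions of \<open>g\<close> that factor through the orbit map form the coordinate
  ring of the orbit closure, generated by \<open>B\<close>. A point of the closure with
  \<open>s x ~= 0\<close> is a homomorphism on it that extends to the coordinate ring of the group;
  the extension is evaluation at a matrix of determinant 1, which carries \<open>T\<close> to
  \<open>x\<close>.\<close>

lemma SL_orbit_open_in_closure:
  fixes T :: "complex^'m::finite^'m"
  shows "\<exists>s\<in>poly_funs mat_coords. (\<exists>x\<in>SL_orbit T. s x ~= 0) &
     (\<forall>x\<in>poly_closure (SL_orbit T). s x ~= 0 --> x \<in> SL_orbit T)"
proof -
  let ?orb = "%g :: 'm special_linear. congr_act (sl_matrix g) T"
  let ?P = "poly_funs (mat_coords :: (complex^'m^'m => complex) set)"
  define B where "B = range (%(i, j) g. ?orb g $ i $ j)"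
  define D where "D = range (%(i, j) (g :: 'm special_linear). sl_matrix g $ i $ j)"
  have orb: "?orb g \<in> SL_orbit T" for g using det_sl_matrix[of g] by (auto simp: SL_orbit_def)
  have orb_ex: "\<exists>g. y = ?orb g" if "y \<in> SL_orbit T" for y
    using that sl_matrix_surj by (fastforce simp: SL_orbit_def)
  have B_in: "(%g. ?orb g $ i $ j) \<in> B" for i j unfolding B_def by (rule range_eqI[of _ _ "(i, j)"]) simp
  have D_in: "(%g. sl_matrix g $ i $ j) \<in> D" for i j unfolding D_def by (rule range_eqI[of _ _ "(i, j)"]) simp
  have BI: "(%g. F (?orb g)) \<in> poly_funs B" if "F \<in> ?P" for F
    by (rule poly_funs_compose_mat[OF that]) (rule poly_funs.coord[OF B_in])
  have BE: "\<exists>F\<in>?P. f = (%g. F (?orb g))" if "f \<in> poly_funs B" for f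
    using that
  proof induction
    case (const c)
    show ?case by (rule bexI[of _ "%_. c"]) (simp_all add: poly_funs.const)
  next
    case (coord f)
    then obtain i j where "f = (%g. ?orb g $ i $ j)" by (auto simp: B_def)
    then show ?case by (intro bexI[of _ "%x. x $ i $ j"]) (simp_all add: mat_coord)
  next
    case (add f h)
    then obtain F H where "F \<in> ?P" "H \<in> ?P" "f = (%g. F (?orb g))" "h = (%g. H (?orb g))" by (elim bexE)
    then show ?case by (intro bexI[of _ "%x. F x + H x"]) (simp_all add: poly_funs.add)
  next
    case (mult f h)
    then obtain F H where "F \<in> ?P" "H \<in> ?P" "f = (%g. F (?orb g))" "h = (%g. H (?orb g))" by (elim bexE)
    then show ?case by (intro bexI[of _ "%x. F x * H x"]) (simp_all add: poly_funs.mult)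
  qed
  have DI: "(%g. F (sl_matrix g)) \<in> poly_funs (D \<union> B)" if "F \<in> ?P" for F
    by (rule poly_funs_compose_mat[OF that]) (rule poly_funs.coord[OF UnI1[OF D_in]])
  have DE: "\<exists>F\<in>?P. f = (%g. F (sl_matrix g))" if "f \<in> poly_funs (D \<union> B)" for f
    using that
  proof induction
    case (const c)
    show ?case by (rule bexI[of _ "%_. c"]) (simp_all add: poly_funs.const)
  next
    case (coord f)
    then consider i j where "f = (%g. sl_matrix g $ i $ j)" | i j where "f = (%g. ?orb g $ i $ j)"
      by (auto simp: B_def D_def)
    then show ?case
    proof cases
      case 1
      then show ?thesis by (intro bexI[of _ "%x. x $ i $ j"]) (simp_all add: mat_coord)
    next
      case 2
      then show ?thesis by (intro bexI[of _ "%h. congr_act h T $ i $ j"]) (simp_all add: congr_act_poly)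
    qed
  next
    case (add f h)
    then obtain F H where "F \<in> ?P" "H \<in> ?P" "f = (%g. F (sl_matrix g))" "h = (%g. H (sl_matrix g))" by (elim bexE)
    then show ?case by (intro bexI[of _ "%x. F x + H x"]) (simp_all add: poly_funs.add)
  next
    case (mult f h)
    then obtain F H where "F \<in> ?P" "H \<in> ?P" "f = (%g. F (sl_matrix g))" "h = (%g. H (sl_matrix g))" by (elim bexE)
    then show ?case by (intro bexI[of _ "%x. F x * H x"]) (simp_all add: poly_funs.mult)
  qed
  have dom: "function_domain (poly_funs (D \<union> B))"
    unfolding function_domain_def
  proof (intro ballI impI)
    fix f h assume "f \<in> poly_funs (D \<union> B)" "h \<in> poly_funs (D \<union> B)" and 0: "\<forall>x. f x * h x = 0"
    then obtain F H where FH: "F \<in> ?P" "H \<in> ?P" "f = (%g. F (sl_matrix g))" "h = (%g. H (sl_matrix g))"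
      using DE by metis
    have "F k * H k = 0" if "det k = 1" for k
      using sl_matrix_surj[OF that] 0 FH(3,4) by auto
    from special_linear_domain[OF FH(1,2) this]
    show "(\<forall>x. f x = 0) \<or> (\<forall>x. h x = 0)" using det_sl_matrix unfolding FH(3,4) by blast
  qed
  have one: "(%_. 1) \<in> poly_funs (D \<union> B)" by (rule poly_funs.const)
  have "finite D" by (simp add: D_def)
  from extend_hom[OF this dom one] obtain u where u: "u \<in> poly_funs B" "\<exists>x. u x ~= 0"
    and ext: "\<forall>\<xi>. algebra_hom (poly_funs B) \<xi> & \<xi> u ~= 0 --> (\<exists>\<xi>'. algebra_hom (poly_funs (D \<union> B)) \<xi>' &
       (\<forall>f\<in>poly_funs B. \<xi>' f = \<xi> f) & \<xi>' (%_. 1) ~= 0)"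
    by auto
  obtain s where s: "s \<in> ?P" "u = (%g. s (?orb g))" using BE[OF u(1)] by (elim bexE)
  have "x \<in> SL_orbit T" if x: "x \<in> poly_closure (SL_orbit T)" and sx: "s x ~= 0" for x
  proof -
    \<comment> \<open>Evaluation at \<open>x\<close>, well defined because two polynomials that
      agree on the orbit also agree on its closure.\<close>
    define \<xi> where "\<xi> f = (SOME F. F \<in> ?P & f = (%g. F (?orb g))) x" for f
    have \<xi>: "\<xi> (%g. F (?orb g)) = F x" if F: "F \<in> ?P" for F
    proof -
      let ?Q = "%H. H \<in> ?P & (%g. F (?orb g)) = (%g. H (?orb g))"
      define H where "H = (SOME H. ?Q H)"
      have "\<exists>H. ?Q H" using F by blast
      then have "?Q (SOME H. ?Q H)" by (rule someI_ex)
      then have H: "H \<in> ?P" "(%g. F (?orb g)) = (%g. H (?orb g))" by (simp_all only: H_def)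
      have "H y - F y = 0" if "y \<in> SL_orbit T" for y
        using orb_ex[OF that] fun_cong[OF H(2)] by auto
      then have "H x - F x = 0" by (rule poly_closureD[OF x poly_funs_diff[OF H(1) F]])
      then show ?thesis by (simp add: \<xi>_def H_def)
    qed
    have "algebra_hom (poly_funs B) \<xi>"
      unfolding algebra_hom_def
    proof (intro conjI allI ballI)
      show "\<xi> (%_. c) = c" for c using \<xi>[OF poly_funs.const[of c]] .
      fix f h assume "f \<in> poly_funs B" "h \<in> poly_funs B"
      then obtain F H where FH: "F \<in> ?P" "H \<in> ?P" "f = (%g. F (?orb g))" "h = (%g. H (?orb g))" using BE by metis
      show "\<xi> (%x. f x + h x) = \<xi> f + \<xi> h"
        unfolding FH(3,4) \<xi>[OF FH(1)] \<xi>[OF FH(2)] by (rule \<xi>[OF poly_funs.add[OF FH(1,2)]])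
      show "\<xi> (%x. f x * h x) = \<xi> f * \<xi> h"
        unfolding FH(3,4) \<xi>[OF FH(1)] \<xi>[OF FH(2)] by (rule \<xi>[OF poly_funs.mult[OF FH(1,2)]])
    qed
    moreover have "\<xi> u ~= 0" using sx \<xi>[OF s(1)] unfolding s(2) by simp
    ultimately obtain \<xi>' where \<xi>': "algebra_hom (poly_funs (D \<union> B)) \<xi>'" "\<forall>f\<in>poly_funs B. \<xi>' f = \<xi> f"
      using ext by blast
    define g0 :: "complex^'m^'m" where "g0 = (\<chi> i j. \<xi>' (%g. sl_matrix g $ i $ j))"
    have ev: "\<xi>' (%g. F (sl_matrix g)) = F g0" if "F \<in> ?P" for F
      using that
    proof induction
      case (const c)
      then show ?case using \<xi>'(1) by (simp add: algebra_hom_def)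
    next
      case (coord F)
      then obtain i j where "F = (%x. x $ i $ j)" by (auto simp: mat_coords_def)
      then show ?case by (simp add: g0_def)
    next
      case (add F H)
      then show ?case using \<xi>'(1) DI by (simp add: algebra_hom_def)
    next
      case (mult F H)
      then show ?case using \<xi>'(1) DI by (simp add: algebra_hom_def)
    qed
    have "det g0 = \<xi>' (%_. 1)" using ev[OF det_poly] by (simp add: det_sl_matrix)
    then have "det g0 = 1" using \<xi>'(1) by (simp add: algebra_hom_def)
    moreover have "congr_act g0 T $ i $ j = x $ i $ j" for i j
    proof -
      have "congr_act g0 T $ i $ j = \<xi>' (%g. ?orb g $ i $ j)" by (rule ev[OF congr_act_poly(1), symmetric])
      also have "\<dots> = \<xi> (%g. ?orb g $ i $ j)" using \<xi>'(2) poly_funs.coord[OF B_in] by blast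
      also have "\<dots> = x $ i $ j" by (rule \<xi>[OF mat_coord])
      finally show ?thesis .
    qed
    then have "congr_act g0 T = x" unfolding vec_eq_iff by blast
    ultimately show ?thesis by (auto simp: SL_orbit_def)
  qed
  moreover have "\<exists>x\<in>SL_orbit T. s x ~= 0" using u(2) orb unfolding s(2) by blast
  ultimately show ?thesis using s(1) by blast
qed

lemma congr_act_mult: "congr_act h (congr_act k T) = congr_act (h ** k) T"
  by (simp add: congr_act_def matrix_transpose_mul matrix_mul_assoc)

lemma SL_inverse:
  fixes h :: "complex^'m::finite^'m"
  assumes "det h = 1"
  shows "\<exists>k. det k = 1 & k ** h = mat 1 & h ** k = mat 1"
proof -
  have "invertible h" using assms by (simp add: invertible_det_nz)
  then obtain k where k: "h ** k = mat 1" "k ** h = mat 1" unfolding invertible_def by blast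
  then have "det h * det k = 1" by (metis det_mul det_I)
  then show ?thesis using k assms by auto
qed

lemma SL_orbit_refl: "T \<in> SL_orbit (T :: complex^'m::finite^'m)"
  unfolding SL_orbit_def by (rule CollectI, rule exI[of _ "mat 1"]) (simp add: congr_act_def transpose_mat)

lemma SL_orbit_congr:
  assumes "T' \<in> SL_orbit T" "det h = 1"
  shows "congr_act h T' \<in> SL_orbit T"
proof -
  obtain k where k: "det k = 1" "T' = congr_act k T" using assms(1) by (auto simp: SL_orbit_def)
  have "congr_act h T' = congr_act (h ** k) T" "det (h ** k) = 1"
    using k assms(2) by (simp_all add: congr_act_mult det_mul)
  then show ?thesis unfolding SL_orbit_def by blast
qed

lemma SL_orbit_sym:
  assumes "T' \<in> SL_orbit T"
  shows "T \<in> SL_orbit T'"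
proof -
  obtain h where h: "det h = 1" "T' = congr_act h T" using assms by (auto simp: SL_orbit_def)
  obtain k where k: "det k = 1" "k ** h = mat 1" using SL_inverse[OF h(1)] by blast
  have "congr_act k T' = T" unfolding h(2) congr_act_mult k(2) by (simp add: congr_act_def transpose_mat)
  then show ?thesis using k(1) by (auto simp: SL_orbit_def)
qed

lemma SL_orbit_eq: "T' \<in> SL_orbit T ==> SL_orbit T' = SL_orbit T"
proof -
  have "SL_orbit T1 \<subseteq> SL_orbit T2" if "T1 \<in> SL_orbit T2" for T1 T2 :: "complex^'m^'m"
    using SL_orbit_congr[OF that] by (auto simp: SL_orbit_def)
  then show "T' \<in> SL_orbit T ==> SL_orbit T' = SL_orbit T" using SL_orbit_sym by blast
qed

lemma poly_closure_subset: "S \<subseteq> poly_closure S"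
  by (auto simp: poly_closure_def)

text \<open>By density the first orbit meets the open part of the common closure that lies inside
  the second one, and orbits that meet are equal.\<close>

lemma SL_orbit_eq_of_closure:
  fixes T1 T2 :: "complex^'m::finite^'m"
  assumes "poly_closure (SL_orbit T1) = poly_closure (SL_orbit T2)"
  shows "SL_orbit T1 = SL_orbit T2"
proof -
  obtain s x where s: "s \<in> poly_funs mat_coords" and x: "x \<in> SL_orbit T2" "s x ~= 0"
    and s_closure: "\<forall>x\<in>poly_closure (SL_orbit T2). s x ~= 0 --> x \<in> SL_orbit T2"
    using SL_orbit_open_in_closure[of T2] by (elim bexE conjE)
  have "\<exists>y\<in>SL_orbit T1. s y ~= 0"
  proof (rule ccontr)
    assume *: "~ ?thesis"
    have "x \<in> poly_closure (SL_orbit T1)" using x(1) poly_closure_subset assms by blast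
    then have "s x = 0" by (rule poly_closureD[OF _ s]) (use * in blast)
    then show False using x(2) by simp
  qed
  then obtain y where y: "y \<in> SL_orbit T1" "s y ~= 0" by blast
  then have "y \<in> SL_orbit T2" using s_closure poly_closure_subset assms by blast
  then show ?thesis using SL_orbit_eq y(1) by metis
qed

lemma poly_closure_congr:
  assumes "x \<in> poly_closure (SL_orbit T)" "det h = 1"
  shows "congr_act h x \<in> poly_closure (SL_orbit (T :: complex^'m::finite^'m))"
  unfolding poly_closure_def
proof (rule CollectI, intro ballI impI)
  fix F assume F: "F \<in> poly_funs mat_coords" "\<forall>y\<in>SL_orbit T. F y = 0"
  have "(%T. F (congr_act h T)) \<in> poly_funs mat_coords"
    by (rule poly_funs_compose_mat[OF F(1) congr_act_poly(2)])
  then show "F (congr_act h x) = 0"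
    by (rule poly_closureD[OF assms(1)]) (use F(2) SL_orbit_congr[OF _ assms(2)] in blast)
qed

section \<open>The orbit correspondence\<close>

definition gram_sum :: "('m::finite, 'p::finite, 'q::finite) W_space => complex^'m^'m" where
  "gram_sum w = fst (gram w) + snd (gram w)"

definition sym_alt_parts :: "complex^'m^'m => (complex^'m^'m) \<times> (complex^'m^'m)" where
  "sym_alt_parts T = ((\<chi> i j. (T $ i $ j + T $ j $ i) / 2), (\<chi> i j. (T $ i $ j - T $ j $ i) / 2))"

lemma sym_alt_parts_in: "sym_alt_parts T \<in> Sym_space \<times> Alt_space"
proof -
  have "fst (sym_alt_parts T) \<in> Sym_space" by (rule Sym_spaceI) (simp add: sym_alt_parts_def add.commute)
  moreover have "snd (sym_alt_parts T) \<in> Alt_space" by (rule Alt_spaceI) (simp add: sym_alt_parts_def diff_divide_distrib)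
  ultimately show ?thesis by (simp add: mem_Times_iff)
qed

lemma sym_alt_parts_sum: "fst (sym_alt_parts T) + snd (sym_alt_parts T) = T"
  by (simp add: sym_alt_parts_def vec_eq_iff field_simps)

lemma sym_alt_parts_add:
  assumes "S \<in> Sym_space" "A \<in> Alt_space"
  shows "sym_alt_parts (S + A) = (S, A)"
proof -
  have "(S $ i $ j + A $ i $ j + (S $ j $ i + A $ j $ i)) / 2 = S $ i $ j" for i j
    unfolding Sym_spaceD[OF assms(1), of j i] Alt_spaceD[OF assms(2), of j i] by simp
  moreover have "(S $ i $ j + A $ i $ j - (S $ j $ i + A $ j $ i)) / 2 = A $ i $ j" for i j
    unfolding Sym_spaceD[OF assms(1), of j i] Alt_spaceD[OF assms(2), of j i] by simp
  ultimately show ?thesis by (simp add: sym_alt_parts_def prod_eq_iff vec_eq_iff)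
qed

lemma sym_alt_parts_poly:
  "(%T. fst (sym_alt_parts T) $ i $ j) \<in> poly_funs mat_coords" "(%T. snd (sym_alt_parts T) $ i $ j) \<in> poly_funs mat_coords"
  by (simp_all add: sym_alt_parts_def poly_funs_divide poly_funs.add poly_funs_diff mat_coord)

lemma Sym_Alt_iso: "variety_iso Sym_Alt_variety mat_space (%(S, A). S + A :: complex^'m::finite^'m)"
proof -
  let ?h = "%(S, A). S + A :: complex^'m^'m"
  let ?Z = "Sym_space \<times> Alt_space :: ((complex^'m^'m) \<times> (complex^'m^'m)) set"
  have left: "sym_alt_parts (?h z) = z" if "z \<in> ?Z" for z using that sym_alt_parts_add by auto
  have right: "?h (sym_alt_parts T) = T" for T using sym_alt_parts_sum[of T] by (simp add: case_prod_beta)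
  have bij: "bij_betw ?h ?Z UNIV"
    by (rule bij_betwI[where g = sym_alt_parts]) (use left right sym_alt_parts_in in auto)
  have inv: "inv_into ?Z ?h T = sym_alt_parts T" for T
    using left[OF sym_alt_parts_in, of T] inv_into_f_f[OF bij_betw_imp_inj_on[OF bij] sym_alt_parts_in, of T] right[of T] by simp
  have "regular_map Sym_Alt_variety mat_space ?h"
    unfolding regular_map_def
  proof (intro conjI ballI)
    show "?h \<in> points Sym_Alt_variety \<rightarrow> points mat_space" by (simp add: mat_space_def)
    fix f assume "f \<in> regular (mat_space :: (complex^'m^'m) variety)"
    then have f: "f \<in> poly_funs mat_coords" by (simp add: mat_space_def)
    have "(%z. f (fst z + snd z)) \<in> poly_funs mat_pair_coords"
      by (rule poly_funs_compose_mat[OF f]) (simp add: poly_funs.add mat_pair_coord)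
    then show "\<exists>f'\<in>regular Sym_Alt_variety. \<forall>x\<in>points Sym_Alt_variety. f (?h x) = f' x"
      by (intro bexI[of _ "%z. f (fst z + snd z)"]) (simp_all add: Sym_Alt_variety_def case_prod_beta)
  qed
  moreover have "regular_map mat_space Sym_Alt_variety (inv_into ?Z ?h)"
    unfolding regular_map_def inv[abs_def]
  proof (intro conjI ballI)
    show "sym_alt_parts \<in> points mat_space \<rightarrow> points Sym_Alt_variety"
      using sym_alt_parts_in by (auto simp: Sym_Alt_variety_def)
    fix f assume "f \<in> regular (Sym_Alt_variety :: ((complex^'m^'m) \<times> (complex^'m^'m)) variety)"
    then have "f \<in> poly_funs mat_pair_coords" by (simp add: Sym_Alt_variety_def)
    then have "(%T. f (sym_alt_parts T)) \<in> poly_funs mat_coords"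
      by (rule poly_funs_compose_pair) (rule sym_alt_parts_poly)+
    then show "\<exists>f'\<in>regular mat_space. \<forall>x\<in>points mat_space. f (sym_alt_parts x) = f' x"
      by (intro bexI[of _ "%T. f (sym_alt_parts T)"]) (simp_all add: mat_space_def)
  qed
  ultimately show ?thesis using bij by (simp add: variety_iso_def Sym_Alt_variety_def mat_space_def)
qed

lemma matrix_add_mult_distrib: "(A + B) ** C = A ** C + B ** (C :: complex^'a::finite^'b::finite)"
  by (simp add: vec_eq_iff matrix_matrix_mult_def distrib_right sum.distrib)

lemma Sym_Alt_equivariant:
  "equivariant SL_group (points Sym_Alt_variety) congr_act2 congr_act (%(S, A). S + A :: complex^'m::finite^'m)"
  by (simp add: equivariant_def congr_act2_def congr_act_def case_prod_beta matrix_add_ldistrib matrix_add_mult_distrib)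

lemma gram_sum_eq_iff: "gram_sum w = gram_sum w' \<longleftrightarrow> gram w = gram w'"
proof
  assume eq: "gram_sum w = gram_sum w'"
  have "sym_alt_parts (gram_sum w) = gram w" for w :: "('m::finite, 'p::finite, 'q::finite) W_space"
    using gram_in[of w] sym_alt_parts_add[of "fst (gram w)" "snd (gram w)"] by (simp add: gram_sum_def mem_Times_iff)
  then show "gram w = gram w'" using eq by metis
qed (simp add: gram_sum_def)

lemma gram_sum_SL_act: "gram_sum (SL_act h w) = congr_act h (gram_sum w)"
  by (simp add: gram_sum_def gram_SL_act congr_act2_def case_prod_beta congr_act_def matrix_add_ldistrib matrix_add_mult_distrib)

lemma gram_sum_mult: "gram_sum (w ** h) = congr_act (transpose h) (gram_sum w)"
  using gram_sum_SL_act[of "transpose h" w] by (simp add: SL_act_def)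

lemma gram_sum_OSp_act: "g \<in> carrier OSp_group ==> gram_sum (OSp_act g w) = gram_sum w"
  by (simp add: gram_sum_def gram_OSp_act)

lemma gram_sum_0: "gram_sum (0 :: ('m::finite, 'p::finite, 'q::finite) W_space) = 0"
proof -
  have "gram_sum ((0 :: ('m, 'p, 'q) W_space) ** (0 :: complex^'m^'m)) = congr_act (transpose 0) (gram_sum (0 :: ('m, 'p, 'q) W_space))"
    by (rule gram_sum_mult)
  then show ?thesis by (simp add: congr_act_def transpose_def zero_vec_def[symmetric])
qed

lemma gram_sum_poly: "(%w. gram_sum w $ i $ j) \<in> poly_funs mat_coords"
  by (simp add: gram_sum_def poly_funs.add gram_poly)

lemma full_imp_full_rank: "full w ==> full_rank w"
proof -
  assume w: "full w"
  have "x = 0" if "w *v x = 0" for x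
  proof -
    have "top_rows w *v x = 0" using that by (simp add: vec_eq_iff top_rows_def matrix_vector_mult_def)
    then show "x = 0" using w by (simp add: full_def full_rank_def)
  qed
  then show "full_rank w" by (simp add: full_rank_def)
qed

lemma full_rank_mult_left_iff:
  assumes "h ** g = mat 1"
  shows "full_rank (g ** w) \<longleftrightarrow> full_rank w"
proof
  assume *: "full_rank (g ** w)"
  have "x = 0" if "w *v x = 0" for x
  proof -
    have "(g ** w) *v x = 0" using that by (simp add: matrix_vector_mul_assoc[symmetric])
    then show "x = 0" using * unfolding full_rank_def by blast
  qed
  then show "full_rank w" by (simp add: full_rank_def)
qed (rule full_rank_mult[OF _ assms])

lemma OSp_act_full_rank:
  fixes w :: "('m::finite, 'p::finite, 'q::finite) W_space"
  assumes "g \<in> carrier OSp_group"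
  shows "full_rank (top_rows (OSp_act g w)) \<longleftrightarrow> full_rank (top_rows w)"
    "full_rank (bottom_rows (OSp_act g w)) \<longleftrightarrow> full_rank (bottom_rows w)"
proof -
  obtain a s where g: "g = (a, s)" by (cases g)
  then have a: "a \<in> isometries (mat 1)" and s: "s \<in> isometries symp_form"
    using assms by (simp_all add: OSp_carrier)
  obtain a' where a': "a' ** a = mat 1" using isometries_inverse[OF invertible_mat_1 a] by blast
  obtain s' where s': "s' ** s = mat 1" using isometries_inverse[OF invertible_symp_form s] by blast
  show "full_rank (top_rows (OSp_act g w)) \<longleftrightarrow> full_rank (top_rows w)"
    by (simp add: g OSp_act_rows full_rank_mult_left_iff[OF a'])
  show "full_rank (bottom_rows (OSp_act g w)) \<longleftrightarrow> full_rank (bottom_rows w)"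
    by (simp add: g OSp_act_rows full_rank_mult_left_iff[OF s'])
qed

lemma OSp_act_full: "g \<in> carrier OSp_group ==> full (OSp_act g w) \<longleftrightarrow> full w"
  by (simp add: full_def OSp_act_full_rank)

lemma full_SL_act:
  fixes w :: "complex^'a::finite^('p::finite + 'r::finite)"
  assumes "det h = 1" "full w"
  shows "full (SL_act h w)"
proof -
  have "invertible (transpose h)" using assms(1) by (simp add: invertible_det_nz)
  then obtain k where k: "k ** transpose h = mat 1" unfolding invertible_def by blast
  have "(k ** B) ** (x ** transpose h) = mat 1" if "B ** x = mat 1" for B and x :: "complex^'a^'p"
    using that k by (metis matrix_mul_assoc matrix_mul_lid)
  moreover have "(k ** B) ** (x ** transpose h) = mat 1" if "B ** x = mat 1" for B and x :: "complex^'a^'r"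
    using that k by (metis matrix_mul_assoc matrix_mul_lid)
  ultimately show ?thesis
    using assms(2) unfolding full_def rows_SL_act full_rank_left_inverse by blast
qed

lemma column_wedge_OSp_act: "column_wedge (OSp_act g w) = OSp_cone_act g (column_wedge w)"
  by (simp add: OSp_act_def OSp_cone_act_def tensor_act_column_wedge)

lemma column_wedge_nth_fun: "($) (column_wedge w) = (%a. minor a w)"
  by (rule ext) (rule column_wedge_nth)

lemma det_zero_matrix: "det ((\<chi> i j. 0) :: complex^'m::finite^'m) = 0"
proof -
  have "column_wedge (0 :: complex^'m^'m) $ id = 0" by (simp only: column_wedge_0 zero_index)
  then show ?thesis by (simp add: column_wedge_nth minor_def)
qed

section \<open>Closures in the cone and the candidate for the lift\<close>

definition vec_closure :: "(complex^'n) set => (complex^'n) set" where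
  "vec_closure S = {x. \<forall>F\<in>poly_funs vec_coords. (\<forall>y\<in>S. F y = 0) --> F x = 0}"

lemma vec_closureD: "x \<in> vec_closure S ==> F \<in> poly_funs vec_coords ==> (!!y. y \<in> S ==> F y = 0) ==> F x = 0"
  unfolding vec_closure_def by blast

text \<open>In the model of the quotients, the image under \<open>\<phi>\<close> of the preimage of
  \<open>Z\<close> under \<open>\<psi>\<close>.\<close>

definition wedges_over :: "(complex^'m^'m) set => (complex^('m::finite => 'p::finite + ('q::finite + 'q))) set" where
  "wedges_over Z = {column_wedge w | w :: ('m, 'p, 'q) W_space. gram_sum w \<in> Z}"

text \<open>The lift itself: for an orbit \<open>Z\<close> the restriction to full points leaves a
  single orbit, by \<open>lifted_orbit_full\<close>.\<close>

definition lifted_orbit :: "(complex^'m^'m) set => (complex^('m::finite => 'p::finite + ('q::finite + 'q))) set" where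
  "lifted_orbit Z = {column_wedge w | w :: ('m, 'p, 'q) W_space. gram_sum w \<in> Z & full w}"

text \<open>Pulls a polynomial on \<open>W\<close> back to the cone along the rational section
  \<open>plucker_matrix\<close>; a power of the coordinate at \<open>f\<close> clears the
  denominators.\<close>

lemma cleared_plucker:
  fixes f :: "'m::finite => 'n::finite" and h :: "complex^'m^'n => complex"
  assumes "h \<in> poly_funs mat_coords"
  shows "\<exists>P\<in>poly_funs vec_coords. \<exists>N. \<forall>x. x $ f ~= 0 --> P x = x $ f ^ N * h (plucker_matrix f (%a. x $ a))"
  using assms
proof induction
  case (const c)
  show ?case by (intro bexI[of _ "%_. c"] exI[of _ 0]) (simp_all add: poly_funs.const)
next
  case (coord h)
  then obtain r l where h: "h = (%w. w $ r $ l)" by (auto simp: mat_coords_def)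
  have "(%x :: complex^('m => 'n). x $ (f(l := r)) * (if l = undefined then x $ f else 1)) \<in> poly_funs vec_coords"
    by (cases "l = undefined") (simp_all add: poly_funs.mult vec_coord)
  then show ?case
    by (intro bexI[of _ "%x. x $ (f(l := r)) * (if l = undefined then x $ f else 1)"] exI[of _ 1])
       (auto simp: h plucker_matrix_nth)
next
  case (add h k)
  then obtain P N Q M where P: "P \<in> poly_funs vec_coords" "\<forall>x. x $ f ~= 0 --> P x = x $ f ^ N * h (plucker_matrix f (%a. x $ a))"
    and Q: "Q \<in> poly_funs vec_coords" "\<forall>x. x $ f ~= 0 --> Q x = x $ f ^ M * k (plucker_matrix f (%a. x $ a))" by (elim bexE exE)
  show ?case
    by (intro bexI[of _ "%x. x $ f ^ M * P x + x $ f ^ N * Q x"] exI[of _ "N + M"])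
       (use P Q in \<open>auto simp: power_add distrib_left mult_ac intro!: poly_funs.add poly_funs.mult poly_funs_power vec_coord\<close>)
next
  case (mult h k)
  then obtain P N Q M where P: "P \<in> poly_funs vec_coords" "\<forall>x. x $ f ~= 0 --> P x = x $ f ^ N * h (plucker_matrix f (%a. x $ a))"
    and Q: "Q \<in> poly_funs vec_coords" "\<forall>x. x $ f ~= 0 --> Q x = x $ f ^ M * k (plucker_matrix f (%a. x $ a))" by (elim bexE exE)
  show ?case
    by (intro bexI[of _ "%x. P x * Q x"] exI[of _ "N + M"])
       (use P Q in \<open>auto simp: power_add mult_ac intro!: poly_funs.mult\<close>)
qed

context
  fixes \<sigma> :: "complex^'m::finite^'m => ('m, 'p::finite, 'q::finite) W_space"
  assumes c: "2 * CARD('m) < CARD('p)" "2 * CARD('m) < 2 * CARD('q) + 1"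
    and \<sigma>: "!!T. gram_sum (\<sigma> T) = T" "!!T. full (\<sigma> T)" "!!i j. (%T. \<sigma> T $ i $ j) \<in> poly_funs mat_coords"
begin

text \<open>An equation \<open>h\<close> of the orbit closure, composed with the Gram sum and the
  section of the chart \<open>f\<close>, becomes a polynomial on the cone. The additional factor
  \<open>x $ f\<close> makes it vanish also on the wedges outside the chart, so it vanishes at
  \<open>column_wedge w0\<close>. The section meets the fibre up to the special linear group, which
  preserves the closure.\<close>

lemma wedges_over_closed_nonzero:
  fixes w0 :: "('m, 'p, 'q) W_space"
  assumes x: "column_wedge w0 \<in> vec_closure (wedges_over (poly_closure (SL_orbit A0)))" and nz: "column_wedge w0 ~= 0"
  shows "gram_sum w0 \<in> poly_closure (SL_orbit A0)"
proof -
  let ?Z = "poly_closure (SL_orbit A0)"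
  obtain f where f: "minor f w0 ~= 0" using nz by (auto simp: column_wedge_eq_0_iff)
  obtain k where k: "det k = 1" "plucker_matrix f (%a. minor a w0) = w0 ** k" using plucker_matrix_orbit[OF f] by blast
  have "gram_sum (w0 ** k) \<in> ?Z"
    unfolding poly_closure_def
  proof (rule CollectI, intro ballI impI)
    fix h assume h: "h \<in> poly_funs mat_coords" "\<forall>y\<in>SL_orbit A0. h y = 0"
    have "(%w :: ('m, 'p, 'q) W_space. h (gram_sum w)) \<in> poly_funs mat_coords"
      by (rule poly_funs_compose_mat[OF h(1) gram_sum_poly])
    from cleared_plucker[OF this, of f] obtain P N where P: "P \<in> poly_funs vec_coords"
      "\<forall>x. x $ f ~= 0 --> P x = x $ f ^ N * h (gram_sum (plucker_matrix f (%a. x $ a) :: ('m, 'p, 'q) W_space))"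
      by (elim bexE exE)
    have "(%x. x $ f * P x) \<in> poly_funs vec_coords" by (intro poly_funs.mult vec_coord P(1))
    then have "column_wedge w0 $ f * P (column_wedge w0) = 0"
    proof (rule vec_closureD[OF x])
      fix y :: "complex^('m => 'p + ('q + 'q))" assume "y \<in> wedges_over ?Z"
      then obtain w :: "('m, 'p, 'q) W_space" where w: "y = column_wedge w" "gram_sum w \<in> ?Z" by (auto simp: wedges_over_def)
      show "y $ f * P y = 0"
      proof (cases "minor f w = 0")
        case False
        obtain j where j: "det j = 1" "plucker_matrix f (%a. minor a w) = w ** j" using plucker_matrix_orbit[OF False] by blast
        have "gram_sum (w ** j) \<in> ?Z" unfolding gram_sum_mult by (rule poly_closure_congr[OF w(2)]) (simp add: j)
        then have "h (gram_sum (w ** j)) = 0" by (rule poly_closureD[OF _ h(1)]) (use h(2) in blast)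
        then have "P y = 0" using P(2)[rule_format, of y] False by (simp add: w(1) column_wedge_nth column_wedge_nth_fun j(2))
        then show ?thesis by simp
      qed (simp add: w(1) column_wedge_nth)
    qed
    then show "h (gram_sum (w0 ** k)) = 0"
      using P(2)[rule_format, of "column_wedge w0"] f by (simp add: column_wedge_nth column_wedge_nth_fun k(2))
  qed
  then have "congr_act (transpose k) (gram_sum w0) \<in> ?Z" by (simp add: gram_sum_mult)
  moreover obtain k' where "det k' = 1" "k' ** transpose k = mat 1" using SL_inverse[of "transpose k"] k(1) by auto
  ultimately show ?thesis using poly_closure_congr[of _ A0 k'] by (metis congr_act_mult congr_act_def matrix_mul_lid matrix_mul_rid transpose_mat)
qed

lemma wedges_over_closed_zero:
  assumes x: "0 \<in> vec_closure (wedges_over (poly_closure (SL_orbit A0)) :: (complex^('m => 'p + ('q + 'q))) set)"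
  shows "0 \<in> (wedges_over (poly_closure (SL_orbit A0)) :: (complex^('m => 'p + ('q + 'q))) set)"
proof -
  let ?Z = "poly_closure (SL_orbit A0)"
  define pen where "pen z T = det (\<chi> i j. fst (sym_alt_parts T) $ i $ j + z * snd (sym_alt_parts T) $ i $ j)"
    for z and T :: "complex^'m^'m"
  have pen_poly: "pen z \<in> poly_funs mat_coords" for z
    unfolding pen_def[abs_def]
    by (rule poly_funs_det) (simp add: poly_funs.add poly_funs_cmult sym_alt_parts_poly)
  have pen_congr: "pen z (congr_act h T) = det h * det h * pen z T" for z h T
  proof -
    have SA: "fst (sym_alt_parts T) \<in> Sym_space" "snd (sym_alt_parts T) \<in> Alt_space"
      using sym_alt_parts_in[of T] by (auto simp: mem_Times_iff)
    have "congr_act h (fst (sym_alt_parts T)) \<in> Sym_space" "congr_act h (snd (sym_alt_parts T)) \<in> Alt_space"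
      using SA by (simp_all add: Sym_space_def Alt_space_def congr_act_def matrix_transpose_mul matrix_mul_assoc)
         (simp_all add: matrix_matrix_mult_def vec_eq_iff sum_negf)
    then have "sym_alt_parts (congr_act h (fst (sym_alt_parts T)) + congr_act h (snd (sym_alt_parts T)))
        = (congr_act h (fst (sym_alt_parts T)), congr_act h (snd (sym_alt_parts T)))"
      by (rule sym_alt_parts_add)
    moreover have "congr_act h (fst (sym_alt_parts T)) + congr_act h (snd (sym_alt_parts T)) = congr_act h T"
      using sym_alt_parts_sum[of T] by (simp add: congr_act_def matrix_add_ldistrib[symmetric] matrix_add_mult_distrib[symmetric])
    ultimately have parts: "sym_alt_parts (congr_act h T) = (congr_act h (fst (sym_alt_parts T)), congr_act h (snd (sym_alt_parts T)))"
      by simp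
    have "(\<chi> i j. congr_act h S $ i $ j + z * congr_act h A $ i $ j) = h ** (\<chi> i j. S $ i $ j + z * A $ i $ j) ** transpose h"
      for S A :: "complex^'m^'m"
      by (simp add: congr_act_def vec_eq_iff matrix_matrix_mult_def transpose_def sum_distrib_left sum_distrib_right
          sum.distrib[symmetric] algebra_simps)
    then show ?thesis unfolding pen_def parts fst_conv snd_conv by (simp add: det_mul mult_ac)
  qed
  have "pen z A0 = 0" for z
  proof (rule ccontr)
    assume c0: "pen z A0 ~= 0"
    \<comment> \<open>This invariant descends to the cone, where it has the constant value
      \<open>pen z A0\<close> on the wedges over the closure but vanishes at \<open>0\<close>; so
      \<open>0\<close> could not be in their closure.\<close>
    have "(%w :: ('m, 'p, 'q) W_space. pen z (gram_sum w)) \<in> invariant_funs SL_group SL_act"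
      unfolding invariant_funs_def
      by (rule CollectI)
         (simp add: mat_space_def poly_funs_compose_mat[OF pen_poly gram_sum_poly] gram_sum_SL_act pen_congr SL_group_def)
    then obtain F where F: "F \<in> poly_funs vec_coords" "(%w :: ('m, 'p, 'q) W_space. pen z (gram_sum w)) = (%w. F (column_wedge w))"
      unfolding SL_invariants[OF refl] by (elim CollectE exE conjE)
    have "(%x. F x - pen z A0) \<in> poly_funs vec_coords" by (intro poly_funs_diff F(1) poly_funs.const)
    then have "F 0 - pen z A0 = 0"
    proof (rule vec_closureD[OF x])
      fix y :: "complex^('m => 'p + ('q + 'q))" assume "y \<in> wedges_over ?Z"
      then obtain w :: "('m, 'p, 'q) W_space" where w: "y = column_wedge w" "gram_sum w \<in> ?Z" by (auto simp: wedges_over_def)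
      have "pen z (gram_sum w) - pen z A0 = 0"
        by (rule poly_closureD[OF w(2), of "%T. pen z T - pen z A0"])
           (auto simp: SL_orbit_def pen_congr intro!: poly_funs_diff pen_poly poly_funs.const)
      then show "F y - pen z A0 = 0" using fun_cong[OF F(2), of w] by (simp add: w(1))
    qed
    moreover have "column_wedge (0 :: ('m, 'p, 'q) W_space) = 0" by (rule column_wedge_0)
    then have "F 0 = pen z 0" using fun_cong[OF F(2), of 0] by (simp add: gram_sum_0)
    moreover have "pen z 0 = 0" by (simp add: pen_def sym_alt_parts_def det_zero_matrix)
    ultimately show False using c0 by simp
  qed
  then have deg: "det (\<chi> i j. fst (sym_alt_parts A0) $ i $ j + z * snd (sym_alt_parts A0) $ i $ j) = 0" for z
    by (simp add: pen_def)
  have parts: "fst (sym_alt_parts A0) \<in> Sym_space" "snd (sym_alt_parts A0) \<in> Alt_space"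
    using sym_alt_parts_in[of A0] by (auto simp: mem_Times_iff)
  from degenerate_pencil_limit[OF parts deg] obtain T u where T: "T \<in> closure {congr_act h A0 | h. det h = 1}"
    and u: "u ~= 0" "T *v u = 0" "transpose T *v u = 0" unfolding sym_alt_parts_sum by (elim bexE exE conjE)
  have TZ: "T \<in> ?Z"
    unfolding poly_closure_def
    by (rule CollectI, intro ballI impI, rule continuous_zero_on_closure[OF mat_poly_continuous T])
       (auto simp: SL_orbit_def)
  obtain k where k: "u $ k ~= 0" using u(1) by (auto simp: vec_eq_iff)
  \<comment> \<open>The projection along \<open>u\<close> that clears coordinate \<open>k\<close>.
    Since \<open>u\<close> lies in both kernels of \<open>T\<close>, it leaves the Gram sum of
    \<open>\<sigma> T\<close> unchanged, while the product has rank less than \<open>m\<close> and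
    wedge zero.\<close>
  define \<pi> :: "complex^'m^'m" where "\<pi> = (\<chi> i j. (if i = j then 1 else 0) - (if j = k then u $ i / u $ k else 0))"
  have \<pi>v: "\<pi> *v x = x - (x $ k / u $ k) *s u" for x
    by (simp add: \<pi>_def vec_eq_iff matrix_vector_mult_def left_diff_distrib sum_subtractf if_distrib[of "%x. x * _"] cong: if_cong)
  have "\<pi> *v u = 0" using k by (simp add: \<pi>v)
  then have "~ invertible \<pi>" using u(1) matrix_left_invertible_ker[of \<pi>] unfolding invertible_def by blast
  then have det0: "det \<pi> = 0" by (simp add: invertible_det_nz)
  have "bform T x u = 0" "bform T u x = 0" for x
    using bform_matrix_vector[of "mat 1" x T u] bform_matrix_vector[of "mat 1" x "transpose T" u] u(2,3) bform_transpose[of T x u]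
    by simp_all
  then have "transpose \<pi> ** T ** \<pi> = T"
    unfolding matrix_eq_bform bform_congr \<pi>v
    by (simp add: bform_diff_left bform_diff_right bform_scale_left bform_scale_right)
  then have "gram_sum (\<sigma> T ** \<pi>) = T" by (simp add: gram_sum_mult \<sigma>(1) congr_act_def)
  moreover have "column_wedge (\<sigma> T ** \<pi>) = 0" by (simp add: column_wedge_eq_0_iff minor_mult_right det0)
  ultimately show ?thesis using TZ unfolding wedges_over_def by (metis (mono_tags, lifting) mem_Collect_eq)
qed

lemma wedges_over_closed:
  fixes w0 :: "('m, 'p, 'q) W_space"
  assumes "column_wedge w0 \<in> vec_closure (wedges_over (poly_closure (SL_orbit A0)))"
  shows "column_wedge w0 \<in> wedges_over (poly_closure (SL_orbit A0))"
proof (cases "column_wedge w0 = 0")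
  case True
  then show ?thesis using assms wedges_over_closed_zero by simp
next
  case False
  from wedges_over_closed_nonzero[OF assms this] show ?thesis unfolding wedges_over_def by blast
qed

text \<open>The special linear group changes the Gram sum within its orbit without changing the
  wedge, so two full points over the same orbit may be assumed to have equal Gram matrices, and
  Witt's theorem applies.\<close>

lemma lifted_orbit_full:
  fixes w0 :: "('m, 'p, 'q) W_space"
  assumes w0: "full w0"
  shows "Group_Action.orbit OSp_group OSp_cone_act (column_wedge w0) = lifted_orbit (SL_orbit (gram_sum w0))"
proof (intro Set.set_eqI iffI)
  fix x assume "x \<in> Group_Action.orbit OSp_group OSp_cone_act (column_wedge w0)"
  then obtain g where g: "g \<in> carrier OSp_group" "x = OSp_cone_act g (column_wedge w0)" by (auto simp: orbit_def)
  have "x = column_wedge (OSp_act g w0)" by (simp add: g(2) column_wedge_OSp_act)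
  moreover have "full (OSp_act g w0)" using w0 by (simp add: OSp_act_full[OF g(1)])
  moreover have "gram_sum (OSp_act g w0) \<in> SL_orbit (gram_sum w0)" by (simp add: gram_sum_OSp_act[OF g(1)] SL_orbit_refl)
  ultimately show "x \<in> lifted_orbit (SL_orbit (gram_sum w0))" unfolding lifted_orbit_def by blast
next
  fix x :: "complex^('m => 'p + ('q + 'q))" assume "x \<in> lifted_orbit (SL_orbit (gram_sum w0))"
  then obtain w :: "('m, 'p, 'q) W_space" where w: "x = column_wedge w" "gram_sum w \<in> SL_orbit (gram_sum w0)" "full w"
    by (auto simp: lifted_orbit_def)
  from SL_orbit_sym[OF w(2)] obtain h where h: "det h = 1" "gram_sum w0 = congr_act h (gram_sum w)" by (auto simp: SL_orbit_def)
  have "gram w0 = gram (SL_act h w)" using h(2) by (simp add: gram_sum_SL_act flip: gram_sum_eq_iff)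
  then obtain g where g: "g \<in> carrier OSp_group" "OSp_act g w0 = SL_act h w"
    using full_OSp_conjugate[OF c(1) w0 full_SL_act[OF h(1) w(3)]] by blast
  have "x = column_wedge (SL_act h w)" using column_wedge_SL_act[of h w] h(1) by (simp add: w(1) SL_group_def)
  then have "x = OSp_cone_act g (column_wedge w0)" by (simp add: g(2)[symmetric] column_wedge_OSp_act)
  then show "x \<in> Group_Action.orbit OSp_group OSp_cone_act (column_wedge w0)" using g(1) unfolding orbit_def by blast
qed

text \<open>One inclusion is closedness of the wedges over the orbit closure. For the other, a
  function that vanishes on the lift is moved along the section: for fixed \<open>g\<close> its
  value at the wedge of \<open>OSp_act g (\<sigma> T)\<close> is polynomial in \<open>T\<close> and
  vanishes on the orbit, hence on its closure. This reaches all full points over the closure, and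
  density the rest.\<close>

lemma closure_lifted_orbit:
  "range (column_wedge :: ('m, 'p, 'q) W_space => _) \<inter> vec_closure (lifted_orbit (SL_orbit A0)) = wedges_over (poly_closure (SL_orbit A0))"
proof (intro subset_antisym subsetI)
  fix x assume x: "x \<in> range (column_wedge :: ('m, 'p, 'q) W_space => _) \<inter> vec_closure (lifted_orbit (SL_orbit A0))"
  then obtain w0 :: "('m, 'p, 'q) W_space" where w0: "x = column_wedge w0" by blast
  have "lifted_orbit (SL_orbit A0) \<subseteq> (wedges_over (poly_closure (SL_orbit A0)) :: (complex^('m => 'p + ('q + 'q))) set)"
    using poly_closure_subset[of "SL_orbit A0"] unfolding lifted_orbit_def wedges_over_def by blast
  then have "x \<in> vec_closure (wedges_over (poly_closure (SL_orbit A0)))"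
    using x unfolding vec_closure_def by blast
  then show "x \<in> wedges_over (poly_closure (SL_orbit A0))" unfolding w0 by (rule wedges_over_closed)
next
  fix x assume "x \<in> (wedges_over (poly_closure (SL_orbit A0)) :: (complex^('m => 'p + ('q + 'q))) set)"
  then obtain w :: "('m, 'p, 'q) W_space" where w: "x = column_wedge w" "gram_sum w \<in> poly_closure (SL_orbit A0)"
    by (auto simp: wedges_over_def)
  have "G x = 0" if G: "G \<in> poly_funs vec_coords" and G0: "\<forall>y\<in>lifted_orbit (SL_orbit A0). G y = 0" for G
  proof -
    have fullz: "G (column_wedge w') = 0" if w': "full w'" "gram w' = gram w" for w' :: "('m, 'p, 'q) W_space"
    proof -
      have "gram (\<sigma> (gram_sum w)) = gram w'" using w'(2) by (simp add: \<sigma>(1) flip: gram_sum_eq_iff)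
      then obtain g where g: "g \<in> carrier OSp_group" "OSp_act g (\<sigma> (gram_sum w)) = w'"
        using full_OSp_conjugate[OF c(1) \<sigma>(2) w'(1)] by blast
      have "(%T. G (column_wedge (OSp_act g (\<sigma> T)))) \<in> poly_funs mat_coords"
      proof (rule poly_funs_compose_mat[of "%w. G (column_wedge w)"])
        show "(%w. G (column_wedge w)) \<in> poly_funs mat_coords" by (rule column_wedge_poly[OF G])
        show "(%T. OSp_act g (\<sigma> T) $ i $ j) \<in> poly_funs mat_coords" for i j
          unfolding OSp_act_def by (intro poly_funs_mat_mult poly_funs.const \<sigma>(3))
      qed
      then have "G (column_wedge (OSp_act g (\<sigma> (gram_sum w)))) = 0"
      proof (rule poly_closureD[OF w(2)])
        fix T assume T: "T \<in> SL_orbit A0"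
        have "full (OSp_act g (\<sigma> T))" "gram_sum (OSp_act g (\<sigma> T)) = T"
          by (simp_all add: OSp_act_full[OF g(1)] \<sigma>(1,2) gram_sum_OSp_act[OF g(1)])
        then have "column_wedge (OSp_act g (\<sigma> T)) \<in> lifted_orbit (SL_orbit A0)"
          unfolding lifted_orbit_def using T by (intro CollectI exI[of _ "OSp_act g (\<sigma> T)"]) simp
        then show "G (column_wedge (OSp_act g (\<sigma> T))) = 0" by (rule G0[rule_format])
      qed
      then show ?thesis by (simp add: g(2))
    qed
    have "G (column_wedge w) = 0"
      by (rule continuous_zero_on_closure[OF mat_poly_continuous[OF column_wedge_poly[OF G]] full_dense[OF c]])
         (use fullz in blast)
    then show ?thesis by (simp add: w(1))
  qed
  then show "x \<in> range (column_wedge :: ('m, 'p, 'q) W_space => _) \<inter> vec_closure (lifted_orbit (SL_orbit A0))"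
    using w(1) unfolding vec_closure_def by blast
qed

text \<open>The section consists of full points, whose wedges are nonzero and have a single orbit of
  the special linear group as fibre. So on the section the Gram sum can be recovered from the wedge
  up to congruence.\<close>

lemma section_in_wedges_over:
  assumes "column_wedge (\<sigma> T) \<in> wedges_over Z" and Z: "!!h T. T \<in> Z ==> det h = 1 ==> congr_act h T \<in> Z"
  shows "T \<in> Z"
proof -
  obtain w :: "('m, 'p, 'q) W_space" where w: "column_wedge (\<sigma> T) = column_wedge w" "gram_sum w \<in> Z"
    using assms(1) by (auto simp: wedges_over_def)
  have "column_wedge w ~= 0" using w(1) full_imp_full_rank[OF \<sigma>(2)] column_wedge_nonzero_iff by metis
  then obtain h where h: "h \<in> carrier SL_group" "SL_act h w = \<sigma> T" using full_SL_conjugate[of w "\<sigma> T"] w(1) by metis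
  then have "gram_sum (\<sigma> T) = congr_act h (gram_sum w)" using gram_sum_SL_act[of h w] by simp
  then show ?thesis using Z[OF w(2)] h(1) by (simp add: \<sigma>(1) SL_group_def)
qed

lemma lifted_orbit_inj:
  assumes "lifted_orbit (SL_orbit A1) = (lifted_orbit (SL_orbit A2) :: (complex^('m => 'p + ('q + 'q))) set)"
  shows "SL_orbit A1 = SL_orbit A2"
proof -
  have "column_wedge (\<sigma> A1) \<in> lifted_orbit (SL_orbit A1)"
    unfolding lifted_orbit_def using \<sigma>(1,2) SL_orbit_refl by (intro CollectI exI[of _ "\<sigma> A1"]) simp
  then have "column_wedge (\<sigma> A1) \<in> wedges_over (SL_orbit A2)"
    unfolding assms unfolding lifted_orbit_def wedges_over_def by blast
  then have "A1 \<in> SL_orbit A2" by (rule section_in_wedges_over) (rule SL_orbit_congr)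
  then show ?thesis by (rule SL_orbit_eq)
qed

text \<open>Maximal minors with all rows in one block detect the rank of that block. If
  \<open>w0\<close> were not full, all minors of one block would vanish on its orbit and on the
  closure, but not at the wedge of \<open>\<sigma> A0\<close>. Hence the orbit is a lift too, its
  closure determines the closure of an orbit of matrices by means of the section, and that
  determines the orbit.\<close>

lemma lifted_orbit_unique:
  fixes w0 :: "('m, 'p, 'q) W_space"
  assumes closure: "range (column_wedge :: ('m, 'p, 'q) W_space => _) \<inter> vec_closure (Group_Action.orbit OSp_group OSp_cone_act (column_wedge w0))
     = wedges_over (poly_closure (SL_orbit A0))"
  shows "Group_Action.orbit OSp_group OSp_cone_act (column_wedge w0) = lifted_orbit (SL_orbit A0)"
proof -
  let ?Ob = "Group_Action.orbit OSp_group OSp_cone_act (column_wedge w0)"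
  have sec: "column_wedge (\<sigma> T) \<in> wedges_over (poly_closure (SL_orbit T))" for T
    unfolding wedges_over_def using \<sigma>(1) poly_closure_subset[of "SL_orbit T"] SL_orbit_refl by (intro CollectI exI[of _ "\<sigma> T"]) auto
  have cl: "column_wedge (\<sigma> A0) \<in> vec_closure ?Ob" using closure sec[of A0] by blast
  have top: "minor (Inl \<circ> a) w = minor a (top_rows w)" and bottom: "minor (Inr \<circ> b) w = minor b (bottom_rows w)"
    for a b and w :: "('m, 'p, 'q) W_space" by (simp_all add: minor_def top_rows_def bottom_rows_def)
  have "full_rank (top_rows w0)"
  proof (rule ccontr)
    assume n: "~ full_rank (top_rows w0)"
    have "column_wedge (\<sigma> A0) $ (Inl \<circ> a) = 0" for a
    proof (rule vec_closureD[OF cl vec_coord])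
      fix y assume "y \<in> ?Ob"
      then obtain g where g: "g \<in> carrier OSp_group" "y = column_wedge (OSp_act g w0)"
        by (auto simp: orbit_def column_wedge_OSp_act)
      then have "~ full_rank (top_rows (OSp_act g w0))" using n by (simp add: OSp_act_full_rank)
      then show "y $ (Inl \<circ> a) = 0" by (simp add: g(2) column_wedge_nth top full_rank_iff_minor)
    qed
    then have "~ full_rank (top_rows (\<sigma> A0))" by (simp add: column_wedge_nth top full_rank_iff_minor)
    then show False using \<sigma>(2) by (simp add: full_def)
  qed
  moreover have "full_rank (bottom_rows w0)"
  proof (rule ccontr)
    assume n: "~ full_rank (bottom_rows w0)"
    have "column_wedge (\<sigma> A0) $ (Inr \<circ> a) = 0" for a
    proof (rule vec_closureD[OF cl vec_coord])
      fix y assume "y \<in> ?Ob"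
      then obtain g where g: "g \<in> carrier OSp_group" "y = column_wedge (OSp_act g w0)"
        by (auto simp: orbit_def column_wedge_OSp_act)
      then have "~ full_rank (bottom_rows (OSp_act g w0))" using n by (simp add: OSp_act_full_rank)
      then show "y $ (Inr \<circ> a) = 0" by (simp add: g(2) column_wedge_nth bottom full_rank_iff_minor)
    qed
    then have "~ full_rank (bottom_rows (\<sigma> A0))" by (simp add: column_wedge_nth bottom full_rank_iff_minor)
    then show False using \<sigma>(2) by (simp add: full_def)
  qed
  ultimately have "full w0" by (simp add: full_def)
  then have Ob: "?Ob = lifted_orbit (SL_orbit (gram_sum w0))" by (rule lifted_orbit_full)
  have eq: "wedges_over (poly_closure (SL_orbit (gram_sum w0))) = (wedges_over (poly_closure (SL_orbit A0)) :: (complex^('m => 'p + ('q + 'q))) set)"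
    using closure closure_lifted_orbit[of "gram_sum w0"] by (simp only: Ob)
  have sub: "poly_closure (SL_orbit T1) \<subseteq> poly_closure (SL_orbit T2)"
    if "wedges_over (poly_closure (SL_orbit T1)) = (wedges_over (poly_closure (SL_orbit T2)) :: (complex^('m => 'p + ('q + 'q))) set)" for T1 T2
  proof
    fix T assume "T \<in> poly_closure (SL_orbit T1)"
    then have "column_wedge (\<sigma> T) \<in> wedges_over (poly_closure (SL_orbit T1))"
      unfolding wedges_over_def using \<sigma>(1) by (intro CollectI exI[of _ "\<sigma> T"]) simp
    then have "column_wedge (\<sigma> T) \<in> wedges_over (poly_closure (SL_orbit T2))" by (simp only: that)
    then show "T \<in> poly_closure (SL_orbit T2)" by (rule section_in_wedges_over) (rule poly_closure_congr)
  qed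
  have "poly_closure (SL_orbit (gram_sum w0)) = poly_closure (SL_orbit A0)"
    using sub[OF eq] sub[OF eq[symmetric]] by blast
  then show ?thesis using Ob SL_orbit_eq_of_closure by metis
qed

end

section \<open>The conditions on the quotient maps\<close>

lemma OSp_quotient_map_eq_iff:
  fixes w w' :: "('m::finite, 'p::finite, 'q::finite) W_space"
  assumes c: "2 * CARD('m) < CARD('p)" "2 * CARD('m) < 2 * CARD('q) + 1" and actG: "actG = OSp_act"
  shows "aff_quotient_map OSp_group actG w = aff_quotient_map OSp_group actG w' \<longleftrightarrow> gram w = gram w'"
proof -
  obtain \<iota> where \<iota>: "variety_iso (affine_quotient OSp_group actG) Sym_Alt_variety \<iota>"
    "\<forall>w. \<iota> (aff_quotient_map OSp_group actG w) = gram w"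
    using OSp_quotient_iso[OF c] unfolding actG by (elim exE conjE)
  have "inj_on \<iota> (points (affine_quotient OSp_group actG))"
    using \<iota>(1) by (simp add: variety_iso_def bij_betw_def)
  then have "aff_quotient_map OSp_group actG w = aff_quotient_map OSp_group actG w'
      \<longleftrightarrow> \<iota> (aff_quotient_map OSp_group actG w) = \<iota> (aff_quotient_map OSp_group actG w')"
    using quotient_map_point by (metis inj_onD)
  then show ?thesis by (simp only: \<iota>(2)[rule_format])
qed

lemma SL_quotient_map_eq_iff:
  fixes w w' :: "('m::finite, 'p::finite, 'q::finite) W_space"
  assumes act: "act = SL_act"
  shows "aff_quotient_map SL_group act w = aff_quotient_map SL_group act w' \<longleftrightarrow> column_wedge w = column_wedge w'"
proof -
  obtain \<iota> where \<iota>: "variety_iso (affine_quotient SL_group act) (grassmann_cone :: (complex^('m => 'p + ('q + 'q))) variety) \<iota>"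
    "\<forall>w. \<iota> (aff_quotient_map SL_group act w) = column_wedge w"
    using SL_quotient_iso unfolding act by (elim exE conjE)
  have "inj_on \<iota> (points (affine_quotient SL_group act))"
    using \<iota>(1) by (simp add: variety_iso_def bij_betw_def)
  then have "aff_quotient_map SL_group act w = aff_quotient_map SL_group act w'
      \<longleftrightarrow> \<iota> (aff_quotient_map SL_group act w) = \<iota> (aff_quotient_map SL_group act w')"
    using quotient_map_point by (metis inj_onD)
  then show ?thesis by (simp only: \<iota>(2)[rule_format])
qed

lemma SL_fiber_orbit:
  fixes w :: "('m::finite, 'p::finite, 'q::finite) W_space"
  assumes act: "act = SL_act" and w: "column_wedge w ~= 0"
  shows "aff_quotient_map SL_group act -` {aff_quotient_map SL_group act w} = Group_Action.orbit SL_group act w"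
proof (intro Set.set_eqI iffI)
  fix v assume "v \<in> aff_quotient_map SL_group act -` {aff_quotient_map SL_group act w}"
  then have "column_wedge w = column_wedge v" using SL_quotient_map_eq_iff[OF act, of v w] by simp
  from full_SL_conjugate[OF this w] show "v \<in> Group_Action.orbit SL_group act w"
    unfolding orbit_def act by blast
next
  fix v assume "v \<in> Group_Action.orbit SL_group act w"
  then obtain h where "h \<in> carrier SL_group" "v = SL_act h w" unfolding orbit_def act by blast
  then have "column_wedge v = column_wedge w" by (simp add: column_wedge_SL_act)
  then show "v \<in> aff_quotient_map SL_group act -` {aff_quotient_map SL_group act w}"
    using SL_quotient_map_eq_iff[OF act, of v w] by simp
qed

lemma zariski_mat_closure:
  "zariski (mat_space :: (complex^'m^'n) variety) closure_of S = poly_closure S"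
  using zariski_closure_of_iff[OF multiplicative_mat_space, of S]
  by (auto simp: poly_closure_def mat_space_def)

lemma zariski_cone_closure:
  assumes "S \<subseteq> points (grassmann_cone :: (complex^('m::finite => 'n::finite)) variety)"
  shows "zariski grassmann_cone closure_of S = points grassmann_cone \<inter> vec_closure S"
  using zariski_closure_of_iff[OF multiplicative_grassmann_cone assms]
  by (auto simp: vec_closure_def regular_grassmann_cone)

text \<open>The open orbit consists of the full points of the null fibre: one orbit by Witt's
  theorem, open because fullness is the nonvanishing of some product of a minor of each block, and
  dense by \<open>full_dense\<close>.\<close>

theorem dense_null_orbit_OSp:
  fixes actG :: "_ => ('m::finite, 'p::finite, 'q::finite) W_space => ('m, 'p, 'q) W_space"
  assumes c: "2 * CARD('m) < CARD('p)" "2 * CARD('m) < 2 * CARD('q) + 1" and actG: "actG = OSp_act"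
  shows "dense_null_orbit OSp_group actG"
proof -
  let ?N = "null_fiber OSp_group actG" and ?Z = "mat_space :: ((complex, 'm) vec, 'p + ('q + 'q)) vec variety"
  have N: "?N = {w. gram w = gram (0 :: ('m, 'p, 'q) W_space)}"
    by (simp add: null_fiber_def OSp_quotient_map_eq_iff[OF c actG])
  obtain w0 :: "('m, 'p, 'q) W_space" where w0: "full w0" "gram w0 = gram (0 :: ('m, 'p, 'q) W_space)"
    using full_dense[OF c, of 0] by (metis (mono_tags, lifting) closure_empty empty_Collect_eq empty_iff)
  let ?O = "Group_Action.orbit OSp_group actG w0"
  have O: "?O = {w \<in> ?N. full w}"
  proof (intro Set.set_eqI iffI)
    fix w assume "w \<in> ?O"
    then obtain g where "g \<in> carrier OSp_group" "w = OSp_act g w0" unfolding orbit_def actG by blast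
    then show "w \<in> {w \<in> ?N. full w}" using w0 by (simp add: N gram_OSp_act OSp_act_full)
  next
    fix w assume "w \<in> {w \<in> ?N. full w}"
    then have "full w" "gram w0 = gram w" using w0(2) by (simp_all add: N)
    then show "w \<in> ?O" using full_OSp_conjugate[OF c(1) w0(1)] unfolding orbit_def actG by blast
  qed
  define V where "V = (\<Union>a. \<Union>b. {w \<in> points ?Z. minor a (top_rows w) * minor b (bottom_rows w) ~= 0})"
  have basic: "openin (zariski ?Z) {w \<in> points ?Z. minor a (top_rows w) * minor b (bottom_rows w) ~= 0}" for a b
  proof (rule openin_zariski_basic)
    have "(%w :: ('m, 'p, 'q) W_space. minor a (top_rows w)) \<in> poly_funs mat_coords"
      by (rule poly_funs_compose_mat[OF minor_poly]) (simp add: top_rows_def mat_coord)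
    moreover have "(%w :: ('m, 'p, 'q) W_space. minor b (bottom_rows w)) \<in> poly_funs mat_coords"
      by (rule poly_funs_compose_mat[OF minor_poly]) (simp add: bottom_rows_def mat_coord)
    ultimately show "(%w. minor a (top_rows w) * minor b (bottom_rows w)) \<in> regular ?Z"
      by (simp add: mat_space_def poly_funs.mult)
  qed
  have "openin (zariski ?Z) (\<Union>b. {w \<in> points ?Z. minor a (top_rows w) * minor b (bottom_rows w) ~= 0})" for a
    by (rule openin_Union) (erule imageE, simp only: basic)
  then have "openin (zariski ?Z) V"
    unfolding V_def by (intro openin_Union) (erule imageE, simp only:)
  moreover have "?O = ?N \<inter> V"
    by (auto simp: O V_def full_def full_rank_iff_minor mat_space_def)
  ultimately have "openin (subtopology (zariski ?Z) ?N) ?O"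
    unfolding openin_subtopology by (intro exI[of _ V]) (simp add: Int_commute)
  moreover have "subtopology (zariski ?Z) ?N closure_of ?O = ?N"
  proof -
    have "w \<in> zariski ?Z closure_of ?O" if w: "w \<in> ?N" for w
      unfolding zariski_mat_closure poly_closure_def
    proof (rule CollectI, intro ballI impI)
      fix F assume F: "F \<in> poly_funs (mat_coords :: (('m, 'p, 'q) W_space => complex) set)" "\<forall>y\<in>?O. F y = 0"
      show "F w = 0"
        by (rule continuous_zero_on_closure[OF mat_poly_continuous[OF F(1)] full_dense[OF c]])
           (use F(2) w in \<open>simp add: O N\<close>)
    qed
    moreover have "?N \<inter> ?O = ?O" by (auto simp: O)
    ultimately show ?thesis unfolding closure_of_subtopology by auto
  qed
  moreover have "?O \<in> orbits OSp_group ?N actG"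
    unfolding orbits_def using w0(2) by (intro CollectI exI[of _ w0]) (simp add: N)
  ultimately show ?thesis unfolding dense_null_orbit_def by blast
qed

text \<open>The open set is the complement of the vertex of the cone, where fibres are single orbits
  cut out by the values of the minors. The matrix \<open>v\<close> guarantees that some minor is not
  identically zero, which gives density.\<close>

theorem generic_fiber_orbit_SL:
  fixes act :: "_ => ('m::finite, 'p::finite, 'q::finite) W_space => ('m, 'p, 'q) W_space" and v :: "('m, 'p, 'q) W_space"
  assumes act: "act = SL_act" and v: "full_rank v"
  shows "generic_fiber_orbit SL_group act"
proof -
  let ?X = "affine_quotient SL_group act" and ?\<phi> = "aff_quotient_map SL_group act"
  have minor_inv: "minor a \<in> invariant_funs SL_group act" for a
    unfolding SL_invariants[OF act]
    by (intro CollectI exI[of _ "%x. x $ a"]) (simp add: vec_coord column_wedge_nth fun_eq_iff)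
  obtain \<iota> where \<iota>: "variety_iso ?X (grassmann_cone :: (complex^('m => 'p + ('q + 'q))) variety) \<iota>"
    "\<forall>w. \<iota> (?\<phi> w) = column_wedge w"
    using SL_quotient_iso unfolding act by (elim exE conjE)
  have pts: "\<exists>w. x = ?\<phi> w" if "x \<in> points ?X" for x
  proof -
    have "\<iota> x \<in> points grassmann_cone" using \<iota>(1) that by (auto simp: variety_iso_def bij_betw_def)
    then obtain w :: "('m, 'p, 'q) W_space" where w: "\<iota> x = column_wedge w" unfolding points_grassmann_cone by blast
    have "inj_on \<iota> (points ?X)" using \<iota>(1) by (simp add: variety_iso_def bij_betw_def)
    then have "x = ?\<phi> w" by (rule inj_onD) (use w \<iota>(2) that quotient_map_point in auto)
    then show ?thesis by blast
  qed
  define U where "U = (\<Union>a. {x \<in> points ?X. x (minor a) ~= 0})"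
  have basic: "openin (zariski ?X) {x \<in> points ?X. x (minor a) ~= 0}" for a
    by (rule openin_zariski_basic[of "%x. x (minor a)"])
       (unfold affine_quotient_def, simp, rule exI[of _ "minor a"], simp add: minor_inv)
  have "openin (zariski ?X) U"
    unfolding U_def by (rule openin_Union) (erule imageE, simp only: basic)
  moreover have "zariski ?X closure_of U = points ?X"
  proof (intro subset_antisym subsetI)
    fix x assume "x \<in> zariski ?X closure_of U"
    then show "x \<in> points ?X"
      using zariski_closure_of_iff[OF multiplicative_affine_quotient, of U] by (auto simp: U_def)
  next
    fix x assume x: "x \<in> points ?X"
    then obtain w where w: "x = ?\<phi> w" using pts by blast
    obtain a where a: "minor a v ~= 0" using v by (auto simp: full_rank_iff_minor)
    have "f x = 0" if f: "f \<in> regular ?X" "\<forall>y\<in>U. f y = 0" for f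
    proof -
      obtain g where g: "g \<in> invariant_funs SL_group act" "f = (%\<xi>. \<xi> g)" using f(1) by (auto simp: affine_quotient_def)
      have "g w = 0"
      proof (rule mat_poly_zero[OF invariant_funs_compose[OF g(1)] minor_poly[of a] _ a])
        fix y :: "('m, 'p, 'q) W_space" assume "minor a y ~= 0"
        then have "?\<phi> y \<in> U" unfolding U_def by (auto simp: quotient_map_point quotient_map_apply[OF minor_inv])
        then show "g y = 0" using f(2) by (auto simp: g(2) quotient_map_apply[OF g(1)])
      qed
      then show ?thesis by (simp add: w g(2) quotient_map_apply[OF g(1)])
    qed
    moreover have "U \<subseteq> points ?X" by (auto simp: U_def)
    ultimately show "x \<in> zariski ?X closure_of U"
      using x zariski_closure_of_iff[OF multiplicative_affine_quotient, of U] by blast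
  qed
  moreover have "\<exists>w. ?\<phi> -` {x} = Group_Action.orbit SL_group act w &
      closedin (zariski mat_space) (Group_Action.orbit SL_group act w)" if xU: "x \<in> U" for x
  proof -
    obtain a where a: "x \<in> points ?X" "x (minor a) ~= 0" using xU unfolding U_def by blast
    then obtain w where w: "x = ?\<phi> w" using pts by blast
    then have "minor a w ~= 0" using a(2) by (simp add: quotient_map_apply[OF minor_inv])
    then have nz: "column_wedge w ~= 0" by (auto simp: column_wedge_eq_0_iff)
    have O: "Group_Action.orbit SL_group act w = {y. column_wedge y = column_wedge w}"
      unfolding SL_fiber_orbit[OF act nz, symmetric] by (auto simp: SL_quotient_map_eq_iff[OF act])
    have "poly_closure {y. column_wedge y = column_wedge w} \<subseteq> {y. column_wedge y = column_wedge w}"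
    proof
      fix y assume y: "y \<in> poly_closure {y. column_wedge y = column_wedge w}"
      have "minor b y - minor b w = 0" for b
        by (rule poly_closureD[OF y poly_funs_diff[OF minor_poly poly_funs.const]]) (simp add: column_wedge_eq_iff)
      then show "y \<in> {y. column_wedge y = column_wedge w}" by (simp add: column_wedge_eq_iff)
    qed
    moreover have "topspace (zariski (mat_space :: ((complex, 'm) vec, 'p + ('q + 'q)) vec variety)) = UNIV"
      by (simp only: topspace_zariski[OF multiplicative_mat_space]) (simp add: mat_space_def)
    ultimately have "closedin (zariski mat_space) {y. column_wedge y = column_wedge w}"
      unfolding closure_of_subset_eq[symmetric] zariski_mat_closure by simp
    then show ?thesis using SL_fiber_orbit[OF act nz] O unfolding w by (intro exI[of _ w]) simp
  qed
  ultimately show ?thesis unfolding generic_fiber_orbit_def by blast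
qed

text \<open>The section passes through every fibre of \<open>\<psi>\<close> in a full point, whose
  image in the cone is not the vertex.\<close>

theorem fibers_meet_single_orbits_OSp_SL:
  fixes actG :: "_ => ('m::finite, 'p::finite, 'q::finite) W_space => ('m, 'p, 'q) W_space" and act
  assumes c: "2 * CARD('m) < CARD('p)" "2 * CARD('m) < 2 * CARD('q) + 1" and actG: "actG = OSp_act" and act: "act = SL_act"
  shows "fibers_meet_single_orbits OSp_group actG SL_group act"
  unfolding fibers_meet_single_orbits_def
proof
  fix y assume y: "y \<in> points (affine_quotient OSp_group actG)"
  obtain \<iota> where \<iota>: "variety_iso (affine_quotient OSp_group actG) Sym_Alt_variety \<iota>"
    "\<forall>w. \<iota> (aff_quotient_map OSp_group actG w) = gram w"
    using OSp_quotient_iso[OF c] unfolding actG by (elim exE conjE)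
  have in_Z: "\<iota> y \<in> Sym_space \<times> Alt_space"
    using \<iota>(1) y by (auto simp: variety_iso_def bij_betw_def Sym_Alt_variety_def)
  obtain \<sigma> :: "_ => ('m, 'p, 'q) W_space" where \<sigma>: "\<forall>z\<in>Sym_space \<times> Alt_space. gram (\<sigma> z) = z" "\<forall>z. full (\<sigma> z)"
    using gram_section[OF c] by (elim exE conjE)
  let ?w = "\<sigma> (\<iota> y)"
  have "inj_on \<iota> (points (affine_quotient OSp_group actG))"
    using \<iota>(1) by (simp add: variety_iso_def bij_betw_def)
  moreover have "\<iota> (aff_quotient_map OSp_group actG ?w) = \<iota> y"
    by (simp only: \<iota>(2)[rule_format] bspec[OF \<sigma>(1) in_Z])
  ultimately have "aff_quotient_map OSp_group actG ?w = y"
    using quotient_map_point y by (metis inj_onD)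
  moreover have "column_wedge ?w ~= 0" using full_imp_full_rank \<sigma>(2) column_wedge_nonzero_iff by metis
  from SL_fiber_orbit[OF act this] have "aff_quotient_map SL_group act ?w \<in> single_orbit_points SL_group act"
    unfolding single_orbit_points_def using quotient_map_point by blast
  ultimately show "aff_quotient_map OSp_group actG -` {y} \<inter> aff_quotient_map SL_group act -` single_orbit_points SL_group act ~= {}"
    by blast
qed

section \<open>Transport to the models and assembly\<close>

lemma orbit_SL_congr: "Group_Action.orbit SL_group congr_act T = SL_orbit T"
  by (auto simp: orbit_def SL_orbit_def SL_group_def)

lemma variety_iso_preimage:
  assumes "variety_iso Z Z' h" "S \<subseteq> points Z'"
  shows "h ` {x \<in> points Z. h x \<in> S} = S"
  using assms by (auto simp: variety_iso_def bij_betw_def)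

text \<open>Isomorphisms of varieties preserve Zariski closures, so the lifting condition can be
  tested between the matrix space and the cone, where closures are explicit.\<close>

lemma lifts_to_iff:
  fixes \<phi> :: "'w => 'x" and \<psi> :: "'w => 'y"
  assumes X: "variety_iso X C \<iota>X" "multiplicative_variety X" "multiplicative_variety C" "!!w. \<phi> w \<in> points X"
    and Y: "variety_iso Y M \<iota>Y" "multiplicative_variety Y" "multiplicative_variety M" "!!w. \<psi> w \<in> points Y"
    and Ob: "Ob \<subseteq> points C" and Ob': "Ob' \<subseteq> points M"
  shows "lifts_to \<phi> \<psi> X Y {y \<in> points Y. \<iota>Y y \<in> Ob'} {x \<in> points X. \<iota>X x \<in> Ob} \<longleftrightarrow>
    (%w. \<iota>X (\<phi> w)) ` {w. \<iota>Y (\<psi> w) \<in> zariski M closure_of Ob'} = zariski C closure_of Ob"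
proof -
  let ?O' = "{y \<in> points Y. \<iota>Y y \<in> Ob'}" and ?O = "{x \<in> points X. \<iota>X x \<in> Ob}"
  have subX: "zariski X closure_of ?O \<subseteq> points X" and subY: "zariski Y closure_of ?O' \<subseteq> points Y"
    using closure_of_subset_topspace topspace_zariski[OF X(2)] topspace_zariski[OF Y(2)] by metis+
  have injX: "inj_on \<iota>X (points X)" and injY: "inj_on \<iota>Y (points Y)"
    using X(1) Y(1) by (simp_all add: variety_iso_def bij_betw_def)
  have clX: "\<iota>X ` (zariski X closure_of ?O) = zariski C closure_of Ob"
    using variety_iso_closure_of[OF X(1-3), of ?O] variety_iso_preimage[OF X(1) Ob] by simp
  have clY: "\<iota>Y ` (zariski Y closure_of ?O') = zariski M closure_of Ob'"
    using variety_iso_closure_of[OF Y(1-3), of ?O'] variety_iso_preimage[OF Y(1) Ob'] by simp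
  have pre: "\<psi> w \<in> zariski Y closure_of ?O' \<longleftrightarrow> \<iota>Y (\<psi> w) \<in> zariski M closure_of Ob'" for w
    unfolding clY[symmetric] using inj_on_image_mem_iff[OF injY Y(4) subY] by blast
  have "\<phi> ` (\<psi> -` (zariski Y closure_of ?O')) \<subseteq> points X" using X(4) by blast
  then have "lifts_to \<phi> \<psi> X Y ?O' ?O \<longleftrightarrow>
      \<iota>X ` (\<phi> ` (\<psi> -` (zariski Y closure_of ?O'))) = \<iota>X ` (zariski X closure_of ?O)"
    unfolding lifts_to_def by (rule inj_on_image_eq_iff[OF injX _ subX, symmetric])
  also have "\<iota>X ` (\<phi> ` (\<psi> -` (zariski Y closure_of ?O'))) = (%w. \<iota>X (\<phi> w)) ` {w. \<iota>Y (\<psi> w) \<in> zariski M closure_of Ob'}"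
    by (simp add: image_image vimage_def pre)
  finally show ?thesis unfolding clX .
qed

lemma variety_iso_compose:
  assumes h: "variety_iso Z1 Z2 h" and k: "variety_iso Z2 Z3 k"
  shows "variety_iso Z1 Z3 (%x. k (h x))"
proof -
  have bh: "bij_betw h (points Z1) (points Z2)" and bk: "bij_betw k (points Z2) (points Z3)"
    using h k by (auto simp: variety_iso_def)
  have b: "bij_betw (%x. k (h x)) (points Z1) (points Z3)"
    using bij_betw_trans[OF bh bk] by (simp add: o_def)
  have comp: "regular_map A D (%x. g (f x))" if f: "regular_map A E f" and g: "regular_map E D g"
    for A :: "'x variety" and E :: "'y variety" and D :: "'z variety" and f g
    unfolding regular_map_def
  proof (intro conjI ballI)
    have fE: "f x \<in> points E" if "x \<in> points A" for x using f that unfolding regular_map_def by blast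
    show "(%x. g (f x)) \<in> points A \<rightarrow> points D" using fE g unfolding regular_map_def by blast
    fix F assume "F \<in> regular D"
    then obtain F1 where F1: "F1 \<in> regular E" "\<forall>x\<in>points E. F (g x) = F1 x" using g unfolding regular_map_def by blast
    then obtain F2 where F2: "F2 \<in> regular A" "\<forall>x\<in>points A. F1 (f x) = F2 x" using f unfolding regular_map_def by blast
    show "\<exists>f'\<in>regular A. \<forall>x\<in>points A. F (g (f x)) = f' x"
      using F1(2) F2(2) fE by (intro bexI[OF _ F2(1)]) simp
  qed
  have inv: "inv_into (points Z1) (%x. k (h x)) z = inv_into (points Z1) h (inv_into (points Z2) k z)" if "z \<in> points Z3" for z
  proof (rule inv_into_f_eq[OF bij_betw_imp_inj_on[OF b]])
    have z2: "inv_into (points Z2) k z \<in> points Z2" using bij_betw_inv_into[OF bk] that by (auto simp: bij_betw_def)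
    then show "inv_into (points Z1) h (inv_into (points Z2) k z) \<in> points Z1"
      using bij_betw_inv_into[OF bh] by (auto simp: bij_betw_def)
    show "k (h (inv_into (points Z1) h (inv_into (points Z2) k z))) = z"
      by (simp add: bij_betw_inv_into_right[OF bh z2] bij_betw_inv_into_right[OF bk that])
  qed
  have "regular_map Z3 Z1 (%z. inv_into (points Z1) h (inv_into (points Z2) k z))"
    by (rule comp) (use h k in \<open>auto simp: variety_iso_def\<close>)
  then have "regular_map Z3 Z1 (inv_into (points Z1) (%x. k (h x)))"
    unfolding regular_map_def using inv by (auto simp: Pi_iff)
  moreover have "regular_map Z1 Z3 (%x. k (h x))"
    by (rule comp) (use h k in \<open>auto simp: variety_iso_def\<close>)
  ultimately show ?thesis using b by (simp add: variety_iso_def)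
qed

theorem mainTheorem5:
  assumes "2 * CARD('m::finite) < CARD('p::finite)"
    and "2 * CARD('m) < 2 * CARD('q::finite) + 1"
  shows
    "let G = OSp_group :: ((complex^'p^'p) \<times> (complex^('q + 'q)^('q + 'q))) monoid;
         actG = OSp_act :: _ \<Rightarrow> ('m, 'p, 'q) W_space \<Rightarrow> ('m, 'p, 'q) W_space;
         G' = SL_group :: (complex^'m^'m) monoid;
         actG' = SL_act :: _ \<Rightarrow> ('m, 'p, 'q) W_space \<Rightarrow> ('m, 'p, 'q) W_space;
         X = affine_quotient G' actG';
         Y = affine_quotient G actG;
         \<phi> = aff_quotient_map G' actG';
         \<psi> = aff_quotient_map G actG;
         M = mat_space :: (complex^'m^'m) variety;
         C = grassmann_cone :: (complex^('m \<Rightarrow> 'p + ('q + 'q))) variety;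
         orbsM = orbits G' (points M) congr_act;
         orbsC = orbits G (points C) OSp_cone_act
     in flat_quotient TYPE('t) G actG \<and> dense_null_orbit G actG \<and> reduced_null_fiber G actG \<and>
        generic_fiber_orbit G' actG' \<and> fibers_meet_single_orbits G actG G' actG' \<and>
        variety_iso Sym_Alt_variety M (\<lambda>(S, A). S + A) \<and>
        equivariant G' (points Sym_Alt_variety) congr_act2 congr_act (\<lambda>(S, A). S + A) \<and>
        (\<exists>\<iota>Y \<iota>X.
           variety_iso Y Sym_Alt_variety \<iota>Y \<and>
           equivariant G' (points Y) (quotient_act G actG actG') congr_act2 \<iota>Y \<and>
           (\<forall>w. \<iota>Y (\<psi> w) = gram w) \<and>
           variety_iso X C \<iota>X \<and>
           equivariant G (points X) (quotient_act G' actG' actG) OSp_cone_act \<iota>X \<and>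
           (\<forall>w. \<iota>X (\<phi> w) = column_wedge w) \<and>
           (\<exists>\<theta>.
              (\<forall>Ob'\<in>orbsM. \<theta> Ob' \<in> orbsC \<and>
                 (\<forall>Ob\<in>orbsC.
                    lifts_to \<phi> \<psi> X Y
                      {y \<in> points Y. (case \<iota>Y y of (S, A) \<Rightarrow> S + A) \<in> Ob'}
                      {x \<in> points X. \<iota>X x \<in> Ob}
                    \<longleftrightarrow> Ob = \<theta> Ob')) \<and>
              inj_on \<theta> orbsM \<and>
              (\<forall>Ob1\<in>orbsM. \<forall>Ob2\<in>orbsM.
                 Ob1 \<subseteq> zariski M closure_of Ob2 \<longrightarrow> \<theta> Ob1 \<subseteq> zariski C closure_of \<theta> Ob2) \<and>
              (\<forall>Ob\<in>orbsM. nilpotent_set M Ob \<longrightarrow> nilpotent_set C (\<theta> Ob))))"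
proof -
  note c = assms
  let ?G = "OSp_group :: ((complex^'p^'p) \<times> (complex^('q + 'q)^('q + 'q))) monoid"
  let ?actG = "OSp_act :: _ => ('m, 'p, 'q) W_space => ('m, 'p, 'q) W_space"
  let ?G' = "SL_group :: (complex^'m^'m) monoid"
  let ?actG' = "SL_act :: _ => ('m, 'p, 'q) W_space => ('m, 'p, 'q) W_space"
  let ?X = "affine_quotient ?G' ?actG'" and ?Y = "affine_quotient ?G ?actG"
  let ?\<phi> = "aff_quotient_map ?G' ?actG'" and ?\<psi> = "aff_quotient_map ?G ?actG"
  let ?M = "mat_space :: (complex^'m^'m) variety"
  let ?C = "grassmann_cone :: (complex^('m => 'p + ('q + 'q))) variety"
  let ?orbsM = "orbits ?G' (points ?M) congr_act" and ?orbsC = "orbits ?G (points ?C) OSp_cone_act"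
  obtain \<iota>Y where Y: "variety_iso ?Y Sym_Alt_variety \<iota>Y" "\<forall>w. \<iota>Y (?\<psi> w) = gram w"
    "equivariant ?G' (points ?Y) (quotient_act ?G ?actG ?actG') congr_act2 \<iota>Y"
    using OSp_quotient_iso[OF c] by (elim exE conjE)
  obtain \<iota>X where X: "variety_iso ?X ?C \<iota>X" "\<forall>w. \<iota>X (?\<phi> w) = column_wedge w"
    "equivariant ?G (points ?X) (quotient_act ?G' ?actG' ?actG) OSp_cone_act \<iota>X"
    using SL_quotient_iso by (elim exE conjE)
  obtain \<sigma>0 :: "_ => ('m, 'p, 'q) W_space" where \<sigma>0: "\<forall>z\<in>Sym_space \<times> Alt_space. gram (\<sigma>0 z) = z" "\<forall>z. full (\<sigma>0 z)"
    "\<forall>i j. (%z. \<sigma>0 z $ i $ j) \<in> poly_funs mat_pair_coords"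
    using gram_section[OF c] by (elim exE conjE)
  define \<sigma> where "\<sigma> T = \<sigma>0 (sym_alt_parts T)" for T
  have \<sigma>1: "gram_sum (\<sigma> T) = T" for T
    unfolding \<sigma>_def gram_sum_def bspec[OF \<sigma>0(1) sym_alt_parts_in] by (rule sym_alt_parts_sum)
  have \<sigma>2: "full (\<sigma> T)" for T unfolding \<sigma>_def by (rule \<sigma>0(2)[rule_format])
  have \<sigma>3: "(%T. \<sigma> T $ i $ j) \<in> poly_funs mat_coords" for i j
    unfolding \<sigma>_def by (rule poly_funs_compose_pair[OF \<sigma>0(3)[rule_format]]) (rule sym_alt_parts_poly)+
  note closure_lifted = closure_lifted_orbit[OF c \<sigma>1 \<sigma>2 \<sigma>3]
  define \<theta> where "\<theta> = (lifted_orbit :: _ => (complex^('m => 'p + ('q + 'q))) set)"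
  have orbM: "\<exists>T. Ob' = SL_orbit T" if "Ob' \<in> ?orbsM" for Ob'
    using that unfolding orbits_def orbit_SL_congr by blast
  have orbC: "\<exists>w0 :: ('m, 'p, 'q) W_space. Ob = Group_Action.orbit ?G OSp_cone_act (column_wedge w0)" if "Ob \<in> ?orbsC" for Ob
    using that unfolding orbits_def points_grassmann_cone by blast
  have \<theta>_orbit: "\<theta> (SL_orbit T) = Group_Action.orbit ?G OSp_cone_act (column_wedge (\<sigma> T))" for T
    using lifted_orbit_full[OF c \<sigma>1 \<sigma>2 \<sigma>3 \<sigma>2, of T] by (simp add: \<theta>_def \<sigma>1)
  have \<theta>_in: "\<theta> (SL_orbit T) \<in> ?orbsC" for T
    unfolding \<theta>_orbit orbits_def points_grassmann_cone by blast
  have Ob_points: "Ob \<subseteq> points ?C" if Ob: "Ob \<in> ?orbsC" for Ob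
  proof
    fix x assume x: "x \<in> Ob"
    obtain w0 :: "('m, 'p, 'q) W_space" where "Ob = Group_Action.orbit ?G OSp_cone_act (column_wedge w0)" using orbC[OF Ob] by blast
    then obtain g where "x = OSp_cone_act g (column_wedge w0)" using x unfolding orbit_def by blast
    then have "x = column_wedge (OSp_act g w0)" by (simp only: column_wedge_OSp_act)
    then show "x \<in> points ?C" unfolding points_grassmann_cone by (rule range_eqI)
  qed
  have \<theta>_closure: "zariski ?C closure_of \<theta> (SL_orbit T) = wedges_over (poly_closure (SL_orbit T))" for T
    unfolding zariski_cone_closure[OF Ob_points[OF \<theta>_in]] points_grassmann_cone
    using closure_lifted[of T] by (simp only: \<theta>_def)
  let ?s = "%y. case \<iota>Y y of (S, A) => S + A"
  have isoYM: "variety_iso ?Y ?M ?s" by (rule variety_iso_compose[OF Y(1) Sym_Alt_iso])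
  have s_gram: "?s (?\<psi> w) = gram_sum w" for w by (simp add: Y(2) gram_sum_def case_prod_beta)
  \<comment> \<open>Existence is \<open>closure_lifted\<close>; the converse, that no other orbit of
    the cone has this closure, is \<open>lifted_orbit_unique\<close>.\<close>
  have lifts: "lifts_to ?\<phi> ?\<psi> ?X ?Y {y \<in> points ?Y. ?s y \<in> SL_orbit T} {x \<in> points ?X. \<iota>X x \<in> Ob} \<longleftrightarrow> Ob = \<theta> (SL_orbit T)"
    if Ob: "Ob \<in> ?orbsC" for T Ob
  proof -
    obtain w0 :: "('m, 'p, 'q) W_space" where w0: "Ob = Group_Action.orbit ?G OSp_cone_act (column_wedge w0)" using orbC[OF Ob] by blast
    have "SL_orbit T \<subseteq> points ?M" by (simp add: mat_space_def)
    from lifts_to_iff[OF X(1) multiplicative_affine_quotient multiplicative_grassmann_cone quotient_map_point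
        isoYM multiplicative_affine_quotient multiplicative_mat_space quotient_map_point Ob_points[OF Ob] this]
    have "lifts_to ?\<phi> ?\<psi> ?X ?Y {y \<in> points ?Y. ?s y \<in> SL_orbit T} {x \<in> points ?X. \<iota>X x \<in> Ob} \<longleftrightarrow>
        (%w. \<iota>X (?\<phi> w)) ` {w. ?s (?\<psi> w) \<in> zariski ?M closure_of SL_orbit T} = zariski ?C closure_of Ob" .
    also have "(%w. \<iota>X (?\<phi> w)) ` {w. ?s (?\<psi> w) \<in> zariski ?M closure_of SL_orbit T} = wedges_over (poly_closure (SL_orbit T))"
      unfolding s_gram zariski_mat_closure X(2)[rule_format] wedges_over_def by blast
    also have "zariski ?C closure_of Ob = range (column_wedge :: ('m, 'p, 'q) W_space => _) \<inter> vec_closure Ob"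
      unfolding zariski_cone_closure[OF Ob_points[OF Ob]] points_grassmann_cone ..
    also have "wedges_over (poly_closure (SL_orbit T)) = range (column_wedge :: ('m, 'p, 'q) W_space => _) \<inter> vec_closure Ob
        \<longleftrightarrow> Ob = \<theta> (SL_orbit T)"
    proof
      assume "wedges_over (poly_closure (SL_orbit T)) = range (column_wedge :: ('m, 'p, 'q) W_space => _) \<inter> vec_closure Ob"
      then show "Ob = \<theta> (SL_orbit T)"
        unfolding w0 \<theta>_def by (intro lifted_orbit_unique[OF c \<sigma>1 \<sigma>2 \<sigma>3]) (rule sym)
    next
      assume "Ob = \<theta> (SL_orbit T)"
      then show "wedges_over (poly_closure (SL_orbit T)) = range (column_wedge :: ('m, 'p, 'q) W_space => _) \<inter> vec_closure Ob"
        using closure_lifted[of T] by (simp only: \<theta>_def)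
    qed
    finally show ?thesis .
  qed
  have "\<theta> Ob' \<in> ?orbsC & (\<forall>Ob\<in>?orbsC.
      lifts_to ?\<phi> ?\<psi> ?X ?Y {y \<in> points ?Y. ?s y \<in> Ob'} {x \<in> points ?X. \<iota>X x \<in> Ob} \<longleftrightarrow> Ob = \<theta> Ob')" if Ob': "Ob' \<in> ?orbsM" for Ob'
  proof -
    obtain T where T: "Ob' = SL_orbit T" using orbM[OF Ob'] by blast
    show ?thesis unfolding T by (intro conjI ballI \<theta>_in lifts)
  qed
  moreover have "inj_on \<theta> ?orbsM"
  proof (rule inj_onI)
    fix Ob1 Ob2 assume Ob: "Ob1 \<in> ?orbsM" "Ob2 \<in> ?orbsM" and eq: "\<theta> Ob1 = \<theta> Ob2"
    obtain T1 T2 where T: "Ob1 = SL_orbit T1" "Ob2 = SL_orbit T2" using orbM[OF Ob(1)] orbM[OF Ob(2)] by blast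
    show "Ob1 = Ob2"
      unfolding T by (rule lifted_orbit_inj[OF c \<sigma>1 \<sigma>2 \<sigma>3]) (use eq in \<open>simp only: T \<theta>_def\<close>)
  qed
  moreover have "\<theta> Ob1 \<subseteq> zariski ?C closure_of \<theta> Ob2"
    if Ob: "Ob2 \<in> ?orbsM" and sub: "Ob1 \<subseteq> zariski ?M closure_of Ob2" for Ob1 Ob2
  proof -
    obtain T where T: "Ob2 = SL_orbit T" using orbM[OF Ob] by blast
    have "Ob1 \<subseteq> poly_closure (SL_orbit T)" using sub unfolding T zariski_mat_closure .
    then show ?thesis unfolding T \<theta>_closure unfolding \<theta>_def lifted_orbit_def wedges_over_def by blast
  qed
  moreover have "nilpotent_set ?C (\<theta> Ob)" if Ob: "Ob \<in> ?orbsM" "nilpotent_set ?M Ob" for Ob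
  proof -
    obtain T where T: "Ob = SL_orbit T" using orbM[OF Ob(1)] by blast
    \<comment> \<open>The zero of \<open>W\<close> lies over both zeros, so it carries
      \<open>0\<close> from the closure of the orbit to the closure of its lift.\<close>
    have "gram_sum (0 :: ('m, 'p, 'q) W_space) \<in> poly_closure (SL_orbit T)"
      using Ob(2) unfolding T nilpotent_set_def zariski_mat_closure gram_sum_0 .
    then have "column_wedge (0 :: ('m, 'p, 'q) W_space) \<in> wedges_over (poly_closure (SL_orbit T))"
      unfolding wedges_over_def by blast
    then show ?thesis unfolding T nilpotent_set_def \<theta>_closure column_wedge_0 .
  qed
  ultimately have lifting: "\<exists>\<theta>. (\<forall>Ob'\<in>?orbsM. \<theta> Ob' \<in> ?orbsC & (\<forall>Ob\<in>?orbsC.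
        lifts_to ?\<phi> ?\<psi> ?X ?Y {y \<in> points ?Y. ?s y \<in> Ob'} {x \<in> points ?X. \<iota>X x \<in> Ob} \<longleftrightarrow> Ob = \<theta> Ob')) &
      inj_on \<theta> ?orbsM &
      (\<forall>Ob1\<in>?orbsM. \<forall>Ob2\<in>?orbsM. Ob1 \<subseteq> zariski ?M closure_of Ob2 --> \<theta> Ob1 \<subseteq> zariski ?C closure_of \<theta> Ob2) &
      (\<forall>Ob\<in>?orbsM. nilpotent_set ?M Ob --> nilpotent_set ?C (\<theta> Ob))"
    by (intro exI[of _ \<theta>] conjI ballI impI) simp_all
  show ?thesis
    unfolding Let_def
    by (intro conjI flat_quotient_OSp[OF c refl] dense_null_orbit_OSp[OF c refl] reduced_null_fiber_OSp[OF c refl]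
        generic_fiber_orbit_SL[OF refl full_imp_full_rank[OF \<sigma>2]] fibers_meet_single_orbits_OSp_SL[OF c refl refl]
        Sym_Alt_iso Sym_Alt_equivariant exI[of _ \<iota>Y] exI[of _ \<iota>X] Y X lifting)
qed

end
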